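(* Let $\pi:Q\to M=Q/G$ be a right principal $G$-bundle equipped with a horizontal distribution $\mathrm{H}Q\subset \mathrm{T}Q$ (not necessarily $G$-invariant) and a smooth Lagrangian $L:\mathrm{T}Q\to\mathbb{R}$. Assume that $L$ is $G$-invariant, i.e. $L((R_g)_*Z)=L(Z)$ for any $g\in G$ and $Z\in\mathrm T_qQ$. Then $\langle\mathrm HL(\widetilde X_q),b\rangle+\langle\mathrm FL(\widetilde X_q),\mathcal B(q)(X,b)\rangle$ vanishes for every horizontal vector $\widetilde X_q$ (with $X=\pi_*\widetilde X_q$) and every $b\in\mathfrak g$, and thus, for a horizontal admissible path $\widetilde X(t)\in\mathrm H_{q(t)}Q$: (i) If $\widetilde X(t)$ is a nonholonomic extremal, it is an unconstrained extremal if and only if $\mathrm FL(\widetilde X(t))=\mathrm{const}$. (ii) If $\widetilde X(t)$ is a vakonomic extremal associated with a Lagrange multiplier $\lambda(t)\in\mathfrak g^*$, then $\lambda(t)$ is a solution of the equation $$\Big\langle\frac{\mathrm d}{\mathrm dt}\big(\mathrm FL(\widetilde X(t))-\lambda(t)\big),b\Big\rangle=-\big\langle\lambda(t),\mathcal B(q(t))(X(t),b)\big\rangle\qquad\text{for every } b\in\mathfrak g.$$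
   Context: Everything is $C^\infty$; $I=[t_0,t_1]$ is a fixed interval; $R_g(q)=q\cdot g$. Variations. $\kappa_Q:\mathrm{TT}Q\to\mathrm{TT}Q$ is the canonical flip, $(q^a,\dot q^b,q'^c,\dot q'^d)\mapsto(q^a,q'^b,\dot q^c,\dot q'^d)$ in induced coordinates. If $\gamma(t)\in\mathrm{T}Q$ is the tangent lift of a curve $q(t)\in Q$ and $\xi(t)\in\mathrm{T}_{q(t)}Q$ is a curve (generator), the standard admissible variation generated by $\xi$ is $\delta_{\xi}\gamma(t)=\kappa_Q(\mathrm{T}_t\xi(t))\in\mathrm{T}_{\gamma(t)}\mathrm{T}Q$, where $\mathrm{T}_t\xi(t)\in\mathrm{TT}Q$ is the tangent lift of the curve $\xi$. The variation of the action is $\langle \mathrm{d}S_L(\gamma),\delta\gamma\rangle=\int_I\langle \mathrm{d}L(\gamma(t)),\delta\gamma(t)\rangle\,\mathrm{d}t$ (for a time-dependent Lagrangian, differentiate in the $\mathrm{T}Q$ variable). Chaplygin system. $\mathrm{V}Q=\ker\pi_*$; a horizontal distribution is a smooth distribution with $\mathrm{T}_qQ=\mathrm{H}_qQ\oplus\mathrm{V}_qQ$ for all $q$. A horizontal admissible path is a curve $\widetilde X(t)\in\mathrm{H}_{q(t)}Q$ which is the tangent lift of a curve $q(t)$. It is an unconstrained extremal (for a possibly time-dependent Lagrangian) if $\langle\mathrm{d}S_L(\widetilde X),\delta_\xi\widetilde X\rangle=0$ for all generators $\xi(t)\in\mathrm{T}_{q(t)}Q$ with $\xi(t_0)=\xi(t_1)=0$;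 a nonholonomic extremal if this holds for all such $\xi$ with $\xi(t)\in\mathrm{H}_{q(t)}Q$; a vakonomic extremal associated with a multiplier $\lambda:I\to\mathfrak g^*$ if it is an unconstrained extremal for $\widetilde L(Z,t)=L(Z)-\langle\lambda(t),\omega(Z)\rangle$. Notation. $\mathfrak g=\mathrm{T}_eG$ carries the left Lie algebra structure. For $a\in\mathfrak g$, $\widetilde a$ is the fundamental vector field on $Q$, with flow $q\mapsto q\cdot\exp(ta)$; this identifies $\mathrm{V}Q\approx Q\times\mathfrak g$. $\omega:\mathrm{T}Q\to\mathfrak g$ is the projection onto the $\mathfrak g$-part in $\mathrm{T}Q=\mathrm{H}Q\oplus_Q(Q\times\mathfrak g)$. For $X\in\mathrm{T}_xM$ and $q\in\pi^{-1}(x)$, $\widetilde X_q\in\mathrm{H}_qQ$ is the horizontal lift. $X(t)=\pi_*\widetilde X(t)$. $\mathcal B(q)(X,a)=\omega([\widetilde X,\widetilde a])(q)\in\mathfrak g$ (tensorial in $X$, so defined by extending $X$ to a vector field on $M$). Derivatives of $L$: $\mathrm{F}L,\mathrm{H}L:\mathrm{H}Q\to\mathfrak g^*$, $\langle\mathrm{F}L(\widetilde X_q),b\rangle=\frac{\mathrm d}{\mathrm dt}\big|_0L(\widetilde X_q+t\,\widetilde b_q)$ and $\langle\mathrm{H}L(\widetilde X_q),b\rangle=\frac{\mathrm d}{\mathrm dt}\big|_0L(\widetilde X_{q\cdot\exp(tb)})$, where $\widetilde X_{q\cdot \exp(tb)}$ is the horizontal lift of the same $X$ to the point $q\cdot\exp(tb)$.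 *)

theory Defs
  imports "HOL-Analysis.Analysis"
begin

section \<open>Smooth maps between normed spaces\<close>

text \<open>
  The model spaces of manifolds are the Euclidean spaces. The library class euclidean_space
  excludes dimension 0 (it requires a nonempty basis); the class below does not, so that trivial
  fibres, bases and discrete structure groups are covered. Finite dimension is expressed as in
  euclidean_space, by a finite set with trivial orthogonal complement; see \<open>finite_dimensional\<close>
  below. Every finite-dimensional inner product space is complete, so listing banach costs nothing.
\<close>

class model_space = real_inner + banach +
  assumes finite_total: "\<exists>B. finite B \<and> (\<forall>x. (\<forall>b\<in>B. inner x b = 0) \<longrightarrow> x = 0)"

lemma finite_dimensional: "\<exists>B :: 'a::model_space set. finite B \<and> span B = UNIV"
proof -
  obtain B :: "'a set" where B: "finite B" "\<And>x. (\<forall>b\<in>B. inner x b = 0) \<Longrightarrow> x = 0"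
    using finite_total by blast
  obtain C where C: "finite C" "span C = span B" "pairwise orthogonal C"
    using basis_orthogonal[OF B(1)] by blast
  have "x \<in> span C" for x
  proof -
    define y where "y = (\<Sum>c\<in>C. (c \<bullet> x / (c \<bullet> c)) *\<^sub>R c)"
    have "orthogonal (x - y) c" if "c \<in> C" for c
    proof -
      have "inner y c = (\<Sum>d\<in>C. if d = c then inner c x else 0)"
        unfolding y_def inner_sum_left
      proof (intro sum.cong refl)
        fix d assume "d \<in> C"
        then show "((d \<bullet> x / (d \<bullet> d)) *\<^sub>R d) \<bullet> c = (if d = c then c \<bullet> x else 0)"
          using pairwiseD[OF C(3) _ that, of d] by (auto simp: orthogonal_def)
      qed
      then have "inner y c = inner x c"
        using that C(1) by (simp add: inner_commute)
      then show ?thesis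
        by (simp add: orthogonal_def inner_diff_left)
    qed
    then have "orthogonal (x - y) c" if "c \<in> span C" for c
      by (rule orthogonal_to_span[OF that])
    then have "x - y = 0"
      using C(2) by (intro B(2)) (auto simp: orthogonal_def span_base)
    moreover have "y \<in> span C"
      unfolding y_def by (intro span_sum span_scale span_base)
    ultimately show ?thesis
      by simp
  qed
  then show ?thesis
    using C(1) by blast
qed

instance euclidean_space \<subseteq> model_space
proof
  show "\<exists>B. finite B \<and> (\<forall>x::'a. (\<forall>b\<in>B. inner x b = 0) \<longrightarrow> x = 0)"
    by (rule exI[of _ Basis]) (auto simp: euclidean_all_zero_iff)
qed

instance prod :: (model_space, model_space) model_space
proof
  obtain B :: "'a set" where B: "finite B" "\<And>x. (\<forall>b\<in>B. inner x b = 0) \<Longrightarrow> x = 0"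
    using finite_total by blast
  obtain C :: "'b set" where C: "finite C" "\<And>x. (\<forall>b\<in>C. inner x b = 0) \<Longrightarrow> x = 0"
    using finite_total by blast
  have "x = 0" if "\<forall>b\<in>B \<times> {0} \<union> {0} \<times> C. inner x b = 0" for x
  proof (cases x)
    case (Pair u v)
    have "inner u b = 0" if "b \<in> B" for b
      using bspec[OF \<open>\<forall>b\<in>B \<times> {0} \<union> {0} \<times> C. inner x b = 0\<close>, of "(b, 0)"] that
      by (simp add: Pair)
    then have "u = 0"
      by (intro B(2)) blast
    moreover have "inner v b = 0" if "b \<in> C" for b
      using bspec[OF \<open>\<forall>b\<in>B \<times> {0} \<union> {0} \<times> C. inner x b = 0\<close>, of "(0, b)"] that
      by (simp add: Pair)
    then have "v = 0"
      by (intro C(2)) blast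
    ultimately show ?thesis
      by (simp add: Pair zero_prod_def)
  qed
  moreover have "finite (B \<times> {0} \<union> {0} \<times> C)"
    using B(1) C(1) by simp
  ultimately show "\<exists>D. finite D \<and> (\<forall>x::'a \<times> 'b. (\<forall>b\<in>D. inner x b = 0) \<longrightarrow> x = 0)"
    by blast
qed

text \<open>
  On an open subset of a finite-dimensional space this is the usual \<open>C\<^sup>k\<close> property (existence
  and continuity of all iterated directional derivatives).
\<close>

primrec C_k_on :: "nat \<Rightarrow> 'a::real_normed_vector set \<Rightarrow> ('a \<Rightarrow> 'b::real_normed_vector) \<Rightarrow> bool" where
  "C_k_on 0 S f \<longleftrightarrow> continuous_on S f"
| "C_k_on (Suc k) S f \<longleftrightarrow>
     (\<forall>x\<in>S. f differentiable (at x)) \<and> (\<forall>v. C_k_on k S (\<lambda>x. frechet_derivative f (at x) v))"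

definition C_inf_on :: "'a::real_normed_vector set \<Rightarrow> ('a \<Rightarrow> 'b::real_normed_vector) \<Rightarrow> bool" where
  "C_inf_on S f \<longleftrightarrow> (\<forall>k. C_k_on k S f)"

section \<open>Manifolds and smooth maps\<close>

text \<open>The values of \<open>chart_fun\<close> outside \<open>chart_dom\<close> are irrelevant.\<close>

datatype ('p, 'e) chart = Chart (chart_dom: "'p set") (chart_fun: "'p \<Rightarrow> 'e")

definition chart_inv :: "('p, 'e) chart \<Rightarrow> 'e \<Rightarrow> 'p" where
  "chart_inv c = inv_into (chart_dom c) (chart_fun c)"

text \<open>A manifold is a whole type, Hausdorff and second countable, together with an atlas.\<close>

definition smooth_manifold ::
    "('p::{t2_space, second_countable_topology}, 'e::model_space) chart set \<Rightarrow> bool" where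
  "smooth_manifold A \<longleftrightarrow>
     (\<Union>c\<in>A. chart_dom c) = UNIV \<and>
     (\<forall>c\<in>A. open (chart_dom c) \<and> open (chart_fun c ` chart_dom c) \<and>
        homeomorphism (chart_dom c) (chart_fun c ` chart_dom c) (chart_fun c) (chart_inv c)) \<and>
     (\<forall>c\<in>A. \<forall>d\<in>A.
        C_inf_on (chart_fun c ` (chart_dom c \<inter> chart_dom d)) (chart_fun d \<circ> chart_inv c))"

definition std_atlas :: "('e, 'e) chart set" where
  "std_atlas = {Chart UNIV id}"

definition prod_atlas ::
    "('p, 'e) chart set \<Rightarrow> ('r, 'f) chart set \<Rightarrow> ('p \<times> 'r, 'e \<times> 'f) chart set" where
  "prod_atlas A B =
     {Chart (chart_dom c \<times> chart_dom d) (map_prod (chart_fun c) (chart_fun d)) | c d. c \<in> A \<and> d \<in> B}"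

text \<open>
  Smoothness on an arbitrary subset \<open>S\<close>: locally, in charts, \<open>f\<close> is the restriction of a smooth
  map \<open>g\<close> defined on an open subset of the model space. For open \<open>S\<close> this is the usual notion;
  for a compact interval \<open>S\<close> it is smoothness up to the end points. No topology on the two
  point types is used, so the definition also applies to tangent bundles as represented below.
\<close>

definition smooth_map_on ::
    "'p set \<Rightarrow> ('p, 'e::real_normed_vector) chart set \<Rightarrow> ('r, 'f::real_normed_vector) chart set
      \<Rightarrow> ('p \<Rightarrow> 'r) \<Rightarrow> bool" where
  "smooth_map_on S A B f \<longleftrightarrow>
     (\<forall>p\<in>S. \<forall>c\<in>A. \<forall>d\<in>B. p \<in> chart_dom c \<longrightarrow> f p \<in> chart_dom d \<longrightarrow>
        (\<exists>W g. open W \<and> chart_fun c p \<in> W \<and> C_inf_on W g \<and>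
           (\<forall>x \<in> S \<inter> chart_dom c. chart_fun c x \<in> W \<longrightarrow>
              f x \<in> chart_dom d \<and> chart_fun d (f x) = g (chart_fun c x))))"

section \<open>Tangent bundles\<close>

text \<open>
  At every point a chart is chosen once and for all, and a tangent vector at \<open>p\<close> is represented by
  its components in that chart. So \<open>T\<^sub>pM\<close> is the model space \<open>'e\<close>, and \<open>TM\<close> is the type
  \<open>'p \<times> 'e\<close>. Its manifold structure is not the product structure: it is given by the atlas of
  induced charts, in which the components in the chosen chart are transformed to
  the components in the given chart by the derivative of the transition map. The construction
  iterates, so that \<open>TTM\<close> is the type \<open>('p \<times> 'e) \<times> ('e \<times> 'e)\<close>.
\<close>

definition chart_at :: "('p, 'e) chart set \<Rightarrow> 'p \<Rightarrow> ('p, 'e) chart" where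
  "chart_at A p = (SOME c. c \<in> A \<and> p \<in> chart_dom c)"

definition tangent_chart ::
    "('p, 'e::real_normed_vector) chart set \<Rightarrow> ('p, 'e) chart \<Rightarrow> ('p \<times> 'e, 'e \<times> 'e) chart" where
  "tangent_chart A c = Chart (chart_dom c \<times> UNIV)
     (\<lambda>(p, v). (chart_fun c p,
        frechet_derivative (chart_fun c \<circ> chart_inv (chart_at A p))
          (at (chart_fun (chart_at A p) p)) v))"

definition tangent_atlas ::
    "('p, 'e::real_normed_vector) chart set \<Rightarrow> ('p \<times> 'e, 'e \<times> 'e) chart set" where
  "tangent_atlas A = tangent_chart A ` A"

definition tangent_map ::
    "('p, 'e::real_normed_vector) chart set \<Rightarrow> ('r, 'f::real_normed_vector) chart set
      \<Rightarrow> ('p \<Rightarrow> 'r) \<Rightarrow> 'p \<times> 'e \<Rightarrow> 'r \<times> 'f" where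
  "tangent_map A B f = (\<lambda>(p, v). (f p,
     frechet_derivative (chart_fun (chart_at B (f p)) \<circ> f \<circ> chart_inv (chart_at A p))
       (at (chart_fun (chart_at A p) p)) v))"

definition differential ::
    "('p, 'e::real_normed_vector) chart set \<Rightarrow> ('p \<Rightarrow> real) \<Rightarrow> 'p \<times> 'e \<Rightarrow> real" where
  "differential A f = (\<lambda>(p, v).
     frechet_derivative (f \<circ> chart_inv (chart_at A p)) (at (chart_fun (chart_at A p) p)) v)"

text \<open>Tangent lift at time \<open>t\<close> of a curve defined on \<open>J\<close>, one-sided at end points of \<open>J\<close>.\<close>

definition velocity ::
    "('p, 'e::real_normed_vector) chart set \<Rightarrow> real set \<Rightarrow> (real \<Rightarrow> 'p) \<Rightarrow> real \<Rightarrow> 'p \<times> 'e" where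
  "velocity A J c t =
     (c t, vector_derivative (\<lambda>s. chart_fun (chart_at A (c t)) (c s)) (at t within J))"

text \<open>
  The canonical flip of \<open>TTM\<close>, in the coordinates of \<open>TTM\<close> induced by a chart of \<open>M\<close> around the
  base point; the result does not depend on that chart.
\<close>

definition canonical_flip ::
    "('p, 'e::real_normed_vector) chart set \<Rightarrow> ('p \<times> 'e) \<times> ('e \<times> 'e) \<Rightarrow> ('p \<times> 'e) \<times> ('e \<times> 'e)" where
  "canonical_flip A w =
     (let C = tangent_chart (tangent_atlas A) (tangent_chart A (chart_at A (fst (fst w))))
      in chart_inv C ((\<lambda>((q, dq), (q', dq')). ((q, q'), (dq, dq'))) (chart_fun C w)))"

definition smooth_vector_field_on ::
    "'p set \<Rightarrow> ('p, 'e::real_normed_vector) chart set \<Rightarrow> ('p \<Rightarrow> 'e) \<Rightarrow> bool" where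
  "smooth_vector_field_on U A X \<longleftrightarrow> smooth_map_on U A (tangent_atlas A) (\<lambda>p. (p, X p))"

text \<open>
  Components of a vector field in a chart, and the Lie bracket with the convention
  \<open>[X, Y] f = X (Y f) - Y (X f)\<close>, computed in the chosen chart at \<open>p\<close>.
\<close>

definition field_in_chart ::
    "('p, 'e::real_normed_vector) chart set \<Rightarrow> ('p, 'e) chart \<Rightarrow> ('p \<Rightarrow> 'e) \<Rightarrow> 'e \<Rightarrow> 'e" where
  "field_in_chart A c X u = snd (chart_fun (tangent_chart A c) (chart_inv c u, X (chart_inv c u)))"

definition lie_bracket ::
    "('p, 'e::real_normed_vector) chart set \<Rightarrow> ('p \<Rightarrow> 'e) \<Rightarrow> ('p \<Rightarrow> 'e) \<Rightarrow> 'p \<Rightarrow> 'e" where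
  "lie_bracket A X Y p =
     (let c = chart_at A p; u = chart_fun c p; X' = field_in_chart A c X; Y' = field_in_chart A c Y
      in frechet_derivative Y' (at u) (X' u) - frechet_derivative X' (at u) (Y' u))"

section \<open>Lie groups and principal bundles\<close>

record ('g, 'h) lie_group_data =
  group_atlas :: "('g, 'h) chart set"
  gmult :: "'g \<Rightarrow> 'g \<Rightarrow> 'g"
  gone :: 'g
  ginv :: "'g \<Rightarrow> 'g"

definition lie_group ::
    "('g::{t2_space, second_countable_topology}, 'h::model_space) lie_group_data \<Rightarrow> bool" where
  "lie_group G \<longleftrightarrow>
     smooth_manifold (group_atlas G) \<and> group (gmult G) (gone G) (ginv G) \<and>
     smooth_map_on UNIV (prod_atlas (group_atlas G) (group_atlas G)) (group_atlas G)
       (\<lambda>(g, h). gmult G g h) \<and>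
     smooth_map_on UNIV (group_atlas G) (group_atlas G) (ginv G)"

definition one_parameter_subgroup ::
    "('g, 'h::real_normed_vector) lie_group_data \<Rightarrow> (real \<Rightarrow> 'g) \<Rightarrow> bool" where
  "one_parameter_subgroup G \<phi> \<longleftrightarrow>
     smooth_map_on UNIV std_atlas (group_atlas G) \<phi> \<and> (\<forall>s t. \<phi> (s + t) = gmult G (\<phi> s) (\<phi> t))"

text \<open>The Lie algebra \<open>T\<^sub>eG\<close> is the model space \<open>'h\<close> of the group.\<close>

definition lie_exp :: "('g, 'h::real_normed_vector) lie_group_data \<Rightarrow> 'h \<Rightarrow> 'g" where
  "lie_exp G a =
     (THE \<phi>. one_parameter_subgroup G \<phi> \<and> velocity (group_atlas G) UNIV \<phi> 0 = (gone G, a)) 1"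

record ('q, 'e, 'm, 'f, 'g, 'h) bundle_data =
  total_atlas :: "('q, 'e) chart set"
  base_atlas :: "('m, 'f) chart set"
  struct_group :: "('g, 'h) lie_group_data"
  proj :: "'q \<Rightarrow> 'm"
  act :: "'q \<Rightarrow> 'g \<Rightarrow> 'q"

text \<open>
  Right principal bundle: \<open>\<psi>\<close> below is an equivariant trivialization over \<open>U\<close>. It follows that the
  action is free and that its orbits are exactly the fibres of the surjective projection.
\<close>

definition principal_bundle ::
    "('q::{t2_space, second_countable_topology}, 'e::model_space,
      'm::{t2_space, second_countable_topology}, 'f::model_space,
      'g::{t2_space, second_countable_topology}, 'h::model_space) bundle_data \<Rightarrow> bool" where
  "principal_bundle P \<longleftrightarrow>
     smooth_manifold (total_atlas P) \<and> smooth_manifold (base_atlas P) \<and> lie_group (struct_group P) \<and>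
     smooth_map_on UNIV (total_atlas P) (base_atlas P) (proj P) \<and>
     smooth_map_on UNIV (prod_atlas (total_atlas P) (group_atlas (struct_group P))) (total_atlas P)
       (\<lambda>(q, g). act P q g) \<and>
     (\<forall>q. act P q (gone (struct_group P)) = q) \<and>
     (\<forall>q g h. act P (act P q g) h = act P q (gmult (struct_group P) g h)) \<and>
     (\<forall>q g. proj P (act P q g) = proj P q) \<and>
     (\<forall>x. \<exists>U \<psi>. open U \<and> x \<in> U \<and> bij_betw \<psi> (proj P -` U) (U \<times> UNIV) \<and>
        smooth_map_on (proj P -` U) (total_atlas P)
          (prod_atlas (base_atlas P) (group_atlas (struct_group P))) \<psi> \<and>
        smooth_map_on (U \<times> UNIV) (prod_atlas (base_atlas P) (group_atlas (struct_group P)))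
          (total_atlas P) (inv_into (proj P -` U) \<psi>) \<and>
        (\<forall>q \<in> proj P -` U. fst (\<psi> q) = proj P q \<and>
           (\<forall>g. snd (\<psi> (act P q g)) = gmult (struct_group P) (snd (\<psi> q)) g)))"

definition fundamental ::
    "('q, 'e::real_normed_vector, 'm, 'f, 'g, 'h::real_normed_vector) bundle_data
      \<Rightarrow> 'h \<Rightarrow> 'q \<Rightarrow> 'e" where
  "fundamental P a q =
     snd (velocity (total_atlas P) UNIV (\<lambda>t. act P q (lie_exp (struct_group P) (t *\<^sub>R a))) 0)"

section \<open>Horizontal distributions\<close>

text \<open>Subsets of the tangent spaces which locally have a smooth frame.\<close>

definition smooth_distribution ::
    "('q::topological_space, 'e::real_normed_vector) chart set \<Rightarrow> ('q \<Rightarrow> 'e set) \<Rightarrow> bool" where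
  "smooth_distribution A H \<longleftrightarrow>
     (\<forall>q. \<exists>U k (X :: nat \<Rightarrow> 'q \<Rightarrow> 'e). open U \<and> q \<in> U \<and>
        (\<forall>i<k. smooth_vector_field_on U A (X i)) \<and>
        (\<forall>p\<in>U. inj_on (\<lambda>i. X i p) {..<k} \<and> independent ((\<lambda>i. X i p) ` {..<k}) \<and>
           H p = span ((\<lambda>i. X i p) ` {..<k})))"

text \<open>The components of \<open>\<pi>\<^sub>* Z\<close>, a vector tangent to the base at the projection of the base point.\<close>

definition proj_push ::
    "('q, 'e::real_normed_vector, 'm, 'f::real_normed_vector, 'g, 'h) bundle_data
      \<Rightarrow> 'q \<times> 'e \<Rightarrow> 'f" where
  "proj_push P Z = snd (tangent_map (total_atlas P) (base_atlas P) (proj P) Z)"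

definition vertical ::
    "('q, 'e::real_normed_vector, 'm, 'f::real_normed_vector, 'g, 'h) bundle_data
      \<Rightarrow> 'q \<Rightarrow> 'e set" where
  "vertical P q = {v. proj_push P (q, v) = 0}"

definition horizontal_distribution ::
    "('q::topological_space, 'e::real_normed_vector, 'm, 'f::real_normed_vector, 'g, 'h) bundle_data
      \<Rightarrow> ('q \<Rightarrow> 'e set) \<Rightarrow> bool" where
  "horizontal_distribution P H \<longleftrightarrow>
     smooth_distribution (total_atlas P) H \<and>
     (\<forall>q. H q \<inter> vertical P q = {0} \<and> {u + v | u v. u \<in> H q \<and> v \<in> vertical P q} = UNIV)"

definition omega ::
    "('q, 'e::real_normed_vector, 'm, 'f, 'g, 'h::real_normed_vector) bundle_data
      \<Rightarrow> ('q \<Rightarrow> 'e set) \<Rightarrow> 'q \<times> 'e \<Rightarrow> 'h" where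
  "omega P H = (\<lambda>(q, v). THE a. \<exists>u \<in> H q. v = u + fundamental P a q)"

text \<open>Horizontal lift to \<open>q\<close> of a vector \<open>X\<close> tangent to the base at \<open>proj P q\<close>.\<close>

definition hlift ::
    "('q, 'e::real_normed_vector, 'm, 'f::real_normed_vector, 'g, 'h) bundle_data
      \<Rightarrow> ('q \<Rightarrow> 'e set) \<Rightarrow> 'q \<Rightarrow> 'f \<Rightarrow> 'e" where
  "hlift P H q X = (THE u. u \<in> H q \<and> proj_push P (q, u) = X)"

text \<open>
  The common value, for all extensions \<open>Y\<close> of \<open>X\<close> to a vector field on a neighbourhood of
  \<open>proj P q\<close> (in particular for all global extensions).
\<close>

definition B_tensor ::
    "('q, 'e::real_normed_vector, 'm::topological_space, 'f::real_normed_vector, 'g,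
      'h::real_normed_vector) bundle_data \<Rightarrow> ('q \<Rightarrow> 'e set) \<Rightarrow> 'q \<Rightarrow> 'f \<Rightarrow> 'h \<Rightarrow> 'h" where
  "B_tensor P H q X a =
     (THE z. \<forall>U Y. open U \<and> proj P q \<in> U \<and> smooth_vector_field_on U (base_atlas P) Y \<and>
          Y (proj P q) = X \<longrightarrow>
        z = omega P H (q, lie_bracket (total_atlas P) (\<lambda>p. hlift P H p (Y (proj P p)))
              (fundamental P a) q))"

section \<open>Lagrangians and extremals\<close>

text \<open>
  The dual of the Lie algebra is the type \<open>'h \<Rightarrow>\<^sub>L real\<close>, every linear form on a
  finite-dimensional space being bounded.
\<close>

definition FL ::
    "('q, 'e::real_normed_vector, 'm, 'f, 'g, 'h::real_normed_vector) bundle_data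
      \<Rightarrow> ('q \<times> 'e \<Rightarrow> real) \<Rightarrow> 'q \<times> 'e \<Rightarrow> ('h \<Rightarrow>\<^sub>L real)" where
  "FL P L = (\<lambda>(q, v). Blinfun (\<lambda>b. deriv (\<lambda>t. L (q, v + t *\<^sub>R fundamental P b q)) 0))"

definition HL ::
    "('q, 'e::real_normed_vector, 'm, 'f::real_normed_vector, 'g, 'h::real_normed_vector) bundle_data
      \<Rightarrow> ('q \<Rightarrow> 'e set) \<Rightarrow> ('q \<times> 'e \<Rightarrow> real) \<Rightarrow> 'q \<times> 'e \<Rightarrow> ('h \<Rightarrow>\<^sub>L real)" where
  "HL P H L = (\<lambda>(q, v).
     let X = proj_push P (q, v);
         q' = (\<lambda>b t. act P q (lie_exp (struct_group P) (t *\<^sub>R b)))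
     in Blinfun (\<lambda>b. deriv (\<lambda>t. L (q' b t, hlift P H (q' b t) X)) 0))"

definition invariant_lagrangian ::
    "('q, 'e::real_normed_vector, 'm, 'f, 'g, 'h) bundle_data \<Rightarrow> ('q \<times> 'e \<Rightarrow> real) \<Rightarrow> bool" where
  "invariant_lagrangian P L \<longleftrightarrow>
     (\<forall>g Z. L (tangent_map (total_atlas P) (total_atlas P) (\<lambda>q. act P q g) Z) = L Z)"

definition action_variation ::
    "('q, 'e::real_normed_vector) chart set \<Rightarrow> real \<Rightarrow> real \<Rightarrow> (real \<Rightarrow> 'q \<times> 'e \<Rightarrow> real)
      \<Rightarrow> (real \<Rightarrow> ('q \<times> 'e) \<times> ('e \<times> 'e)) \<Rightarrow> real" where
  "action_variation A t0 t1 L \<delta> =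
     integral {t0..t1} (\<lambda>t. differential (tangent_atlas A) (L t) (\<delta> t))"

definition admissible_variation ::
    "('q, 'e::real_normed_vector) chart set \<Rightarrow> real \<Rightarrow> real \<Rightarrow> (real \<Rightarrow> 'q \<times> 'e)
      \<Rightarrow> real \<Rightarrow> ('q \<times> 'e) \<times> ('e \<times> 'e)" where
  "admissible_variation A t0 t1 \<xi> t =
     canonical_flip A (velocity (tangent_atlas A) {t0..t1} \<xi> t)"

text \<open>Smooth generators along the base curve of \<open>\<gamma>\<close> vanishing at the end points.\<close>

definition generator ::
    "('q, 'e::real_normed_vector) chart set \<Rightarrow> real \<Rightarrow> real \<Rightarrow> (real \<Rightarrow> 'q \<times> 'e)
      \<Rightarrow> (real \<Rightarrow> 'q \<times> 'e) \<Rightarrow> bool" where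
  "generator A t0 t1 \<gamma> \<xi> \<longleftrightarrow>
     smooth_map_on {t0..t1} std_atlas (tangent_atlas A) \<xi> \<and>
     (\<forall>t\<in>{t0..t1}. fst (\<xi> t) = fst (\<gamma> t)) \<and> snd (\<xi> t0) = 0 \<and> snd (\<xi> t1) = 0"

definition horizontal_admissible_path ::
    "('q, 'e::real_normed_vector) chart set \<Rightarrow> ('q \<Rightarrow> 'e set) \<Rightarrow> real \<Rightarrow> real
      \<Rightarrow> (real \<Rightarrow> 'q \<times> 'e) \<Rightarrow> bool" where
  "horizontal_admissible_path A H t0 t1 \<gamma> \<longleftrightarrow>
     (\<exists>q. smooth_map_on {t0..t1} std_atlas A q \<and>
        (\<forall>t\<in>{t0..t1}. \<gamma> t = velocity A {t0..t1} q t \<and> snd (\<gamma> t) \<in> H (q t)))"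

definition unconstrained_extremal ::
    "('q, 'e::real_normed_vector) chart set \<Rightarrow> real \<Rightarrow> real \<Rightarrow> (real \<Rightarrow> 'q \<times> 'e \<Rightarrow> real)
      \<Rightarrow> (real \<Rightarrow> 'q \<times> 'e) \<Rightarrow> bool" where
  "unconstrained_extremal A t0 t1 L \<gamma> \<longleftrightarrow>
     (\<forall>\<xi>. generator A t0 t1 \<gamma> \<xi> \<longrightarrow>
        action_variation A t0 t1 L (admissible_variation A t0 t1 \<xi>) = 0)"

definition nonholonomic_extremal ::
    "('q, 'e::real_normed_vector) chart set \<Rightarrow> ('q \<Rightarrow> 'e set) \<Rightarrow> real \<Rightarrow> real
      \<Rightarrow> (real \<Rightarrow> 'q \<times> 'e \<Rightarrow> real) \<Rightarrow> (real \<Rightarrow> 'q \<times> 'e) \<Rightarrow> bool" where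
  "nonholonomic_extremal A H t0 t1 L \<gamma> \<longleftrightarrow>
     (\<forall>\<xi>. generator A t0 t1 \<gamma> \<xi> \<and> (\<forall>t\<in>{t0..t1}. snd (\<xi> t) \<in> H (fst (\<gamma> t))) \<longrightarrow>
        action_variation A t0 t1 L (admissible_variation A t0 t1 \<xi>) = 0)"

definition vakonomic_extremal ::
    "('q, 'e::real_normed_vector, 'm, 'f, 'g, 'h::real_normed_vector) bundle_data
      \<Rightarrow> ('q \<Rightarrow> 'e set) \<Rightarrow> real \<Rightarrow> real \<Rightarrow> ('q \<times> 'e \<Rightarrow> real) \<Rightarrow> (real \<Rightarrow> ('h \<Rightarrow>\<^sub>L real))
      \<Rightarrow> (real \<Rightarrow> 'q \<times> 'e) \<Rightarrow> bool" where
  "vakonomic_extremal P H t0 t1 L \<mu> \<gamma> \<longleftrightarrow>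
     smooth_map_on {t0..t1} std_atlas std_atlas \<mu> \<and>
     unconstrained_extremal (total_atlas P) t0 t1
       (\<lambda>t Z. L Z - blinfun_apply (\<mu> t) (omega P H Z)) \<gamma>"

end

theory Submission
  imports Defs
begin

text \<open>
  Differentiating the invariance of \<open>L\<close> along a one-parameter subgroup shows that \<open>dL\<close> annihilates
  \<open>\<kappa> (T b~)\<close> for every fundamental field \<open>b~\<close>. Extend a horizontal vector to the horizontal lift of a
  vector field \<open>Y\<close> on the base. Along an orbit the derivative of the lift differs from that of the
  invariant transport by the vertical vector \<open>[Y~, b~]\<close>, whose \<open>\<g>\<close>-part is \<open>\<B>\<close>; this is the identity
  between \<open>HL\<close> and \<open>FL\<close>.

  For a vertical generator \<open>\<xi>(t) = a(t)~\<close> the same annihilation leaves only the term with the derivative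
  of \<open>a\<close>, so the variation of the action is the integral of \<open>\<langle>FL, a'\<rangle>\<close>. Every generator is a horizontal one
  plus a vertical one, and the lemma of du Bois-Reymond gives (i). With a multiplier the variation of
  \<open>\<langle>\<lambda>, \<omega>\<rangle>\<close> contributes \<open>\<langle>\<lambda>, a'\<rangle> + \<langle>\<lambda>, \<B>(q)(X, a)\<rangle>\<close>, because \<open>\<omega>\<close> vanishes on the lift of \<open>Y\<close>; the same
  lemma gives (ii).

  Fundamental fields are defined through the exponential map, so one-parameter subgroups must be
  constructed: an integral curve of a left-invariant field in a chart (Picard iteration) is translated
  to the unit, where it is a local homomorphism, and extended by powers.
\<close>

section \<open>Calculus on finite-dimensional spaces\<close>

text \<open>A tangent vector is stored by its components in a chart chosen separately at every
  point, and this choice may jump between neighbouring points. Stored components can therefore not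
  be differentiated. Fundamental fields, \<omega>, horizontal lifts and Lagrangians are first
  rewritten in one fixed chart (\<open>fund_rep\<close>, \<open>omega_rep\<close>,
  \<open>lift_rep\<close>, \<open>lag_rep\<close>) and proved smooth there. For \<omega> and the
  lifts, which are given by unique description, this rests on a general fact: a solution of a linear
  equation with smooth coefficients and injective left side is smooth.

  Commuting second derivatives do the geometric work in three places: the flip does not depend on
  the chart, the velocity of a translated vector is the derivative of the fundamental field along
  it, and the bracket of a lift with a fundamental field is vertical.

  \<open>C_k_on\<close> sees derivatives in fixed directions only. Moving directions, which every
  chain rule produces, are expanded over a finite spanning set; this is how finite dimension enters
  the calculus.\<close>

lemma model_space_expansion:
  obtains B :: "'a::model_space set" and d where "finite B" "\<And>x. x = (\<Sum>b\<in>B. (x \<bullet> d b) *\<^sub>R b)"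
proof -
  obtain B0 :: "'a set" where B0: "finite B0" "span B0 = UNIV"
    using finite_dimensional by blast
  obtain C where C: "finite C" "span C = span B0" "pairwise orthogonal C"
    using basis_orthogonal[OF B0(1)] by blast
  \<comment> \<open>This expansion plays the role of a basis, also in dimension 0. A zero vector in
    \<open>C\<close> does no harm, since \<open>c /\<^sub>R (c \<bullet> c)\<close> is then 0
    too.\<close>
  have "x = (\<Sum>c\<in>C. (x \<bullet> (c /\<^sub>R (c \<bullet> c))) *\<^sub>R c)" for x
  proof -
    define y where "y = (\<Sum>c\<in>C. (x \<bullet> (c /\<^sub>R (c \<bullet> c))) *\<^sub>R c)"
    have "orthogonal (x - y) c" if "c \<in> C" for c
    proof -
      have "inner y c = (\<Sum>d\<in>C. if d = c then inner x c else 0)"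
        unfolding y_def inner_sum_left
      proof (intro sum.cong refl)
        fix d assume "d \<in> C"
        then show "((x \<bullet> (d /\<^sub>R (d \<bullet> d))) *\<^sub>R d) \<bullet> c = (if d = c then x \<bullet> c else 0)"
          using pairwiseD[OF C(3) _ that, of d] by (cases "c = 0") (auto simp: orthogonal_def)
      qed
      then show ?thesis
        using that C(1) by (simp add: orthogonal_def inner_diff_left)
    qed
    then have "orthogonal (x - y) c" if "c \<in> span C" for c
      by (rule orthogonal_to_span[OF that])
    then have "orthogonal (x - y) (x - y)"
      using C(2) B0(2) by auto
    then show ?thesis
      by (simp add: orthogonal_def y_def)
  qed
  with C(1) show thesis
    by (rule that)
qed

lemma linear_imp_bounded_linear:
  fixes f :: "'a::model_space \<Rightarrow> 'b::real_normed_vector"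
  assumes "linear f"
  shows "bounded_linear f"
proof -
  obtain B :: "'a set" and d where B: "finite B" "\<And>x. x = (\<Sum>b\<in>B. (x \<bullet> d b) *\<^sub>R b)"
    by (rule model_space_expansion) blast
  interpret f: linear f by fact
  have "norm (f x) \<le> norm x * (\<Sum>b\<in>B. norm (d b) * norm (f b))" for x
  proof -
    have "norm (f x) = norm (\<Sum>b\<in>B. (x \<bullet> d b) *\<^sub>R f b)"
      by (subst B(2)[of x]) (simp add: f.sum f.scale)
    also have "\<dots> \<le> (\<Sum>b\<in>B. norm x * norm (d b) * norm (f b))"
      by (intro sum_norm_le) (auto intro!: mult_right_mono Cauchy_Schwarz_ineq2)
    finally show ?thesis
      by (simp add: sum_distrib_left mult.assoc)
  qed
  then show ?thesis
    by (intro bounded_linear_intro[where K = "\<Sum>b\<in>B. norm (d b) * norm (f b)"])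
      (auto simp: f.add f.scale)
qed

lemma frechet_derivative_cong_open:
  assumes "open S" "x \<in> S" "\<And>y. y \<in> S \<Longrightarrow> f y = g y"
  shows "frechet_derivative f (at x) = frechet_derivative g (at x)"
    "f differentiable (at x) \<longleftrightarrow> g differentiable (at x)"
proof -
  \<comment> \<open>\<open>frechet_derivative\<close> chooses among all \<open>D\<close> with this
    property, so equivalence for every \<open>D\<close> gives equal values even at points where no
    derivative exists.\<close>
  have *: "(f has_derivative D) (at x) \<longleftrightarrow> (g has_derivative D) (at x)" for D
    using has_derivative_transform_within_open[of f D x UNIV S g]
      has_derivative_transform_within_open[of g D x UNIV S f] assms by auto
  then show "frechet_derivative f (at x) = frechet_derivative g (at x)"
    by (simp add: frechet_derivative_def)
  show "f differentiable (at x) \<longleftrightarrow> g differentiable (at x)"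
    using * by (simp add: differentiable_def)
qed

section \<open>Calculus of maps of class \<open>C_k_on\<close>\<close>

lemma C_k_on_imp_continuous_on: "C_k_on k S f \<Longrightarrow> continuous_on S f"
  by (cases k) (auto intro!: continuous_at_imp_continuous_on differentiable_imp_continuous_within)

lemma C_k_on_SucD: "C_k_on (Suc k) S f \<Longrightarrow> C_k_on k S f"
proof (induction k arbitrary: f)
  case 0 then show ?case using C_k_on_imp_continuous_on by fastforce
qed auto

lemma C_k_on_subset: "C_k_on k S f \<Longrightarrow> T \<subseteq> S \<Longrightarrow> C_k_on k T f"
proof (induction k arbitrary: f)
  case 0 then show ?case by (auto intro: continuous_on_subset)
qed auto

lemma C_k_on_cong:
  assumes "open S" "\<And>x. x \<in> S \<Longrightarrow> f x = g x" "C_k_on k S f"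
  shows "C_k_on k S g"
  using assms(2,3)
proof (induction k arbitrary: f g)
  case 0 then show ?case using continuous_on_cong by fastforce
next
  case (Suc k)
  note * = frechet_derivative_cong_open[OF assms(1) _ Suc.prems(1)]
  have "C_k_on k S (\<lambda>x. frechet_derivative g (at x) v)" for v
    by (rule Suc.IH[of "\<lambda>x. frechet_derivative f (at x) v"]) (use Suc.prems(2) *(1) in auto)
  then show ?case
    using Suc.prems(2) *(2) by auto
qed

lemma C_k_on_local:
  assumes "\<And>x. x \<in> S \<Longrightarrow> \<exists>W. open W \<and> x \<in> W \<and> C_k_on k W f"
  shows "C_k_on k S f"
  using assms
proof (induction k arbitrary: f)
  case 0
  then show ?case
    by (auto intro!: continuous_at_imp_continuous_on) (metis continuous_on_eq_continuous_at)
next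
  case (Suc k)
  have "C_k_on k S (\<lambda>x. frechet_derivative f (at x) v)" for v
  proof (rule Suc.IH)
    fix x assume "x \<in> S"
    then obtain W where "open W" "x \<in> W" "C_k_on (Suc k) W f"
      using Suc.prems by blast
    then show "\<exists>W. open W \<and> x \<in> W \<and> C_k_on k W (\<lambda>x. frechet_derivative f (at x) v)"
      by auto
  qed
  moreover have "f differentiable (at x)" if "x \<in> S" for x
    using Suc.prems[OF that] by auto
  ultimately show ?case
    by simp
qed

text \<open>Lets inductions on the order work with an explicit derivative \<open>D\<close> instead
  of the chosen \<open>frechet_derivative\<close>.\<close>

lemma C_k_on_SucI:
  assumes "open S" "\<And>x. x \<in> S \<Longrightarrow> (f has_derivative D x) (at x)" "\<And>v. C_k_on k S (\<lambda>x. D x v)"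
  shows "C_k_on (Suc k) S f"
proof -
  have *: "D x = frechet_derivative f (at x)" if "x \<in> S" for x
    using frechet_derivative_at[OF assms(2)[OF that]] .
  have "C_k_on k S (\<lambda>x. frechet_derivative f (at x) v)" for v
    by (rule C_k_on_cong[OF assms(1) _ assms(3)[of v]]) (simp add: *)
  moreover have "f differentiable (at x)" if "x \<in> S" for x
    using assms(2)[OF that] unfolding differentiable_def by blast
  ultimately show ?thesis
    by simp
qed

lemma C_k_on_Suc_has_derivative:
  "C_k_on (Suc k) S f \<Longrightarrow> x \<in> S \<Longrightarrow> (f has_derivative frechet_derivative f (at x)) (at x)"
  by (simp add: frechet_derivative_works)

lemma C_k_on_const: "open S \<Longrightarrow> C_k_on k S (\<lambda>x. c)"
proof (induction k arbitrary: c)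
  case (Suc k)
  then show ?case by (intro C_k_on_SucI[where D = "\<lambda>_ _. 0"]) auto
qed simp

lemma C_k_on_bounded_linear:
  assumes "open S" "bounded_linear f"
  shows "C_k_on k S f"
proof (cases k)
  case 0
  then show ?thesis using bounded_linear.continuous_on[OF assms(2) continuous_on_id] by simp
next
  case (Suc j)
  then show ?thesis
    using C_k_on_SucI[OF assms(1) bounded_linear_imp_has_derivative[OF assms(2)] C_k_on_const[OF assms(1)]]
    by simp
qed

lemma C_k_on_bounded_linear_comp:
  assumes "open S" "bounded_linear l" "C_k_on k S f"
  shows "C_k_on k S (\<lambda>x. l (f x))"
  using assms(3)
proof (induction k arbitrary: f)
  case 0
  then show ?case using bounded_linear.continuous_on[OF assms(2)] by auto
next
  case (Suc k)
  then show ?case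
    using assms(1) by (intro C_k_on_SucI[where D = "\<lambda>x v. l (frechet_derivative f (at x) v)"])
      (auto intro!: bounded_linear.has_derivative[OF assms(2)] C_k_on_Suc_has_derivative[OF Suc.prems])
qed

lemma C_k_on_add:
  assumes "open S" "C_k_on k S f" "C_k_on k S g"
  shows "C_k_on k S (\<lambda>x. f x + g x)"
  using assms(2,3)
proof (induction k arbitrary: f g)
  case (Suc k)
  show ?case
    by (rule C_k_on_SucI[OF assms(1) has_derivative_add[OF C_k_on_Suc_has_derivative[OF Suc.prems(1)]
            C_k_on_Suc_has_derivative[OF Suc.prems(2)]]]) (use Suc in auto)
qed (auto intro: continuous_intros)

lemma C_k_on_sum:
  assumes "open S" "\<And>i. i \<in> I \<Longrightarrow> C_k_on k S (f i)"
  shows "C_k_on k S (\<lambda>x. \<Sum>i\<in>I. f i x)"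
  using assms(2)
proof (induction I rule: infinite_finite_induct)
  case (insert i I)
  then show ?case by (simp add: C_k_on_add assms(1))
qed (auto intro: C_k_on_const assms(1))

lemma C_k_on_bounded_bilinear:
  assumes "open S" "bounded_bilinear p" "C_k_on k S f" "C_k_on k S g"
  shows "C_k_on k S (\<lambda>x. p (f x) (g x))"
  using assms(3,4)
proof (induction k arbitrary: f g)
  case 0
  then show ?case using bounded_bilinear.continuous_on[OF assms(2)] by auto
next
  case (Suc k)
  have "C_k_on k S (\<lambda>x. p (f x) (frechet_derivative g (at x) v) + p (frechet_derivative f (at x) v) (g x))" for v
    using Suc.prems C_k_on_SucD[OF Suc.prems(1)] C_k_on_SucD[OF Suc.prems(2)]
    by (intro C_k_on_add[OF assms(1)] Suc.IH) auto
  then show ?case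
    using bounded_bilinear.FDERIV[OF assms(2) C_k_on_Suc_has_derivative[OF Suc.prems(1)]
            C_k_on_Suc_has_derivative[OF Suc.prems(2)]]
    by (intro C_k_on_SucI[OF assms(1)]) auto
qed

lemma linear_expansion:
  fixes B :: "'a::real_inner set"
  assumes "linear f" "\<And>x. x = (\<Sum>b\<in>B. (x \<bullet> d b) *\<^sub>R b)"
  shows "f x = (\<Sum>b\<in>B. (x \<bullet> d b) *\<^sub>R f b)"
  by (subst assms(2)[of x]) (simp add: linear_sum[OF assms(1)] linear_scale[OF assms(1)])

text \<open>The chain rule differentiates \<open>f\<close> in the moving direction
  \<open>Dg(x) v\<close>, which \<open>C_k_on\<close> does not cover. Expanding this direction over
  a finite spanning set leaves products of smooth coefficients with fixed-direction derivatives of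
  \<open>f\<close> at \<open>g x\<close>, and to these the induction hypothesis applies.\<close>

lemma C_k_on_compose:
  fixes f :: "'b::model_space \<Rightarrow> 'c::real_normed_vector"
  assumes "open S" "open T" "C_k_on k T f" "C_k_on k S g" "g ` S \<subseteq> T"
  shows "C_k_on k S (\<lambda>x. f (g x))"
  using assms(3,4)
proof (induction k arbitrary: f)
  case 0
  then show ?case using continuous_on_compose2[of T f S g] assms(5) by auto
next
  case (Suc k)
  obtain B :: "'b set" and d where B: "finite B" "\<And>x. x = (\<Sum>b\<in>B. (x \<bullet> d b) *\<^sub>R b)"
    by (rule model_space_expansion) blast
  have der: "(f has_derivative frechet_derivative f (at (g x))) (at (g x))" if "x \<in> S" for x
    using C_k_on_Suc_has_derivative[OF Suc.prems(1)] assms(5) that by blast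
  have exp: "frechet_derivative f (at (g x)) w = (\<Sum>b\<in>B. (w \<bullet> d b) *\<^sub>R frechet_derivative f (at (g x)) b)"
    if "x \<in> S" for x w
    by (rule linear_expansion[OF has_derivative_linear[OF der[OF that]] B(2)])
  have D: "((\<lambda>x. f (g x)) has_derivative
      (\<lambda>v. \<Sum>b\<in>B. (frechet_derivative g (at x) v \<bullet> d b) *\<^sub>R frechet_derivative f (at (g x)) b)) (at x)"
    if "x \<in> S" for x
    using has_derivative_compose[OF C_k_on_Suc_has_derivative[OF Suc.prems(2) that] der[OF that]]
    by (subst (asm) exp[OF that]) 
  have "C_k_on k S (\<lambda>x. \<Sum>b\<in>B. (frechet_derivative g (at x) v \<bullet> d b) *\<^sub>R frechet_derivative f (at (g x)) b)" for v
    using Suc.prems C_k_on_SucD[OF Suc.prems(2)]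
    by (intro C_k_on_sum[OF assms(1)] C_k_on_bounded_bilinear[OF assms(1) bounded_bilinear_scaleR]
        C_k_on_bounded_linear_comp[OF assms(1) bounded_linear_inner_left] Suc.IH) auto
  from C_k_on_SucI[OF assms(1) D this] show ?case .
qed

section \<open>Smooth maps: the same rules for all orders at once\<close>

lemma C_inf_onD: "C_inf_on S f \<Longrightarrow> C_k_on k S f"
  by (simp add: C_inf_on_def)

lemma C_inf_on_subset: "C_inf_on S f \<Longrightarrow> T \<subseteq> S \<Longrightarrow> C_inf_on T f"
  unfolding C_inf_on_def using C_k_on_subset by blast

lemma C_inf_on_cong: "open S \<Longrightarrow> (\<And>x. x \<in> S \<Longrightarrow> f x = g x) \<Longrightarrow> C_inf_on S f \<Longrightarrow> C_inf_on S g"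
  unfolding C_inf_on_def using C_k_on_cong by blast

lemma C_inf_on_local:
  "(\<And>x. x \<in> S \<Longrightarrow> \<exists>W. open W \<and> x \<in> W \<and> C_inf_on W f) \<Longrightarrow> C_inf_on S f"
  unfolding C_inf_on_def by (intro allI C_k_on_local) meson

lemma C_inf_on_imp_continuous_on: "C_inf_on S f \<Longrightarrow> continuous_on S f"
  using C_inf_onD C_k_on_imp_continuous_on by blast

lemma C_inf_on_has_derivative:
  "C_inf_on S f \<Longrightarrow> x \<in> S \<Longrightarrow> (f has_derivative frechet_derivative f (at x)) (at x)"
  using C_inf_onD C_k_on_Suc_has_derivative by blast

lemma C_inf_on_linear:
  "C_inf_on S f \<Longrightarrow> x \<in> S \<Longrightarrow> linear (frechet_derivative f (at x))"
  using C_inf_on_has_derivative has_derivative_linear by blast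

lemma C_inf_on_frechet_derivative: "C_inf_on S f \<Longrightarrow> C_inf_on S (\<lambda>x. frechet_derivative f (at x) v)"
  unfolding C_inf_on_def by (metis C_k_on.simps(2))

lemma C_inf_on_const: "open S \<Longrightarrow> C_inf_on S (\<lambda>x. c)"
  by (simp add: C_inf_on_def C_k_on_const)

lemma C_inf_on_bounded_linear: "open S \<Longrightarrow> bounded_linear f \<Longrightarrow> C_inf_on S f"
  by (simp add: C_inf_on_def C_k_on_bounded_linear)

lemma C_inf_on_ident: "open S \<Longrightarrow> C_inf_on S (\<lambda>x. x)"
  by (rule C_inf_on_bounded_linear[OF _ bounded_linear_ident])

lemma C_inf_on_bounded_linear_comp:
  "open S \<Longrightarrow> bounded_linear l \<Longrightarrow> C_inf_on S f \<Longrightarrow> C_inf_on S (\<lambda>x. l (f x))"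
  by (simp add: C_inf_on_def C_k_on_bounded_linear_comp)

lemma C_inf_on_add:
  "open S \<Longrightarrow> C_inf_on S f \<Longrightarrow> C_inf_on S g \<Longrightarrow> C_inf_on S (\<lambda>x. f x + g x)"
  by (simp add: C_inf_on_def C_k_on_add)

lemma C_inf_on_diff:
  assumes "open S" "C_inf_on S f" "C_inf_on S g" shows "C_inf_on S (\<lambda>x. f x - g x)"
  using C_inf_on_add[OF assms(1,2) C_inf_on_bounded_linear_comp[OF assms(1) bounded_linear_minus[OF bounded_linear_ident] assms(3)]]
  by simp

lemma C_inf_on_sum:
  "open S \<Longrightarrow> (\<And>i. i \<in> I \<Longrightarrow> C_inf_on S (f i)) \<Longrightarrow> C_inf_on S (\<lambda>x. \<Sum>i\<in>I. f i x)"
  by (simp add: C_inf_on_def C_k_on_sum)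

lemma C_inf_on_bounded_bilinear:
  "open S \<Longrightarrow> bounded_bilinear p \<Longrightarrow> C_inf_on S f \<Longrightarrow> C_inf_on S g \<Longrightarrow> C_inf_on S (\<lambda>x. p (f x) (g x))"
  by (simp add: C_inf_on_def C_k_on_bounded_bilinear)

lemma C_inf_on_compose:
  fixes f :: "'b::model_space \<Rightarrow> 'c::real_normed_vector"
  shows "open S \<Longrightarrow> open T \<Longrightarrow> C_inf_on T f \<Longrightarrow> C_inf_on S g \<Longrightarrow> g ` S \<subseteq> T \<Longrightarrow> C_inf_on S (\<lambda>x. f (g x))"
  unfolding C_inf_on_def using C_k_on_compose by blast

lemma C_inf_on_Pair:
  assumes "open S" "C_inf_on S f" "C_inf_on S g" shows "C_inf_on S (\<lambda>x. (f x, g x))"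
proof -
  have l: "bounded_linear (\<lambda>x. (x, 0))" "bounded_linear (\<lambda>x. (0, x))"
    by (auto intro!: bounded_linear_Pair bounded_linear_ident bounded_linear_zero)
  from C_inf_on_add[OF assms(1) C_inf_on_bounded_linear_comp[OF assms(1) l(1) assms(2)]
      C_inf_on_bounded_linear_comp[OF assms(1) l(2) assms(3)]]
  show ?thesis
    by simp
qed

lemma C_inf_on_fst: "open S \<Longrightarrow> C_inf_on S f \<Longrightarrow> C_inf_on S (\<lambda>x. fst (f x))"
  by (rule C_inf_on_bounded_linear_comp[OF _ bounded_linear_fst])

lemma C_inf_on_snd: "open S \<Longrightarrow> C_inf_on S f \<Longrightarrow> C_inf_on S (\<lambda>x. snd (f x))"
  by (rule C_inf_on_bounded_linear_comp[OF _ bounded_linear_snd])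

text \<open>A derivative with moving base point and moving direction, reduced to fixed directions by
  the same expansion. It is the source of smoothness for tangent transition maps, fundamental fields
  and \<open>FL\<close> along a path.\<close>

lemma C_inf_on_frechet_derivative_comp:
  fixes f :: "'b::model_space \<Rightarrow> 'c::real_normed_vector"
  assumes "open S" "open T" "C_inf_on T f" "C_inf_on S g" "g ` S \<subseteq> T" "C_inf_on S w"
  shows "C_inf_on S (\<lambda>x. frechet_derivative f (at (g x)) (w x))"
proof -
  obtain B :: "'b set" and d where B: "finite B" "\<And>x. x = (\<Sum>b\<in>B. (x \<bullet> d b) *\<^sub>R b)"
    by (rule model_space_expansion) blast
  have "C_inf_on S (\<lambda>x. \<Sum>b\<in>B. (w x \<bullet> d b) *\<^sub>R frechet_derivative f (at (g x)) b)"
    by (intro C_inf_on_sum[OF assms(1)] C_inf_on_bounded_bilinear[OF assms(1) bounded_bilinear_scaleR]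
        C_inf_on_bounded_linear_comp[OF assms(1) bounded_linear_inner_left assms(6)]
        C_inf_on_compose[OF assms(1,2) C_inf_on_frechet_derivative[OF assms(3)] assms(4,5)])
  moreover have "frechet_derivative f (at (g x)) (w x) = (\<Sum>b\<in>B. (w x \<bullet> d b) *\<^sub>R frechet_derivative f (at (g x)) b)"
    if "x \<in> S" for x
    by (rule linear_expansion[OF C_inf_on_linear[OF assms(3)] B(2)]) (use assms that in auto)
  ultimately show ?thesis
    using C_inf_on_cong[OF assms(1)] by (metis (mono_tags, lifting))
qed

subsection \<open>Symmetry of second derivatives\<close>

text \<open>Two applications of the mean value theorem: first along \<open>v\<close> to the
  difference of \<open>f\<close> on two parallel segments, then along \<open>w\<close> to the
  resulting difference of derivatives.\<close>

lemma second_difference: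
  fixes f :: "'a::real_normed_vector \<Rightarrow> real"
  assumes "C_inf_on S f" "s > 0" "ball x r \<subseteq> S" "s * (norm v + norm w) < r"
  shows "\<exists>y. dist x y \<le> s * (norm v + norm w) \<and>
    f (x + s *\<^sub>R v + s *\<^sub>R w) - f (x + s *\<^sub>R v) - f (x + s *\<^sub>R w) + f x =
    s * s * frechet_derivative (\<lambda>y. frechet_derivative f (at y) v) (at y) w"
proof -
  have in_ball: "dist x (x + p *\<^sub>R v + q *\<^sub>R w) \<le> s * (norm v + norm w)" if "0 \<le> p" "p \<le> s" "0 \<le> q" "q \<le> s" for p q
  proof -
    have "dist x (x + p *\<^sub>R v + q *\<^sub>R w) = norm (p *\<^sub>R v + q *\<^sub>R w)"
      by (simp add: dist_norm norm_minus_commute algebra_simps)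
    also have "\<dots> \<le> p * norm v + q * norm w"
      using norm_triangle_ineq[of "p *\<^sub>R v" "q *\<^sub>R w"] that by simp
    also have "\<dots> \<le> s * norm v + s * norm w"
      using that by (intro add_mono mult_right_mono) auto
    finally show ?thesis by (simp add: algebra_simps)
  qed
  have in_S: "x + p *\<^sub>R v + q *\<^sub>R w \<in> S" if "0 \<le> p" "p \<le> s" "0 \<le> q" "q \<le> s" for p q
    using in_ball[OF that] assms(3,4) by auto
  \<comment> \<open>The summand \<open>0 *\<^sub>R w\<close> keeps both arguments in the shape to
    which \<open>in_S\<close> applies.\<close>
  define g where "g p = f (x + p *\<^sub>R v + s *\<^sub>R w) - f (x + p *\<^sub>R v + 0 *\<^sub>R w)" for p
  define g' where "g' p = frechet_derivative f (at (x + p *\<^sub>R v + s *\<^sub>R w)) v - frechet_derivative f (at (x + p *\<^sub>R v + 0 *\<^sub>R w)) v" for p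
  have line: "((\<lambda>p. h (x + p *\<^sub>R a + b)) has_real_derivative frechet_derivative h (at (x + p *\<^sub>R a + b)) a) (at p)"
    if "C_inf_on S h" "x + p *\<^sub>R a + b \<in> S" for h :: "'a \<Rightarrow> real" and p a b
  proof -
    have "((\<lambda>p. x + p *\<^sub>R a + b) has_derivative (\<lambda>t. t *\<^sub>R a)) (at p)"
      by (auto intro!: derivative_eq_intros)
    from has_derivative_compose[OF this C_inf_on_has_derivative[OF that]]
    have "((\<lambda>p. h (x + p *\<^sub>R a + b)) has_derivative (\<lambda>t. frechet_derivative h (at (x + p *\<^sub>R a + b)) (t *\<^sub>R a))) (at p)" .
    then show ?thesis
      using linear_scale[OF C_inf_on_linear[OF that]] by (simp add: has_field_derivative_def mult_commute_abs)
  qed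
  have "(g has_real_derivative g' p) (at p)" if "0 \<le> p" "p \<le> s" for p
    unfolding g_def[abs_def] g'_def using that assms(2)
    by (intro DERIV_diff line assms(1) in_S) auto
  then obtain p where p: "0 < p" "p < s" "g s - g 0 = (s - 0) * g' p"
    using MVT2[of 0 s g g'] assms(2) by auto
  define k where "k q = frechet_derivative f (at (x + q *\<^sub>R w + p *\<^sub>R v)) v" for q
  define k' where "k' q = frechet_derivative (\<lambda>y. frechet_derivative f (at y) v) (at (x + q *\<^sub>R w + p *\<^sub>R v)) w" for q
  have "(k has_real_derivative k' q) (at q)" if "0 \<le> q" "q \<le> s" for q
    unfolding k_def[abs_def] k'_def using in_S[of p q] that p
    by (intro line C_inf_on_frechet_derivative assms(1)) (auto simp: algebra_simps)
  then obtain q where q: "0 < q" "q < s" "k s - k 0 = (s - 0) * k' q"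
    using MVT2[of 0 s k k'] assms(2) by auto
  have "g' p = k s - k 0"
    by (simp add: g'_def k_def algebra_simps)
  then have "g s - g 0 = s * (s * k' q)"
    using p q by simp
  then show ?thesis
    using in_ball[of p q] p q
    by (intro exI[of _ "x + q *\<^sub>R w + p *\<^sub>R v"]) (auto simp: g_def k'_def algebra_simps)
qed

text \<open>The second difference is symmetric in \<open>v\<close> and \<open>w\<close>, so it
  equals both mixed derivatives, each at its own nearby point. Continuity of the mixed derivatives
  then forces equality at \<open>x\<close>.\<close>

lemma symmetric_second_derivative_real:
  fixes f :: "'a::real_normed_vector \<Rightarrow> real"
  assumes "open S" "C_inf_on S f" "x \<in> S"
  shows "frechet_derivative (\<lambda>y. frechet_derivative f (at y) v) (at x) w =
         frechet_derivative (\<lambda>y. frechet_derivative f (at y) w) (at x) v"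
proof -
  define A where "A v w y = frechet_derivative (\<lambda>y. frechet_derivative f (at y) v) (at y) w" for v w y
  obtain r where r: "r > 0" "ball x r \<subseteq> S"
    using assms(1,3) open_contains_ball by blast
  have cont: "isCont (A v w) x" for v w
    using C_inf_on_imp_continuous_on[OF C_inf_on_frechet_derivative[OF C_inf_on_frechet_derivative[OF assms(2)]]]
      assms(1,3) unfolding A_def by (metis continuous_on_eq_continuous_at)
  have "dist (A v w x) (A w v x) < e" if "e > 0" for e
  proof -
    obtain d1 where d1: "d1 > 0" "\<And>y. dist y x < d1 \<Longrightarrow> dist (A v w y) (A v w x) < e/2"
      using cont[of v w] \<open>e > 0\<close> by (metis continuous_at_eps_delta half_gt_zero)
    obtain d2 where d2: "d2 > 0" "\<And>y. dist y x < d2 \<Longrightarrow> dist (A w v y) (A w v x) < e/2"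
      using cont[of w v] \<open>e > 0\<close> by (metis continuous_at_eps_delta half_gt_zero)
    define m where "m = min r (min d1 d2)"
    \<comment> \<open>The added 1 avoids division by 0 when \<open>v\<close> and \<open>w\<close>
      vanish and makes the estimate below strict.\<close>
    define s where "s = m / (norm v + norm w + 1)"
    have "m > 0" using r d1 d2 by (simp add: m_def)
    then have "s > 0" by (simp add: s_def add_nonneg_pos)
    have s: "s * (norm v + norm w) < m"
    proof -
      have "s * (norm v + norm w) < s * (norm v + norm w + 1)" using \<open>s > 0\<close> by simp
      also have "\<dots> = m" unfolding s_def using norm_ge_zero[of v] norm_ge_zero[of w]
        by (smt (verit) nonzero_eq_divide_eq)
      finally show ?thesis .
    qed
    obtain y1 where y1: "dist x y1 \<le> s * (norm v + norm w)"
      "f (x + s *\<^sub>R v + s *\<^sub>R w) - f (x + s *\<^sub>R v) - f (x + s *\<^sub>R w) + f x = s * s * A v w y1"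
      using second_difference[OF assms(2) \<open>s > 0\<close> r(2), of v w] s unfolding A_def m_def by auto
    obtain y2 where y2: "dist x y2 \<le> s * (norm v + norm w)"
      "f (x + s *\<^sub>R v + s *\<^sub>R w) - f (x + s *\<^sub>R v) - f (x + s *\<^sub>R w) + f x = s * s * A w v y2"
      using second_difference[OF assms(2) \<open>s > 0\<close> r(2), of w v] s unfolding A_def m_def
      by (auto simp: algebra_simps)
    have "A v w y1 = A w v y2"
      using y1(2) y2(2) \<open>s > 0\<close> by simp
    moreover have "dist (A v w y1) (A v w x) < e/2"
      using y1(1) s by (intro d1(2)) (auto simp: dist_commute m_def)
    moreover have "dist (A w v y2) (A w v x) < e/2"
      using y2(1) s by (intro d2(2)) (auto simp: dist_commute m_def)
    ultimately show ?thesis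
      by (metis dist_commute dist_triangle_half_l)
  qed
  then show ?thesis
    unfolding A_def by (metis dist_self less_irrefl zero_less_dist_iff)
qed

text \<open>Reduced to real values by testing with all \<open>e \<bullet> f\<close>.\<close>

lemma symmetric_second_derivative:
  fixes f :: "'a::real_normed_vector \<Rightarrow> 'b::real_inner"
  assumes "open S" "C_inf_on S f" "x \<in> S"
  shows "frechet_derivative (\<lambda>y. frechet_derivative f (at y) v) (at x) w =
         frechet_derivative (\<lambda>y. frechet_derivative f (at y) w) (at x) v"
proof (rule vector_eq_ldot[THEN iffD1], rule allI)
  fix e :: 'b
  have inner: "frechet_derivative (\<lambda>y. e \<bullet> h y) (at y) = (\<lambda>u. e \<bullet> frechet_derivative h (at y) u)"
    if "C_inf_on S h" "y \<in> S" for h :: "'a \<Rightarrow> 'b" and y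
    using frechet_derivative_at[OF has_derivative_inner_right[OF C_inf_on_has_derivative[OF that]]] by simp
  have "C_inf_on S (\<lambda>y. e \<bullet> f y)"
    by (intro C_inf_on_bounded_linear_comp[OF _ bounded_linear_inner_right] assms)
  note sym = symmetric_second_derivative_real[OF assms(1) this assms(3)]
  have "frechet_derivative (\<lambda>y. frechet_derivative (\<lambda>y. e \<bullet> f y) (at y) v) (at x) w =
      e \<bullet> frechet_derivative (\<lambda>y. frechet_derivative f (at y) v) (at x) w" for v w
  proof -
    have "frechet_derivative (\<lambda>y. frechet_derivative (\<lambda>y. e \<bullet> f y) (at y) v) (at x) =
      frechet_derivative (\<lambda>y. e \<bullet> frechet_derivative f (at y) v) (at x)"
      by (rule frechet_derivative_cong_open[OF assms(1,3)]) (simp add: inner[OF assms(2)])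
    then show ?thesis
      by (simp add: inner[OF C_inf_on_frechet_derivative[OF assms(2)] assms(3)])
  qed
  then show "e \<bullet> frechet_derivative (\<lambda>y. frechet_derivative f (at y) v) (at x) w =
      e \<bullet> frechet_derivative (\<lambda>y. frechet_derivative f (at y) w) (at x) v"
    using sym by simp
qed

subsection \<open>Smooth families of linear equations\<close>

lemma injective_linear_bounded_left_inverse:
  fixes A :: "'a::model_space \<Rightarrow> 'b::model_space"
  assumes "linear A" "\<And>u. A u = 0 \<Longrightarrow> u = 0"
  obtains B where "bounded_linear B" "\<And>u. B (A u) = u"
proof -
  have "inj A"
    using linear_injective_0[OF assms(1)] assms(2) by blast
  then obtain B where "linear B" "B \<circ> A = id"
    using linear_injective_left_inverse[OF assms(1)] by blast
  then show thesis
    by (intro that[of B] linear_imp_bounded_linear) (auto simp: fun_eq_iff)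
qed

text \<open>A product rule for a coefficient that is merely continuous; the vanishing of
  \<open>g\<close> at \<open>x\<close> removes the term that would differentiate \<open>c\<close>.
  It breaks a circle in \<open>solution_C_k\<close>, where the coefficients come from the solution
  whose differentiability is still to be shown.\<close>

lemma has_derivative_scaleR_vanishing:
  fixes g :: "'a::real_normed_vector \<Rightarrow> 'b::real_normed_vector"
  assumes "isCont c x" "(g has_derivative D) (at x)" "g x = 0"
  shows "((\<lambda>y. c y *\<^sub>R g y) has_derivative (\<lambda>v. c x *\<^sub>R D v)) (at x)"
proof -
  have D: "bounded_linear D" using assms(2) by (rule has_derivative_bounded_linear)
  obtain K where K: "\<And>v. norm (D v) \<le> norm v * K" using bounded_linear.bounded[OF D] by blast
  have lim: "((\<lambda>y. norm (g y - g x - D (y - x)) / norm (y - x)) \<longlongrightarrow> 0) (at x)"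
    using assms(2) by (simp add: has_derivative_iff_norm)
  have c: "(c \<longlongrightarrow> c x) (at x)" using assms(1) by (simp add: isCont_def)
  have "((\<lambda>y. norm (c y) * (norm (g y - g x - D (y - x)) / norm (y - x)) + norm (c y - c x) * \<bar>K\<bar>) \<longlongrightarrow> norm (c x) * 0 + norm (c x - c x) * \<bar>K\<bar>) (at x)"
    by (intro tendsto_intros c lim)
  then have l: "((\<lambda>y. norm (c y) * (norm (g y - g x - D (y - x)) / norm (y - x)) + norm (c y - c x) * \<bar>K\<bar>) \<longlongrightarrow> 0) (at x)"
    by simp
  have b: "norm (norm (c y *\<^sub>R g y - c x *\<^sub>R g x - c x *\<^sub>R D (y - x)) / norm (y - x))
      \<le> norm (c y) * (norm (g y - g x - D (y - x)) / norm (y - x)) + norm (c y - c x) * \<bar>K\<bar>" if "y \<noteq> x" for y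
  proof -
    have "c y *\<^sub>R g y - c x *\<^sub>R g x - c x *\<^sub>R D (y - x) = c y *\<^sub>R (g y - g x - D (y - x)) + (c y - c x) *\<^sub>R D (y - x)"
      using assms(3) by (simp add: algebra_simps)
    then have "norm (c y *\<^sub>R g y - c x *\<^sub>R g x - c x *\<^sub>R D (y - x)) \<le> norm (c y) * norm (g y - g x - D (y - x)) + norm (c y - c x) * norm (D (y - x))"
      by (metis norm_scaleR norm_triangle_ineq real_norm_def)
    also have "\<dots> \<le> norm (c y) * norm (g y - g x - D (y - x)) + norm (c y - c x) * (\<bar>K\<bar> * norm (y - x))"
      using K[of "y - x"] mult_right_mono[OF abs_ge_self norm_ge_zero, of K "y - x"]
      by (intro add_left_mono mult_left_mono) (auto simp: mult.commute)
    finally show ?thesis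
      using that by (simp add: field_simps)
  qed
  have "((\<lambda>y. norm (c y *\<^sub>R g y - c x *\<^sub>R g x - c x *\<^sub>R D (y - x)) / norm (y - x)) \<longlongrightarrow> 0) (at x)"
    by (rule Lim_null_comparison[OF _ l]) (use b in \<open>auto simp: eventually_at_filter\<close>)
  then show ?thesis
    using bounded_linear_compose[OF bounded_linear_scaleR_right D] by (simp add: has_derivative_iff_norm)
qed

text \<open>Solutions are given from outside, so injectivity of each \<open>A x\<close> is enough: a
  left inverse at one point controls the solution nearby. No formula for an inverse depending on
  \<open>x\<close> is involved.\<close>

locale smooth_linear_equation =
  fixes S :: "'x::real_normed_vector set" and A :: "'x \<Rightarrow> 'e::model_space \<Rightarrow> 'f::model_space"
  assumes open_S: "open S"
    and linear_A: "\<And>x. x \<in> S \<Longrightarrow> linear (A x)"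
    and injective_A: "\<And>x u. x \<in> S \<Longrightarrow> A x u = 0 \<Longrightarrow> u = 0"
    and C_inf_A: "\<And>u. C_inf_on S (\<lambda>x. A x u)"
begin

text \<open>Near \<open>x\<close> the equation is compared with the one at \<open>x\<close> itself,
  which has a bounded left inverse \<open>B\<close>; \<open>\<epsilon> y\<close> bounds the operator
  norm of \<open>A y - A x\<close>.\<close>

lemma solution_continuous:
  assumes "continuous_on S w" "\<And>x. x \<in> S \<Longrightarrow> A x (u x) = w x"
  shows "continuous_on S u"
proof (rule continuous_at_imp_continuous_on, rule ballI)
  fix x assume x: "x \<in> S"
  obtain E :: "'e set" and d where E: "finite E" "\<And>x. x = (\<Sum>b\<in>E. (x \<bullet> d b) *\<^sub>R b)"
    by (rule model_space_expansion) blast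
  obtain B where B: "bounded_linear B" "\<And>u. B (A x u) = u"
    using injective_linear_bounded_left_inverse[OF linear_A[OF x] injective_A[OF x]] by blast
  obtain K where K: "K > 0" "\<And>v. norm (B v) \<le> norm v * K"
    using bounded_linear.pos_bounded[OF B(1)] by blast
  define \<epsilon> where "\<epsilon> y = (\<Sum>b\<in>E. norm (d b) * norm (A y b - A x b))" for y
  have \<epsilon>: "norm (A y v - A x v) \<le> norm v * \<epsilon> y" if "y \<in> S" for y v
  proof -
    have "A y v - A x v = (\<Sum>b\<in>E. (v \<bullet> d b) *\<^sub>R (A y b - A x b))"
      by (simp add: linear_expansion[OF linear_A[OF x] E(2), of v] linear_expansion[OF linear_A[OF that] E(2), of v]
          sum_subtractf scaleR_diff_right)
    also have "norm \<dots> \<le> (\<Sum>b\<in>E. norm v * norm (d b) * norm (A y b - A x b))"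
      by (intro sum_norm_le) (auto intro!: mult_right_mono Cauchy_Schwarz_ineq2)
    finally show ?thesis by (simp add: \<epsilon>_def sum_distrib_left mult.assoc)
  qed
  have wx: "(w \<longlongrightarrow> w x) (at x)"
    using assms(1) x open_S by (metis continuous_on_eq_continuous_at isCont_def)
  have Ax: "((\<lambda>y. A y b) \<longlongrightarrow> A x b) (at x)" for b
    using C_inf_on_imp_continuous_on[OF C_inf_A] x open_S by (metis continuous_on_eq_continuous_at isCont_def)
  have "(\<epsilon> \<longlongrightarrow> (\<Sum>b\<in>E. norm (d b) * norm (A x b - A x b))) (at x)"
    unfolding \<epsilon>_def[abs_def] by (intro tendsto_intros Ax)
  then have \<epsilon>0: "(\<epsilon> \<longlongrightarrow> 0) (at x)" by simp
  have "((\<lambda>y. 2 * K * (norm (w y - w x) + norm (u x) * \<epsilon> y)) \<longlongrightarrow> 2 * K * (norm (w x - w x) + norm (u x) * 0)) (at x)"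
    by (intro tendsto_intros wx \<epsilon>0)
  then have lim: "((\<lambda>y. 2 * K * (norm (w y - w x) + norm (u x) * \<epsilon> y)) \<longlongrightarrow> 0) (at x)" by simp
  have bound: "norm (u y - u x) \<le> 2 * K * (norm (w y - w x) + norm (u x) * \<epsilon> y)" if y: "y \<in> S" and e: "\<epsilon> y < 1 / (2 * K)" for y
  proof -
    interpret Ax: linear "A x" by (rule linear_A[OF x])
    interpret Ay: linear "A y" by (rule linear_A[OF y])
    have "A x (u y - u x) = w y - w x - (A y (u y - u x) - A x (u y - u x)) - (A y (u x) - A x (u x))"
      using assms(2)[OF x] assms(2)[OF y] by (simp add: Ax.diff Ay.diff)
    then have "norm (A x (u y - u x)) \<le> norm (w y - w x) + norm (u y - u x) * \<epsilon> y + norm (u x) * \<epsilon> y"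
      using \<epsilon>[OF y, of "u y - u x"] \<epsilon>[OF y, of "u x"]
        norm_triangle_ineq4[of "w y - w x" "A y (u y - u x) - A x (u y - u x)"]
        norm_triangle_ineq4[of "w y - w x - (A y (u y - u x) - A x (u y - u x))" "A y (u x) - A x (u x)"]
      by (smt (verit))
    then have "norm (u y - u x) \<le> (norm (w y - w x) + norm (u y - u x) * \<epsilon> y + norm (u x) * \<epsilon> y) * K"
      using K(2)[of "A x (u y - u x)"] K(1) by (simp add: B(2)) (meson mult_right_mono order_trans less_imp_le)
    \<comment> \<open>The smallness of \<open>\<epsilon> y\<close> makes this term at most half of
      the left side. Absorbing it there produces the factor 2 in the bound.\<close>
    moreover have "norm (u y - u x) * \<epsilon> y * K \<le> norm (u y - u x) * (1/2)"
      using e K(1) by (subst mult.assoc, intro mult_left_mono) (auto simp: field_simps)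
    ultimately show ?thesis
      by (simp add: algebra_simps)
  qed
  have "eventually (\<lambda>y. y \<in> S \<and> \<epsilon> y < 1 / (2 * K)) (at x)"
    using \<epsilon>0 K(1) by (intro eventually_conj eventually_at_in_open'[OF open_S x] order_tendstoD(2)[OF \<epsilon>0]) auto
  then have "((\<lambda>y. u y - u x) \<longlongrightarrow> 0) (at x)"
    by (intro Lim_null_comparison[OF _ lim]) (auto elim!: eventually_mono bound)
  then show "isCont u x"
    by (simp add: isCont_def LIM_zero_iff)
qed

text \<open>Differentiability is obtained first, by hand; afterwards the directional derivatives of
  \<open>u\<close> solve the same linear equation with a new right side, so the induction runs over
  all right sides.\<close>

lemma solution_C_k:
  assumes "C_k_on k S w" "\<And>x. x \<in> S \<Longrightarrow> A x (u x) = w x"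
  shows "C_k_on k S u"
  using assms
proof (induction k arbitrary: u w)
  case 0
  then show ?case using solution_continuous by auto
next
  case (Suc k)
  obtain E :: "'e set" and d where E: "finite E" "\<And>x. x = (\<Sum>b\<in>E. (x \<bullet> d b) *\<^sub>R b)"
    by (rule model_space_expansion) blast
  have u_k: "C_k_on k S u"
    using Suc.IH[OF C_k_on_SucD[OF Suc.prems(1)] Suc.prems(2)] .
  have u_cont: "isCont u x" if "x \<in> S" for x
    using C_k_on_imp_continuous_on[OF u_k] open_S that by (simp add: continuous_on_eq_continuous_at)
  have diff: "u differentiable (at x)" if x: "x \<in> S" for x
  proof -
    obtain B where B: "bounded_linear B" "\<And>u. B (A x u) = u"
      using injective_linear_bounded_left_inverse[OF linear_A[OF x] injective_A[OF x]] by blast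
    \<comment> \<open>On \<open>S\<close>, \<open>h y\<close> is \<open>A x (u y)\<close>, so the
      fixed left inverse \<open>B\<close> recovers \<open>u y\<close> from it. Here \<open>u\<close>
      occurs only as a coefficient of differences that vanish at \<open>x\<close>, hence its
      continuity suffices for differentiating \<open>h\<close> at \<open>x\<close>.\<close>
    define h where "h y = w y - (\<Sum>b\<in>E. (u y \<bullet> d b) *\<^sub>R (A y b - A x b))" for y
    have uh: "B (h y) = u y" if y: "y \<in> S" for y
    proof -
      have "(\<Sum>b\<in>E. (u y \<bullet> d b) *\<^sub>R (A y b - A x b)) = A y (u y) - A x (u y)"
        by (simp add: linear_expansion[OF linear_A[OF x] E(2), of "u y"] linear_expansion[OF linear_A[OF y] E(2), of "u y"]
          sum_subtractf scaleR_diff_right)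
      then have "h y = A x (u y)"
        using Suc.prems(2)[OF y] by (simp add: h_def)
      then show ?thesis using B(2) by simp
    qed
    have Ad: "((\<lambda>y. A y b - A x b) has_derivative frechet_derivative (\<lambda>y. A y b) (at x)) (at x)" for b
      using has_derivative_diff[OF C_inf_on_has_derivative[OF C_inf_A x, of b] has_derivative_const[of "A x b"]] by simp
    have "isCont (\<lambda>y. u y \<bullet> d b) x" for b
      by (intro continuous_intros u_cont x)
    from has_derivative_scaleR_vanishing[OF this Ad]
    have dd: "((\<lambda>y. (u y \<bullet> d b) *\<^sub>R (A y b - A x b)) has_derivative (\<lambda>v. (u x \<bullet> d b) *\<^sub>R frechet_derivative (\<lambda>y. A y b) (at x) v)) (at x)" for b
      by simp
    have "(h has_derivative (\<lambda>v. frechet_derivative w (at x) v - (\<Sum>b\<in>E. (u x \<bullet> d b) *\<^sub>R frechet_derivative (\<lambda>y. A y b) (at x) v))) (at x)"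
      unfolding h_def[abs_def] by (intro has_derivative_diff has_derivative_sum dd C_k_on_Suc_has_derivative[OF Suc.prems(1) x])
    from bounded_linear.has_derivative[OF B(1) this]
    have "(u has_derivative (\<lambda>v. B (frechet_derivative w (at x) v - (\<Sum>b\<in>E. (u x \<bullet> d b) *\<^sub>R frechet_derivative (\<lambda>y. A y b) (at x) v)))) (at x)"
      by (rule has_derivative_transform_within_open[OF _ open_S x]) (simp add: uh)
    then show ?thesis by (auto simp: differentiable_def)
  qed
  then have du: "(u has_derivative frechet_derivative u (at x)) (at x)" if "x \<in> S" for x
    using that by (simp add: frechet_derivative_works)
  \<comment> \<open>Differentiating \<open>A x (u x) = w x\<close> in direction \<open>v\<close>
    exhibits the derivative of \<open>u\<close> as a solution whose right side contains only
    \<open>u\<close> itself and is of class \<open>k\<close>.\<close>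
  have "C_k_on k S (\<lambda>x. frechet_derivative u (at x) v)" for v
  proof (rule Suc.IH)
    show "C_k_on k S (\<lambda>x. frechet_derivative w (at x) v + - (\<Sum>b\<in>E. (u x \<bullet> d b) *\<^sub>R frechet_derivative (\<lambda>y. A y b) (at x) v))"
      using Suc.prems(1)
      by (intro C_k_on_add[OF open_S] C_k_on_bounded_linear_comp[OF open_S bounded_linear_minus[OF bounded_linear_ident]]
          C_k_on_sum[OF open_S] C_k_on_bounded_bilinear[OF open_S bounded_bilinear_scaleR]
          C_k_on_bounded_linear_comp[OF open_S bounded_linear_inner_left u_k] C_inf_onD[OF C_inf_on_frechet_derivative[OF C_inf_A]]) auto
  next
    fix x assume x: "x \<in> S"
    have "((\<lambda>y. \<Sum>b\<in>E. (u y \<bullet> d b) *\<^sub>R A y b) has_derivative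
       (\<lambda>v. \<Sum>b\<in>E. (u x \<bullet> d b) *\<^sub>R frechet_derivative (\<lambda>y. A y b) (at x) v + (frechet_derivative u (at x) v \<bullet> d b) *\<^sub>R A x b)) (at x)"
      by (intro has_derivative_sum has_derivative_scaleR has_derivative_inner_left du x C_inf_on_has_derivative[OF C_inf_A x])
    moreover have "(\<Sum>b\<in>E. (u y \<bullet> d b) *\<^sub>R A y b) = w y" if "y \<in> S" for y
      using linear_expansion[OF linear_A[OF that] E(2), of "u y"] Suc.prems(2)[OF that] by simp
    ultimately have "(w has_derivative
       (\<lambda>v. \<Sum>b\<in>E. (u x \<bullet> d b) *\<^sub>R frechet_derivative (\<lambda>y. A y b) (at x) v + (frechet_derivative u (at x) v \<bullet> d b) *\<^sub>R A x b)) (at x)"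
      using has_derivative_transform_within_open[OF _ open_S x] by fastforce
    from fun_cong[OF frechet_derivative_at[OF this], of v]
    show "A x (frechet_derivative u (at x) v) = frechet_derivative w (at x) v + - (\<Sum>b\<in>E. (u x \<bullet> d b) *\<^sub>R frechet_derivative (\<lambda>y. A y b) (at x) v)"
      using linear_expansion[OF linear_A[OF x] E(2), of "frechet_derivative u (at x) v"]
      by (simp add: sum.distrib eq_diff_eq add.commute)
  qed
  then show ?case
    using diff by simp
qed

lemma solution_C_inf: "C_inf_on S w \<Longrightarrow> (\<And>x. x \<in> S \<Longrightarrow> A x (u x) = w x) \<Longrightarrow> C_inf_on S u"
  by (metis C_inf_on_def solution_C_k)

end

subsection \<open>Ordinary differential equations\<close>

lemma C_inf_on_locally_lipschitz:
  fixes V :: "'a::model_space \<Rightarrow> 'b::real_normed_vector"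
  assumes "open S" "C_inf_on S V" "x0 \<in> S"
  obtains \<rho> K where "\<rho> > 0" "K > 0" "cball x0 \<rho> \<subseteq> S"
    "\<And>x y. x \<in> cball x0 \<rho> \<Longrightarrow> y \<in> cball x0 \<rho> \<Longrightarrow> norm (V x - V y) \<le> K * norm (x - y)"
proof -
  obtain E :: "'a set" and d where E: "finite E" "\<And>x. x = (\<Sum>b\<in>E. (x \<bullet> d b) *\<^sub>R b)"
    by (rule model_space_expansion) blast
  define N where "N x = (\<Sum>b\<in>E. norm (d b) * norm (frechet_derivative V (at x) b))" for x
  have N: "norm (frechet_derivative V (at x) v) \<le> norm v * N x" if "x \<in> S" for x v
  proof -
    have "norm (frechet_derivative V (at x) v) \<le> (\<Sum>b\<in>E. norm v * norm (d b) * norm (frechet_derivative V (at x) b))"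
      by (subst linear_expansion[OF C_inf_on_linear[OF assms(2) that] E(2)], intro sum_norm_le)
        (auto intro!: mult_right_mono Cauchy_Schwarz_ineq2)
    then show ?thesis by (simp add: N_def sum_distrib_left mult.assoc)
  qed
  have "continuous_on S N"
    unfolding N_def[abs_def]
    by (intro continuous_intros C_inf_on_imp_continuous_on[OF C_inf_on_frechet_derivative[OF assms(2)]])
  then have "isCont N x0"
    using assms(1,3) by (simp add: continuous_on_eq_continuous_at)
  then obtain \<delta> where \<delta>: "\<delta> > 0" "\<And>y. dist y x0 < \<delta> \<Longrightarrow> dist (N y) (N x0) < 1"
    by (metis continuous_at_eps_delta zero_less_one)
  obtain r where r: "r > 0" "cball x0 r \<subseteq> S"
    using assms(1,3) open_contains_cball by blast
  \<comment> \<open>Half of \<open>\<delta>\<close> keeps the closed ball inside the open one on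
    which \<open>N\<close> exceeds \<open>N x0\<close> by less than 1; this gives the Lipschitz
    constant \<open>N x0 + 1\<close>.\<close>
  define \<rho> where "\<rho> = min r (\<delta> / 2)"
  have "N x0 \<ge> 0" by (auto simp: N_def intro!: sum_nonneg)
  have sub: "cball x0 \<rho> \<subseteq> S" using r by (auto simp: \<rho>_def)
  have "norm (V x - V y) \<le> (N x0 + 1) * norm (x - y)" if "x \<in> cball x0 \<rho>" "y \<in> cball x0 \<rho>" for x y
  proof (rule differentiable_bound[OF convex_cball _ _ that])
    fix z assume z: "z \<in> cball x0 \<rho>"
    then show "(V has_derivative frechet_derivative V (at z)) (at z within cball x0 \<rho>)"
      using C_inf_on_has_derivative[OF assms(2)] sub has_derivative_at_withinI by blast
    have "N z \<le> N x0 + 1"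
      using \<delta>(2)[of z] z \<open>\<delta> > 0\<close> by (auto simp: \<rho>_def dist_commute dist_real_def)
    then have "norm (frechet_derivative V (at z) v) \<le> (N x0 + 1) * norm v" for v
      using N[of z v] z sub mult_left_mono[of "N z" "N x0 + 1" "norm v"] by (fastforce simp: mult.commute)
    then show "onorm (frechet_derivative V (at z)) \<le> N x0 + 1"
      using \<open>N x0 \<ge> 0\<close> by (intro onorm_bound) simp_all
  qed
  moreover have "\<rho> > 0" using r \<delta> by (simp add: \<rho>_def)
  ultimately show thesis
    using that[of \<rho> "N x0 + 1"] sub \<open>N x0 \<ge> 0\<close> by auto
qed

text \<open>Solutions for positive times are enough here: the curve is later recentred at an
  interior time, which yields a two-sided interval.\<close>

lemma picard_local_solution:
  fixes V :: "'a::banach \<Rightarrow> 'a"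
  assumes "\<rho> > 0" "K > 0"
    "\<And>x y. x \<in> cball x0 \<rho> \<Longrightarrow> y \<in> cball x0 \<rho> \<Longrightarrow> norm (V x - V y) \<le> K * norm (x - y)"
  obtains r x where "r > 0" "\<And>t. t \<in> {0<..<r} \<Longrightarrow> x t \<in> cball x0 \<rho>"
    "\<And>t. t \<in> {0<..<r} \<Longrightarrow> (x has_vector_derivative V (x t)) (at t)"
proof -
  define M where "M = norm (V x0) + K * \<rho>"
  have VM: "norm (V x) \<le> M" if "x \<in> cball x0 \<rho>" for x
  proof -
    have "norm (V x) \<le> norm (V x0) + norm (V x - V x0)"
      by (metis norm_triangle_sub)
    also have "\<dots> \<le> norm (V x0) + K * norm (x - x0)"
      using assms(1,3) that by simp
    also have "\<dots> \<le> M"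
      using that assms(2) by (auto simp: M_def dist_norm norm_minus_commute)
    finally show ?thesis .
  qed
  have "M > 0" using assms by (simp add: M_def add_nonneg_pos)
  \<comment> \<open>\<open>M\<close> bounds \<open>V\<close> on the ball, so the first entry keeps
    the integral curve in the ball; the second makes the integral operator a contraction with factor
    1/2.\<close>
  define r where "r = min (\<rho> / M) (1 / (2 * K))"
  have "r > 0" using assms \<open>M > 0\<close> by (simp add: r_def)
  have rM: "r * M \<le> \<rho>" using \<open>M > 0\<close> by (simp add: r_def min_def field_simps split: if_splits)
  have rK: "r * K \<le> 1/2" using assms(2) by (simp add: r_def min_def field_simps split: if_splits)
  \<comment> \<open>Clamping the time turns the integral operator into a self-map of bounded
    continuous functions on the whole line, a complete space. The fixed point solves the equation
    only inside \<open>{0<..<r}\<close>.\<close>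
  define cl where "cl t = max 0 (min r t)" for t
  have cl: "cl t \<in> {0..r}" "t \<in> {0..r} \<Longrightarrow> cl t = t" for t using \<open>r > 0\<close> by (auto simp: cl_def)
  have ccl: "continuous_on UNIV cl" unfolding cl_def[abs_def] by (intro continuous_intros)
  have contV: "continuous_on (cball x0 \<rho>) V"
    by (rule lipschitz_on_continuous_on[of K])
       (use assms in \<open>auto simp: lipschitz_on_def dist_norm\<close>)
  define X where "X = {f :: real \<Rightarrow>\<^sub>C 'a. \<forall>t. apply_bcontfun f t \<in> cball x0 \<rho>}"
  define I where "I f t = x0 + integral {0..cl t} (\<lambda>s. V (apply_bcontfun f s))" for f t
  have cV: "continuous_on T (\<lambda>s. V (apply_bcontfun f s))" if "f \<in> X" for f T
    by (rule continuous_on_compose2[OF contV]) (use that in \<open>auto simp: X_def\<close>)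
  have iV: "(\<lambda>s. V (apply_bcontfun f s)) integrable_on {a..b}" if "f \<in> X" for f a b
    by (intro integrable_continuous_interval cV that)
  have Iball: "I f t \<in> cball x0 \<rho>" if "f \<in> X" for f t
  proof -
    have "norm (integral {0..cl t} (\<lambda>s. V (apply_bcontfun f s))) \<le> M * (cl t - 0)"
      using cl(1)[of t] that by (intro integral_bound cV VM) (auto simp: X_def)
    also have "\<dots> \<le> M * r" using cl(1)[of t] \<open>M > 0\<close> by auto
    finally show ?thesis using rM by (simp add: I_def dist_norm mult.commute)
  qed
  have Icont: "continuous_on UNIV (I f)" if "f \<in> X" for f
  proof -
    have "continuous_on {0..r} (\<lambda>t. integral {0..t} (\<lambda>s. V (apply_bcontfun f s)))"
      by (rule indefinite_integral_continuous_1[OF iV[OF that]])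
    from continuous_on_compose2[OF this ccl]
    have "continuous_on UNIV (\<lambda>t. integral {0..cl t} (\<lambda>s. V (apply_bcontfun f s)))"
      using cl(1) by blast
    then show ?thesis unfolding I_def[abs_def] by (intro continuous_intros)
  qed
  have Ib: "I f \<in> bcontfun" if "f \<in> X" for f
    using Icont[OF that] Iball[OF that] by (intro bcontfun_normI[where b = "norm x0 + \<rho>"])
      (auto simp: dist_norm, metis norm_triangle_sub norm_minus_commute add_left_mono order_trans)
  define T where "T f = Bcontfun (I f)" for f
  have T: "apply_bcontfun (T f) = I f" if "f \<in> X" for f
    using Ib[OF that] by (simp add: T_def Bcontfun_inverse)
  have "closed X"
  proof -
    have "X = {f. \<forall>t. dist x0 (apply_bcontfun f t) \<le> \<rho>}" by (auto simp: X_def)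
    moreover have "continuous_on UNIV (\<lambda>f :: real \<Rightarrow>\<^sub>C 'a. apply_bcontfun f t)" for t
      by (intro lipschitz_on_continuous_on[of 1]) (auto simp: lipschitz_on_def dist_bounded)
    then have "closed {f :: real \<Rightarrow>\<^sub>C 'a. dist x0 (apply_bcontfun f t) \<le> \<rho>}" for t
      by (intro closed_Collect_le continuous_intros)
    ultimately show ?thesis by (simp add: closed_Collect_all)
  qed
  then have "complete X" by (simp add: complete_eq_closed)
  moreover have "X \<noteq> {}"
  proof -
    have "const_bcontfun x0 \<in> X" using assms(1) by (simp add: X_def)
    then show ?thesis by blast
  qed
  moreover have "T ` X \<subseteq> X" using Iball T by (auto simp: X_def)
  moreover have "dist (T f) (T g) \<le> 1/2 * dist f g" if "f \<in> X" "g \<in> X" for f g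
  proof (rule dist_bound)
    fix t
    have "norm (V (apply_bcontfun f s) - V (apply_bcontfun g s)) \<le> K * dist f g" for s
    proof -
      have "norm (V (apply_bcontfun f s) - V (apply_bcontfun g s)) \<le> K * norm (apply_bcontfun f s - apply_bcontfun g s)"
        using that by (intro assms(3)) (auto simp: X_def)
      also have "\<dots> \<le> K * dist f g"
        using dist_bounded[of f s g] assms(2) by (simp add: dist_norm)
      finally show ?thesis .
    qed
    then have "norm (integral {0..cl t} (\<lambda>s. V (apply_bcontfun f s) - V (apply_bcontfun g s))) \<le> K * dist f g * (cl t - 0)"
      using cl(1)[of t] that by (intro integral_bound continuous_intros cV) auto
    also have "\<dots> \<le> K * dist f g * r" using cl(1)[of t] assms(2) by (intro mult_left_mono) auto
    also have "\<dots> = r * K * dist f g" by simp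
    also have "\<dots> \<le> 1/2 * dist f g" by (intro mult_right_mono rK) auto
    finally show "dist (apply_bcontfun (T f) t) (apply_bcontfun (T g) t) \<le> 1/2 * dist f g"
      using that by (simp add: T I_def dist_norm integral_diff[OF iV iV])
  qed
  ultimately have "\<exists>!f. f \<in> X \<and> T f = f"
    by (intro Banach_fix[of X "1/2" T]) auto
  then obtain f where f: "f \<in> X" "T f = f"
    by blast
  define x where "x = apply_bcontfun f"
  have x: "x t = x0 + integral {0..t} (\<lambda>s. V (x s))" if "t \<in> {0..r}" for t
  proof -
    have "x t = I f t"
      unfolding x_def by (subst f(2)[symmetric]) (simp only: T[OF f(1)])
    then show ?thesis
      by (simp only: I_def cl(2)[OF that] x_def)
  qed
  show thesis
  proof
    show "r > 0" by fact
    fix t assume t: "t \<in> {0<..<r}"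
    show "x t \<in> cball x0 \<rho>" using f(1) by (simp add: X_def x_def)
    have "continuous_on {0..r} (\<lambda>s. V (x s))" unfolding x_def by (rule cV[OF f(1)])
    from integral_has_vector_derivative[OF this, of t]
    have "((\<lambda>u. x0 + integral {0..u} (\<lambda>s. V (x s))) has_vector_derivative V (x t)) (at t within {0..r})"
      using t by (auto intro!: derivative_eq_intros)
    then have "((\<lambda>u. x0 + integral {0..u} (\<lambda>s. V (x s))) has_vector_derivative V (x t)) (at t)"
      using t at_within_interior[of t "{0..r}"] by simp
    then show "(x has_vector_derivative V (x t)) (at t)"
      by (rule has_vector_derivative_transform_within_open[of _ _ _ "{0<..<r}"]) (use t x in auto)
  qed
qed

text \<open>Bootstrapping: if \<open>x\<close> is of class \<open>k\<close>, then so is its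
  derivative \<open>V (x t)\<close>, and \<open>x\<close> is of class \<open>Suc k\<close>.\<close>

lemma smooth_ode_local_solution:
  fixes V :: "'a::model_space \<Rightarrow> 'a"
  assumes "open S" "C_inf_on S V" "x0 \<in> S"
  obtains r x where "r > 0" "C_inf_on {0<..<r} x" "\<And>t. t \<in> {0<..<r} \<Longrightarrow> x t \<in> S"
    "\<And>t. t \<in> {0<..<r} \<Longrightarrow> (x has_vector_derivative V (x t)) (at t)"
proof -
  obtain \<rho> K where K: "\<rho> > 0" "K > 0" "cball x0 \<rho> \<subseteq> S"
    "\<And>x y. x \<in> cball x0 \<rho> \<Longrightarrow> y \<in> cball x0 \<rho> \<Longrightarrow> norm (V x - V y) \<le> K * norm (x - y)"
    using C_inf_on_locally_lipschitz[OF assms] by blast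
  obtain r x where x: "r > 0" "\<And>t. t \<in> {0<..<r} \<Longrightarrow> x t \<in> cball x0 \<rho>"
    "\<And>t. t \<in> {0<..<r} \<Longrightarrow> (x has_vector_derivative V (x t)) (at t)"
    using picard_local_solution[OF K(1,2,4)] by blast
  have "C_k_on k {0<..<r} x" for k
  proof (induction k)
    case 0
    then show ?case
      using x(3) has_vector_derivative_continuous
      by (auto intro!: continuous_at_imp_continuous_on) blast
  next
    case (Suc k)
    have "C_k_on k {0<..<r} (\<lambda>t. V (x t))"
      using K(3) x(2) by (intro C_k_on_compose[OF _ assms(1) C_inf_onD[OF assms(2)] Suc]) auto
    then show ?case
      using x(3) by (intro C_k_on_SucI[where D = "\<lambda>t v. v *\<^sub>R V (x t)"] C_k_on_bounded_linear_comp[OF _ bounded_linear_scaleR_right])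
        (auto simp: has_vector_derivative_def)
  qed
  then show thesis
    using that[of r x] x K(3) unfolding C_inf_on_def by blast
qed

section \<open>Atlases without a topology on the points\<close>

text \<open>The part of the manifold axioms that mentions no topology on the points. It is inherited
  by \<open>tangent_atlas\<close>, whose point type is a product but whose manifold structure is not
  the product one; openness is therefore read off in charts, here and in
  \<open>atlas_open\<close>.\<close>

definition smooth_atlas :: "('p, 'e::real_normed_vector) chart set \<Rightarrow> bool" where
  "smooth_atlas A \<longleftrightarrow> (\<Union>c\<in>A. chart_dom c) = UNIV \<and>
     (\<forall>c\<in>A. inj_on (chart_fun c) (chart_dom c)) \<and>
     (\<forall>c\<in>A. \<forall>d\<in>A. open (chart_fun c ` (chart_dom c \<inter> chart_dom d)) \<and>
        C_inf_on (chart_fun c ` (chart_dom c \<inter> chart_dom d)) (chart_fun d \<circ> chart_inv c))"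

definition atlas_open :: "('p, 'e::real_normed_vector) chart set \<Rightarrow> 'p set \<Rightarrow> bool" where
  "atlas_open A S \<longleftrightarrow> (\<forall>c\<in>A. open (chart_fun c ` (S \<inter> chart_dom c)))"

definition rep :: "('p, 'e) chart \<Rightarrow> ('r, 'f) chart \<Rightarrow> ('p \<Rightarrow> 'r) \<Rightarrow> 'e \<Rightarrow> 'f" where
  "rep c d f = chart_fun d \<circ> f \<circ> chart_inv c"

definition rep_dom :: "'p set \<Rightarrow> ('p, 'e) chart \<Rightarrow> ('r, 'f) chart \<Rightarrow> ('p \<Rightarrow> 'r) \<Rightarrow> 'e set" where
  "rep_dom S c d f = chart_fun c ` {p \<in> S \<inter> chart_dom c. f p \<in> chart_dom d}"

text \<open>The coordinates in \<open>c\<close> of the vector stored as \<open>v\<close>. With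
  \<open>c\<close> fixed they vary smoothly along a smooth field, whereas \<open>v\<close> refers to
  a chart that changes with \<open>p\<close>.\<close>

definition components :: "('p, 'e::real_normed_vector) chart set \<Rightarrow> ('p, 'e) chart \<Rightarrow> 'p \<Rightarrow> 'e \<Rightarrow> 'e" where
  "components A c p v = frechet_derivative (chart_fun c \<circ> chart_inv (chart_at A p)) (at (chart_fun (chart_at A p) p)) v"

lemma chart_fun_tangent_chart: "chart_fun (tangent_chart A c) (p, v) = (chart_fun c p, components A c p v)"
  by (simp add: tangent_chart_def components_def)

lemma chart_dom_tangent_chart [simp]: "chart_dom (tangent_chart A c) = chart_dom c \<times> UNIV"
  by (simp add: tangent_chart_def)

lemma smooth_map_onD:
  assumes "smooth_map_on S A B f" "p \<in> S" "c \<in> A" "d \<in> B" "p \<in> chart_dom c" "f p \<in> chart_dom d"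
  obtains W g where "open W" "chart_fun c p \<in> W" "C_inf_on W g"
    "\<And>x. x \<in> S \<Longrightarrow> x \<in> chart_dom c \<Longrightarrow> chart_fun c x \<in> W \<Longrightarrow> f x \<in> chart_dom d"
    "\<And>x. x \<in> S \<Longrightarrow> x \<in> chart_dom c \<Longrightarrow> chart_fun c x \<in> W \<Longrightarrow> chart_fun d (f x) = g (chart_fun c x)"
  using assms unfolding smooth_map_on_def by (metis Int_iff)

lemma smooth_map_on_subset: "smooth_map_on S A B f \<Longrightarrow> T \<subseteq> S \<Longrightarrow> smooth_map_on T A B f"
  unfolding smooth_map_on_def
proof (intro ballI impI)
  fix p c d
  assume *: "\<forall>p\<in>S. \<forall>c\<in>A. \<forall>d\<in>B. p \<in> chart_dom c \<longrightarrow> f p \<in> chart_dom d \<longrightarrow>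
      (\<exists>W g. open W \<and> chart_fun c p \<in> W \<and> C_inf_on W g \<and>
        (\<forall>x\<in>S \<inter> chart_dom c. chart_fun c x \<in> W \<longrightarrow> f x \<in> chart_dom d \<and> chart_fun d (f x) = g (chart_fun c x)))"
    and TS: "T \<subseteq> S" and p: "p \<in> T" "c \<in> A" "d \<in> B" "p \<in> chart_dom c" "f p \<in> chart_dom d"
  from bspec[OF bspec[OF bspec[OF * subsetD[OF TS p(1)]] p(2)] p(3)] p(4,5)
  obtain W g where "open W" "chart_fun c p \<in> W" "C_inf_on W g"
    "\<forall>x\<in>S \<inter> chart_dom c. chart_fun c x \<in> W \<longrightarrow> f x \<in> chart_dom d \<and> chart_fun d (f x) = g (chart_fun c x)"
    by auto
  then show "\<exists>W g. open W \<and> chart_fun c p \<in> W \<and> C_inf_on W g \<and>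
        (\<forall>x\<in>T \<inter> chart_dom c. chart_fun c x \<in> W \<longrightarrow> f x \<in> chart_dom d \<and> chart_fun d (f x) = g (chart_fun c x))"
    using TS by (intro exI[of _ W] exI[of _ g]) auto
qed

lemma smooth_map_on_cong: "smooth_map_on S A B f \<Longrightarrow> (\<And>x. x \<in> S \<Longrightarrow> f x = g x) \<Longrightarrow> smooth_map_on S A B g"
  unfolding smooth_map_on_def by simp

context
  fixes A :: "('p, 'e::real_normed_vector) chart set"
  assumes A: "smooth_atlas A"
begin

lemma chart_inv_left [simp]: "c \<in> A \<Longrightarrow> p \<in> chart_dom c \<Longrightarrow> chart_inv c (chart_fun c p) = p"
  using A by (simp add: smooth_atlas_def chart_inv_def)

lemma chart_at_in [simp]: "chart_at A p \<in> A" "p \<in> chart_dom (chart_at A p)"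
proof -
  have "\<exists>c. c \<in> A \<and> p \<in> chart_dom c"
    using A unfolding smooth_atlas_def by blast
  then have "chart_at A p \<in> A \<and> p \<in> chart_dom (chart_at A p)"
    unfolding chart_at_def by (rule someI_ex)
  then show "chart_at A p \<in> A" "p \<in> chart_dom (chart_at A p)" by auto
qed

lemma open_overlap: "c \<in> A \<Longrightarrow> d \<in> A \<Longrightarrow> open (chart_fun c ` (chart_dom c \<inter> chart_dom d))"
  using A by (simp add: smooth_atlas_def)

lemma C_inf_transition: "c \<in> A \<Longrightarrow> d \<in> A \<Longrightarrow> C_inf_on (chart_fun c ` (chart_dom c \<inter> chart_dom d)) (chart_fun d \<circ> chart_inv c)"
  using A by (simp add: smooth_atlas_def)

lemma open_chart_image: "c \<in> A \<Longrightarrow> open (chart_fun c ` chart_dom c)"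
  using open_overlap[of c c] by simp

lemma atlas_open_UNIV: "atlas_open A UNIV"
  using open_chart_image by (simp add: atlas_open_def)

text \<open>Continuity of \<open>f\<close> is built into \<open>smooth_map_on\<close>: the local
  representative comes with a neighbourhood that \<open>f\<close> maps into the target chart. Hence
  the coordinate expression has an open domain.\<close>

lemma open_rep_dom:
  assumes "smooth_map_on S A B f" "atlas_open A S" "c \<in> A" "d \<in> B"
  shows "open (rep_dom S c d f)" "C_inf_on (rep_dom S c d f) (rep c d f)"
proof -
  have *: "\<exists>W. open W \<and> x \<in> W \<and> W \<subseteq> rep_dom S c d f \<and> C_inf_on W (rep c d f)" if "x \<in> rep_dom S c d f" for x
  proof -
    obtain p where p: "p \<in> S" "p \<in> chart_dom c" "f p \<in> chart_dom d" "x = chart_fun c p"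
      using \<open>x \<in> rep_dom S c d f\<close> by (auto simp: rep_dom_def)
    obtain W g where W: "open W" "chart_fun c p \<in> W" "C_inf_on W g"
      "\<And>x. x \<in> S \<Longrightarrow> x \<in> chart_dom c \<Longrightarrow> chart_fun c x \<in> W \<Longrightarrow> f x \<in> chart_dom d"
      "\<And>x. x \<in> S \<Longrightarrow> x \<in> chart_dom c \<Longrightarrow> chart_fun c x \<in> W \<Longrightarrow> chart_fun d (f x) = g (chart_fun c x)"
      using smooth_map_onD[OF assms(1) p(1) assms(3,4) p(2,3)] by blast
    define W' where "W' = W \<inter> chart_fun c ` (S \<inter> chart_dom c)"
    have "open W'" using W(1) assms(2,3) by (auto simp: W'_def atlas_open_def)
    moreover have "x \<in> W'" using p W(2) by (auto simp: W'_def)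
    moreover have "W' \<subseteq> rep_dom S c d f" using W(4) by (auto simp: W'_def rep_dom_def)
    moreover have "C_inf_on W' (rep c d f)"
    proof (rule C_inf_on_cong[OF \<open>open W'\<close>])
      show "C_inf_on W' g" using W(3) by (rule C_inf_on_subset) (simp add: W'_def)
      show "g y = rep c d f y" if "y \<in> W'" for y
        using that W(5) assms(3) by (auto simp: W'_def rep_def)
    qed
    ultimately show ?thesis by blast
  qed
  show "open (rep_dom S c d f)"
    using * by (subst open_subopen) blast
  show "C_inf_on (rep_dom S c d f) (rep c d f)"
    using * by (intro C_inf_on_local) blast
qed

lemma rep_domI: "p \<in> S \<Longrightarrow> p \<in> chart_dom c \<Longrightarrow> f p \<in> chart_dom d \<Longrightarrow> chart_fun c p \<in> rep_dom S c d f"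
  by (auto simp: rep_dom_def)

lemma rep_domD:
  assumes "x \<in> rep_dom S c d f" "c \<in> A"
  shows "chart_inv c x \<in> S" "chart_inv c x \<in> chart_dom c" "f (chart_inv c x) \<in> chart_dom d" "chart_fun c (chart_inv c x) = x"
  using assms by (auto simp: rep_dom_def)

lemma chart_inv_right: "c \<in> A \<Longrightarrow> x \<in> chart_fun c ` chart_dom c \<Longrightarrow> chart_fun c (chart_inv c x) = x"
  by auto

lemma chart_inv_in_dom: "c \<in> A \<Longrightarrow> x \<in> chart_fun c ` chart_dom c \<Longrightarrow> chart_inv c x \<in> chart_dom c"
  by auto

lemma rep_has_derivative:
  assumes "smooth_map_on S A B f" "atlas_open A S" "c \<in> A" "d \<in> B" "p \<in> S" "p \<in> chart_dom c" "f p \<in> chart_dom d"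
  shows "(rep c d f has_derivative frechet_derivative (rep c d f) (at (chart_fun c p))) (at (chart_fun c p))"
  using open_rep_dom[OF assms(1-4)] rep_domI[where f = f, OF assms(5-7)] C_inf_on_has_derivative by blast

lemma smooth_map_on_ident: "smooth_map_on S A A (\<lambda>x. x)"
  unfolding smooth_map_on_def
proof (intro ballI impI)
  fix p c d assume "p \<in> S" "c \<in> A" "d \<in> A" "p \<in> chart_dom c" "p \<in> chart_dom d"
  then show "\<exists>W g. open W \<and> chart_fun c p \<in> W \<and> C_inf_on W g \<and>
              (\<forall>x\<in>S \<inter> chart_dom c. chart_fun c x \<in> W \<longrightarrow> x \<in> chart_dom d \<and> chart_fun d x = g (chart_fun c x))"
    using open_overlap C_inf_transition
    by (intro exI[of _ "chart_fun c ` (chart_dom c \<inter> chart_dom d)"] exI[of _ "chart_fun d \<circ> chart_inv c"])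
      (auto, metis chart_inv_left)
qed

end

lemma has_derivative_at_eq:
  assumes "(f has_derivative f') (at x)" "(g has_derivative g') (at x)" "open W" "x \<in> W" "\<And>y. y \<in> W \<Longrightarrow> f y = g y"
  shows "f' = g'"
  using has_derivative_unique[OF has_derivative_transform_within_open[OF assms(1,3,4)] assms(2)] assms(5) by blast

lemma smooth_map_on_compose:
  fixes A :: "('p, 'e::real_normed_vector) chart set" and B :: "('r, 'f::model_space) chart set"
  assumes "smooth_atlas B" "smooth_map_on S A B f" "smooth_map_on T B C g" "f ` S \<subseteq> T"
  shows "smooth_map_on S A C (\<lambda>x. g (f x))"
  unfolding smooth_map_on_def
proof (intro ballI impI)
  fix p c e assume p: "p \<in> S" "c \<in> A" "e \<in> C" "p \<in> chart_dom c" "g (f p) \<in> chart_dom e"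
  let ?d = "chart_at B (f p)"
  note d = chart_at_in[OF assms(1), of "f p"]
  obtain W h where W: "open W" "chart_fun c p \<in> W" "C_inf_on W h"
      "\<And>x. x \<in> S \<Longrightarrow> x \<in> chart_dom c \<Longrightarrow> chart_fun c x \<in> W \<Longrightarrow> f x \<in> chart_dom ?d"
      "\<And>x. x \<in> S \<Longrightarrow> x \<in> chart_dom c \<Longrightarrow> chart_fun c x \<in> W \<Longrightarrow> chart_fun ?d (f x) = h (chart_fun c x)"
    using smooth_map_onD[OF assms(2) p(1,2) d(1) p(4) d(2)] by blast
  have "f p \<in> T" using p assms(4) by blast
  obtain Z k where Z: "open Z" "chart_fun ?d (f p) \<in> Z" "C_inf_on Z k"
      "\<And>x. x \<in> T \<Longrightarrow> x \<in> chart_dom ?d \<Longrightarrow> chart_fun ?d x \<in> Z \<Longrightarrow> g x \<in> chart_dom e"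
      "\<And>x. x \<in> T \<Longrightarrow> x \<in> chart_dom ?d \<Longrightarrow> chart_fun ?d x \<in> Z \<Longrightarrow> chart_fun e (g x) = k (chart_fun ?d x)"
    using smooth_map_onD[OF assms(3) \<open>f p \<in> T\<close> d(1) p(3) d(2) p(5)] by blast
  define W' where "W' = W \<inter> h -` Z"
  have "open W'"
    unfolding W'_def by (intro continuous_open_preimage C_inf_on_imp_continuous_on W Z)
  moreover have "chart_fun c p \<in> W'"
    using W(2) W(5)[OF p(1,4) W(2)] Z(2) by (simp add: W'_def)
  moreover have "C_inf_on W' (\<lambda>x. k (h x))"
    by (rule C_inf_on_compose[OF \<open>open W'\<close> Z(1,3) C_inf_on_subset[OF W(3)]]) (auto simp: W'_def)
  moreover have "g (f x) \<in> chart_dom e \<and> chart_fun e (g (f x)) = k (h (chart_fun c x))"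
    if x: "x \<in> S" "x \<in> chart_dom c" "chart_fun c x \<in> W'" for x
  proof -
    have "chart_fun c x \<in> W" "f x \<in> T" using x assms(4) by (auto simp: W'_def)
    then show ?thesis
      using W(4,5)[of x] Z(4,5)[of "f x"] x by (auto simp: W'_def)
  qed
  ultimately show "\<exists>W h. open W \<and> chart_fun c p \<in> W \<and> C_inf_on W h \<and>
      (\<forall>x\<in>S \<inter> chart_dom c. chart_fun c x \<in> W \<longrightarrow> g (f x) \<in> chart_dom e \<and> chart_fun e (g (f x)) = h (chart_fun c x))"
    by blast
qed

text \<open>One pair of charts per point suffices; composing with transition maps on both sides
  transfers the local representative to any other pair.\<close>

lemma smooth_map_onI:
  fixes A :: "('p, 'e::model_space) chart set" and B :: "('r, 'f::model_space) chart set"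
  assumes A: "smooth_atlas A" and B: "smooth_atlas B"
    and *: "\<And>p. p \<in> S \<Longrightarrow> \<exists>c\<in>A. \<exists>d\<in>B. p \<in> chart_dom c \<and> (\<exists>W g. open W \<and> chart_fun c p \<in> W \<and> C_inf_on W g \<and>
              (\<forall>x\<in>S. x \<in> chart_dom c \<longrightarrow> chart_fun c x \<in> W \<longrightarrow> f x \<in> chart_dom d \<and> chart_fun d (f x) = g (chart_fun c x)))"
  shows "smooth_map_on S A B f"
  unfolding smooth_map_on_def
proof (intro ballI impI)
  fix p c' d' assume p: "p \<in> S" "c' \<in> A" "d' \<in> B" "p \<in> chart_dom c'" "f p \<in> chart_dom d'"
  obtain c d W g where cd: "c \<in> A" "d \<in> B" "p \<in> chart_dom c"
    and W: "open W" "chart_fun c p \<in> W" "C_inf_on W g"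
      "\<And>x. x \<in> S \<Longrightarrow> x \<in> chart_dom c \<Longrightarrow> chart_fun c x \<in> W \<Longrightarrow> f x \<in> chart_dom d \<and> chart_fun d (f x) = g (chart_fun c x)"
    using *[OF p(1)] by blast
  have fp: "f p \<in> chart_dom d" "chart_fun d (f p) = g (chart_fun c p)" using W(4)[OF p(1) cd(3) W(2)] by auto
  define O1 where "O1 = chart_fun c' ` (chart_dom c' \<inter> chart_dom c)"
  define O2 where "O2 = chart_fun d ` (chart_dom d \<inter> chart_dom d')"
  note O1 = open_overlap[OF A p(2) cd(1), folded O1_def] C_inf_transition[OF A p(2) cd(1), folded O1_def]
  note O2 = open_overlap[OF B cd(2) p(3), folded O2_def] C_inf_transition[OF B cd(2) p(3), folded O2_def]
  define W1 where "W1 = W \<inter> g -` O2"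
  have W1: "open W1" unfolding W1_def by (intro continuous_open_preimage C_inf_on_imp_continuous_on W O2)
  define W2 where "W2 = O1 \<inter> (chart_fun c \<circ> chart_inv c') -` W1"
  have W2: "open W2" unfolding W2_def by (intro continuous_open_preimage C_inf_on_imp_continuous_on O1 W1)
  have 1: "C_inf_on W1 (\<lambda>x. (chart_fun d' \<circ> chart_inv d) (g x))"
    by (rule C_inf_on_compose[OF W1 O2 C_inf_on_subset[OF W(3)]]) (auto simp: W1_def)
  have 2: "C_inf_on W2 (\<lambda>x. (chart_fun d' \<circ> chart_inv d) (g ((chart_fun c \<circ> chart_inv c') x)))"
    by (rule C_inf_on_compose[OF W2 W1 1 C_inf_on_subset[OF O1(2)]]) (auto simp: W2_def)
  have "chart_fun c' p \<in> W2"
    using p cd W(2) fp by (auto simp: W2_def W1_def O1_def O2_def chart_inv_left[OF A] intro!: image_eqI[of _ _ p] image_eqI[of _ _ "f p"])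
  moreover have "f x \<in> chart_dom d' \<and> chart_fun d' (f x) = (chart_fun d' \<circ> chart_inv d) (g ((chart_fun c \<circ> chart_inv c') (chart_fun c' x)))"
    if x: "x \<in> S" "x \<in> chart_dom c'" "chart_fun c' x \<in> W2" for x
  proof -
    have xx: "chart_inv c' (chart_fun c' x) = x" using x p(2) by (simp add: chart_inv_left[OF A])
    have "x \<in> chart_dom c" using x(3) xx p(2) by (auto simp: W2_def O1_def chart_inv_left[OF A])
    moreover have "chart_fun c x \<in> W" "g (chart_fun c x) \<in> O2" using x(3) xx by (auto simp: W2_def W1_def)
    ultimately have "f x \<in> chart_dom d" "chart_fun d (f x) \<in> O2" "chart_fun d (f x) = g (chart_fun c x)"
      using W(4)[OF x(1)] by auto
    moreover have "chart_inv d (chart_fun d (f x)) = f x"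
      using calculation(1) cd(2) by (intro chart_inv_left[OF B])
    moreover have "f x \<in> chart_dom d'"
      using calculation(2) cd(2) chart_inv_left[OF B cd(2) calculation(1)] unfolding O2_def
      by (metis (no_types, lifting) Int_iff chart_inv_left[OF B] imageE)
    ultimately show ?thesis using xx by simp
  qed
  ultimately show "\<exists>W h. open W \<and> chart_fun c' p \<in> W \<and> C_inf_on W h \<and>
      (\<forall>x\<in>S \<inter> chart_dom c'. chart_fun c' x \<in> W \<longrightarrow> f x \<in> chart_dom d' \<and> chart_fun d' (f x) = h (chart_fun c' x))"
    using W2 2 by blast
qed

lemma smooth_map_on_const: "smooth_map_on S A B (\<lambda>x. b)"
  unfolding smooth_map_on_def using C_inf_on_const[OF open_UNIV] by fastforce

lemma smooth_atlas_std: "smooth_atlas std_atlas"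
  unfolding smooth_atlas_def std_atlas_def chart_inv_def
  by (auto simp: inv_id o_def id_def C_inf_on_ident)

lemma std_atlas_chart: "Chart UNIV id \<in> std_atlas" "chart_inv (Chart UNIV id) = id"
  by (auto simp: std_atlas_def chart_inv_def inv_id)

lemma in_std_atlas: "c \<in> std_atlas \<longleftrightarrow> c = Chart UNIV id"
  by (simp add: std_atlas_def)

lemma chart_inv_prod:
  assumes "smooth_atlas A" "smooth_atlas B" "c \<in> A" "d \<in> B" "x \<in> chart_fun c ` chart_dom c" "y \<in> chart_fun d ` chart_dom d"
  shows "chart_inv (Chart (chart_dom c \<times> chart_dom d) (map_prod (chart_fun c) (chart_fun d))) (x, y) = (chart_inv c x, chart_inv d y)"
proof -
  have "inj_on (map_prod (chart_fun c) (chart_fun d)) (chart_dom c \<times> chart_dom d)"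
    using assms unfolding smooth_atlas_def by (simp add: map_prod_inj_on)
  moreover have "(x, y) = map_prod (chart_fun c) (chart_fun d) (chart_inv c x, chart_inv d y)"
    using assms by (auto simp: chart_inv_left)
  moreover have "(chart_inv c x, chart_inv d y) \<in> chart_dom c \<times> chart_dom d"
    using assms by (auto simp: chart_inv_left)
  ultimately have "inv_into (chart_dom c \<times> chart_dom d) (map_prod (chart_fun c) (chart_fun d)) (x, y) = (chart_inv c x, chart_inv d y)"
    by (metis inv_into_f_f)
  then show ?thesis
    by (simp add: chart_inv_def[of "Chart _ _"])
qed

lemma in_prod_atlas: "c \<in> A \<Longrightarrow> d \<in> B \<Longrightarrow> Chart (chart_dom c \<times> chart_dom d) (map_prod (chart_fun c) (chart_fun d)) \<in> prod_atlas A B"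
  by (auto simp: prod_atlas_def)

lemma C_inf_on_map_prod:
  fixes f :: "'a::model_space \<Rightarrow> 'c::real_normed_vector" and g :: "'b::model_space \<Rightarrow> 'd::real_normed_vector"
  assumes "open S" "open T" "C_inf_on S f" "C_inf_on T g"
  shows "C_inf_on (S \<times> T) (\<lambda>z. (f (fst z), g (snd z)))"
proof -
  have o: "open (S \<times> T)" using assms by (simp add: open_Times)
  show ?thesis
    by (intro C_inf_on_Pair[OF o] C_inf_on_compose[OF o assms(1,3)] C_inf_on_compose[OF o assms(2,4)]
        C_inf_on_fst C_inf_on_snd C_inf_on_ident o) auto
qed

lemma smooth_atlas_prod:
  fixes A :: "('p, 'e::model_space) chart set" and B :: "('r, 'f::model_space) chart set"
  assumes A: "smooth_atlas A" and B: "smooth_atlas B"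
  shows "smooth_atlas (prod_atlas A B)"
  unfolding smooth_atlas_def
proof (intro conjI ballI)
  have "(p, r) \<in> (\<Union>c\<in>prod_atlas A B. chart_dom c)" for p r
    by (rule UN_I[OF in_prod_atlas[OF chart_at_in(1)[OF A, of p] chart_at_in(1)[OF B, of r]]])
       (simp add: chart_at_in[OF A] chart_at_in[OF B])
  then show "(\<Union>c\<in>prod_atlas A B. chart_dom c) = UNIV" by auto
  fix C assume "C \<in> prod_atlas A B"
  then obtain c1 c2 where c: "c1 \<in> A" "c2 \<in> B" "C = Chart (chart_dom c1 \<times> chart_dom c2) (map_prod (chart_fun c1) (chart_fun c2))"
    by (auto simp: prod_atlas_def)
  show "inj_on (chart_fun C) (chart_dom C)"
    using A B c by (auto simp: smooth_atlas_def map_prod_inj_on)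
  fix D assume "D \<in> prod_atlas A B"
  then obtain d1 d2 where d: "d1 \<in> A" "d2 \<in> B" "D = Chart (chart_dom d1 \<times> chart_dom d2) (map_prod (chart_fun d1) (chart_fun d2))"
    by (auto simp: prod_atlas_def)
  have eq: "chart_fun C ` (chart_dom C \<inter> chart_dom D) =
      chart_fun c1 ` (chart_dom c1 \<inter> chart_dom d1) \<times> chart_fun c2 ` (chart_dom c2 \<inter> chart_dom d2)"
    unfolding c d by (auto simp: image_iff map_prod_def)
  note o = open_overlap[OF A c(1) d(1)] open_overlap[OF B c(2) d(2)]
  show "open (chart_fun C ` (chart_dom C \<inter> chart_dom D))"
    unfolding eq by (intro open_Times o)
  show "C_inf_on (chart_fun C ` (chart_dom C \<inter> chart_dom D)) (chart_fun D \<circ> chart_inv C)"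
    unfolding eq
  proof (rule C_inf_on_cong[OF _ _ C_inf_on_map_prod[OF o C_inf_transition[OF A c(1) d(1)] C_inf_transition[OF B c(2) d(2)]]])
    fix z assume "z \<in> chart_fun c1 ` (chart_dom c1 \<inter> chart_dom d1) \<times> chart_fun c2 ` (chart_dom c2 \<inter> chart_dom d2)"
    then obtain x y where xy: "z = (x, y)" "x \<in> chart_fun c1 ` chart_dom c1" "y \<in> chart_fun c2 ` chart_dom c2"
      by auto
    show "((chart_fun d1 \<circ> chart_inv c1) (fst z), (chart_fun d2 \<circ> chart_inv c2) (snd z)) = (chart_fun D \<circ> chart_inv C) z"
      unfolding c(3) d(3) xy(1) using chart_inv_prod[OF A B c(1,2) xy(2,3)] by simp
  qed (intro open_Times o)
qed

lemma smooth_map_on_Pair: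
  assumes "smooth_map_on S A B f" "smooth_map_on S A C g"
  shows "smooth_map_on S A (prod_atlas B C) (\<lambda>x. (f x, g x))"
  unfolding smooth_map_on_def
proof (intro ballI impI)
  fix p c D assume p: "p \<in> S" "c \<in> A" "D \<in> prod_atlas B C" "p \<in> chart_dom c" "(f p, g p) \<in> chart_dom D"
  then obtain d e where d: "d \<in> B" "e \<in> C" "D = Chart (chart_dom d \<times> chart_dom e) (map_prod (chart_fun d) (chart_fun e))"
    by (auto simp: prod_atlas_def)
  obtain W h where W: "open W" "chart_fun c p \<in> W" "C_inf_on W h"
      "\<And>x. x \<in> S \<Longrightarrow> x \<in> chart_dom c \<Longrightarrow> chart_fun c x \<in> W \<Longrightarrow> f x \<in> chart_dom d"
      "\<And>x. x \<in> S \<Longrightarrow> x \<in> chart_dom c \<Longrightarrow> chart_fun c x \<in> W \<Longrightarrow> chart_fun d (f x) = h (chart_fun c x)"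
    using smooth_map_onD[OF assms(1) p(1,2) d(1) p(4)] p(5) d(3) by auto
  obtain Z k where Z: "open Z" "chart_fun c p \<in> Z" "C_inf_on Z k"
      "\<And>x. x \<in> S \<Longrightarrow> x \<in> chart_dom c \<Longrightarrow> chart_fun c x \<in> Z \<Longrightarrow> g x \<in> chart_dom e"
      "\<And>x. x \<in> S \<Longrightarrow> x \<in> chart_dom c \<Longrightarrow> chart_fun c x \<in> Z \<Longrightarrow> chart_fun e (g x) = k (chart_fun c x)"
    using smooth_map_onD[OF assms(2) p(1,2) d(2) p(4)] p(5) d(3) by auto
  have "C_inf_on (W \<inter> Z) (\<lambda>x. (h x, k x))"
    by (intro C_inf_on_Pair open_Int W Z C_inf_on_subset[OF W(3)] C_inf_on_subset[OF Z(3)]) auto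
  then show "\<exists>W h. open W \<and> chart_fun c p \<in> W \<and> C_inf_on W h \<and>
      (\<forall>x\<in>S \<inter> chart_dom c. chart_fun c x \<in> W \<longrightarrow> (f x, g x) \<in> chart_dom D \<and> chart_fun D (f x, g x) = h (chart_fun c x))"
    using W Z d(3) by (intro exI[of _ "W \<inter> Z"] exI[of _ "\<lambda>x. (h x, k x)"]) auto
qed

lemma smooth_manifold_atlas:
  assumes "smooth_manifold A"
  shows "smooth_atlas A" "open U \<Longrightarrow> atlas_open A U"
proof -
  have op: "open (chart_fun c ` (U \<inter> chart_dom c))" if "c \<in> A" "open U" for c U
  proof -
    have h: "homeomorphism (chart_dom c) (chart_fun c ` chart_dom c) (chart_fun c) (chart_inv c)"
      and o: "open (chart_fun c ` chart_dom c)"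
      using assms that(1) by (auto simp: smooth_manifold_def)
    have "chart_fun c ` (U \<inter> chart_dom c) = chart_fun c ` chart_dom c \<inter> chart_inv c -` U"
      using h unfolding homeomorphism_def by (auto simp: image_iff) 
    then show ?thesis
      using continuous_open_preimage[OF _ o that(2)] h by (simp add: homeomorphism_def)
  qed
  then show "open U \<Longrightarrow> atlas_open A U" by (simp add: atlas_open_def)
  have "inj_on (chart_fun c) (chart_dom c)" if "c \<in> A" for c
    using assms that unfolding smooth_manifold_def homeomorphism_def by (metis inj_on_inverseI)
  then show "smooth_atlas A"
    using assms op unfolding smooth_manifold_def smooth_atlas_def by (metis Int_commute)
qed

lemma atlas_open_vimage:
  fixes B :: "('r, 'f::model_space) chart set"
  assumes A: "smooth_atlas A" and B: "smooth_atlas B" and f: "smooth_map_on UNIV A B f" and U: "atlas_open B U"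
  shows "atlas_open A (f -` U)"
  unfolding atlas_open_def
proof (intro ballI, subst open_subopen, intro ballI)
  fix c x assume c: "c \<in> A" and "x \<in> chart_fun c ` (f -` U \<inter> chart_dom c)"
  then obtain p where p: "p \<in> chart_dom c" "f p \<in> U" "x = chart_fun c p" by auto
  let ?d = "chart_at B (f p)"
  note d = chart_at_in[OF B, of "f p"]
  note r = open_rep_dom[OF A f atlas_open_UNIV[OF A] c d(1)]
  define W where "W = rep_dom UNIV c ?d f \<inter> rep c ?d f -` (chart_fun ?d ` (U \<inter> chart_dom ?d))"
  have "open W"
    unfolding W_def using U d by (intro continuous_open_preimage C_inf_on_imp_continuous_on r) (auto simp: atlas_open_def)
  moreover have "x \<in> W"
    using p d c by (auto simp: W_def rep_dom_def rep_def chart_inv_left[OF A])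
  moreover have "W \<subseteq> chart_fun c ` (f -` U \<inter> chart_dom c)"
  proof
    fix y assume "y \<in> W"
    then obtain r where r: "y = chart_fun c r" "r \<in> chart_dom c" "f r \<in> chart_dom ?d"
      "chart_fun ?d (f r) \<in> chart_fun ?d ` (U \<inter> chart_dom ?d)"
      using c by (auto simp: W_def rep_dom_def rep_def chart_inv_left[OF A])
    then have "f r \<in> U"
      using d(1) by (auto, metis chart_inv_left[OF B])
    with r show "y \<in> chart_fun c ` (f -` U \<inter> chart_dom c)" by auto
  qed
  ultimately show "\<exists>T. open T \<and> x \<in> T \<and> T \<subseteq> chart_fun c ` (f -` U \<inter> chart_dom c)"
    by blast
qed

text \<open>The chain rule with all three charts free. With the identity as one of the two maps it
  becomes the transformation rule for components and for tangent maps.\<close>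

lemma rep_compose_derivative:
  fixes A :: "('p, 'e::real_normed_vector) chart set" and B :: "('r, 'f::model_space) chart set"
    and C :: "('s, 'k::real_normed_vector) chart set"
  assumes A: "smooth_atlas A" and B: "smooth_atlas B"
    and f: "smooth_map_on S A B f" "atlas_open A S" and g: "smooth_map_on T B C g" "atlas_open B T" and "f ` S \<subseteq> T"
    and c: "c \<in> A" "d \<in> B" "e \<in> C" and p: "p \<in> S" "p \<in> chart_dom c" "f p \<in> chart_dom d" "g (f p) \<in> chart_dom e"
  shows "frechet_derivative (rep c e (\<lambda>x. g (f x))) (at (chart_fun c p)) v =
    frechet_derivative (rep d e g) (at (chart_fun d (f p))) (frechet_derivative (rep c d f) (at (chart_fun c p)) v)"
proof -
  have fT: "f p \<in> T" using assms p by blast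
  note df = rep_has_derivative[OF A f c(1,2) p(1,2,3)]
  note dg = rep_has_derivative[OF B g c(2,3) fT p(3,4)]
  have fp: "rep c d f (chart_fun c p) = chart_fun d (f p)" using c p by (simp add: rep_def chart_inv_left[OF A])
  have "((\<lambda>x. rep d e g (rep c d f x)) has_derivative
      (\<lambda>v. frechet_derivative (rep d e g) (at (chart_fun d (f p))) (frechet_derivative (rep c d f) (at (chart_fun c p)) v))) (at (chart_fun c p))"
    using has_derivative_compose[OF df] dg fp by simp
  moreover have "rep d e g (rep c d f x) = rep c e (\<lambda>x. g (f x)) x" if "x \<in> rep_dom S c d f" for x
    using that c by (auto simp: rep_dom_def rep_def chart_inv_left[OF A] chart_inv_left[OF B])
  ultimately have "(rep c e (\<lambda>x. g (f x)) has_derivative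
      (\<lambda>v. frechet_derivative (rep d e g) (at (chart_fun d (f p))) (frechet_derivative (rep c d f) (at (chart_fun c p)) v))) (at (chart_fun c p))"
    using has_derivative_transform_within_open[OF _ open_rep_dom(1)[OF A f c(1,2)] rep_domI[where f = f, OF A p(1-3)]] by blast
  then show ?thesis
    using frechet_derivative_at by metis
qed

section \<open>Tangent vectors in charts\<close>

lemma rep_ident: "rep c d (\<lambda>x. x) = chart_fun d \<circ> chart_inv c"
  by (simp add: rep_def o_def)

context
  fixes A :: "('p, 'e::model_space) chart set"
  assumes A: "smooth_atlas A"
begin

lemma transition_derivative_compose:
  assumes "a \<in> A" "c \<in> A" "d \<in> A" "p \<in> chart_dom a" "p \<in> chart_dom c" "p \<in> chart_dom d"
  shows "frechet_derivative (chart_fun d \<circ> chart_inv a) (at (chart_fun a p)) v =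
    frechet_derivative (chart_fun d \<circ> chart_inv c) (at (chart_fun c p)) (frechet_derivative (chart_fun c \<circ> chart_inv a) (at (chart_fun a p)) v)"
  using rep_compose_derivative[OF A A smooth_map_on_ident[OF A] atlas_open_UNIV[OF A] smooth_map_on_ident[OF A] atlas_open_UNIV[OF A]
      _ assms(1-3) UNIV_I assms(4-6)]
  by (simp add: rep_ident)

lemma transition_self:
  assumes "c \<in> A" "p \<in> chart_dom c"
  shows "frechet_derivative (chart_fun c \<circ> chart_inv c) (at (chart_fun c p)) v = v"
proof -
  have "((chart_fun c \<circ> chart_inv c) has_derivative (\<lambda>v. v)) (at (chart_fun c p))"
    by (rule has_derivative_transform_within_open[OF has_derivative_ident open_chart_image[OF A assms(1)]])
      (use assms in \<open>auto simp: chart_inv_left[OF A]\<close>)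
  then show ?thesis using frechet_derivative_at by metis
qed

lemma components_transition:
  assumes "c \<in> A" "d \<in> A" "p \<in> chart_dom c" "p \<in> chart_dom d"
  shows "components A d p v = frechet_derivative (chart_fun d \<circ> chart_inv c) (at (chart_fun c p)) (components A c p v)"
  unfolding components_def
  by (rule transition_derivative_compose[OF chart_at_in(1)[OF A] assms(1,2) chart_at_in(2)[OF A] assms(3,4)])

lemma components_chart_at [simp]: "components A (chart_at A p) p v = v"
  unfolding components_def by (rule transition_self[OF chart_at_in[OF A]])

lemma linear_components:
  assumes "c \<in> A" "p \<in> chart_dom c"
  shows "linear (components A c p)"
  unfolding components_def
  by (rule C_inf_on_linear[OF C_inf_transition[OF A chart_at_in(1)[OF A] assms(1)]])
    (use assms chart_at_in[OF A] in auto)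

lemma components_inverse:
  assumes "c \<in> A" "p \<in> chart_dom c"
  shows "frechet_derivative (chart_fun (chart_at A p) \<circ> chart_inv c) (at (chart_fun c p)) (components A c p v) = v"
    "components A c p (frechet_derivative (chart_fun (chart_at A p) \<circ> chart_inv c) (at (chart_fun c p)) w) = w"
proof -
  show "frechet_derivative (chart_fun (chart_at A p) \<circ> chart_inv c) (at (chart_fun c p)) (components A c p v) = v"
    using components_transition[OF assms(1) chart_at_in(1)[OF A] assms(2) chart_at_in(2)[OF A], of v] by simp
  show "components A c p (frechet_derivative (chart_fun (chart_at A p) \<circ> chart_inv c) (at (chart_fun c p)) w) = w"
    using transition_derivative_compose[OF assms(1) chart_at_in(1)[OF A] assms(1) assms(2) chart_at_in(2)[OF A] assms(2)]
      transition_self[OF assms] unfolding components_def by simp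
qed

lemma components_inject: "c \<in> A \<Longrightarrow> p \<in> chart_dom c \<Longrightarrow> components A c p v = components A c p w \<longleftrightarrow> v = w"
  by (metis components_inverse(1))

lemma tangent_chart_inj: "c \<in> A \<Longrightarrow> inj_on (chart_fun (tangent_chart A c)) (chart_dom (tangent_chart A c))"
proof (rule inj_onI)
  fix z y assume c: "c \<in> A" and zy: "z \<in> chart_dom (tangent_chart A c)" "y \<in> chart_dom (tangent_chart A c)"
    "chart_fun (tangent_chart A c) z = chart_fun (tangent_chart A c) y"
  obtain p v q w where [simp]: "z = (p, v)" "y = (q, w)" by (cases z, cases y) auto
  have "p = q" using zy c by (auto simp: chart_fun_tangent_chart) (metis chart_inv_left[OF A])
  then show "z = y" using zy c by (auto simp: chart_fun_tangent_chart components_inject)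
qed

lemma chart_inv_tangent_chart:
  assumes "c \<in> A" "x \<in> chart_fun c ` chart_dom c"
  shows "chart_inv (tangent_chart A c) (x, w) = (chart_inv c x,
     frechet_derivative (chart_fun (chart_at A (chart_inv c x)) \<circ> chart_inv c) (at x) w)"
proof -
  obtain p where p: "p \<in> chart_dom c" "x = chart_fun c p" using assms by auto
  let ?z = "(p, frechet_derivative (chart_fun (chart_at A p) \<circ> chart_inv c) (at x) w)"
  have "chart_fun (tangent_chart A c) ?z = (x, w)"
    using p assms by (simp add: chart_fun_tangent_chart components_inverse(2))
  moreover have "?z \<in> chart_dom (tangent_chart A c)" using p by simp
  ultimately have "chart_inv (tangent_chart A c) (x, w) = ?z"
    unfolding chart_inv_def using tangent_chart_inj[OF assms(1)] by (metis inv_into_f_f)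
  then show ?thesis using p assms by (simp add: chart_inv_left[OF A])
qed

lemma chart_inv_tangent_chart_components:
  "c \<in> A \<Longrightarrow> p \<in> chart_dom c \<Longrightarrow> chart_inv (tangent_chart A c) (chart_fun c p, components A c p v) = (p, v)"
  by (simp add: chart_inv_tangent_chart chart_inv_left[OF A] components_inverse(1))

lemma components_chart_inv_tangent_chart:
  assumes "c \<in> A" "x \<in> chart_fun c ` chart_dom c"
  shows "components A c (chart_inv c x) (snd (chart_inv (tangent_chart A c) (x, w))) = w"
  using assms components_inverse(2)[OF assms(1), of "chart_inv c x"]
  by (auto simp: chart_inv_tangent_chart chart_inv_left[OF A])

lemma tangent_chart_image:
  assumes "c \<in> A"
  shows "chart_fun (tangent_chart A c) ` ((S \<inter> chart_dom c) \<times> UNIV) = chart_fun c ` (S \<inter> chart_dom c) \<times> UNIV"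
proof (intro set_eqI iffI)
  fix z assume "z \<in> chart_fun c ` (S \<inter> chart_dom c) \<times> (UNIV :: 'e set)"
  then obtain p w where p: "p \<in> S" "p \<in> chart_dom c" "z = (chart_fun c p, w)" by auto
  show "z \<in> chart_fun (tangent_chart A c) ` ((S \<inter> chart_dom c) \<times> UNIV)"
    using p components_inverse(2)[OF assms p(2), of w]
    by (intro image_eqI[of _ _ "(p, frechet_derivative (chart_fun (chart_at A p) \<circ> chart_inv c) (at (chart_fun c p)) w)"])
      (auto simp: chart_fun_tangent_chart)
qed (auto simp: chart_fun_tangent_chart)

lemma tangent_transition:
  assumes "c \<in> A" "d \<in> A" "x \<in> chart_fun c ` (chart_dom c \<inter> chart_dom d)"
  shows "(chart_fun (tangent_chart A d) \<circ> chart_inv (tangent_chart A c)) (x, w) =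
    ((chart_fun d \<circ> chart_inv c) x, frechet_derivative (chart_fun d \<circ> chart_inv c) (at x) w)"
proof -
  obtain p where p: "p \<in> chart_dom c" "p \<in> chart_dom d" "x = chart_fun c p" using assms by auto
  then show ?thesis
    using assms components_transition[OF assms(1,2) p(1,2)] components_inverse(2)[OF assms(1) p(1)]
    by (simp add: chart_inv_tangent_chart chart_inv_left[OF A] chart_fun_tangent_chart)
qed

lemma smooth_atlas_tangent: "smooth_atlas (tangent_atlas A)"
  unfolding smooth_atlas_def tangent_atlas_def
proof (intro conjI ballI)
  show "(\<Union>c\<in>tangent_chart A ` A. chart_dom c) = UNIV"
    using chart_at_in[OF A] by fastforce
  fix C assume "C \<in> tangent_chart A ` A"
  then obtain c where c: "c \<in> A" "C = tangent_chart A c" by blast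
  show "inj_on (chart_fun C) (chart_dom C)" unfolding c using tangent_chart_inj[OF c(1)] .
  fix D assume "D \<in> tangent_chart A ` A"
  then obtain d where d: "d \<in> A" "D = tangent_chart A d" by blast
  have eq: "chart_fun C ` (chart_dom C \<inter> chart_dom D) = chart_fun c ` (chart_dom c \<inter> chart_dom d) \<times> UNIV"
    using tangent_chart_image[OF c(1), of "chart_dom d"] by (simp add: c d Int_commute Times_Int_distrib1[symmetric])
  note o = open_overlap[OF A c(1) d(1)] and T = C_inf_transition[OF A c(1) d(1)]
  show o2: "open (chart_fun C ` (chart_dom C \<inter> chart_dom D))" unfolding eq by (intro open_Times o) simp
  show "C_inf_on (chart_fun C ` (chart_dom C \<inter> chart_dom D)) (chart_fun D \<circ> chart_inv C)"
  proof (rule C_inf_on_cong[OF o2])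
    show "C_inf_on (chart_fun C ` (chart_dom C \<inter> chart_dom D))
       (\<lambda>z. ((chart_fun d \<circ> chart_inv c) (fst z), frechet_derivative (chart_fun d \<circ> chart_inv c) (at (fst z)) (snd z)))"
      by (intro C_inf_on_Pair o2 C_inf_on_compose[OF o2 o T] C_inf_on_frechet_derivative_comp[OF o2 o T]
          C_inf_on_fst C_inf_on_snd C_inf_on_ident) (auto simp: eq)
    fix z assume "z \<in> chart_fun C ` (chart_dom C \<inter> chart_dom D)"
    then have z: "fst z \<in> chart_fun c ` (chart_dom c \<inter> chart_dom d)" unfolding eq by auto
    show "((chart_fun d \<circ> chart_inv c) (fst z), frechet_derivative (chart_fun d \<circ> chart_inv c) (at (fst z)) (snd z)) =
      (chart_fun D \<circ> chart_inv C) z"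
      unfolding c(2) d(2) using tangent_transition[OF c(1) d(1) z, of "snd z"] by simp
  qed
qed

lemma in_tangent_atlas: "c \<in> A \<Longrightarrow> tangent_chart A c \<in> tangent_atlas A"
  by (simp add: tangent_atlas_def)

text \<open>Frees \<open>tangent_map\<close> from the charts selected by \<open>chart_at\<close>:
  the transition maps at source and target are absorbed by the chain rule.\<close>

lemma tangent_map_components:
  fixes B :: "('r, 'f::model_space) chart set"
  assumes B: "smooth_atlas B" and f: "smooth_map_on S A B f" "atlas_open A S"
    and c: "c \<in> A" "d \<in> B" and p: "p \<in> S" "p \<in> chart_dom c" "f p \<in> chart_dom d"
  shows "components B d (f p) (snd (tangent_map A B f (p, v))) =
    frechet_derivative (rep c d f) (at (chart_fun c p)) (components A c p v)"
proof -
  let ?a = "chart_at A p" and ?b = "chart_at B (f p)"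
  note a = chart_at_in[OF A, of p] and b = chart_at_in[OF B, of "f p"]
  have "components B d (f p) (snd (tangent_map A B f (p, v))) =
    frechet_derivative (chart_fun d \<circ> chart_inv ?b) (at (chart_fun ?b (f p))) (frechet_derivative (rep ?a ?b f) (at (chart_fun ?a p)) v)"
    by (simp add: components_def tangent_map_def rep_def)
  also have "\<dots> = frechet_derivative (rep ?a d f) (at (chart_fun ?a p)) v"
    using rep_compose_derivative[OF A B f smooth_map_on_ident[OF B] atlas_open_UNIV[OF B] _ a(1) b(1) c(2) p(1) a(2) b(2) p(3), of v]
    by (simp add: rep_ident)
  also have "\<dots> = frechet_derivative (rep ?a d f) (at (chart_fun ?a p))
      (frechet_derivative (chart_fun ?a \<circ> chart_inv c) (at (chart_fun c p)) (components A c p v))"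
    using components_transition[OF c(1) a(1) p(2) a(2), of v] by simp
  also have "\<dots> = frechet_derivative (rep c d f) (at (chart_fun c p)) (components A c p v)"
    using rep_compose_derivative[OF A A smooth_map_on_ident[OF A] f(2) f _ c(1) a(1) c(2) p(1,2) a(2) p(3), of "components A c p v"]
    by (simp add: rep_ident)
  finally show ?thesis .
qed

lemma differential_components:
  assumes f: "smooth_map_on UNIV A std_atlas f" and c: "c \<in> A" "p \<in> chart_dom c"
  shows "differential A f (p, v) = frechet_derivative (f \<circ> chart_inv c) (at (chart_fun c p)) (components A c p v)"
proof -
  let ?a = "chart_at A p" and ?s = "Chart UNIV id"
  note a = chart_at_in[OF A, of p]
  have "differential A f (p, v) = frechet_derivative (rep ?a ?s f) (at (chart_fun ?a p)) (components A ?a p v)"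
    by (simp add: differential_def rep_def)
  also have "components A ?a p v = frechet_derivative (chart_fun ?a \<circ> chart_inv c) (at (chart_fun c p)) (components A c p v)"
    by (rule components_transition[OF c(1) a(1) c(2) a(2)])
  also have "frechet_derivative (rep ?a ?s f) (at (chart_fun ?a p)) \<dots> = frechet_derivative (rep c ?s f) (at (chart_fun c p)) (components A c p v)"
    using rep_compose_derivative[OF A A smooth_map_on_ident[OF A] atlas_open_UNIV[OF A] f atlas_open_UNIV[OF A] _ c(1) a(1) std_atlas_chart(1) UNIV_I c(2) a(2)]
    by (simp add: rep_ident)
  finally show ?thesis by (simp add: rep_def)
qed

lemma smooth_real_C_inf:
  assumes f: "smooth_map_on UNIV A std_atlas f" and c: "c \<in> A"
  shows "C_inf_on (chart_fun c ` chart_dom c) (\<lambda>x. f (chart_inv c x))"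
  using open_rep_dom(2)[OF A f atlas_open_UNIV[OF A] c std_atlas_chart(1)]
  by (simp add: rep_dom_def rep_def o_def)

end

section \<open>Velocities of curves\<close>

text \<open>A relational form of \<open>velocity\<close>, required in every chart and together with
  eventual membership in the chart domain. \<open>velocity\<close> looks at the chosen chart only
  and returns some value even if the derivative does not exist or the curve leaves the
  chart.\<close>

definition has_velocity :: "('p, 'e::real_normed_vector) chart set \<Rightarrow> real set \<Rightarrow> (real \<Rightarrow> 'p) \<Rightarrow> real \<Rightarrow> 'e \<Rightarrow> bool" where
  "has_velocity A J \<sigma> t v \<longleftrightarrow> (\<forall>c\<in>A. \<sigma> t \<in> chart_dom c \<longrightarrow>
     eventually (\<lambda>s. \<sigma> s \<in> chart_dom c) (at t within J) \<and>
     ((\<lambda>s. chart_fun c (\<sigma> s)) has_vector_derivative components A c (\<sigma> t) v) (at t within J))"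

lemma has_velocityD:
  assumes "has_velocity A J \<sigma> t v" "c \<in> A" "\<sigma> t \<in> chart_dom c"
  shows "eventually (\<lambda>s. \<sigma> s \<in> chart_dom c) (at t within J)"
    "((\<lambda>s. chart_fun c (\<sigma> s)) has_vector_derivative components A c (\<sigma> t) v) (at t within J)"
  using assms unfolding has_velocity_def by auto

lemma has_vector_derivative_compose_within:
  assumes "(x has_vector_derivative w) (at t within J)" "(g has_derivative g') (at (x t))"
    "eventually (\<lambda>s. y s = g (x s)) (at t within J)" "y t = g (x t)" "t \<in> J"
  shows "(y has_vector_derivative g' w) (at t within J)"
proof -
  have "((\<lambda>s. g (x s)) has_derivative (\<lambda>h. g' (h *\<^sub>R w))) (at t within J)"
    using has_derivative_in_compose[of x "\<lambda>h. h *\<^sub>R w" t J g g'] assms(1,2)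
    by (simp add: has_vector_derivative_def has_derivative_at_withinI)
  then have "((\<lambda>s. g (x s)) has_vector_derivative g' w) (at t within J)"
    using linear_scale[OF has_derivative_linear[OF assms(2)]] by (simp add: has_vector_derivative_def)
  then show ?thesis
    using assms(3-5) unfolding has_vector_derivative_def
    by (rule_tac has_derivative_transform_eventually) (auto elim: eventually_mono)
qed

context
  fixes A :: "('p, 'e::model_space) chart set"
  assumes A: "smooth_atlas A"
begin

lemma has_velocity_compose:
  fixes B :: "('r, 'f::model_space) chart set"
  assumes B: "smooth_atlas B" and f: "smooth_map_on S A B f" "atlas_open A S"
    and \<sigma>: "\<sigma> t \<in> S" "has_velocity A J \<sigma> t v" and t: "t \<in> J"
  shows "has_velocity B J (\<lambda>s. f (\<sigma> s)) t (snd (tangent_map A B f (\<sigma> t, v)))"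
  unfolding has_velocity_def
proof (intro ballI impI)
  fix d assume d: "d \<in> B" "f (\<sigma> t) \<in> chart_dom d"
  let ?c = "chart_at A (\<sigma> t)"
  note c = chart_at_in[OF A, of "\<sigma> t"]
  note h = has_velocityD[OF \<sigma>(2) c]
  note O = open_rep_dom[OF A f c(1) d(1)]
  have in_O: "chart_fun ?c (\<sigma> t) \<in> rep_dom S ?c d f"
    by (rule rep_domI[where f = f, OF A \<sigma>(1) c(2) d(2)])
  have "((\<lambda>s. chart_fun ?c (\<sigma> s)) \<longlongrightarrow> chart_fun ?c (\<sigma> t)) (at t within J)"
    using has_vector_derivative_continuous[OF h(2)] by (simp add: continuous_within)
  from topological_tendstoD[OF this O(1) in_O] h(1)
  have ev: "eventually (\<lambda>s. \<sigma> s \<in> chart_dom ?c \<and> chart_fun ?c (\<sigma> s) \<in> rep_dom S ?c d f) (at t within J)"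
    by (rule eventually_conj[rotated])
  have in_d: "f q \<in> chart_dom d" if "q \<in> chart_dom ?c" "chart_fun ?c q \<in> rep_dom S ?c d f" for q
    using that c(1) by (auto simp: rep_dom_def) (metis chart_inv_left[OF A])
  have "((\<lambda>s. chart_fun d (f (\<sigma> s))) has_vector_derivative
      frechet_derivative (rep ?c d f) (at (chart_fun ?c (\<sigma> t))) (components A ?c (\<sigma> t) v)) (at t within J)"
  proof (rule has_vector_derivative_compose_within[OF h(2) C_inf_on_has_derivative[OF O(2) in_O]])
    show "eventually (\<lambda>s. chart_fun d (f (\<sigma> s)) = rep ?c d f (chart_fun ?c (\<sigma> s))) (at t within J)"
      using ev by eventually_elim (use c(1) in \<open>simp add: rep_def chart_inv_left[OF A]\<close>)
    show "chart_fun d (f (\<sigma> t)) = rep ?c d f (chart_fun ?c (\<sigma> t))"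
      using c by (simp add: rep_def chart_inv_left[OF A])
  qed (rule t)
  then show "eventually (\<lambda>s. f (\<sigma> s) \<in> chart_dom d) (at t within J) \<and>
     ((\<lambda>s. chart_fun d (f (\<sigma> s))) has_vector_derivative components B d (f (\<sigma> t)) (snd (tangent_map A B f (\<sigma> t, v)))) (at t within J)"
    unfolding tangent_map_components[OF A B f c(1) d(1) \<sigma>(1) c(2) d(2)]
    using ev in_d by (auto elim: eventually_mono)
qed

lemma has_velocity_chartI:
  assumes c: "c \<in> A" "\<sigma> t \<in> chart_dom c" "eventually (\<lambda>s. \<sigma> s \<in> chart_dom c) (at t within J)"
    and der: "((\<lambda>s. chart_fun c (\<sigma> s)) has_vector_derivative components A c (\<sigma> t) v) (at t within J)"
    and t: "t \<in> J"
  shows "has_velocity A J \<sigma> t v"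
  unfolding has_velocity_def
proof (intro ballI impI)
  fix d assume d: "d \<in> A" "\<sigma> t \<in> chart_dom d"
  note O = open_overlap[OF A c(1) d(1)] C_inf_transition[OF A c(1) d(1)]
  have in_O: "chart_fun c (\<sigma> t) \<in> chart_fun c ` (chart_dom c \<inter> chart_dom d)" using c d by auto
  have "((\<lambda>s. chart_fun c (\<sigma> s)) \<longlongrightarrow> chart_fun c (\<sigma> t)) (at t within J)"
    using has_vector_derivative_continuous[OF der] by (simp add: continuous_within)
  from topological_tendstoD[OF this O(1) in_O] c(3)
  have ev: "eventually (\<lambda>s. \<sigma> s \<in> chart_dom c \<and> chart_fun c (\<sigma> s) \<in> chart_fun c ` (chart_dom c \<inter> chart_dom d)) (at t within J)"
    by (rule eventually_conj[rotated])
  have in_d: "q \<in> chart_dom d" if "q \<in> chart_dom c" "chart_fun c q \<in> chart_fun c ` (chart_dom c \<inter> chart_dom d)" for q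
    using that c(1) by auto (metis chart_inv_left[OF A])
  have "((\<lambda>s. chart_fun d (\<sigma> s)) has_vector_derivative
      frechet_derivative (chart_fun d \<circ> chart_inv c) (at (chart_fun c (\<sigma> t))) (components A c (\<sigma> t) v)) (at t within J)"
  proof (rule has_vector_derivative_compose_within[OF der C_inf_on_has_derivative[OF O(2) in_O]])
    show "eventually (\<lambda>s. chart_fun d (\<sigma> s) = (chart_fun d \<circ> chart_inv c) (chart_fun c (\<sigma> s))) (at t within J)"
      using ev by eventually_elim (use c(1) in \<open>simp add: chart_inv_left[OF A]\<close>)
  qed (use c t in \<open>simp_all add: chart_inv_left[OF A]\<close>)
  then show "eventually (\<lambda>s. \<sigma> s \<in> chart_dom d) (at t within J) \<and>
     ((\<lambda>s. chart_fun d (\<sigma> s)) has_vector_derivative components A d (\<sigma> t) v) (at t within J)"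
    unfolding components_transition[OF A c(1) d(1) c(2) d(2)]
    using ev in_d by (auto elim: eventually_mono)
qed

lemma has_velocity_chart_derivative:
  assumes c: "c \<in> A" "\<sigma> t \<in> chart_dom c" "eventually (\<lambda>s. \<sigma> s \<in> chart_dom c) (at t within J)"
    and der: "((\<lambda>s. chart_fun c (\<sigma> s)) has_vector_derivative w) (at t within J)"
    and t: "t \<in> J"
  obtains v where "has_velocity A J \<sigma> t v" "components A c (\<sigma> t) v = w"
proof
  let ?v = "frechet_derivative (chart_fun (chart_at A (\<sigma> t)) \<circ> chart_inv c) (at (chart_fun c (\<sigma> t))) w"
  show "components A c (\<sigma> t) ?v = w" by (rule components_inverse(2)[OF A c(1,2)])
  then show "has_velocity A J \<sigma> t ?v" using der t by (intro has_velocity_chartI[OF c]) simp_all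
qed

lemma has_velocity_unique:
  assumes "has_velocity A J \<sigma> t u" "has_velocity A J \<sigma> t v" "at t within J \<noteq> bot"
  shows "u = v"
  using vector_derivative_unique_within[OF assms(3) has_velocityD(2)[OF assms(1)] has_velocityD(2)[OF assms(2)]]
    chart_at_in[OF A] components_chart_at[OF A] by metis

lemma has_velocity_velocity:
  assumes "has_velocity A J \<sigma> t v" "at t within J \<noteq> bot"
  shows "velocity A J \<sigma> t = (\<sigma> t, v)"
proof -
  have "((\<lambda>s. chart_fun (chart_at A (\<sigma> t)) (\<sigma> s)) has_vector_derivative v) (at t within J)"
    using has_velocityD(2)[OF assms(1) chart_at_in[OF A]] by (simp add: components_chart_at[OF A])
  then show ?thesis
    by (simp add: velocity_def vector_derivative_within[OF assms(2)])
qed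

lemma has_velocity_const: "has_velocity A J (\<lambda>_. p) t 0"
  unfolding has_velocity_def using linear_0[OF linear_components[OF A]] by simp

lemma smooth_curve_chart:
  assumes \<sigma>: "smooth_map_on J std_atlas A \<sigma>" and t: "t \<in> J" and c: "c \<in> A" "\<sigma> t \<in> chart_dom c"
  obtains W g where "open W" "t \<in> W" "C_inf_on W g" "\<And>s. s \<in> J \<Longrightarrow> s \<in> W \<Longrightarrow> \<sigma> s \<in> chart_dom c"
    "\<And>s. s \<in> J \<Longrightarrow> s \<in> W \<Longrightarrow> chart_fun c (\<sigma> s) = g s"
  using smooth_map_onD[OF \<sigma> t std_atlas_chart(1) c(1) _ c(2)] by (metis UNIV_I chart.sel id_apply)

lemma smooth_curve_has_velocity:
  assumes \<sigma>: "smooth_map_on J std_atlas A \<sigma>" and t: "t \<in> J"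
  obtains v where "has_velocity A J \<sigma> t v"
proof -
  let ?c = "chart_at A (\<sigma> t)"
  note c = chart_at_in[OF A, of "\<sigma> t"]
  obtain W g where W: "open W" "t \<in> W" "C_inf_on W g" "\<And>s. s \<in> J \<Longrightarrow> s \<in> W \<Longrightarrow> \<sigma> s \<in> chart_dom ?c"
    "\<And>s. s \<in> J \<Longrightarrow> s \<in> W \<Longrightarrow> chart_fun ?c (\<sigma> s) = g s"
    using smooth_curve_chart[OF \<sigma> t c] by blast
  have evW: "eventually (\<lambda>s. s \<in> J \<and> s \<in> W) (at t within J)"
    using W(1,2) by (auto simp: eventually_at_topological)
  have "((\<lambda>s. chart_fun ?c (\<sigma> s)) has_vector_derivative frechet_derivative g (at t) 1) (at t within J)"
  proof (rule has_vector_derivative_compose_within[where x = "\<lambda>s. s", OF has_vector_derivative_id C_inf_on_has_derivative[OF W(3,2)]])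
    show "eventually (\<lambda>s. chart_fun ?c (\<sigma> s) = g s) (at t within J)"
      by (rule eventually_mono[OF evW]) (use W in auto)
  qed (use W t in auto)
  note der = this
  show thesis
  proof (rule has_velocity_chart_derivative[where \<sigma> = \<sigma>, OF c _ der])
    show "eventually (\<lambda>s. \<sigma> s \<in> chart_dom ?c) (at t within J)"
      by (rule eventually_mono[OF evW]) (use W in auto)
  qed (use t that in auto)
qed

lemma has_velocity_shift:
  assumes "has_velocity A UNIV (\<lambda>h. \<sigma> (t + h)) 0 v"
  shows "has_velocity A UNIV \<sigma> t v"
  unfolding has_velocity_def
proof (intro ballI impI)
  fix c assume c: "c \<in> A" "\<sigma> t \<in> chart_dom c"
  note h = has_velocityD[OF assms c(1)]
  have "eventually (\<lambda>s. \<sigma> s \<in> chart_dom c) (at t)"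
    using h(1) c(2) by (simp add: eventually_at_to_0[of _ t] add.commute)
  moreover have "((\<lambda>s. chart_fun c (\<sigma> (t + (s - t)))) has_vector_derivative components A c (\<sigma> t) v) (at t)"
    by (rule vector_diff_chain_at[of "\<lambda>s. s - t" 1 t, unfolded o_def, simplified])
      (use h(2) c(2) in \<open>auto intro!: derivative_eq_intros\<close>)
  ultimately show "eventually (\<lambda>s. \<sigma> s \<in> chart_dom c) (at t) \<and>
     ((\<lambda>s. chart_fun c (\<sigma> s)) has_vector_derivative components A c (\<sigma> t) v) (at t)"
    by simp
qed

text \<open>In a chart the curve has zero derivative, so it is locally constant; connectedness of
  \<open>J\<close> makes this global.\<close>

lemma zero_velocity_imp_constant:
  assumes "open J" "connected J" "\<And>t. t \<in> J \<Longrightarrow> has_velocity A UNIV \<sigma> t 0" "s \<in> J" "t \<in> J"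
  shows "\<sigma> s = \<sigma> t"
proof (rule connected_local_const[OF assms(2,4,5)], rule ballI)
  fix t assume t: "t \<in> J"
  let ?c = "chart_at A (\<sigma> t)"
  note c = chart_at_in[OF A, of "\<sigma> t"]
  have "eventually (\<lambda>s. \<sigma> s \<in> chart_dom ?c \<and> s \<in> J) (nhds t)"
    using has_velocityD(1)[OF assms(3)[OF t] c] t assms(1) c(2)
    by (intro eventually_conj) (auto simp: eventually_at_filter eventually_nhds_in_open elim: eventually_mono)
  then obtain e where e: "e > 0" "\<And>s. dist s t < e \<Longrightarrow> \<sigma> s \<in> chart_dom ?c \<and> s \<in> J"
    by (auto simp: eventually_nhds_metric)
  have "\<exists>k. \<forall>s\<in>ball t e. chart_fun ?c (\<sigma> s) = k"
  proof (rule has_derivative_zero_constant)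
    fix s assume "s \<in> ball t e"
    then have s: "\<sigma> s \<in> chart_dom ?c" "s \<in> J" using e(2)[of s] by (auto simp: dist_commute)
    have "((\<lambda>s. chart_fun ?c (\<sigma> s)) has_vector_derivative 0) (at s)"
      using has_velocityD(2)[OF assms(3)[OF s(2)] c(1) s(1)] linear_0[OF linear_components[OF A c(1) s(1)]] by simp
    then show "((\<lambda>s. chart_fun ?c (\<sigma> s)) has_derivative (\<lambda>h. 0)) (at s within ball t e)"
      by (simp add: has_vector_derivative_def has_derivative_at_withinI)
  qed auto
  then have "\<sigma> t = \<sigma> s" if "s \<in> ball t e" for s
    using e c(1) that by (metis dist_commute mem_ball centre_in_ball chart_inv_left[OF A])
  then have "eventually (\<lambda>s. \<sigma> t = \<sigma> s) (nhds t)"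
    unfolding eventually_nhds_metric using e(1) by (auto simp: dist_commute)
  then show "eventually (\<lambda>s. \<sigma> t = \<sigma> s) (at t within J)"
    by (auto simp: eventually_at_filter elim: eventually_mono)
qed

end

text \<open>The chart selected in the product atlas at \<open>(p, r)\<close> need not be the product
  of the charts selected at \<open>p\<close> and \<open>r\<close>, so the pair \<open>(v, u)\<close>
  has to be transformed.\<close>

definition pair_velocity :: "('p, 'e::real_normed_vector) chart set \<Rightarrow> ('r, 'f::real_normed_vector) chart set
    \<Rightarrow> 'p \<Rightarrow> 'r \<Rightarrow> 'e \<Rightarrow> 'f \<Rightarrow> 'e \<times> 'f" where
  "pair_velocity A B p r v u = (let c = chart_at A p; d = chart_at B r;
     D = Chart (chart_dom c \<times> chart_dom d) (map_prod (chart_fun c) (chart_fun d))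
   in frechet_derivative (chart_fun (chart_at (prod_atlas A B) (p, r)) \<circ> chart_inv D) (at (chart_fun D (p, r))) (v, u))"

lemma has_velocity_Pair:
  fixes A :: "('p, 'e::model_space) chart set" and B :: "('r, 'f::model_space) chart set"
  assumes A: "smooth_atlas A" and B: "smooth_atlas B"
    and \<sigma>: "has_velocity A J \<sigma> t v" and \<tau>: "has_velocity B J \<tau> t u" and t: "t \<in> J"
  shows "has_velocity (prod_atlas A B) J (\<lambda>s. (\<sigma> s, \<tau> s)) t (pair_velocity A B (\<sigma> t) (\<tau> t) v u)"
proof -
  let ?c = "chart_at A (\<sigma> t)" and ?d = "chart_at B (\<tau> t)"
  let ?D = "Chart (chart_dom ?c \<times> chart_dom ?d) (map_prod (chart_fun ?c) (chart_fun ?d))"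
  note c = chart_at_in[OF A, of "\<sigma> t"] and d = chart_at_in[OF B, of "\<tau> t"]
  note AB = smooth_atlas_prod[OF A B]
  note D = in_prod_atlas[OF c(1) d(1)]
  show ?thesis
  proof (rule has_velocity_chartI[OF smooth_atlas_prod[OF A B] D])
    show "(\<sigma> t, \<tau> t) \<in> chart_dom ?D" using c d by simp
    show "eventually (\<lambda>s. (\<sigma> s, \<tau> s) \<in> chart_dom ?D) (at t within J)"
      using has_velocityD(1)[OF \<sigma> c] has_velocityD(1)[OF \<tau> d] by eventually_elim simp
    have "components (prod_atlas A B) ?D (\<sigma> t, \<tau> t) (pair_velocity A B (\<sigma> t) (\<tau> t) v u) = (v, u)"
      unfolding pair_velocity_def Let_def by (rule components_inverse(2)[OF AB D]) (use c d in simp)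
    moreover have "((\<lambda>s. (chart_fun ?c (\<sigma> s), chart_fun ?d (\<tau> s))) has_vector_derivative (v, u)) (at t within J)"
      using has_velocityD(2)[OF \<sigma> c] has_velocityD(2)[OF \<tau> d]
      by (intro has_vector_derivative_Pair) (simp_all add: components_chart_at[OF A] components_chart_at[OF B])
    ultimately show "((\<lambda>s. chart_fun ?D (\<sigma> s, \<tau> s)) has_vector_derivative
        components (prod_atlas A B) ?D (\<sigma> t, \<tau> t) (pair_velocity A B (\<sigma> t) (\<tau> t) v u)) (at t within J)"
      by simp
  qed (rule t)
qed

lemma smooth_map_on_fst:
  fixes A :: "('p, 'e::model_space) chart set" and B :: "('r, 'f::model_space) chart set"
  assumes A: "smooth_atlas A"
  shows "smooth_map_on S (prod_atlas A B) A fst"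
  unfolding smooth_map_on_def
proof (intro ballI impI)
  fix p C c' assume "p \<in> S" "C \<in> prod_atlas A B" and c': "c' \<in> A" and p: "p \<in> chart_dom C" "fst p \<in> chart_dom c'"
  then obtain c d where c: "c \<in> A" "d \<in> B" "C = Chart (chart_dom c \<times> chart_dom d) (map_prod (chart_fun c) (chart_fun d))"
    by (auto simp: prod_atlas_def)
  define W :: "('e \<times> 'f) set" where "W = chart_fun c ` (chart_dom c \<inter> chart_dom c') \<times> UNIV"
  have W: "open W" unfolding W_def by (intro open_Times open_overlap[OF A c(1) c'] open_UNIV)
  have "C_inf_on W (\<lambda>z. (chart_fun c' \<circ> chart_inv c) (fst z))"
    by (rule C_inf_on_compose[OF W open_overlap[OF A c(1) c'] C_inf_transition[OF A c(1) c'] C_inf_on_fst[OF W C_inf_on_ident[OF W]]])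
      (auto simp: W_def)
  moreover have "chart_fun C p \<in> W" using p c by (auto simp: W_def)
  moreover have "fst x \<in> chart_dom c' \<and> chart_fun c' (fst x) = (chart_fun c' \<circ> chart_inv c) (fst (chart_fun C x))"
    if "x \<in> chart_dom C" "chart_fun C x \<in> W" for x
    using that c chart_inv_left[OF A c(1)] by (cases x) (auto simp: W_def, metis)
  ultimately show "\<exists>W g. open W \<and> chart_fun C p \<in> W \<and> C_inf_on W g \<and>
      (\<forall>x\<in>S \<inter> chart_dom C. chart_fun C x \<in> W \<longrightarrow> fst x \<in> chart_dom c' \<and> chart_fun c' (fst x) = g (chart_fun C x))"
    using W by blast
qed

lemma smooth_map_on_snd:
  fixes A :: "('p, 'e::model_space) chart set" and B :: "('r, 'f::model_space) chart set"
  assumes B: "smooth_atlas B"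
  shows "smooth_map_on S (prod_atlas A B) B snd"
  unfolding smooth_map_on_def
proof (intro ballI impI)
  fix p C d' assume "p \<in> S" "C \<in> prod_atlas A B" and d': "d' \<in> B" and p: "p \<in> chart_dom C" "snd p \<in> chart_dom d'"
  then obtain c d where c: "c \<in> A" "d \<in> B" "C = Chart (chart_dom c \<times> chart_dom d) (map_prod (chart_fun c) (chart_fun d))"
    by (auto simp: prod_atlas_def)
  define W :: "('e \<times> 'f) set" where "W = UNIV \<times> chart_fun d ` (chart_dom d \<inter> chart_dom d')"
  have W: "open W" unfolding W_def by (intro open_Times open_overlap[OF B c(2) d'] open_UNIV)
  have "C_inf_on W (\<lambda>z. (chart_fun d' \<circ> chart_inv d) (snd z))"
    by (rule C_inf_on_compose[OF W open_overlap[OF B c(2) d'] C_inf_transition[OF B c(2) d'] C_inf_on_snd[OF W C_inf_on_ident[OF W]]])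
      (auto simp: W_def)
  moreover have "chart_fun C p \<in> W" using p c by (auto simp: W_def)
  moreover have "snd x \<in> chart_dom d' \<and> chart_fun d' (snd x) = (chart_fun d' \<circ> chart_inv d) (snd (chart_fun C x))"
    if "x \<in> chart_dom C" "chart_fun C x \<in> W" for x
    using that c chart_inv_left[OF B c(2)] by (cases x) (auto simp: W_def, metis)
  ultimately show "\<exists>W g. open W \<and> chart_fun C p \<in> W \<and> C_inf_on W g \<and>
      (\<forall>x\<in>S \<inter> chart_dom C. chart_fun C x \<in> W \<longrightarrow> snd x \<in> chart_dom d' \<and> chart_fun d' (snd x) = g (chart_fun C x))"
    using W by blast
qed

lemma smooth_map_on_std:
  fixes f :: "'a::real_normed_vector \<Rightarrow> 'b::real_normed_vector"
  assumes "open W" "C_inf_on W f" "S \<subseteq> W"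
  shows "smooth_map_on S std_atlas std_atlas f"
  unfolding smooth_map_on_def using assms by (fastforce simp: in_std_atlas)

lemma smooth_map_on_real_local:
  fixes f :: "real \<Rightarrow> 'p" and A :: "('p, 'e::real_normed_vector) chart set"
  assumes "\<And>t. t \<in> S \<Longrightarrow> \<exists>U. open U \<and> t \<in> U \<and> smooth_map_on (S \<inter> U) std_atlas A f"
  shows "smooth_map_on S std_atlas A f"
  unfolding smooth_map_on_def
proof (intro ballI impI)
  fix t d and c :: "(real, real) chart" assume t: "t \<in> S" and c: "c \<in> std_atlas" and d: "d \<in> A" "f t \<in> chart_dom d"
  have c': "chart_dom c = UNIV" "chart_fun c = id" using c by (auto simp: in_std_atlas)
  obtain U where U: "open U" "t \<in> U" "smooth_map_on (S \<inter> U) std_atlas A f"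
    using assms[OF t] by blast
  obtain W g where W: "open W" "t \<in> W" "C_inf_on W g" "\<And>s. s \<in> S \<inter> U \<Longrightarrow> s \<in> W \<Longrightarrow> f s \<in> chart_dom d"
    "\<And>s. s \<in> S \<inter> U \<Longrightarrow> s \<in> W \<Longrightarrow> chart_fun d (f s) = g s"
    using smooth_map_onD[OF U(3) _ std_atlas_chart(1) d(1) _ d(2)] t U(2) by (metis Int_iff UNIV_I chart.sel id_apply)
  show "\<exists>W g. open W \<and> chart_fun c t \<in> W \<and> C_inf_on W g \<and>
      (\<forall>x\<in>S \<inter> chart_dom c. chart_fun c x \<in> W \<longrightarrow> f x \<in> chart_dom d \<and> chart_fun d (f x) = g (chart_fun c x))"
    using W U C_inf_on_subset[OF W(3), of "W \<inter> U"] by (intro exI[of _ "W \<inter> U"] exI[of _ g]) (auto simp: c')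
qed

section \<open>One-parameter subgroups\<close>

locale lie_group_setup =
  fixes G :: "('g::{t2_space, second_countable_topology}, 'h::model_space) lie_group_data"
  assumes lie_group: "lie_group G"
begin

abbreviation "GA \<equiv> group_atlas G"
abbreviation mult (infixl "\<cdot>" 70) where "x \<cdot> y \<equiv> gmult G x y"
abbreviation "e \<equiv> gone G"
abbreviation "i \<equiv> ginv G"

lemma GA: "smooth_atlas GA"
  using lie_group smooth_manifold_atlas unfolding lie_group_def by blast

sublocale gr: group "gmult G" e i
  using lie_group unfolding lie_group_def by blast

lemma smooth_mult: "smooth_map_on UNIV (prod_atlas GA GA) GA (\<lambda>(g, h). g \<cdot> h)"
  using lie_group unfolding lie_group_def by blast

lemma smooth_inv: "smooth_map_on UNIV GA GA i"
  using lie_group unfolding lie_group_def by blast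

lemma smooth_mult_comp: "smooth_map_on S B GA f \<Longrightarrow> smooth_map_on S B GA g \<Longrightarrow> smooth_map_on S B GA (\<lambda>x. f x \<cdot> g x)"
  using smooth_map_on_compose[OF smooth_atlas_prod[OF GA GA] smooth_map_on_Pair smooth_mult] by fastforce

lemma smooth_left_mult: "smooth_map_on UNIV GA GA (\<lambda>h. g \<cdot> h)"
  by (rule smooth_mult_comp[OF smooth_map_on_const smooth_map_on_ident[OF GA]])

text \<open>The left logarithmic derivative: \<sigma> is an integral curve of the left-invariant
  field of \<open>a\<close>. Translating to the unit states this without introducing the
  field.\<close>

definition has_left_velocity :: "(real \<Rightarrow> 'g) \<Rightarrow> real \<Rightarrow> 'h \<Rightarrow> bool" where
  "has_left_velocity \<sigma> t a \<longleftrightarrow> has_velocity GA UNIV (\<lambda>h. i (\<sigma> t) \<cdot> \<sigma> (t + h)) 0 a"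

lemma has_left_velocity_translate: "has_left_velocity \<sigma> t a \<Longrightarrow> has_left_velocity (\<lambda>s. g \<cdot> \<sigma> s) t a"
proof -
  have "i (g \<cdot> \<sigma> t) \<cdot> (g \<cdot> \<sigma> (t + h)) = i (\<sigma> t) \<cdot> \<sigma> (t + h)" for h
    by (metis gr.assoc gr.inverse_distrib_swap gr.left_inverse gr.left_neutral)
  then show "has_left_velocity \<sigma> t a \<Longrightarrow> has_left_velocity (\<lambda>s. g \<cdot> \<sigma> s) t a"
    by (simp add: has_left_velocity_def)
qed

lemma has_left_velocity_shift: "has_left_velocity \<sigma> (s + t) a \<Longrightarrow> has_left_velocity (\<lambda>t. \<sigma> (s + t)) t a"
  by (simp add: has_left_velocity_def add.assoc)

text \<open>No derivative of multiplication or inversion is computed. The velocity of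
  \<open>f (\<alpha> h, \<beta> h)\<close> depends only on the velocities of the two arguments, both
  equal to \<open>a\<close>; replacing \<beta> by \<alpha> makes the curve constant, so that
  velocity is 0.\<close>

lemma has_left_velocity_quotient:
  assumes "has_left_velocity \<sigma> t a" "has_left_velocity \<tau> t a"
  shows "has_velocity GA UNIV (\<lambda>s. \<sigma> s \<cdot> i (\<tau> s)) t 0"
proof (rule has_velocity_shift[OF GA])
  define \<alpha> where "\<alpha> h = i (\<sigma> t) \<cdot> \<sigma> (t + h)" for h
  define \<beta> where "\<beta> h = i (\<tau> t) \<cdot> \<tau> (t + h)" for h
  define F where "F z = fst z \<cdot> i (snd z)" for z
  define f where "f z = \<sigma> t \<cdot> F z \<cdot> i (\<tau> t)" for z
  let ?GG = "prod_atlas GA GA"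
  note GG = smooth_atlas_prod[OF GA GA]
  have \<alpha>: "has_velocity GA UNIV \<alpha> 0 a" "\<alpha> 0 = e" and \<beta>: "has_velocity GA UNIV \<beta> 0 a" "\<beta> 0 = e"
    using assms by (simp_all add: has_left_velocity_def \<alpha>_def[abs_def] \<beta>_def[abs_def])
  have F: "smooth_map_on UNIV ?GG GA F"
    unfolding F_def[abs_def]
    by (intro smooth_mult_comp smooth_map_on_compose[OF GA _ smooth_inv]
        smooth_map_on_fst smooth_map_on_snd GA) auto
  have f: "smooth_map_on UNIV ?GG GA f"
    unfolding f_def[abs_def] by (intro smooth_mult_comp F smooth_map_on_const)
  have "has_velocity GA UNIV (\<lambda>h. f (\<alpha> h, \<alpha> h)) 0 (snd (tangent_map ?GG GA f ((e, e), pair_velocity GA GA e e a a)))"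
    using has_velocity_compose[OF GG GA f atlas_open_UNIV[OF GG] UNIV_I has_velocity_Pair[OF GA GA \<alpha>(1) \<alpha>(1) UNIV_I] UNIV_I] \<alpha>(2) by simp
  moreover have "f (\<alpha> h, \<alpha> h) = \<sigma> t \<cdot> i (\<tau> t)" for h
    by (simp add: f_def F_def)
  ultimately have "snd (tangent_map ?GG GA f ((e, e), pair_velocity GA GA e e a a)) = 0"
    using has_velocity_unique[OF GA _ has_velocity_const[OF GA]] by simp
  moreover have "has_velocity GA UNIV (\<lambda>h. f (\<alpha> h, \<beta> h)) 0 (snd (tangent_map ?GG GA f ((e, e), pair_velocity GA GA e e a a)))"
    using has_velocity_compose[OF GG GA f atlas_open_UNIV[OF GG] UNIV_I has_velocity_Pair[OF GA GA \<alpha>(1) \<beta>(1) UNIV_I] UNIV_I] \<alpha>(2) \<beta>(2) by simp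
  moreover have "f (\<alpha> h, \<beta> h) = \<sigma> (t + h) \<cdot> i (\<tau> (t + h))" for h
    by (simp add: f_def F_def \<alpha>_def \<beta>_def gr.inverse_distrib_swap gr.assoc)
      (metis gr.assoc gr.left_inverse gr.left_neutral gr.inverse_inverse)
  ultimately show "has_velocity GA UNIV (\<lambda>h. \<sigma> (t + h) \<cdot> i (\<tau> (t + h))) 0 0"
    by simp
qed

text \<open>Uniqueness of integral curves on a whole interval, obtained from the constancy of the
  quotient rather than from a Lipschitz estimate.\<close>

lemma has_left_velocity_eq:
  assumes "open J" "connected J" "\<And>t. t \<in> J \<Longrightarrow> has_left_velocity \<sigma> t a" "\<And>t. t \<in> J \<Longrightarrow> has_left_velocity \<tau> t a"
    "s \<in> J" "\<sigma> s = \<tau> s" "t \<in> J"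
  shows "\<sigma> t = \<tau> t"
proof -
  have "\<sigma> t \<cdot> i (\<tau> t) = \<sigma> s \<cdot> i (\<tau> s)"
    by (rule zero_velocity_imp_constant[OF GA assms(1,2) has_left_velocity_quotient]) (use assms in auto)
  then show ?thesis
    using assms(6) by (metis gr.inverse_unique gr.right_inverse gr.inverse_inverse gr.assoc gr.left_inverse gr.left_neutral gr.right_neutral)
qed

lemma one_parameter_subgroup_0: "one_parameter_subgroup G \<phi> \<Longrightarrow> \<phi> 0 = e"
  unfolding one_parameter_subgroup_def by (metis add.right_neutral gr.assoc gr.left_inverse gr.left_neutral)

lemma one_parameter_subgroup_has_left_velocity:
  assumes "one_parameter_subgroup G \<phi>" "has_velocity GA UNIV \<phi> 0 a"
  shows "has_left_velocity \<phi> t a"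
proof -
  have "i (\<phi> t) \<cdot> \<phi> (t + h) = \<phi> h" for h
    using assms(1) unfolding one_parameter_subgroup_def by (metis gr.assoc gr.left_inverse gr.left_neutral)
  then show ?thesis using assms(2) by (simp add: has_left_velocity_def)
qed

lemma one_parameter_subgroup_unique:
  assumes "one_parameter_subgroup G \<phi>" "has_velocity GA UNIV \<phi> 0 a" "one_parameter_subgroup G \<psi>" "has_velocity GA UNIV \<psi> 0 a"
  shows "\<phi> = \<psi>"
proof
  fix t
  show "\<phi> t = \<psi> t"
    by (rule has_left_velocity_eq[of UNIV \<phi> a \<psi> 0])
      (simp_all add: one_parameter_subgroup_has_left_velocity[OF assms(1,2)]
        one_parameter_subgroup_has_left_velocity[OF assms(3,4)] one_parameter_subgroup_0[OF assms(1)] one_parameter_subgroup_0[OF assms(3)])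
qed

lemma local_integral_curve:
  obtains r \<sigma> where "r > 0" "smooth_map_on {0<..<r} std_atlas GA \<sigma>" "\<And>t. t \<in> {0<..<r} \<Longrightarrow> has_left_velocity \<sigma> t a"
proof -
  define k where "k = chart_at GA e"
  have k: "k \<in> GA" "e \<in> chart_dom k" using chart_at_in[OF GA] by (auto simp: k_def)
  let ?kk = "Chart (chart_dom k \<times> chart_dom k) (map_prod (chart_fun k) (chart_fun k))"
  let ?GG = "prod_atlas GA GA"
  let ?M = "\<lambda>(g, h). g \<cdot> h"
  note GG = smooth_atlas_prod[OF GA GA]
  note kk = in_prod_atlas[OF k(1) k(1)]
  define K where "K = chart_fun k ` chart_dom k"
  have K: "open K" unfolding K_def by (rule open_chart_image[OF GA k(1)])
  define Z where "Z = rep_dom UNIV ?kk k ?M"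
  define m where "m = rep ?kk k ?M"
  have Om: "open Z" "C_inf_on Z m"
    unfolding Z_def m_def using open_rep_dom[OF GG smooth_mult atlas_open_UNIV[OF GG] kk k(1)] by auto
  have in_O: "(x, chart_fun k e) \<in> Z" if x: "x \<in> K" for x
  proof -
    obtain g where g: "g \<in> chart_dom k" "x = chart_fun k g" using x by (auto simp: K_def)
    have "chart_fun ?kk (g, e) \<in> Z" unfolding Z_def by (rule rep_domI[OF GG]) (use g k in auto)
    then show ?thesis using g by simp
  qed
  \<comment> \<open>The left-invariant field of \<open>a\<close> in the chart \<open>k\<close>. As a
    partial derivative of the multiplication at the unit it is visibly smooth in \<open>x\<close>;
    \<open>VL\<close> identifies it with the derivative of a left translation.\<close>
  define V where "V x = frechet_derivative m (at (x, chart_fun k e)) (0, a)" for x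
  have V: "C_inf_on K V"
    unfolding V_def[abs_def]
    by (intro C_inf_on_frechet_derivative_comp[OF K Om] C_inf_on_Pair C_inf_on_const C_inf_on_ident K) (use in_O in auto)
  have VL: "V x = frechet_derivative (rep k k (\<lambda>h. chart_inv k x \<cdot> h)) (at (chart_fun k e)) a" if x: "x \<in> K" for x
  proof -
    have d1: "(m has_derivative frechet_derivative m (at (x, chart_fun k e))) (at (x, chart_fun k e))"
      by (rule C_inf_on_has_derivative[OF Om(2) in_O[OF x]])
    have d2: "((\<lambda>y. m (x, y)) has_derivative (\<lambda>v. frechet_derivative m (at (x, chart_fun k e)) (0, v))) (at (chart_fun k e))"
      by (rule has_derivative_compose[OF has_derivative_Pair[OF has_derivative_const has_derivative_ident]]) (use d1 in simp)
    have "(rep k k (\<lambda>h. chart_inv k x \<cdot> h) has_derivative (\<lambda>v. frechet_derivative m (at (x, chart_fun k e)) (0, v))) (at (chart_fun k e))"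
    proof (rule has_derivative_transform_within_open[OF d2 K])
      show "chart_fun k e \<in> K" using k by (simp add: K_def)
      fix y assume "y \<in> K"
      then show "m (x, y) = rep k k (\<lambda>h. chart_inv k x \<cdot> h) y"
        using chart_inv_prod[OF GA GA k(1) k(1), of x y] x by (simp add: m_def rep_def K_def)
    qed
    then show ?thesis unfolding V_def by (metis frechet_derivative_at)
  qed
  obtain r x where x: "r > 0" "C_inf_on {0<..<r} x" "\<And>t. t \<in> {0<..<r} \<Longrightarrow> x t \<in> K"
    "\<And>t. t \<in> {0<..<r} \<Longrightarrow> (x has_vector_derivative V (x t)) (at t)"
    using smooth_ode_local_solution[OF K V, of "chart_fun k e"] k by (auto simp: K_def)
  define \<sigma> where "\<sigma> t = chart_inv k (x t)" for t
  have \<sigma>: "\<sigma> t \<in> chart_dom k" "chart_fun k (\<sigma> t) = x t" if "t \<in> {0<..<r}" for t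
    using x(3)[OF that] k(1) by (auto simp: \<sigma>_def K_def chart_inv_left[OF GA])
  have smooth: "smooth_map_on {0<..<r} std_atlas GA \<sigma>"
  proof (rule smooth_map_onI[OF smooth_atlas_std GA])
    fix t assume "t \<in> {0<..<r}"
    then show "\<exists>c\<in>std_atlas. \<exists>d\<in>GA. t \<in> chart_dom c \<and> (\<exists>W g. open W \<and> chart_fun c t \<in> W \<and> C_inf_on W g \<and>
              (\<forall>x\<in>{0<..<r}. x \<in> chart_dom c \<longrightarrow> chart_fun c x \<in> W \<longrightarrow> \<sigma> x \<in> chart_dom d \<and> chart_fun d (\<sigma> x) = g (chart_fun c x)))"
      using x(2) \<sigma> k by (intro bexI[of _ "Chart UNIV id"] bexI[of _ k] conjI exI[of _ "{0<..<r}"] exI[of _ x]) (auto simp: in_std_atlas)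
  qed
  have "has_left_velocity \<sigma> t a" if t: "t \<in> {0<..<r}" for t
  proof -
    define g where "g = \<sigma> t"
    have gk: "g \<in> chart_dom k" "chart_fun k g = x t" using \<sigma>[OF t] by (auto simp: g_def)
    have ev: "eventually (\<lambda>s. s \<in> {0<..<r}) (at t)" using t by (intro eventually_at_in_open') auto
    have "((\<lambda>s. chart_fun k (\<sigma> s)) has_vector_derivative V (x t)) (at t)"
      by (rule has_vector_derivative_transform_within_open[OF x(4)[OF t], of "{0<..<r}"]) (use t \<sigma> in auto)
    then obtain v where v: "has_velocity GA UNIV \<sigma> t v" "components GA k g v = V (x t)"
      using has_velocity_chart_derivative[OF GA k(1), of \<sigma> t UNIV] \<sigma> t ev UNIV_I unfolding g_def
      by (metis (mono_tags, lifting) eventually_mono)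
    define u where "u = snd (tangent_map GA GA (\<lambda>h. i g \<cdot> h) (\<sigma> t, v))"
    have u: "has_velocity GA UNIV (\<lambda>s. i g \<cdot> \<sigma> s) t u"
      unfolding u_def by (rule has_velocity_compose[OF GA GA smooth_left_mult atlas_open_UNIV[OF GA] UNIV_I v(1) UNIV_I])
    have "u = components GA k (i g \<cdot> g) u" by (simp add: k_def components_chart_at[OF GA])
    also have "\<dots> = frechet_derivative (rep k k (\<lambda>h. i g \<cdot> h)) (at (chart_fun k g)) (components GA k g v)"
      unfolding u_def g_def
      by (rule tangent_map_components[OF GA GA smooth_left_mult atlas_open_UNIV[OF GA] k(1) k(1)]) (use \<sigma> t k in auto)
    \<comment> \<open>The velocity of \<sigma> at \<open>g\<close> is \<open>a\<close> pushed
      forward by left translation with \<open>g\<close>; translating back with the inverse gives the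
      derivative of the identity, so \<open>u = a\<close>.\<close>
    also have "\<dots> = frechet_derivative (rep k k (\<lambda>h. i g \<cdot> h)) (at (chart_fun k (g \<cdot> e)))
       (frechet_derivative (rep k k (\<lambda>h. g \<cdot> h)) (at (chart_fun k e)) a)"
      using VL[OF x(3)[OF t]] v(2) by (simp add: g_def \<sigma>_def)
    also have "\<dots> = frechet_derivative (rep k k (\<lambda>h. i g \<cdot> (g \<cdot> h))) (at (chart_fun k e)) a"
      by (rule rep_compose_derivative[OF GA GA smooth_left_mult atlas_open_UNIV[OF GA] smooth_left_mult atlas_open_UNIV[OF GA], symmetric])
        (use k gk in auto)
    also have "(\<lambda>h. i g \<cdot> (g \<cdot> h)) = (\<lambda>h. h)"
      by (metis gr.assoc gr.left_inverse gr.left_neutral)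
    also have "frechet_derivative (rep k k (\<lambda>h. h)) (at (chart_fun k e)) a = a"
      unfolding rep_ident by (rule transition_self[OF GA k])
    finally have "u = a" .
    show ?thesis
      unfolding has_left_velocity_def has_velocity_def
    proof (intro ballI impI)
      fix c assume c: "c \<in> GA" "i (\<sigma> t) \<cdot> \<sigma> (t + 0) \<in> chart_dom c"
      note h = has_velocityD[OF u c(1)]
      have "eventually (\<lambda>h. i (\<sigma> t) \<cdot> \<sigma> (t + h) \<in> chart_dom c) (at 0)"
        using h(1) c(2) by (simp add: eventually_at_to_0[of _ t] add.commute g_def)
      moreover have "((\<lambda>h. chart_fun c (i g \<cdot> \<sigma> (t + h))) has_vector_derivative components GA c e u) (at 0)"
        by (rule vector_diff_chain_at[of "\<lambda>h. t + h" 1 0, unfolded o_def, simplified])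
          (use h(2) c(2) in \<open>auto intro!: derivative_eq_intros simp: g_def\<close>)
      ultimately show "eventually (\<lambda>h. i (\<sigma> t) \<cdot> \<sigma> (t + h) \<in> chart_dom c) (at 0) \<and>
         ((\<lambda>h. chart_fun c (i (\<sigma> t) \<cdot> \<sigma> (t + h))) has_vector_derivative components GA c (i (\<sigma> t) \<cdot> \<sigma> (t + 0)) a) (at 0)"
        using \<open>u = a\<close> by (simp add: g_def)
    qed
  qed
  with x(1) smooth show thesis by (rule that)
qed

end

section \<open>Extension of local homomorphisms and the exponential map\<close>

context lie_group_setup
begin

definition gpow :: "'g \<Rightarrow> nat \<Rightarrow> 'g" where
  "gpow g n = ((\<lambda>h. g \<cdot> h) ^^ n) e"

lemma gpow_simps [simp]: "gpow g 0 = e" "gpow g (Suc n) = g \<cdot> gpow g n"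
  by (simp_all add: gpow_def)

lemma gpow_add: "gpow g (m + n) = gpow g m \<cdot> gpow g n"
  by (induction m) (simp_all add: gr.assoc)

lemma gpow_mult: "gpow g (m * n) = gpow (gpow g m) n"
  by (induction n) (simp_all add: gpow_add)

lemma gpow_commute: "g \<cdot> h = h \<cdot> g \<Longrightarrow> gpow g n \<cdot> h = h \<cdot> gpow g n"
  by (induction n) (simp_all, metis gr.assoc)

lemma gpow_mult_distrib: "g \<cdot> h = h \<cdot> g \<Longrightarrow> gpow (g \<cdot> h) n = gpow g n \<cdot> gpow h n"
proof (induction n)
  case (Suc n)
  have "g \<cdot> h \<cdot> (gpow g n \<cdot> gpow h n) = g \<cdot> (h \<cdot> gpow g n) \<cdot> gpow h n"
    by (simp add: gr.assoc)
  also have "h \<cdot> gpow g n = gpow g n \<cdot> h"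
    using gpow_commute[OF Suc.prems] by simp
  finally show ?case
    using Suc by (simp add: gr.assoc)
qed simp

text \<open>The extension takes the \<open>n\<close>-th power of \<phi> at \<open>t / n\<close> for
  large \<open>n\<close>. Two admissible exponents are compared through their product.\<close>

lemma local_homomorphism_extends:
  assumes r: "r > 0" and hom: "\<And>s t. \<bar>s\<bar> < r \<Longrightarrow> \<bar>t\<bar> < r \<Longrightarrow> \<bar>s + t\<bar> < r \<Longrightarrow> \<phi> (s + t) = \<phi> s \<cdot> \<phi> t"
  obtains \<Phi> :: "real \<Rightarrow> 'g" where "\<And>s t. \<Phi> (s + t) = \<Phi> s \<cdot> \<Phi> t" "\<And>t. \<bar>t\<bar> < r \<Longrightarrow> \<Phi> t = \<phi> t"
proof -
  have \<phi>0: "\<phi> 0 = e"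
    using hom[of 0 0] r by (metis abs_zero add.right_neutral gr.assoc gr.left_inverse gr.left_neutral)
  have pow: "\<phi> (real m * t) = gpow (\<phi> t) m" if "\<bar>real m * t\<bar> < r" for m t
    using that
  proof (induction m)
    case (Suc m)
    have le: "\<bar>real m * t\<bar> \<le> \<bar>real (Suc m) * t\<bar>" "\<bar>t\<bar> \<le> \<bar>real (Suc m) * t\<bar>"
      by (auto simp: abs_mult intro!: mult_right_mono mult_le_cancel_right1[THEN iffD2])
    then have "\<phi> (t + real m * t) = \<phi> t \<cdot> \<phi> (real m * t)"
      using Suc.prems by (intro hom) (auto simp: algebra_simps)
    then show ?case
      using Suc le by (simp add: algebra_simps)
  qed (simp add: \<phi>0)
  \<comment> \<open>Large enough that \<open>t / n\<close> lies in the domain of the local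
    homomorphism for every \<open>n \<ge> N t\<close>; the added 1 makes the inequality strict and
    \<open>n\<close> positive.\<close>
  define N where "N t = nat \<lceil>\<bar>t\<bar> / r\<rceil> + 1" for t
  have N: "\<bar>t / real n\<bar> < r" if "n \<ge> N t" for n t
  proof -
    have "\<bar>t\<bar> / r \<le> real (nat \<lceil>\<bar>t\<bar> / r\<rceil>)"
      using real_nat_ceiling_ge by blast
    also have "\<dots> < real n" using that by (simp add: N_def)
    finally show ?thesis using r that by (simp add: field_simps N_def abs_divide)
  qed
  define \<Phi> where "\<Phi> t = gpow (\<phi> (t / real (N t))) (N t)" for t
  have refine: "gpow (\<phi> (t / real n)) n = gpow (\<phi> (t / real (m * n))) (m * n)" if "\<bar>t / real n\<bar> < r" "n \<ge> 1" "m \<ge> 1" for m n t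
  proof -
    have "real m * (t / real (m * n)) = t / real n" using that by simp
    then show ?thesis using pow[of m "t / real (m * n)"] that by (simp add: gpow_mult)
  qed
  have N1: "N t \<ge> 1" for t by (simp add: N_def)
  have \<Phi>: "\<Phi> t = gpow (\<phi> (t / real n)) n" if "\<bar>t / real n\<bar> < r" "n \<ge> 1" for n t
    unfolding \<Phi>_def using refine[OF that N1, of t] refine[OF N[OF order_refl] N1 that(2), of t]
    by (simp only: mult.commute)
  show thesis
  proof
    show "\<Phi> (s + t) = \<Phi> s \<cdot> \<Phi> t" for s t
    proof -
      define n where "n = N s + N t + N (s + t)"
      have n: "\<bar>s / real n\<bar> < r" "\<bar>t / real n\<bar> < r" "\<bar>(s + t) / real n\<bar> < r" "n \<ge> 1"
        using N[of s n] N[of t n] N[of "s + t" n] N1[of s] by (simp_all add: n_def)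
      \<comment> \<open>Both orders of the sum give the same group element, so the two factors
        commute and the power of the product splits.\<close>
      have c: "\<phi> (s / real n + t / real n) = \<phi> (s / real n) \<cdot> \<phi> (t / real n)"
        "\<phi> (t / real n + s / real n) = \<phi> (t / real n) \<cdot> \<phi> (s / real n)"
        by (rule hom; use n in \<open>simp add: add_divide_distrib add.commute\<close>)+
      then have "\<phi> (s / real n) \<cdot> \<phi> (t / real n) = \<phi> (t / real n) \<cdot> \<phi> (s / real n)"
        by (simp add: add.commute)
      from gpow_mult_distrib[OF this] show ?thesis
        using \<Phi>[OF n(1,4)] \<Phi>[OF n(2,4)] \<Phi>[OF n(3,4)] c by (simp add: add_divide_distrib)
    qed
    show "\<Phi> t = \<phi> t" if "\<bar>t\<bar> < r" for t
      using \<Phi>[of t 1] that by simp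
  qed
qed

lemma smooth_affine: "smooth_map_on S std_atlas std_atlas (\<lambda>t::real. a * t + b)"
proof (rule smooth_map_on_std[OF open_UNIV _ subset_UNIV])
  show "C_inf_on UNIV (\<lambda>t. a * t + b)"
    by (intro C_inf_on_add C_inf_on_const C_inf_on_bounded_linear[OF _ bounded_linear_mult_right] open_UNIV)
qed

text \<open>For fixed \<open>s\<close>, the curves \<open>\<phi> (s + t)\<close> and
  \<open>\<phi> s \<cdot> \<phi> t\<close> have the same left velocity and agree at
  \<open>t = 0\<close>, so they coincide: near 0, \<phi> is a homomorphism.\<close>

lemma one_parameter_subgroup_exists:
  obtains \<phi> where "one_parameter_subgroup G \<phi>" "has_velocity GA UNIV \<phi> 0 a"
proof -
  obtain R \<sigma> where \<sigma>: "R > 0" "smooth_map_on {0<..<R} std_atlas GA \<sigma>" "\<And>t. t \<in> {0<..<R} \<Longrightarrow> has_left_velocity \<sigma> t a"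
    using local_integral_curve by blast
  \<comment> \<open>Recentring at the midpoint of the interval of \<sigma> gives a curve through the
    unit defined on both sides of 0.\<close>
  define r where "r = R / 2"
  have r: "r > 0" using \<sigma>(1) by (simp add: r_def)
  define \<phi> where "\<phi> t = i (\<sigma> r) \<cdot> \<sigma> (r + t)" for t
  have in_R: "r + t \<in> {0<..<R}" if "\<bar>t\<bar> < r" for t
    using that by (auto simp: r_def abs_if split: if_splits)
  have vel: "has_left_velocity \<phi> t a" if "\<bar>t\<bar> < r" for t
    unfolding \<phi>_def[abs_def]
    by (intro has_left_velocity_translate has_left_velocity_shift \<sigma>(3) in_R that)
  have \<phi>0: "\<phi> 0 = e" by (simp add: \<phi>_def)
  have smooth: "smooth_map_on {-r<..<r} std_atlas GA \<phi>"
  proof -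
    have "smooth_map_on {-r<..<r} std_atlas GA (\<lambda>t. \<sigma> (1 * t + r))"
      by (rule smooth_map_on_compose[OF smooth_atlas_std smooth_affine \<sigma>(2)]) (auto simp: r_def)
    then have "smooth_map_on {-r<..<r} std_atlas GA (\<lambda>t. i (\<sigma> r) \<cdot> \<sigma> (1 * t + r))"
      by (intro smooth_mult_comp smooth_map_on_const)
    then show ?thesis by (simp add: \<phi>_def[abs_def] add.commute)
  qed
  have "\<phi> (s + t) = \<phi> s \<cdot> \<phi> t" if s: "\<bar>s\<bar> < r" "\<bar>t\<bar> < r" "\<bar>s + t\<bar> < r" for s t
  proof -
    \<comment> \<open>The times at which both curves are controlled; this interval contains 0 and
      \<open>t\<close>, which allows the comparison.\<close>
    define J where "J = {max (-r) (-r - s)<..<min r (r - s)}"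
    have J: "x \<in> J \<longleftrightarrow> \<bar>x\<bar> < r \<and> \<bar>s + x\<bar> < r" for x by (auto simp: J_def)
    show ?thesis
    proof (rule has_left_velocity_eq[of J "\<lambda>t. \<phi> (s + t)" a "\<lambda>t. \<phi> s \<cdot> \<phi> t" 0])
      show "has_left_velocity (\<lambda>t. \<phi> (s + t)) t a" if "t \<in> J" for t
        using that by (intro has_left_velocity_shift vel) (simp add: J)
      show "has_left_velocity (\<lambda>t. \<phi> s \<cdot> \<phi> t) t a" if "t \<in> J" for t
        using that by (intro has_left_velocity_translate vel) (simp add: J)
    qed (use s r in \<open>simp_all add: \<phi>0 J, simp_all add: J_def\<close>)
  qed
  then obtain \<Phi> where \<Phi>: "\<And>s t. \<Phi> (s + t) = \<Phi> s \<cdot> \<Phi> t" "\<And>t. \<bar>t\<bar> < r \<Longrightarrow> \<Phi> t = \<phi> t"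
    using local_homomorphism_extends[OF r] by metis
  \<comment> \<open>Near any \<open>t\<close> the extension is the left translate by
    \<open>\<Phi> t\<close> of the smooth local curve, shifted in time.\<close>
  have "smooth_map_on UNIV std_atlas GA \<Phi>"
  proof (rule smooth_map_on_real_local)
    fix t :: real
    have "smooth_map_on {t-r<..<t+r} std_atlas GA (\<lambda>s. \<phi> (1 * s + (- t)))"
      by (rule smooth_map_on_compose[OF smooth_atlas_std smooth_affine smooth]) auto
    then have "smooth_map_on {t-r<..<t+r} std_atlas GA (\<lambda>s. \<Phi> t \<cdot> \<phi> (1 * s + (- t)))"
      by (intro smooth_mult_comp smooth_map_on_const)
    then have "smooth_map_on {t-r<..<t+r} std_atlas GA \<Phi>"
    proof (rule smooth_map_on_cong)
      fix s assume "s \<in> {t-r<..<t+r}"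
      then have "\<bar>s - t\<bar> < r" by auto
      then show "\<Phi> t \<cdot> \<phi> (1 * s + (- t)) = \<Phi> s"
        using \<Phi>(1)[of t "s - t"] \<Phi>(2)[of "s - t"] by simp
    qed
    then show "\<exists>U. open U \<and> t \<in> U \<and> smooth_map_on (UNIV \<inter> U) std_atlas GA \<Phi>"
      using r by (intro exI[of _ "{t-r<..<t+r}"]) auto
  qed
  then have "one_parameter_subgroup G \<Phi>"
    using \<Phi>(1) by (simp add: one_parameter_subgroup_def)
  moreover have "has_velocity GA UNIV \<Phi> 0 a"
  proof -
    have v: "has_velocity GA UNIV \<phi> 0 a"
      using vel[of 0] r by (simp add: has_left_velocity_def \<phi>0) 
    have ev: "eventually (\<lambda>s. \<phi> s = \<Phi> s) (at 0)"
      using eventually_at_in_open'[of "{-r<..<r}" 0] r \<Phi>(2) by (auto elim!: eventually_mono)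
    note k = chart_at_in[OF GA, of e]
    note h = has_velocityD[OF v k(1)]
    show ?thesis
    proof (rule has_velocity_chartI[OF GA k(1)])
      show "\<Phi> 0 \<in> chart_dom (chart_at GA e)" using \<Phi>(2)[of 0] r k \<phi>0 by simp
      show "eventually (\<lambda>s. \<Phi> s \<in> chart_dom (chart_at GA e)) (at 0)"
        using h(1) ev k \<phi>0 by (auto elim: eventually_elim2)
      show "((\<lambda>s. chart_fun (chart_at GA e) (\<Phi> s)) has_vector_derivative components GA (chart_at GA e) (\<Phi> 0) a) (at 0)"
        by (rule has_vector_derivative_transform_within_open[of "\<lambda>s. chart_fun (chart_at GA e) (\<phi> s)" _ _ "{-r<..<r}"])
          (use h(2) k \<phi>0 \<Phi>(2) r in auto)
    qed simp
  qed
  ultimately show thesis by (rule that)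
qed

lemma lie_exp_eq:
  assumes "one_parameter_subgroup G \<phi>" "has_velocity GA UNIV \<phi> 0 a"
  shows "lie_exp G a = \<phi> 1"
proof -
  have "(THE \<phi>. one_parameter_subgroup G \<phi> \<and> velocity GA UNIV \<phi> 0 = (e, a)) = \<phi>"
  proof (rule the_equality)
    show "one_parameter_subgroup G \<phi> \<and> velocity GA UNIV \<phi> 0 = (e, a)"
      using assms has_velocity_velocity[OF GA assms(2)] one_parameter_subgroup_0 by simp
    fix \<psi> assume \<psi>: "one_parameter_subgroup G \<psi> \<and> velocity GA UNIV \<psi> 0 = (e, a)"
    then have "smooth_map_on UNIV std_atlas GA \<psi>" by (simp add: one_parameter_subgroup_def)
    then obtain v where v: "has_velocity GA UNIV \<psi> 0 v"
      using smooth_curve_has_velocity[OF GA _ UNIV_I] by blast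
    then have "v = a" using has_velocity_velocity[OF GA v] \<psi> by simp
    then show "\<psi> = \<phi>" using one_parameter_subgroup_unique v \<psi> assms by blast
  qed
  then show ?thesis by (simp add: lie_exp_def)
qed

text \<open>If \<phi> is the subgroup with velocity \<open>a\<close>, then
  \<open>\<lambda>s. \<phi> (t * s)\<close> is the one with velocity \<open>t *\<^sub>R a\<close>;
  evaluation at 1 shows that the exponential curve is \<phi> itself. The second claim keeps
  \<open>0 *\<^sub>R a\<close> unsimplified so that it matches the curve at time 0.\<close>

lemma lie_exp_curve:
  shows "smooth_map_on UNIV std_atlas GA (\<lambda>t. lie_exp G (t *\<^sub>R a))" (is ?A)
    and "lie_exp G (0 *\<^sub>R a) = e" (is ?B)
    and "has_velocity GA UNIV (\<lambda>t. lie_exp G (t *\<^sub>R a)) 0 a" (is ?C)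
proof -
  obtain \<phi> where \<phi>: "one_parameter_subgroup G \<phi>" "has_velocity GA UNIV \<phi> 0 a"
    by (rule one_parameter_subgroup_exists)
  have sm: "smooth_map_on UNIV std_atlas GA \<phi>" and hom: "\<And>s t. \<phi> (s + t) = \<phi> s \<cdot> \<phi> t"
    using \<phi>(1) by (auto simp: one_parameter_subgroup_def)
  have "lie_exp G (t *\<^sub>R a) = \<phi> t" for t
  proof -
    have "smooth_map_on UNIV std_atlas GA (\<lambda>s. \<phi> (t * s + 0))"
      by (rule smooth_map_on_compose[OF smooth_atlas_std smooth_affine sm]) auto
    then have "one_parameter_subgroup G (\<lambda>s. \<phi> (t * s))"
      by (simp add: one_parameter_subgroup_def hom distrib_left)
    moreover have "has_velocity GA UNIV (\<lambda>s. \<phi> (t * s)) 0 (t *\<^sub>R a)"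
    proof -
      note k = chart_at_in[OF GA, of "\<phi> 0"]
      note h = has_velocityD[OF \<phi>(2) k]
      have lim: "((\<lambda>s. t * s) \<longlongrightarrow> 0) (at 0)" by (intro tendsto_eq_intros) auto
      have h1: "eventually (\<lambda>s. \<phi> s \<in> chart_dom (chart_at GA (\<phi> 0))) (nhds 0)"
        using h(1) k(2) by (auto simp: eventually_at_filter elim: eventually_mono)
      show ?thesis
      proof (rule has_velocity_chartI[OF GA k(1)])
        show "eventually (\<lambda>s. \<phi> (t * s) \<in> chart_dom (chart_at GA (\<phi> 0))) (at 0)"
          using eventually_compose_filterlim[OF h1 lim] .
        have "((\<lambda>s. chart_fun (chart_at GA (\<phi> 0)) (\<phi> (t * s))) has_vector_derivative t *\<^sub>R a) (at 0)"
          by (rule vector_diff_chain_at[of "\<lambda>s. t * s" t 0, unfolded o_def])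
            (use h(2) in \<open>auto intro!: derivative_eq_intros simp: components_chart_at[OF GA]\<close>)
        then show "((\<lambda>s. chart_fun (chart_at GA (\<phi> 0)) (\<phi> (t * s))) has_vector_derivative
            components GA (chart_at GA (\<phi> 0)) (\<phi> (t * 0)) (t *\<^sub>R a)) (at 0)"
          by (simp add: components_chart_at[OF GA])
      qed (use k in auto)
    qed
    ultimately show ?thesis
      using lie_exp_eq by fastforce
  qed
  then show ?A ?B ?C
    using sm \<phi>(2) one_parameter_subgroup_0[OF \<phi>(1)] by (simp_all del: scaleR_zero_left)
qed

end

section \<open>Curves and vector fields in charts\<close>

text \<open>A product rule for a family of linear maps known to be smooth only on each fixed vector.
  The first term differentiates the family with the vector frozen at \<open>g u\<close>.\<close>

lemma has_derivative_linear_family: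
  fixes A :: "'x::real_normed_vector \<Rightarrow> 'e::model_space \<Rightarrow> 'f::real_normed_vector"
  assumes S: "open S" "u \<in> S" and lin: "\<And>x. x \<in> S \<Longrightarrow> linear (A x)" and A: "\<And>w. C_inf_on S (\<lambda>x. A x w)"
    and g: "(g has_derivative g') (at u)"
  shows "((\<lambda>x. A x (g x)) has_derivative (\<lambda>y. frechet_derivative (\<lambda>x. A x (g u)) (at u) y + A u (g' y))) (at u)"
proof -
  obtain E :: "'e set" and d where E: "finite E" "\<And>x. x = (\<Sum>b\<in>E. (x \<bullet> d b) *\<^sub>R b)"
    by (rule model_space_expansion) blast
  note e = linear_expansion[OF lin E(2)]
  have dA: "((\<lambda>x. A x b) has_derivative frechet_derivative (\<lambda>x. A x b) (at u)) (at u)" for b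
    by (rule C_inf_on_has_derivative[OF A S(2)])
  have "((\<lambda>x. \<Sum>b\<in>E. (g u \<bullet> d b) *\<^sub>R A x b) has_derivative (\<lambda>y. \<Sum>b\<in>E. (g u \<bullet> d b) *\<^sub>R frechet_derivative (\<lambda>x. A x b) (at u) y)) (at u)"
    by (intro has_derivative_sum has_derivative_scaleR_right dA)
  then have "((\<lambda>x. A x (g u)) has_derivative (\<lambda>y. \<Sum>b\<in>E. (g u \<bullet> d b) *\<^sub>R frechet_derivative (\<lambda>x. A x b) (at u) y)) (at u)"
    by (rule has_derivative_transform_within_open[OF _ S]) (rule e[symmetric])
  from frechet_derivative_at[OF this]
  have *: "frechet_derivative (\<lambda>x. A x (g u)) (at u) y = (\<Sum>b\<in>E. (g u \<bullet> d b) *\<^sub>R frechet_derivative (\<lambda>x. A x b) (at u) y)" for y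
    by metis
  have "((\<lambda>x. \<Sum>b\<in>E. (g x \<bullet> d b) *\<^sub>R A x b) has_derivative
     (\<lambda>y. \<Sum>b\<in>E. (g u \<bullet> d b) *\<^sub>R frechet_derivative (\<lambda>x. A x b) (at u) y + (g' y \<bullet> d b) *\<^sub>R A u b)) (at u)"
    by (intro has_derivative_sum has_derivative_scaleR has_derivative_inner_left g dA)
  then have "((\<lambda>x. \<Sum>b\<in>E. (g x \<bullet> d b) *\<^sub>R A x b) has_derivative (\<lambda>y. frechet_derivative (\<lambda>x. A x (g u)) (at u) y + A u (g' y))) (at u)"
    by (rule has_derivative_eq_rhs) (intro ext, simp only: * e[OF S(2), of "g' _"] sum.distrib)
  then show ?thesis
    by (rule has_derivative_transform_within_open[OF _ S]) (rule e[symmetric])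
qed

lemma frechet_derivative_Pair_add:
  fixes f :: "'a::real_normed_vector \<times> 'b::real_normed_vector \<Rightarrow> 'c::real_normed_vector"
  assumes "C_inf_on S f" "z \<in> S"
  shows "frechet_derivative f (at z) (y, w1 + w2) = frechet_derivative f (at z) (y, w1) + frechet_derivative f (at z) (0, w2)"
  using linear_add[OF C_inf_on_linear[OF assms], of "(y, w1)" "(0, w2)"] by simp

lemma has_velocity_transform:
  assumes "has_velocity A UNIV \<sigma> t v" "open W" "t \<in> W" "\<And>s. s \<in> W \<Longrightarrow> \<sigma> s = \<tau> s"
  shows "has_velocity A UNIV \<tau> t v"
  unfolding has_velocity_def
proof (intro ballI impI)
  fix c assume c: "c \<in> A" "\<tau> t \<in> chart_dom c"
  have eq: "\<sigma> t = \<tau> t" using assms by auto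
  note h = has_velocityD[OF assms(1) c(1), unfolded eq, OF c(2)]
  have "eventually (\<lambda>s. s \<in> W) (at t)" using assms by (intro eventually_at_in_open')
  with h(1) have "eventually (\<lambda>s. \<tau> s \<in> chart_dom c) (at t)"
    by eventually_elim (use assms(4) in auto)
  moreover have "((\<lambda>s. chart_fun c (\<tau> s)) has_vector_derivative components A c (\<tau> t) v) (at t)"
    by (rule has_vector_derivative_transform_within_open[OF h(2) assms(2,3)]) (simp add: assms(4))
  ultimately show "eventually (\<lambda>s. \<tau> s \<in> chart_dom c) (at t) \<and>
      ((\<lambda>s. chart_fun c (\<tau> s)) has_vector_derivative components A c (\<tau> t) v) (at t)" by simp
qed

lemma has_velocity_eventually_in_open:
  assumes A: "smooth_atlas A" and v: "has_velocity A UNIV \<sigma> t v" and U: "atlas_open A U" "\<sigma> t \<in> U"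
  obtains W where "open W" "t \<in> W" "\<And>s. s \<in> W \<Longrightarrow> \<sigma> s \<in> U"
proof -
  let ?c = "chart_at A (\<sigma> t)"
  note c = chart_at_in[OF A, of "\<sigma> t"]
  note h = has_velocityD[OF v c]
  have op: "open (chart_fun ?c ` (U \<inter> chart_dom ?c))" using U(1) c(1) by (auto simp: atlas_open_def)
  have "((\<lambda>s. chart_fun ?c (\<sigma> s)) \<longlongrightarrow> chart_fun ?c (\<sigma> t)) (at t)"
    using has_vector_derivative_continuous[OF h(2)] by (simp add: continuous_within)
  from topological_tendstoD[OF this op] U(2) c(2)
  have "eventually (\<lambda>s. chart_fun ?c (\<sigma> s) \<in> chart_fun ?c ` (U \<inter> chart_dom ?c)) (at t)" by blast
  with h(1) have "eventually (\<lambda>s. \<sigma> s \<in> U) (at t)"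
  proof eventually_elim
    case (elim s)
    then obtain p where p: "p \<in> U" "p \<in> chart_dom ?c" "chart_fun ?c (\<sigma> s) = chart_fun ?c p" by auto
    then have "\<sigma> s = p" using elim(1) c(1) by (metis chart_inv_left[OF A])
    then show ?case using p by simp
  qed
  then have "eventually (\<lambda>s. \<sigma> s \<in> U) (nhds t)"
    using U(2) by (auto simp: eventually_at_filter elim: eventually_mono)
  then show thesis unfolding eventually_nhds using that by blast
qed

lemma curve_through:
  fixes A :: "('p, 'e::model_space) chart set"
  assumes A: "smooth_atlas A"
  obtains \<sigma> where "\<sigma> 0 = p" "has_velocity A UNIV \<sigma> 0 v"
proof
  let ?c = "chart_at A p"
  note c = chart_at_in[OF A, of p]
  define \<sigma> where "\<sigma> t = chart_inv ?c (chart_fun ?c p + t *\<^sub>R v)" for t :: real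
  show 0: "\<sigma> 0 = p" using c by (simp add: \<sigma>_def chart_inv_left[OF A])
  have "((\<lambda>t. chart_fun ?c p + t *\<^sub>R v) \<longlongrightarrow> chart_fun ?c p + 0 *\<^sub>R v) (at 0)"
    by (intro tendsto_intros)
  then have "((\<lambda>t. chart_fun ?c p + t *\<^sub>R v) \<longlongrightarrow> chart_fun ?c p) (at 0)" by simp
  from topological_tendstoD[OF this open_chart_image[OF A c(1)]] c(2)
  have ev: "eventually (\<lambda>t. chart_fun ?c p + t *\<^sub>R v \<in> chart_fun ?c ` chart_dom ?c) (at 0)" by blast
  have \<sigma>: "\<sigma> t \<in> chart_dom ?c" "chart_fun ?c (\<sigma> t) = chart_fun ?c p + t *\<^sub>R v"
    if "chart_fun ?c p + t *\<^sub>R v \<in> chart_fun ?c ` chart_dom ?c" for t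
    using chart_inv_in_dom[OF A c(1) that] chart_inv_right[OF A c(1) that] by (auto simp: \<sigma>_def)
  show "has_velocity A UNIV \<sigma> 0 v"
  proof (rule has_velocity_chartI[OF A c(1)])
    show "eventually (\<lambda>s. \<sigma> s \<in> chart_dom ?c) (at 0)"
      using ev by eventually_elim (rule \<sigma>(1))
    have "((\<lambda>t. chart_fun ?c (\<sigma> t)) has_vector_derivative v) (at 0)"
      by (rule has_vector_derivative_compose_within[where x = "\<lambda>s. s" and g' = "\<lambda>t. t *\<^sub>R v" and w = 1 and g = "\<lambda>t. chart_fun ?c p + t *\<^sub>R v", simplified])
        (use eventually_mono[OF ev \<sigma>(2)] 0 in \<open>auto intro!: derivative_eq_intros\<close>)
    then show "((\<lambda>t. chart_fun ?c (\<sigma> t)) has_vector_derivative components A ?c (\<sigma> 0) v) (at 0)"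
      using 0 by (simp add: components_chart_at[OF A])
  qed (use 0 c in auto)
qed

lemma atlas_open_Times_UNIV:
  assumes "atlas_open A U" "smooth_atlas B"
  shows "atlas_open (prod_atlas A B) (U \<times> UNIV)"
  unfolding atlas_open_def
proof
  fix C assume "C \<in> prod_atlas A B"
  then obtain c d where c: "c \<in> A" "d \<in> B" "C = Chart (chart_dom c \<times> chart_dom d) (map_prod (chart_fun c) (chart_fun d))"
    by (auto simp: prod_atlas_def)
  have "chart_fun C ` (U \<times> UNIV \<inter> chart_dom C) = chart_fun c ` (U \<inter> chart_dom c) \<times> chart_fun d ` chart_dom d"
    using c(3) by (auto simp: image_iff map_prod_def)
  then show "open (chart_fun C ` (U \<times> UNIV \<inter> chart_dom C))"
    using assms(1) c(1) open_chart_image[OF assms(2) c(2)] by (auto simp: atlas_open_def intro!: open_Times)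
qed

lemma smooth_on_tangent_C_inf:
  fixes A :: "('p, 'e::model_space) chart set" and K :: "'p \<times> 'e \<Rightarrow> 'b::real_normed_vector"
  assumes A: "smooth_atlas A" and K: "smooth_map_on UNIV (tangent_atlas A) std_atlas K" and c: "c \<in> A"
  shows "C_inf_on (chart_fun c ` chart_dom c \<times> UNIV) (\<lambda>z. K (chart_inv (tangent_chart A c) z))"
  using smooth_real_C_inf[OF smooth_atlas_tangent[OF A] K in_tangent_atlas[OF A c]] tangent_chart_image[OF A c, of UNIV]
  by simp

lemma linear_tangent_map:
  assumes "smooth_atlas A" "smooth_atlas B" "smooth_map_on S A B f" "atlas_open A S" "p \<in> S"
  shows "linear (\<lambda>v. snd (tangent_map A B f (p, v)))"
proof -
  note c = chart_at_in[OF assms(1), of p] and d = chart_at_in[OF assms(2), of "f p"]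
  have "linear (frechet_derivative (rep (chart_at A p) (chart_at B (f p)) f) (at (chart_fun (chart_at A p) p)))"
    by (rule C_inf_on_linear[OF open_rep_dom(2)[OF assms(1,3,4) c(1) d(1)] rep_domI[where f = f, OF assms(1,5) c(2) d(2)]])
  then show ?thesis by (simp add: tangent_map_def rep_def)
qed

section \<open>Principal bundles\<close>

locale bundle_setup =
  fixes P :: "('q::{t2_space, second_countable_topology}, 'e::model_space,
               'm::{t2_space, second_countable_topology}, 'f::model_space,
               'g::{t2_space, second_countable_topology}, 'h::model_space) bundle_data"
  assumes principal_bundle: "principal_bundle P"
begin

abbreviation "QA \<equiv> total_atlas P"
abbreviation "MA \<equiv> base_atlas P"
abbreviation "GA \<equiv> group_atlas (struct_group P)"
abbreviation "\<e> \<equiv> gone (struct_group P)"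

lemma QA: "smooth_atlas QA" and MA: "smooth_atlas MA"
  and QA_open: "open U \<Longrightarrow> atlas_open QA U" and MA_open: "open V \<Longrightarrow> atlas_open MA V"
  using principal_bundle smooth_manifold_atlas unfolding principal_bundle_def by blast+

sublocale lg: lie_group_setup "struct_group P"
  using principal_bundle unfolding principal_bundle_def by unfold_locales blast

lemma smooth_proj: "smooth_map_on UNIV QA MA (proj P)"
  using principal_bundle unfolding principal_bundle_def by blast

lemma smooth_act: "smooth_map_on UNIV (prod_atlas QA GA) QA (\<lambda>(q, g). act P q g)"
  using principal_bundle unfolding principal_bundle_def by blast

lemma act_one [simp]: "act P q \<e> = q"
  and proj_act [simp]: "proj P (act P q g) = proj P q"
  using principal_bundle unfolding principal_bundle_def by blast+

lemma smooth_act_comp: "smooth_map_on S B QA f \<Longrightarrow> smooth_map_on S B GA g \<Longrightarrow> smooth_map_on S B QA (\<lambda>x. act P (f x) (g x))"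
  using smooth_map_on_compose[OF smooth_atlas_prod[OF QA lg.GA] smooth_map_on_Pair smooth_act] by fastforce

lemma smooth_orbit: "smooth_map_on UNIV GA QA (act P q)"
  using smooth_act_comp[OF smooth_map_on_const smooth_map_on_ident[OF lg.GA]] by simp

lemma smooth_right_translation: "smooth_map_on UNIV QA QA (\<lambda>q. act P q g)"
  using smooth_act_comp[OF smooth_map_on_ident[OF QA] smooth_map_on_const] by simp

definition ck :: "('g, 'h) chart" where "ck = chart_at GA \<e>"

lemma ck: "ck \<in> GA" "\<e> \<in> chart_dom ck"
  using chart_at_in[OF lg.GA] by (auto simp: ck_def)

definition act_rep :: "('q, 'e) chart \<Rightarrow> 'e \<times> 'h \<Rightarrow> 'e" where
  "act_rep c = rep (Chart (chart_dom c \<times> chart_dom ck) (map_prod (chart_fun c) (chart_fun ck))) c (\<lambda>(q, g). act P q g)"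

definition act_rep_dom :: "('q, 'e) chart \<Rightarrow> ('e \<times> 'h) set" where
  "act_rep_dom c = rep_dom UNIV (Chart (chart_dom c \<times> chart_dom ck) (map_prod (chart_fun c) (chart_fun ck))) c (\<lambda>(q, g). act P q g)"

text \<open>The fundamental field of \<open>b\<close> in the chart \<open>c\<close>, written as the
  derivative of the action in the group variable at the unit. This shows smoothness in the point and
  linearity in \<open>b\<close> at once.\<close>

definition fund_rep :: "('q, 'e) chart \<Rightarrow> 'h \<Rightarrow> 'e \<Rightarrow> 'e" where
  "fund_rep c b x = frechet_derivative (act_rep c) (at (x, chart_fun ck \<e>)) (0, b)"

abbreviation "img c \<equiv> chart_fun c ` chart_dom c"

lemma act_rep_smooth:
  assumes "c \<in> QA"
  shows "open (act_rep_dom c)" "C_inf_on (act_rep_dom c) (act_rep c)"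
  unfolding act_rep_def act_rep_dom_def
  using open_rep_dom[OF smooth_atlas_prod[OF QA lg.GA] smooth_act atlas_open_UNIV[OF smooth_atlas_prod[OF QA lg.GA]]
    in_prod_atlas[OF assms ck(1)] assms] by auto

lemma act_rep_domI:
  assumes "c \<in> QA" "q \<in> chart_dom c" "g \<in> chart_dom ck" "act P q g \<in> chart_dom c"
  shows "(chart_fun c q, chart_fun ck g) \<in> act_rep_dom c"
  unfolding act_rep_dom_def rep_dom_def using assms by (auto intro!: image_eqI[of _ _ "(q, g)"])

lemma act_rep_domD:
  assumes "(x, y) \<in> act_rep_dom c"
  obtains q g where "q \<in> chart_dom c" "g \<in> chart_dom ck" "act P q g \<in> chart_dom c" "x = chart_fun c q" "y = chart_fun ck g"
  using assms unfolding act_rep_dom_def rep_dom_def by auto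

lemma act_rep_eq:
  assumes "c \<in> QA" "q \<in> chart_dom c" "g \<in> chart_dom ck"
  shows "act_rep c (chart_fun c q, chart_fun ck g) = chart_fun c (act P q g)"
  using assms ck by (simp add: act_rep_def rep_def chart_inv_prod[OF QA lg.GA] chart_inv_left[OF QA] chart_inv_left[OF lg.GA])

lemma act_rep_one:
  assumes "c \<in> QA" "x \<in> img c"
  shows "(x, chart_fun ck \<e>) \<in> act_rep_dom c" "act_rep c (x, chart_fun ck \<e>) = x"
proof -
  obtain q where q: "q \<in> chart_dom c" "x = chart_fun c q" using assms by auto
  show "(x, chart_fun ck \<e>) \<in> act_rep_dom c" "act_rep c (x, chart_fun ck \<e>) = x"
    unfolding q(2) using act_rep_domI[OF assms(1) q(1) ck(2)] act_rep_eq[OF assms(1) q(1) ck(2)] q by auto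
qed

lemma fund_rep_smooth: "c \<in> QA \<Longrightarrow> C_inf_on (img c) (fund_rep c b)"
  unfolding fund_rep_def[abs_def]
  by (intro C_inf_on_frechet_derivative_comp[OF _ act_rep_smooth] C_inf_on_Pair C_inf_on_const C_inf_on_ident open_chart_image[OF QA])
     (auto intro: act_rep_one(1))

lemma fund_rep_linear: "c \<in> QA \<Longrightarrow> x \<in> img c \<Longrightarrow> linear (\<lambda>b. fund_rep c b x)"
proof -
  assume "c \<in> QA" "x \<in> img c"
  then have l: "linear (frechet_derivative (act_rep c) (at (x, chart_fun ck \<e>)))"
    by (intro C_inf_on_linear[OF act_rep_smooth(2)] act_rep_one)
  show ?thesis
    unfolding fund_rep_def
    by (rule linearI) (use linear_add[OF l, of "(0, _)" "(0, _)"] linear_scale[OF l, of _ "(0, _)"] in auto)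
qed

text \<open>Only the value and the velocity of the exponential curve at time 0 matter, so the
  fundamental vector is the image of \<open>b\<close> under the tangent map of the orbit
  map.\<close>

lemma fundamental_tangent_map:
  shows "has_velocity QA UNIV (\<lambda>t. act P q (lie_exp (struct_group P) (t *\<^sub>R b))) 0 (fundamental P b q)"
    and "fundamental P b q = snd (tangent_map GA QA (act P q) (\<e>, b))"
proof -
  note x = lg.lie_exp_curve[of b]
  have *: "has_velocity QA UNIV (\<lambda>t. act P q (lie_exp (struct_group P) (t *\<^sub>R b))) 0 (snd (tangent_map GA QA (act P q) (\<e>, b)))"
    using has_velocity_compose[OF lg.GA QA smooth_orbit atlas_open_UNIV[OF lg.GA] UNIV_I x(3) UNIV_I] unfolding x(2) .
  then show "fundamental P b q = snd (tangent_map GA QA (act P q) (\<e>, b))"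
    using has_velocity_velocity[OF QA *] by (simp add: fundamental_def)
  with * show "has_velocity QA UNIV (\<lambda>t. act P q (lie_exp (struct_group P) (t *\<^sub>R b))) 0 (fundamental P b q)" by simp
qed

lemma fundamental_components:
  assumes c: "c \<in> QA" "q \<in> chart_dom c"
  shows "components QA c q (fundamental P b q) = fund_rep c b (chart_fun c q)"
proof -
  have x: "chart_fun c q \<in> img c" using c by auto
  have "components QA c q (fundamental P b q) = frechet_derivative (rep ck c (act P q)) (at (chart_fun ck \<e>)) b"
    using tangent_map_components[OF lg.GA QA smooth_orbit atlas_open_UNIV[OF lg.GA] ck(1) c(1) UNIV_I ck(2), of q b] c
      components_chart_at[OF lg.GA, of \<e> b]
    by (simp add: fundamental_tangent_map(2) ck_def)
  also have "\<dots> = fund_rep c b (chart_fun c q)"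
  proof -
    have d1: "(act_rep c has_derivative frechet_derivative (act_rep c) (at (chart_fun c q, chart_fun ck \<e>))) (at (chart_fun c q, chart_fun ck \<e>))"
      by (rule C_inf_on_has_derivative[OF act_rep_smooth(2)[OF c(1)] act_rep_one(1)[OF c(1) x]])
    have d2: "((\<lambda>y. act_rep c (chart_fun c q, y)) has_derivative (\<lambda>v. frechet_derivative (act_rep c) (at (chart_fun c q, chart_fun ck \<e>)) (0, v))) (at (chart_fun ck \<e>))"
      by (rule has_derivative_compose[OF has_derivative_Pair[OF has_derivative_const has_derivative_ident]]) (use d1 in simp)
    have "(rep ck c (act P q) has_derivative (\<lambda>v. frechet_derivative (act_rep c) (at (chart_fun c q, chart_fun ck \<e>)) (0, v))) (at (chart_fun ck \<e>))"
    proof (rule has_derivative_transform_within_open[OF d2 open_chart_image[OF lg.GA ck(1)]])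
      show "chart_fun ck \<e> \<in> chart_fun ck ` chart_dom ck" using ck by auto
      fix y assume "y \<in> chart_fun ck ` chart_dom ck"
      then show "act_rep c (chart_fun c q, y) = rep ck c (act P q) y"
        using act_rep_eq[OF c] ck by (auto simp: rep_def chart_inv_left[OF lg.GA])
    qed
    then show ?thesis unfolding fund_rep_def by (metis frechet_derivative_at)
  qed
  finally show ?thesis .
qed

lemma linear_fundamental: "linear (\<lambda>b. fundamental P b q)"
proof -
  note c = chart_at_in[OF QA, of q]
  have "fundamental P b q = fund_rep (chart_at QA q) b (chart_fun (chart_at QA q) q)" for b
    using fundamental_components[OF c] by (simp add: components_chart_at[OF QA])
  then show ?thesis using fund_rep_linear[OF c(1)] c(2) by simp
qed

lemma linear_proj_push: "linear (\<lambda>v. proj_push P (q, v))"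
  unfolding proj_push_def by (rule linear_tangent_map[OF QA MA smooth_proj atlas_open_UNIV[OF QA] UNIV_I])

lemma proj_push_velocity:
  assumes "has_velocity QA UNIV \<sigma> t v"
  shows "has_velocity MA UNIV (\<lambda>s. proj P (\<sigma> s)) t (proj_push P (\<sigma> t, v))"
  unfolding proj_push_def by (rule has_velocity_compose[OF QA MA smooth_proj atlas_open_UNIV[OF QA] UNIV_I assms UNIV_I])

lemma proj_push_fundamental: "proj_push P (q, fundamental P b q) = 0"
proof -
  have "has_velocity MA UNIV (\<lambda>s. proj P q) 0 (proj_push P (q, fundamental P b q))"
    using proj_push_velocity[OF fundamental_tangent_map(1)[of q b]] lg.lie_exp_curve(2)[of b] by simp
  from has_velocity_unique[OF MA this has_velocity_const[OF MA]] show ?thesis by simp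
qed

lemma trivialization_at:
  obtains \<theta> where "linear \<theta>" "\<And>b. \<theta> (fundamental P b q) = b"
    "\<And>v. proj_push P (q, v) = 0 \<Longrightarrow> v = fundamental P (\<theta> v) q"
    "\<And>X. \<exists>v. proj_push P (q, v) = X"
proof -
  let ?G = "struct_group P"
  obtain U \<psi> where U: "open U" "proj P q \<in> U" and \<psi>: "bij_betw \<psi> (proj P -` U) (U \<times> UNIV)"
    "smooth_map_on (proj P -` U) QA (prod_atlas MA GA) \<psi>"
    "smooth_map_on (U \<times> UNIV) (prod_atlas MA GA) QA (inv_into (proj P -` U) \<psi>)"
    and eqv: "\<And>q. q \<in> proj P -` U \<Longrightarrow> fst (\<psi> q) = proj P q"
      "\<And>q g. q \<in> proj P -` U \<Longrightarrow> snd (\<psi> (act P q g)) = gmult ?G (snd (\<psi> q)) g"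
    using principal_bundle unfolding principal_bundle_def by metis
  define S where "S = proj P -` U"
  define \<Psi> where "\<Psi> = inv_into S \<psi>"
  define s where "s p = snd (\<psi> p)" for p
  note MG = smooth_atlas_prod[OF MA lg.GA]
  have S: "atlas_open QA S" unfolding S_def by (rule atlas_open_vimage[OF QA MA smooth_proj MA_open[OF U(1)]])
  have qS: "q \<in> S" using U(2) by (simp add: S_def)
  have UU: "atlas_open (prod_atlas MA GA) (U \<times> UNIV)" by (rule atlas_open_Times_UNIV[OF MA_open[OF U(1)] lg.GA])
  have smooth_s: "smooth_map_on S QA GA s"
    unfolding s_def[abs_def] by (rule smooth_map_on_compose[OF MG \<psi>(2)[folded S_def] smooth_map_on_snd[OF lg.GA]]) auto
  have smooth_\<Psi>: "smooth_map_on (U \<times> UNIV) (prod_atlas MA GA) QA \<Psi>" using \<psi>(3) by (simp add: \<Psi>_def S_def)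
  have \<psi>_eq: "\<psi> p = (proj P p, s p)" if "p \<in> S" for p
    using eqv(1)[of p] that by (simp add: s_def S_def prod_eq_iff)
  have \<Psi>\<psi>: "\<Psi> (proj P p, s p) = p" if "p \<in> S" for p
    using \<psi>(1) that \<psi>_eq[OF that] unfolding \<Psi>_def S_def[symmetric] bij_betw_def by (metis inv_into_f_f)
  have \<psi>\<Psi>: "proj P (\<Psi> (x, g)) = x" if "x \<in> U" for x g
  proof -
    have "(x, g) \<in> \<psi> ` S" using \<psi>(1) that by (auto simp: bij_betw_def S_def)
    then have "\<Psi> (x, g) \<in> S" "\<psi> (\<Psi> (x, g)) = (x, g)"
      unfolding \<Psi>_def by (auto intro: inv_into_into f_inv_into_f)
    then show ?thesis using \<psi>_eq by fastforce
  qed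
  have actS: "act P p g \<in> S" "s (act P p g) = gmult ?G (s p) g" if "p \<in> S" for p g
    using that eqv(2)[of p g] by (auto simp: S_def s_def)
  \<comment> \<open>The group component normalized to the unit at \<open>q\<close>. It inverts the
    orbit map, hence its tangent map \<theta> inverts
    \<open>b \<mapsto> fundamental P b q\<close>.\<close>
  define \<rho> where "\<rho> p = gmult ?G (ginv ?G (s q)) (s p)" for p
  have smooth_\<rho>: "smooth_map_on S QA GA \<rho>"
    unfolding \<rho>_def[abs_def] by (intro lg.smooth_mult_comp smooth_map_on_const smooth_s)
  have \<rho>_act: "\<rho> (act P q g) = g" for g
    unfolding \<rho>_def actS(2)[OF qS] by (metis lg.gr.assoc lg.gr.left_inverse lg.gr.left_neutral)
  have \<rho>q: "\<rho> q = \<e>" by (simp add: \<rho>_def)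
  have \<Psi>_act: "\<Psi> (proj P q, s p) = act P q (\<rho> p)" if "p \<in> S" for p
  proof -
    have "s (act P q (\<rho> p)) = s p"
      unfolding actS(2)[OF qS] \<rho>_def by (metis lg.gr.assoc lg.gr.right_inverse lg.gr.left_neutral)
    then show ?thesis using \<Psi>\<psi>[OF actS(1)[OF qS, of "\<rho> p"]] by simp
  qed
  define \<theta> where "\<theta> v = snd (tangent_map QA GA \<rho> (q, v))" for v
  have lin: "linear \<theta>" unfolding \<theta>_def[abs_def] by (rule linear_tangent_map[OF QA lg.GA smooth_\<rho> S qS])
  have \<theta>F: "\<theta> (fundamental P b q) = b" for b
  proof -
    note x = lg.lie_exp_curve[of b]
    have "has_velocity GA UNIV (\<lambda>t. \<rho> (act P q (lie_exp ?G (t *\<^sub>R b)))) 0 (\<theta> (fundamental P b q))"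
      using has_velocity_compose[OF QA lg.GA smooth_\<rho> S _ fundamental_tangent_map(1)[of q b] UNIV_I] qS
      by (simp only: x(2) act_one \<theta>_def)
    then have "has_velocity GA UNIV (\<lambda>t. lie_exp ?G (t *\<^sub>R b)) 0 (\<theta> (fundamental P b q))"
      by (simp only: \<rho>_act)
    from has_velocity_unique[OF lg.GA this x(3)] show ?thesis by simp
  qed
  have vert: "v = fundamental P (\<theta> v) q" if v: "proj_push P (q, v) = 0" for v
  proof -
    obtain \<sigma> where \<sigma>: "\<sigma> 0 = q" "has_velocity QA UNIV \<sigma> 0 v" by (rule curve_through[OF QA])
    obtain W where W: "open W" "0 \<in> W" "\<And>t. t \<in> W \<Longrightarrow> \<sigma> t \<in> S"
      using has_velocity_eventually_in_open[OF QA \<sigma>(2) S] \<sigma>(1) qS by metis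
    define w where "w = snd (tangent_map QA GA s (\<sigma> 0, v))"
    have s: "has_velocity GA UNIV (\<lambda>t. s (\<sigma> t)) 0 w"
      unfolding w_def by (rule has_velocity_compose[OF QA lg.GA smooth_s S _ \<sigma>(2) UNIV_I]) (use \<sigma>(1) qS in simp)
    have p: "has_velocity MA UNIV (\<lambda>t. proj P (\<sigma> t)) 0 0"
      using proj_push_velocity[OF \<sigma>(2)] \<sigma>(1) v by simp
    have p': "has_velocity MA UNIV (\<lambda>t. proj P q) 0 0" by (rule has_velocity_const[OF MA])
    \<comment> \<open>For vertical \<open>v\<close> the base component of \<sigma> has velocity 0,
      just as if it were constant. So \<sigma> and the curve with base component frozen at
      \<open>proj P q\<close> have the same velocity, and the latter curve runs in the orbit of
      \<open>q\<close>.\<close>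
    let ?pv = "pair_velocity MA GA (proj P q) (s q) 0 w"
    let ?u = "snd (tangent_map (prod_atlas MA GA) QA \<Psi> ((proj P q, s q), ?pv))"
    have 1: "has_velocity QA UNIV (\<lambda>t. \<Psi> (proj P (\<sigma> t), s (\<sigma> t))) 0 ?u"
      using has_velocity_compose[OF MG QA smooth_\<Psi> UU _ has_velocity_Pair[OF MA lg.GA p s UNIV_I] UNIV_I] U(2)
      by (simp add: \<sigma>(1))
    have 2: "has_velocity QA UNIV (\<lambda>t. \<Psi> (proj P q, s (\<sigma> t))) 0 ?u"
      using has_velocity_compose[OF MG QA smooth_\<Psi> UU _ has_velocity_Pair[OF MA lg.GA p' s UNIV_I] UNIV_I] U(2)
      by (simp add: \<sigma>(1))
    have "has_velocity QA UNIV \<sigma> 0 ?u"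
      by (rule has_velocity_transform[OF 1 W(1,2)]) (use W(3) \<Psi>\<psi> in auto)
    then have "v = ?u" using has_velocity_unique[OF QA \<sigma>(2)] by simp
    have "has_velocity QA UNIV (\<lambda>t. act P q (\<rho> (\<sigma> t))) 0 ?u"
      by (rule has_velocity_transform[OF 2 W(1,2)]) (use W(3) \<Psi>_act in auto)
    moreover have "has_velocity QA UNIV (\<lambda>t. act P q (\<rho> (\<sigma> t))) 0 (fundamental P (\<theta> v) q)"
    proof -
      have "has_velocity GA UNIV (\<lambda>t. \<rho> (\<sigma> t)) 0 (\<theta> v)"
        using has_velocity_compose[OF QA lg.GA smooth_\<rho> S _ \<sigma>(2) UNIV_I] \<sigma>(1) qS by (simp add: \<theta>_def)
      from has_velocity_compose[OF lg.GA QA smooth_orbit atlas_open_UNIV[OF lg.GA] UNIV_I this UNIV_I, of q]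
      show ?thesis by (simp add: fundamental_tangent_map(2) \<sigma>(1) \<rho>q)
    qed
    ultimately have "?u = fundamental P (\<theta> v) q" using has_velocity_unique[OF QA] by simp
    with \<open>v = ?u\<close> show ?thesis by simp
  qed
  have surj: "\<exists>v. proj_push P (q, v) = X" for X
  proof -
    obtain \<eta> where \<eta>: "\<eta> 0 = proj P q" "has_velocity MA UNIV \<eta> 0 X" by (rule curve_through[OF MA])
    obtain W where W: "open W" "0 \<in> W" "\<And>t. t \<in> W \<Longrightarrow> \<eta> t \<in> U"
      using has_velocity_eventually_in_open[OF MA \<eta>(2) MA_open[OF U(1)]] \<eta>(1) U(2) by metis
    \<comment> \<open>A base curve with velocity \<open>X\<close> is lifted with constant group
      component; the velocity of the lift is a preimage of \<open>X\<close>.\<close>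
    let ?v = "snd (tangent_map (prod_atlas MA GA) QA \<Psi> ((\<eta> 0, s q), pair_velocity MA GA (\<eta> 0) (s q) X 0))"
    have "has_velocity QA UNIV (\<lambda>t. \<Psi> (\<eta> t, s q)) 0 ?v"
      by (rule has_velocity_compose[OF MG QA smooth_\<Psi> UU _ has_velocity_Pair[OF MA lg.GA \<eta>(2) has_velocity_const[OF lg.GA] UNIV_I] UNIV_I])
        (use \<eta>(1) U(2) in simp)
    from proj_push_velocity[OF this]
    have "has_velocity MA UNIV (\<lambda>t. proj P (\<Psi> (\<eta> t, s q))) 0 (proj_push P (q, ?v))"
      using \<eta>(1) \<Psi>\<psi>[OF qS] by simp
    then have "has_velocity MA UNIV \<eta> 0 (proj_push P (q, ?v))"
      by (rule has_velocity_transform[OF _ W(1,2)]) (use W(3) \<psi>\<Psi> in auto)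
    from has_velocity_unique[OF MA this \<eta>(2)] show ?thesis by (intro exI[of _ ?v]) simp
  qed
  show thesis by (rule that[OF lin \<theta>F vert surj])
qed

lemma vertical_eq: "v \<in> vertical P q \<longleftrightarrow> (\<exists>b. v = fundamental P b q)"
proof -
  obtain \<theta> where "\<And>v. proj_push P (q, v) = 0 \<Longrightarrow> v = fundamental P (\<theta> v) q"
    by (rule trivialization_at[of q]) blast
  then show ?thesis using proj_push_fundamental by (auto simp: vertical_def)
qed

lemma fundamental_inject: "fundamental P a q = fundamental P b q \<longleftrightarrow> a = b"
proof -
  obtain \<theta> where "\<And>b. \<theta> (fundamental P b q) = b"
    by (rule trivialization_at[of q]) blast
  then show ?thesis by metis
qed

lemma proj_push_surj: "\<exists>v. proj_push P (q, v) = X"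
  by (rule trivialization_at[of q]) blast

lemma proj_push_components:
  assumes "c \<in> QA" "d \<in> MA" "q \<in> chart_dom c" "proj P q \<in> chart_dom d"
  shows "components MA d (proj P q) (proj_push P (q, v)) =
    frechet_derivative (rep c d (proj P)) (at (chart_fun c q)) (components QA c q v)"
  unfolding proj_push_def by (rule tangent_map_components[OF QA MA smooth_proj atlas_open_UNIV[OF QA] assms(1,2) UNIV_I assms(3,4)])

end

section \<open>Horizontal distributions\<close>

locale horizontal_setup = bundle_setup P
  for P :: "('q::{t2_space, second_countable_topology}, 'e::model_space,
               'm::{t2_space, second_countable_topology}, 'f::model_space,
               'g::{t2_space, second_countable_topology}, 'h::model_space) bundle_data" +
  fixes H :: "'q \<Rightarrow> 'e set"
  assumes horizontal: "horizontal_distribution P H"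
begin

lemma subspace_H: "subspace (H q)"
proof -
  obtain U k and X :: "nat \<Rightarrow> 'q \<Rightarrow> 'e" where "q \<in> U" "\<forall>p\<in>U. H p = span ((\<lambda>i. X i p) ` {..<k})"
    using horizontal unfolding horizontal_distribution_def smooth_distribution_def by meson
  then show ?thesis by (metis subspace_span)
qed

lemma horizontal_vertical: "v \<in> H q \<Longrightarrow> proj_push P (q, v) = 0 \<Longrightarrow> v = 0"
  using horizontal unfolding horizontal_distribution_def vertical_def by blast

lemma fundamental_in_H: "fundamental P a q \<in> H q \<Longrightarrow> a = 0"
  using horizontal_vertical[OF _ proj_push_fundamental] fundamental_inject[where a = a and b = 0 and q = q] linear_0[OF linear_fundamental[of q]] by metis

lemma split_vector: "\<exists>u\<in>H q. \<exists>a. v = u + fundamental P a q"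
proof -
  have "v \<in> {u + v | u v. u \<in> H q \<and> v \<in> vertical P q}"
    using horizontal unfolding horizontal_distribution_def by blast
  then show ?thesis using vertical_eq by auto
qed

lemma omega_eqI:
  assumes "u \<in> H q" "v = u + fundamental P a q"
  shows "omega P H (q, v) = a"
  unfolding omega_def prod.case
proof (rule the_equality)
  show "\<exists>u\<in>H q. v = u + fundamental P a q" using assms by blast
  fix b assume "\<exists>u\<in>H q. v = u + fundamental P b q"
  then obtain u' where u': "u' \<in> H q" "v = u' + fundamental P b q" by blast
  have "u' = u + fundamental P a q - fundamental P b q"
    using assms(2) u'(2) by (simp only: eq_diff_eq)
  then have "fundamental P (b - a) q = u - u'"
    by (simp add: linear_diff[OF linear_fundamental[of q]])
  then have "fundamental P (b - a) q \<in> H q" using subspace_diff[OF subspace_H] assms(1) u'(1) by metis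
  then show "b = a" using fundamental_in_H by fastforce
qed

lemma omega_split: "v - fundamental P (omega P H (q, v)) q \<in> H q"
  using split_vector[of q v] omega_eqI by fastforce

lemma omega_horizontal: "v \<in> H q \<longleftrightarrow> omega P H (q, v) = 0"
  using omega_eqI[of v q v 0] omega_split[of v q] linear_0[OF linear_fundamental[of q]] by auto

lemma omega_fundamental: "omega P H (q, fundamental P a q) = a"
  by (rule omega_eqI[OF subspace_0[OF subspace_H]]) simp

lemma linear_omega: "linear (\<lambda>v. omega P H (q, v))"
proof (rule linearI)
  fix v w :: 'e and r :: real
  show "omega P H (q, v + w) = omega P H (q, v) + omega P H (q, w)"
    by (rule omega_eqI[OF subspace_add[OF subspace_H omega_split[of v q] omega_split[of w q]]])
      (simp add: linear_add[OF linear_fundamental])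
  show "omega P H (q, r *\<^sub>R v) = r *\<^sub>R omega P H (q, v)"
    by (rule omega_eqI[OF subspace_scale[OF subspace_H omega_split[of v q], of r]])
      (simp add: linear_scale[OF linear_fundamental] scaleR_diff_right)
qed

lemma hlift_ex1: "\<exists>!u. u \<in> H q \<and> proj_push P (q, u) = X"
proof (rule ex_ex1I)
  obtain v where v: "proj_push P (q, v) = X" using proj_push_surj by blast
  have "proj_push P (q, v - fundamental P (omega P H (q, v)) q) = X"
    using v linear_diff[OF linear_proj_push] by (simp add: proj_push_fundamental)
  then show "\<exists>u. u \<in> H q \<and> proj_push P (q, u) = X" using omega_split by blast
  fix u w assume "u \<in> H q \<and> proj_push P (q, u) = X" "w \<in> H q \<and> proj_push P (q, w) = X"
  then have "u - w \<in> H q" "proj_push P (q, u - w) = 0"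
    using subspace_diff[OF subspace_H] linear_diff[OF linear_proj_push] by auto
  then show "u = w" using horizontal_vertical by fastforce
qed

lemma hlift: "hlift P H q X \<in> H q" "proj_push P (q, hlift P H q X) = X"
  using theI'[OF hlift_ex1[of q X]] unfolding hlift_def by auto

lemma hlift_proj_push: "v \<in> H q \<Longrightarrow> hlift P H q (proj_push P (q, v)) = v"
  using hlift_ex1[of q "proj_push P (q, v)"] hlift[of q "proj_push P (q, v)"] by blast

text \<open>
  In a chart around a given point, a vector with components \<open>w\<close> over a nearby point is expanded in the
  moving frame of horizontal and fundamental fields; its coefficients form a vector \<open>u\<close> at the given
  point, so \<open>u\<close> solves a linear equation depending smoothly on the base point.
\<close>

lemma smooth_omega: "smooth_map_on UNIV (tangent_atlas QA) std_atlas (omega P H)"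
proof (rule smooth_map_onI[OF smooth_atlas_tangent[OF QA] smooth_atlas_std])
  fix z :: "'q \<times> 'e"
  obtain q0 v0 where z: "z = (q0, v0)" by (cases z)
  have "smooth_distribution QA H" using horizontal by (simp add: horizontal_distribution_def)
  then obtain U k and X :: "nat \<Rightarrow> 'q \<Rightarrow> 'e" where U: "open U" "q0 \<in> U"
    and "\<forall>i<k. smooth_vector_field_on U QA (X i)"
    and "\<forall>p\<in>U. inj_on (\<lambda>i. X i p) {..<k} \<and> independent ((\<lambda>i. X i p) ` {..<k}) \<and>
           H p = span ((\<lambda>i. X i p) ` {..<k})"
    unfolding smooth_distribution_def by metis
  then have X: "\<And>i. i < k \<Longrightarrow> smooth_vector_field_on U QA (X i)"
    "\<And>p. p \<in> U \<Longrightarrow> inj_on (\<lambda>i. X i p) {..<k}" "\<And>p. p \<in> U \<Longrightarrow> independent ((\<lambda>i. X i p) ` {..<k})"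
    "\<And>p. p \<in> U \<Longrightarrow> H p = span ((\<lambda>i. X i p) ` {..<k})"
    by auto
  define c where "c = chart_at QA q0"
  have c: "c \<in> QA" "q0 \<in> chart_dom c" using chart_at_in[OF QA] by (auto simp: c_def)
  define S where "S = chart_fun c ` (U \<inter> chart_dom c)"
  have S: "open S" using QA_open[OF U(1)] c(1) by (simp add: S_def atlas_open_def)
  have S_img: "S \<subseteq> img c" by (auto simp: S_def)
  have pS: "chart_inv c x \<in> U" "chart_inv c x \<in> chart_dom c" "chart_fun c (chart_inv c x) = x" if "x \<in> S" for x
    using that c(1) by (auto simp: S_def chart_inv_left[OF QA])
  define \<Xi> where "\<Xi> i x = components QA c (chart_inv c x) (X i (chart_inv c x))" for i x
  have \<Xi>: "C_inf_on S (\<Xi> i)" if "i < k" for i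
  proof -
    note r = open_rep_dom(2)[OF QA X(1)[OF that, unfolded smooth_vector_field_on_def] QA_open[OF U(1)] c(1) in_tangent_atlas[OF QA c(1)]]
    have "rep_dom U c (tangent_chart QA c) (\<lambda>p. (p, X i p)) = S"
      by (auto simp: rep_dom_def S_def)
    with r have "C_inf_on S (\<lambda>x. snd (rep c (tangent_chart QA c) (\<lambda>p. (p, X i p)) x))"
      by (intro C_inf_on_snd[OF S]) simp
    then show ?thesis by (simp add: rep_def chart_fun_tangent_chart \<Xi>_def[abs_def])
  qed
  define B where "B = (\<lambda>i. X i q0) ` {..<k}"
  \<comment> \<open>Functionals dual to the horizontal frame at \<open>q0\<close>, extended linearly
    from the frame to the whole model space.\<close>
  define l where "l i = (SOME f. linear f \<and> (\<forall>b\<in>B. f b = (if b = X i q0 then 1 else 0 :: real)))" for i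
  have "\<exists>f. linear f \<and> (\<forall>b\<in>B. f b = (if b = X i q0 then 1 else 0 :: real))" for i
    unfolding B_def by (rule linear_independent_extend[OF X(3)[OF U(2)]])
  then have "linear (l i) \<and> (\<forall>b\<in>B. l i b = (if b = X i q0 then 1 else 0))" for i
    unfolding l_def by (rule someI_ex)
  then have l: "\<And>i. linear (l i)" "\<And>i b. b \<in> B \<Longrightarrow> l i b = (if b = X i q0 then 1 else 0 :: real)"
    by auto
  define W where "W v = omega P H (q0, v)" for v
  define F where "F a = fundamental P a q0" for a
  have W: "linear W" unfolding W_def[abs_def] by (rule linear_omega)
  have F: "linear F" unfolding F_def[abs_def] by (rule linear_fundamental)
  define \<alpha> where "\<alpha> i v = l i (v - F (W v))" for i v
  have \<alpha>: "linear (\<alpha> i)" for i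
    by (rule linearI) (simp_all add: \<alpha>_def linear_add[OF W] linear_scale[OF W] linear_add[OF F] linear_scale[OF F]
      linear_add[OF l(1)] linear_diff[OF l(1)] linear_scale[OF l(1)] right_diff_distrib)
  have \<alpha>_comb: "\<alpha> i ((\<Sum>j<k. r j *\<^sub>R X j q0) + F a) = r i" "W ((\<Sum>j<k. r j *\<^sub>R X j q0) + F a) = a" if "i < k" for i r a
  proof -
    let ?h = "\<Sum>j<k. r j *\<^sub>R X j q0"
    have "?h \<in> H q0" unfolding X(4)[OF U(2)] by (intro span_sum span_scale span_base) auto
    then show "W (?h + F a) = a" unfolding W_def F_def by (intro omega_eqI) auto
    then have "\<alpha> i (?h + F a) = l i ?h" by (simp add: \<alpha>_def)
    also have "\<dots> = (\<Sum>j<k. r j * l i (X j q0))" by (simp add: linear_sum[OF l(1)] linear_scale[OF l(1)])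
    also have "\<dots> = (\<Sum>j<k. if j = i then r i else 0)"
    proof (rule sum.cong[OF refl])
      fix j assume j: "j \<in> {..<k}"
      then have "X j q0 = X i q0 \<longleftrightarrow> j = i" using X(2)[OF U(2)] that by (auto simp: inj_on_def)
      then show "r j * l i (X j q0) = (if j = i then r i else 0)" using l(2)[of "X j q0" i] j by (auto simp: B_def)
    qed
    finally show "\<alpha> i (?h + F a) = r i" using that by simp
  qed
  have W_comb: "W ((\<Sum>j<k. r j *\<^sub>R X j q0) + F a) = a" for r a
  proof -
    have "(\<Sum>j<k. r j *\<^sub>R X j q0) \<in> H q0" unfolding X(4)[OF U(2)] by (intro span_sum span_scale span_base) auto
    then show ?thesis unfolding W_def F_def by (intro omega_eqI) auto
  qed
  have H_comb: "\<exists>r. h = (\<Sum>j<k. r j *\<^sub>R X j p)" if p: "p \<in> U" and h: "h \<in> H p" for p h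
  proof -
    have "h \<in> span ((\<lambda>i. X i p) ` {..<k})" using X(4)[OF p] h by simp
    then obtain s where "h = (\<Sum>v\<in>(\<lambda>i. X i p) ` {..<k}. s v *\<^sub>R v)"
      unfolding span_finite[OF finite_imageI[OF finite_lessThan]] by auto
    also have "\<dots> = (\<Sum>j<k. s (X j p) *\<^sub>R X j p)" by (subst sum.reindex[OF X(2)[OF p]]) simp
    finally show ?thesis by (rule exI[of _ "\<lambda>j. s (X j p)"])
  qed
  have expand0: "v = (\<Sum>j<k. \<alpha> j v *\<^sub>R X j q0) + F (W v)" for v
  proof -
    obtain r where r: "v - F (W v) = (\<Sum>j<k. r j *\<^sub>R X j q0)"
      using H_comb[OF U(2) omega_split[of v q0]] by (auto simp: W_def F_def)
    then have v: "v = (\<Sum>j<k. r j *\<^sub>R X j q0) + F (W v)" by (simp add: algebra_simps)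
    have "\<alpha> j v = r j" if "j < k" for j using \<alpha>_comb(1)[OF that, of r "W v"] v by simp
    with v show ?thesis by simp
  qed
  define A where "A x v = (\<Sum>j<k. \<alpha> j v *\<^sub>R \<Xi> j x) + fund_rep c (W v) x" for x v
  have A_comp: "A x v = components QA c (chart_inv c x) ((\<Sum>j<k. \<alpha> j v *\<^sub>R X j (chart_inv c x)) + fundamental P (W v) (chart_inv c x))"
    if "x \<in> S" for x v
    using pS[OF that] c(1) linear_components[OF QA c(1) pS(2)[OF that]]
    by (simp add: A_def \<Xi>_def linear_add linear_sum linear_scale fundamental_components)
  interpret smooth_linear_equation "S \<times> (UNIV :: 'e set)" "\<lambda>z. A (fst z)"
  proof (rule smooth_linear_equation.intro)
    show "open (S \<times> (UNIV :: 'e set))" using S by (intro open_Times) auto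
    fix z :: "'e \<times> 'e" and v :: 'e assume "z \<in> S \<times> UNIV"
    then have x: "fst z \<in> S" by auto
    let ?p = "chart_inv c (fst z)"
    have fl: "linear (\<lambda>a. fund_rep c a (fst z))" by (rule fund_rep_linear[OF c(1)]) (use x S_img in auto)
    show "linear (A (fst z))"
      by (rule linearI) (simp_all add: A_def linear_add[OF \<alpha>] linear_scale[OF \<alpha>] linear_add[OF W] linear_scale[OF W]
          linear_add[OF fl] linear_scale[OF fl] scaleR_add_left sum.distrib scaleR_sum_right algebra_simps)
    assume "A (fst z) v = 0"
    then have 0: "(\<Sum>j<k. \<alpha> j v *\<^sub>R X j ?p) + fundamental P (W v) ?p = 0"
      using A_comp[OF x, of v] components_inject[OF QA c(1) pS(2)[OF x]] linear_0[OF linear_components[OF QA c(1) pS(2)[OF x]]] by metis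
    have h: "(\<Sum>j<k. \<alpha> j v *\<^sub>R X j ?p) \<in> H ?p" unfolding X(4)[OF pS(1)[OF x]] by (intro span_sum span_scale span_base) auto
    from omega_eqI[OF h refl, of "W v"] have "W v = 0"
      unfolding 0 using linear_0[OF linear_omega] by simp
    then have "(\<Sum>j<k. \<alpha> j v *\<^sub>R X j ?p) = 0" using 0 linear_0[OF linear_fundamental] by simp
    \<comment> \<open>Independence is stated for the set of frame vectors; coefficients indexed by
      \<open>j\<close> become functions on that set through the inverse of the injective
      enumeration.\<close>
    moreover have inv: "the_inv_into {..<k} (\<lambda>i. X i ?p) (X j ?p) = j" if "j < k" for j
      using the_inv_into_f_f[OF X(2)[OF pS(1)[OF x]], of j] that by simp
    ultimately have "(\<Sum>y\<in>(\<lambda>i. X i ?p) ` {..<k}. \<alpha> (the_inv_into {..<k} (\<lambda>i. X i ?p) y) v *\<^sub>R y) = 0"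
      by (subst sum.reindex[OF X(2)[OF pS(1)[OF x]]]) simp
    from independentD[OF X(3)[OF pS(1)[OF x]] finite_imageI[OF finite_lessThan] subset_refl this]
    have "\<alpha> (the_inv_into {..<k} (\<lambda>i. X i ?p) y) v = 0" if "y \<in> (\<lambda>i. X i ?p) ` {..<k}" for y
      using that .
    then have "\<alpha> j v = 0" if "j < k" for j
      using inv[OF that] that by (metis (no_types, lifting) imageI lessThan_iff)
    then show "v = 0" using expand0[of v] \<open>W v = 0\<close> linear_0[OF F] by simp
  next
    fix v
    have o: "open (S \<times> (UNIV :: 'e set))" using S by (intro open_Times) auto
    have "C_inf_on S (\<lambda>x. \<alpha> j v *\<^sub>R \<Xi> j x)" if "j \<in> {..<k}" for j
      by (rule C_inf_on_bounded_linear_comp[OF S bounded_linear_scaleR_right]) (use \<Xi> that in auto)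
    from C_inf_on_add[OF S C_inf_on_sum[OF S this] C_inf_on_subset[OF fund_rep_smooth[OF c(1)] S_img]]
    have "C_inf_on S (\<lambda>x. A x v)"
      unfolding A_def .
    from C_inf_on_compose[OF o S this C_inf_on_fst[OF o C_inf_on_ident[OF o]]]
    show "C_inf_on (S \<times> (UNIV :: 'e set)) (\<lambda>z. A (fst z) v)"
      by auto
  qed
  \<comment> \<open>Existence of the solution: the vector at \<open>q0\<close> with the frame
    coefficients that the given vector has at the nearby point. Its image under the fixed linear map
    \<open>W\<close> is the value of \<omega> at that nearby point.\<close>
  have "\<exists>u. A (fst y) u = snd y \<and> W u = omega P H (chart_inv (tangent_chart QA c) y)" if "y \<in> S \<times> UNIV" for y
  proof -
    obtain x w where y: "y = (x, w)" "x \<in> S" using \<open>y \<in> S \<times> UNIV\<close> by (cases y) auto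
    let ?p = "chart_inv c x" and ?v = "snd (chart_inv (tangent_chart QA c) (x, w))"
    have xi: "x \<in> img c" using y S_img by auto
    have pv: "chart_inv (tangent_chart QA c) (x, w) = (?p, ?v)"
      using chart_inv_tangent_chart[OF QA c(1) xi] by simp
    obtain r where r: "?v - fundamental P (omega P H (?p, ?v)) ?p = (\<Sum>j<k. r j *\<^sub>R X j ?p)"
      using H_comb[OF pS(1)[OF y(2)] omega_split[of ?v ?p]] by blast
    let ?a = "omega P H (?p, ?v)"
    let ?u = "(\<Sum>j<k. r j *\<^sub>R X j q0) + F ?a"
    have "A x ?u = components QA c ?p ((\<Sum>j<k. r j *\<^sub>R X j ?p) + fundamental P ?a ?p)"
      unfolding A_comp[OF y(2)] using \<alpha>_comb(1) by (simp add: W_comb)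
    also have "(\<Sum>j<k. r j *\<^sub>R X j ?p) + fundamental P ?a ?p = ?v" using r by (simp add: algebra_simps)
    also have "components QA c ?p ?v = w" by (rule components_chart_inv_tangent_chart[OF QA c(1) xi])
    finally have "A x ?u = w" .
    then show ?thesis using W_comb[of r ?a] pv by (intro exI[of _ ?u]) (simp add: y)
  qed
  then obtain u where u: "\<And>y. y \<in> S \<times> UNIV \<Longrightarrow> A (fst y) (u y) = snd y"
    "\<And>y. y \<in> S \<times> UNIV \<Longrightarrow> W (u y) = omega P H (chart_inv (tangent_chart QA c) y)" by metis
  have "C_inf_on (S \<times> UNIV) u"
    by (rule solution_C_inf[OF C_inf_on_snd[OF open_S C_inf_on_ident[OF open_S]] u(1)])
  then have Wu: "C_inf_on (S \<times> UNIV) (\<lambda>y. W (u y))"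
    by (rule C_inf_on_bounded_linear_comp[OF open_S linear_imp_bounded_linear[OF W]])
  show "\<exists>C\<in>tangent_atlas QA. \<exists>d\<in>std_atlas. z \<in> chart_dom C \<and> (\<exists>Y g. open Y \<and> chart_fun C z \<in> Y \<and> C_inf_on Y g \<and>
      (\<forall>x\<in>UNIV. x \<in> chart_dom C \<longrightarrow> chart_fun C x \<in> Y \<longrightarrow> omega P H x \<in> chart_dom d \<and> chart_fun d (omega P H x) = g (chart_fun C x)))"
  proof (intro bexI[of _ "tangent_chart QA c"] bexI[of _ "Chart UNIV id"] conjI exI[of _ "S \<times> UNIV"] exI[of _ "\<lambda>y. W (u y)"] ballI impI)
    show "open (S \<times> (UNIV :: 'e set))" by (rule open_S)
    show "C_inf_on (S \<times> UNIV) (\<lambda>y. W (u y))" by (rule Wu)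
    show "chart_fun (tangent_chart QA c) z \<in> S \<times> UNIV" using c U by (auto simp: z chart_fun_tangent_chart S_def)
    show "z \<in> chart_dom (tangent_chart QA c)" using c by (simp add: z)
    show "tangent_chart QA c \<in> tangent_atlas QA" by (rule in_tangent_atlas[OF QA c(1)])
    show "Chart UNIV id \<in> std_atlas" by (rule std_atlas_chart(1))
    fix y assume y: "y \<in> chart_dom (tangent_chart QA c)" "chart_fun (tangent_chart QA c) y \<in> S \<times> UNIV"
    have "chart_inv (tangent_chart QA c) (chart_fun (tangent_chart QA c) y) = y"
      by (rule chart_inv_left[OF smooth_atlas_tangent[OF QA] in_tangent_atlas[OF QA c(1)] y(1)])
    then show "chart_fun (Chart UNIV id) (omega P H y) = W (u (chart_fun (tangent_chart QA c) y))"
      using u(2)[OF y(2)] by simp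
  qed simp
qed

definition omega_rep :: "('q, 'e) chart \<Rightarrow> 'e \<times> 'e \<Rightarrow> 'h" where
  "omega_rep c z = omega P H (chart_inv (tangent_chart QA c) z)"

lemma omega_rep_smooth: "c \<in> QA \<Longrightarrow> C_inf_on (img c \<times> UNIV) (omega_rep c)"
  unfolding omega_rep_def[abs_def] by (rule smooth_on_tangent_C_inf[OF QA smooth_omega])

lemma omega_rep_eq: "c \<in> QA \<Longrightarrow> q \<in> chart_dom c \<Longrightarrow> omega_rep c (chart_fun c q, components QA c q v) = omega P H (q, v)"
  by (simp add: omega_rep_def chart_inv_tangent_chart_components[OF QA])

lemma open_img: "c \<in> QA \<Longrightarrow> open (img c \<times> (UNIV :: 'e set))"
  by (intro open_Times open_chart_image[OF QA]) auto

lemma omega_rep_linear: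
  assumes "c \<in> QA" "x \<in> img c"
  shows "linear (\<lambda>w. omega_rep c (x, w))"
proof -
  obtain q where q: "q \<in> chart_dom c" "x = chart_fun c q" using assms by auto
  define T where "T w = frechet_derivative (chart_fun (chart_at QA q) \<circ> chart_inv c) (at x) w" for w
  have T: "omega_rep c (x, w) = omega P H (q, T w)" for w
    using chart_inv_tangent_chart[OF QA assms, of w] q assms(1) by (simp add: omega_rep_def T_def chart_inv_left[OF QA])
  have "linear T"
    unfolding T_def[abs_def]
    by (rule C_inf_on_linear[OF C_inf_transition[OF QA assms(1) chart_at_in(1)[OF QA]]]) (use q chart_at_in[OF QA] in auto)
  from linear_compose[OF this linear_omega] show ?thesis unfolding T by (simp add: o_def)
qed

lemma omega_rep_derivative_snd:
  assumes "c \<in> QA" "x \<in> img c"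
  shows "frechet_derivative (omega_rep c) (at (x, w)) (0, z) = omega_rep c (x, z)"
proof -
  have "((\<lambda>w. omega_rep c (x, w)) has_derivative (\<lambda>z. frechet_derivative (omega_rep c) (at (x, w)) (0, z))) (at w)"
    by (rule has_derivative_compose[OF has_derivative_Pair[OF has_derivative_const has_derivative_ident]])
      (use C_inf_on_has_derivative[OF omega_rep_smooth[OF assms(1)], of "(x, w)"] assms(2) in auto)
  moreover have "((\<lambda>w. omega_rep c (x, w)) has_derivative (\<lambda>w. omega_rep c (x, w))) (at w)"
    by (rule bounded_linear_imp_has_derivative[OF linear_imp_bounded_linear[OF omega_rep_linear[OF assms]]])
  ultimately show ?thesis by (metis has_derivative_unique)
qed

subsection \<open>Horizontal lifts of vector fields\<close>

definition lift_rep :: "('q, 'e) chart \<Rightarrow> ('m \<Rightarrow> 'f) \<Rightarrow> 'e \<Rightarrow> 'e" where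
  "lift_rep c Y x = components QA c (chart_inv c x) (hlift P H (chart_inv c x) (Y (proj P (chart_inv c x))))"

text \<open>The horizontal lift solves the linear equations \<open>T\<pi> u = Y\<close> and \<open>\<omega> u = 0\<close>.\<close>

lemma lift_rep_smooth:
  assumes c: "c \<in> QA" "q \<in> chart_dom c" and U: "open U" "proj P q \<in> U" and Y: "smooth_vector_field_on U MA Y"
  obtains S where "open S" "chart_fun c q \<in> S" "S \<subseteq> img c" "C_inf_on S (lift_rep c Y)"
    "\<And>x. x \<in> S \<Longrightarrow> omega_rep c (x, lift_rep c Y x) = 0"
    "\<And>x. x \<in> S \<Longrightarrow> proj P (chart_inv c x) \<in> U"
    "\<And>x. x \<in> S \<Longrightarrow> proj P (chart_inv c x) \<in> chart_dom (chart_at MA (proj P q))"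
    "\<And>x. x \<in> S \<Longrightarrow> frechet_derivative (rep c (chart_at MA (proj P q)) (proj P)) (at x) (lift_rep c Y x) =
       components MA (chart_at MA (proj P q)) (proj P (chart_inv c x)) (Y (proj P (chart_inv c x)))"
proof -
  define d where "d = chart_at MA (proj P q)"
  have d: "d \<in> MA" "proj P q \<in> chart_dom d" using chart_at_in[OF MA] by (auto simp: d_def)
  define pr where "pr = rep c d (proj P)"
  have UO: "atlas_open QA (proj P -` U)" by (rule atlas_open_vimage[OF QA MA smooth_proj MA_open[OF U(1)]])
  have smU: "smooth_map_on (proj P -` U) QA MA (proj P)" by (rule smooth_map_on_subset[OF smooth_proj]) simp
  define S where "S = rep_dom (proj P -` U) c d (proj P)"
  have S: "open S" "C_inf_on S pr" unfolding S_def pr_def using open_rep_dom[OF QA smU UO c(1) d(1)] by auto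
  have qS: "chart_fun c q \<in> S" unfolding S_def by (rule rep_domI[where f = "proj P", OF QA]) (use U c d in auto)
  have pS: "proj P (chart_inv c x) \<in> U" "chart_inv c x \<in> chart_dom c" "proj P (chart_inv c x) \<in> chart_dom d"
    "chart_fun c (chart_inv c x) = x" if "x \<in> S" for x
    using rep_domD[OF QA that[unfolded S_def] c(1)] by auto
  have S_img: "S \<subseteq> img c" by (auto simp: S_def rep_dom_def)
  define Y' where "Y' y = components MA d (chart_inv d y) (Y (chart_inv d y))" for y
  define V where "V = rep_dom U d (tangent_chart MA d) (\<lambda>p. (p, Y p))"
  have V: "open V" "C_inf_on V (rep d (tangent_chart MA d) (\<lambda>p. (p, Y p)))"
    unfolding V_def using open_rep_dom[OF MA Y[unfolded smooth_vector_field_on_def] MA_open[OF U(1)] d(1) in_tangent_atlas[OF MA d(1)]] by auto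
  have Y': "C_inf_on V Y'"
    using C_inf_on_snd[OF V] by (simp add: rep_def chart_fun_tangent_chart Y'_def[abs_def])
  have prV: "pr x \<in> V" if "x \<in> S" for x
    using pS[OF that] by (auto simp: pr_def rep_def V_def rep_dom_def)
  have Ypr: "C_inf_on S (\<lambda>x. Y' (pr x))"
    by (rule C_inf_on_compose[OF S(1) V(1) Y' S(2)]) (use prV in auto)
  have Ypr_eq: "Y' (pr x) = components MA d (proj P (chart_inv c x)) (Y (proj P (chart_inv c x)))" if "x \<in> S" for x
    using pS[OF that] d(1) by (simp add: Y'_def pr_def rep_def chart_inv_left[OF MA])
  have push: "frechet_derivative pr (at x) (components QA c (chart_inv c x) v) = components MA d (proj P (chart_inv c x)) (proj_push P (chart_inv c x, v))"
    if "x \<in> S" for x v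
    using proj_push_components[OF c(1) d(1) pS(2,3)[OF that], of v] pS(4)[OF that] by (simp add: pr_def)
  \<comment> \<open>The system is injective because a vector killed by both maps is vertical and
    horizontal, hence 0.\<close>
  interpret smooth_linear_equation S "\<lambda>x u. (frechet_derivative pr (at x) u, omega_rep c (x, u))"
  proof (rule smooth_linear_equation.intro)
    show "open S" by (rule S(1))
    fix x and u :: 'e assume x: "x \<in> S"
    have xi: "x \<in> img c" using x S_img by auto
    show "linear (\<lambda>u. (frechet_derivative pr (at x) u, omega_rep c (x, u)))"
      using C_inf_on_linear[OF S(2) x] omega_rep_linear[OF c(1) xi] by (auto simp: linear_iff)
  next
    fix x u assume x: "x \<in> S"
    assume 0: "(frechet_derivative pr (at x) u, omega_rep c (x, u)) = 0"
    define p v where "p = chart_inv c x" and "v = frechet_derivative (chart_fun (chart_at QA p) \<circ> chart_inv c) (at x) u"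
    have p: "p \<in> chart_dom c" "chart_fun c p = x" using pS[OF x] by (auto simp: p_def)
    have u: "u = components QA c p v" using components_inverse(2)[OF QA c(1) p(1), of u] p(2) by (simp add: v_def)
    have "omega P H (p, v) = 0" using 0 omega_rep_eq[OF c(1) p(1), of v] by (simp add: u p zero_prod_def)
    moreover have "components MA d (proj P p) (proj_push P (p, v)) = components MA d (proj P p) 0"
      using push[OF x, of v] 0 linear_0[OF linear_components[OF MA d(1) pS(3)[OF x]]] by (simp add: u zero_prod_def p_def)
    then have "proj_push P (p, v) = 0" using components_inject[OF MA d(1) pS(3)[OF x]] by (simp add: p_def)
    ultimately have "v = 0" using horizontal_vertical omega_horizontal by blast
    then show "u = 0" using u linear_0[OF linear_components[OF QA c(1) p(1)]] by simp
  next
    fix u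
    show "C_inf_on S (\<lambda>x. (frechet_derivative pr (at x) u, omega_rep c (x, u)))"
      by (intro C_inf_on_Pair[OF S(1)] C_inf_on_frechet_derivative[OF S(2)] C_inf_on_compose[OF S(1) open_img[OF c(1)] omega_rep_smooth[OF c(1)]]
        C_inf_on_ident C_inf_on_const S(1)) (use S_img in auto)
  qed
  have sol: "(frechet_derivative pr (at x) (lift_rep c Y x), omega_rep c (x, lift_rep c Y x)) = (Y' (pr x), 0)" if x: "x \<in> S" for x
  proof -
    have "omega_rep c (x, lift_rep c Y x) = omega P H (chart_inv c x, hlift P H (chart_inv c x) (Y (proj P (chart_inv c x))))"
      using omega_rep_eq[OF c(1) pS(2)[OF x]] pS(4)[OF x] by (simp add: lift_rep_def)
    also have "\<dots> = 0" using omega_horizontal hlift(1) by blast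
    finally show ?thesis
      using push[OF x] Ypr_eq[OF x] hlift(2) by (simp add: lift_rep_def)
  qed
  have "C_inf_on S (lift_rep c Y)"
    by (rule solution_C_inf[OF C_inf_on_Pair[OF S(1) Ypr C_inf_on_const[OF S(1)]] sol])
  then show thesis
    using that[OF S(1) qS S_img] sol pS Ypr_eq by (simp add: d_def pr_def)
qed

end

section \<open>Infinitesimal invariance and the tensor B\<close>

context bundle_setup
begin

definition lag_rep :: "('q, 'e) chart \<Rightarrow> ('q \<times> 'e \<Rightarrow> real) \<Rightarrow> 'e \<times> 'e \<Rightarrow> real" where
  "lag_rep c L z = L (chart_inv (tangent_chart QA c) z)"

lemma lag_rep_smooth:
  assumes "smooth_map_on UNIV (tangent_atlas QA) std_atlas L" "c \<in> QA"
  shows "C_inf_on (img c \<times> UNIV) (lag_rep c L)"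
  unfolding lag_rep_def[abs_def] by (rule smooth_on_tangent_C_inf[OF QA assms])

lemma lag_rep_eq: "c \<in> QA \<Longrightarrow> q \<in> chart_dom c \<Longrightarrow> lag_rep c L (chart_fun c q, components QA c q v) = L (q, v)"
  by (simp add: lag_rep_def chart_inv_tangent_chart_components[OF QA])

text \<open>Invariance written with the action in coordinates, so that the group element becomes a
  variable \<open>y\<close> in which the identity can be differentiated.\<close>

lemma lag_rep_invariant:
  assumes inv: "invariant_lagrangian P L" and c: "c \<in> QA" and xy: "(x, y) \<in> act_rep_dom c"
  shows "lag_rep c L (act_rep c (x, y), frechet_derivative (act_rep c) (at (x, y)) (w, 0)) = lag_rep c L (x, w)"
proof -
  obtain q g where q: "q \<in> chart_dom c" "g \<in> chart_dom ck" "act P q g \<in> chart_dom c" "x = chart_fun c q" "y = chart_fun ck g"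
    by (rule act_rep_domD[OF xy])
  define v where "v = frechet_derivative (chart_fun (chart_at QA q) \<circ> chart_inv c) (at (chart_fun c q)) w"
  have w: "w = components QA c q v" unfolding v_def by (rule components_inverse(2)[OF QA c q(1), symmetric])
  have x: "x \<in> img c" using q by auto
  have d1: "(act_rep c has_derivative frechet_derivative (act_rep c) (at (x, y))) (at (x, y))"
    by (rule C_inf_on_has_derivative[OF act_rep_smooth(2)[OF c] xy])
  have d2: "((\<lambda>x. act_rep c (x, y)) has_derivative (\<lambda>w. frechet_derivative (act_rep c) (at (x, y)) (w, 0))) (at x)"
    by (rule has_derivative_compose[OF has_derivative_Pair[OF has_derivative_ident has_derivative_const]]) (use d1 in simp)
  have "(rep c c (\<lambda>q. act P q g) has_derivative (\<lambda>w. frechet_derivative (act_rep c) (at (x, y)) (w, 0))) (at x)"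
    by (rule has_derivative_transform_within_open[OF d2 open_chart_image[OF QA c] x])
      (use c q act_rep_eq[OF c _ q(2)] in \<open>auto simp: rep_def chart_inv_left[OF QA]\<close>)
  then have D: "frechet_derivative (rep c c (\<lambda>q. act P q g)) (at x) w = frechet_derivative (act_rep c) (at (x, y)) (w, 0)"
    by (metis frechet_derivative_at)
  let ?Z = "tangent_map QA QA (\<lambda>q. act P q g) (q, v)"
  have Z: "fst ?Z = act P q g" by (simp add: tangent_map_def)
  have "components QA c (act P q g) (snd ?Z) = frechet_derivative (act_rep c) (at (x, y)) (w, 0)"
    using tangent_map_components[OF QA QA smooth_right_translation atlas_open_UNIV[OF QA] c c UNIV_I q(1,3), of v] D w q(4)
    by simp
  then have "lag_rep c L (act_rep c (x, y), frechet_derivative (act_rep c) (at (x, y)) (w, 0)) = L (act P q g, snd ?Z)"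
    using lag_rep_eq[OF c q(3), of L "snd ?Z"] act_rep_eq[OF c q(1,2)] q(4,5) by simp
  also have "(act P q g, snd ?Z) = ?Z" using Z by (metis prod.collapse)
  also have "L ?Z = L (q, v)" using inv by (simp add: invariant_lagrangian_def)
  also have "\<dots> = lag_rep c L (x, w)" using lag_rep_eq[OF c q(1)] by (simp add: q(4) w)
  finally show ?thesis .
qed

text \<open>
  Differentiating the invariance identity along the group uses that the mixed derivatives of the action
  commute: the velocity of \<open>(R\<^sub>g)\<^sub>* w\<close> is the derivative of the fundamental field along \<open>w\<close>.
\<close>

lemma infinitesimal_invariance:
  assumes L: "smooth_map_on UNIV (tangent_atlas QA) std_atlas L" "invariant_lagrangian P L" and c: "c \<in> QA" and x: "x \<in> img c"
  shows "frechet_derivative (lag_rep c L) (at (x, w)) (fund_rep c b x, frechet_derivative (fund_rep c b) (at x) w) = 0"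
proof -
  define m where "m = act_rep c"
  define y0 where "y0 = chart_fun ck \<e>"
  note m = act_rep_smooth[OF c, folded m_def]
  have xy: "(x, y0) \<in> act_rep_dom c" using act_rep_one(1)[OF c x] by (simp add: y0_def)
  define m2 where "m2 u z = frechet_derivative m (at z) u" for u z
  have m2: "C_inf_on (act_rep_dom c) (m2 u)" for u
    unfolding m2_def[abs_def] by (rule C_inf_on_frechet_derivative[OF m(2)])
  have py: "((\<lambda>y. (x, y)) has_derivative (\<lambda>b. (0, b))) (at y0)"
    by (rule has_derivative_Pair[OF has_derivative_const has_derivative_ident])
  have px: "((\<lambda>x. (x, y0)) has_derivative (\<lambda>w. (w, 0))) (at x)"
    by (rule has_derivative_Pair[OF has_derivative_ident has_derivative_const])
  have d1: "((\<lambda>y. m (x, y)) has_derivative (\<lambda>b. m2 (0, b) (x, y0))) (at y0)"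
    using has_derivative_compose[OF py C_inf_on_has_derivative[OF m(2) xy]] by (simp add: m2_def)
  have d2: "((\<lambda>y. m2 (w, 0) (x, y)) has_derivative (\<lambda>b. frechet_derivative (m2 (w, 0)) (at (x, y0)) (0, b))) (at y0)"
    by (rule has_derivative_compose[OF py C_inf_on_has_derivative[OF m2 xy]])
  have "((\<lambda>x. m2 (0, b) (x, y0)) has_derivative (\<lambda>w. frechet_derivative (m2 (0, b)) (at (x, y0)) (w, 0))) (at x)"
    by (rule has_derivative_compose[OF px C_inf_on_has_derivative[OF m2 xy]])
  then have "(fund_rep c b has_derivative (\<lambda>w. frechet_derivative (m2 (0, b)) (at (x, y0)) (w, 0))) (at x)"
    by (simp add: fund_rep_def[abs_def] m2_def[abs_def] m_def y0_def)
  then have DF: "frechet_derivative (fund_rep c b) (at x) w = frechet_derivative (m2 (0, b)) (at (x, y0)) (w, 0)"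
    by (metis frechet_derivative_at)
  have sym: "frechet_derivative (m2 (w, 0)) (at (x, y0)) (0, b) = frechet_derivative (m2 (0, b)) (at (x, y0)) (w, 0)"
    unfolding m2_def[abs_def] by (rule symmetric_second_derivative[OF m xy])
  \<comment> \<open>Acting by the unit is the identity, so the derivative in the point variable is
    the identity there and the curve of transported vectors starts at \<open>w\<close>.\<close>
  have one: "m2 (w, 0) (x, y0) = w"
  proof -
    have "((\<lambda>x. m (x, y0)) has_derivative (\<lambda>w. m2 (w, 0) (x, y0))) (at x)"
      using has_derivative_compose[OF px C_inf_on_has_derivative[OF m(2) xy]] by (simp add: m2_def)
    from has_derivative_at_eq[OF this has_derivative_ident open_chart_image[OF QA c] x]
    have "(\<lambda>w. m2 (w, 0) (x, y0)) = (\<lambda>w. w)" using act_rep_one(2)[OF c] by (simp add: m_def y0_def)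
    then show ?thesis by metis
  qed
  have mx: "m (x, y0) = x" using act_rep_one(2)[OF c x] by (simp add: m_def y0_def)
  have xw: "(x, w) \<in> img c \<times> UNIV" using x by auto
  have "((\<lambda>y. lag_rep c L (m (x, y), m2 (w, 0) (x, y))) has_derivative
     (\<lambda>b. frechet_derivative (lag_rep c L) (at (x, w)) (m2 (0, b) (x, y0), frechet_derivative (m2 (w, 0)) (at (x, y0)) (0, b)))) (at y0)"
    by (rule has_derivative_compose[OF has_derivative_Pair[OF d1 d2]])
      (use C_inf_on_has_derivative[OF lag_rep_smooth[OF L(1) c] xw] in \<open>simp add: mx one\<close>)
  moreover have "((\<lambda>y. lag_rep c L (x, w)) has_derivative (\<lambda>b. 0)) (at y0)" by simp
  moreover have "open ((\<lambda>y. (x, y)) -` act_rep_dom c)"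
    by (rule open_vimage[OF m(1)]) (intro continuous_intros)
  moreover have "y0 \<in> (\<lambda>y. (x, y)) -` act_rep_dom c" using xy by simp
  ultimately have "(\<lambda>b. frechet_derivative (lag_rep c L) (at (x, w)) (m2 (0, b) (x, y0), frechet_derivative (m2 (w, 0)) (at (x, y0)) (0, b))) = (\<lambda>b. 0)"
    by (rule has_derivative_at_eq) (use lag_rep_invariant[OF L(2) c] in \<open>auto simp: m_def m2_def\<close>)
  then have "frechet_derivative (lag_rep c L) (at (x, w)) (m2 (0, b) (x, y0), frechet_derivative (m2 (w, 0)) (at (x, y0)) (0, b)) = 0"
    by metis
  then show ?thesis
    unfolding DF sym by (simp add: fund_rep_def m2_def m_def y0_def)
qed

lemma FL_eq:
  assumes L: "smooth_map_on UNIV (tangent_atlas QA) std_atlas L" and c: "c \<in> QA" "q \<in> chart_dom c"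
  shows "blinfun_apply (FL P L (q, v)) b =
    frechet_derivative (lag_rep c L) (at (chart_fun c q, components QA c q v)) (0, fund_rep c b (chart_fun c q))"
proof -
  define x w where "x = chart_fun c q" and "w = components QA c q v"
  have x: "x \<in> img c" using c by (auto simp: x_def)
  define f where "f b = frechet_derivative (lag_rep c L) (at (x, w)) (0, fund_rep c b x)" for b
  have xw: "(x, w) \<in> img c \<times> UNIV" using x by auto
  note dL = C_inf_on_has_derivative[OF lag_rep_smooth[OF L c(1)] xw]
  have lin: "linear (frechet_derivative (lag_rep c L) (at (x, w)))" by (rule has_derivative_linear[OF dL])
  have "deriv (\<lambda>t. L (q, v + t *\<^sub>R fundamental P b q)) 0 = f b" for b
  proof (rule DERIV_imp_deriv)
    have Leq: "L (q, v + t *\<^sub>R fundamental P b q) = lag_rep c L (x, w + t *\<^sub>R fund_rep c b x)" for t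
      using lag_rep_eq[OF c, of L "v + t *\<^sub>R fundamental P b q"] linear_components[OF QA c]
      by (simp add: linear_add linear_scale fundamental_components[OF c] x_def w_def)
    have "((\<lambda>t. (x, w + t *\<^sub>R fund_rep c b x)) has_vector_derivative (0, fund_rep c b x)) (at 0)"
      by (auto intro!: derivative_eq_intros has_vector_derivative_Pair)
    then have "((\<lambda>t. lag_rep c L (x, w + t *\<^sub>R fund_rep c b x)) has_vector_derivative f b) (at 0)"
      unfolding f_def by (rule has_vector_derivative_compose_within) (use dL in auto)
    then show "((\<lambda>t. L (q, v + t *\<^sub>R fundamental P b q)) has_real_derivative f b) (at 0)"
      by (simp add: Leq has_real_derivative_iff_has_vector_derivative)
  qed
  \<comment> \<open>\<open>Blinfun\<close> is inverted by \<open>blinfun_apply\<close> only on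
    bounded linear maps, so linearity in \<open>b\<close> has to be checked before the definition of
    \<open>FL\<close> can be evaluated.\<close>
  moreover have "linear f"
    unfolding f_def[abs_def]
  proof -
    have "linear (\<lambda>b. (0 :: 'e, fund_rep c b x))"
      by (rule linearI) (simp_all add: linear_add[OF fund_rep_linear[OF c(1) x]] linear_scale[OF fund_rep_linear[OF c(1) x]])
    from linear_compose[OF this lin]
    show "linear (\<lambda>b. frechet_derivative (lag_rep c L) (at (x, w)) (0, fund_rep c b x))" by (simp add: o_def)
  qed
  ultimately show ?thesis
    using bounded_linear_Blinfun_apply[OF linear_imp_bounded_linear[of f]]
    by (simp add: FL_def) (simp add: f_def x_def w_def)
qed

text \<open>The field with constant components in a chart. It supplies an extension of
  \<open>X\<close>, which the identity between \<open>HL\<close> and \<open>FL\<close> needs and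
  without which the description in \<open>B_tensor\<close> would be vacuous.\<close>

lemma constant_base_field:
  obtains U Y where "open U" "proj P q \<in> U" "smooth_vector_field_on U MA Y" "Y (proj P q) = X"
proof -
  define d where "d = chart_at MA (proj P q)"
  have d: "d \<in> MA" "proj P q \<in> chart_dom d" using chart_at_in[OF MA] by (auto simp: d_def)
  define Y where "Y m = frechet_derivative (chart_fun (chart_at MA m) \<circ> chart_inv d) (at (chart_fun d m)) X" for m
  have "open (chart_dom d)"
    using principal_bundle d(1) unfolding principal_bundle_def smooth_manifold_def by blast
  moreover have "smooth_vector_field_on (chart_dom d) MA Y"
    unfolding smooth_vector_field_on_def
  proof (rule smooth_map_onI[OF MA smooth_atlas_tangent[OF MA]])
    fix p assume "p \<in> chart_dom d"
    then show "\<exists>c\<in>MA. \<exists>D\<in>tangent_atlas MA. p \<in> chart_dom c \<and> (\<exists>W g. open W \<and> chart_fun c p \<in> W \<and> C_inf_on W g \<and>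
        (\<forall>x\<in>chart_dom d. x \<in> chart_dom c \<longrightarrow> chart_fun c x \<in> W \<longrightarrow> (x, Y x) \<in> chart_dom D \<and> chart_fun D (x, Y x) = g (chart_fun c x)))"
      using d(1) in_tangent_atlas[OF MA d(1)]
      by (intro bexI[of _ d] bexI[of _ "tangent_chart MA d"] conjI exI[of _ UNIV] exI[of _ "\<lambda>x. (x, X)"])
        (auto simp: chart_fun_tangent_chart Y_def components_inverse(2)[OF MA] intro!: C_inf_on_Pair C_inf_on_ident C_inf_on_const)
  qed
  moreover have "Y (proj P q) = X"
    unfolding Y_def using transition_self[OF MA d] by (simp add: d_def)
  ultimately show thesis using that d(2) by blast
qed

end

section \<open>The bracket of a horizontal lift with a fundamental field\<close>

context horizontal_setup
begin

text \<open>The components of \<open>\<kappa> (T\<^sub>v b~)\<close>, along which \<open>\<omega>\<close> has derivative \<open>\<B>(q)(X, b)\<close>.\<close>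

definition fund_variation :: "('q, 'e) chart \<Rightarrow> 'h \<Rightarrow> 'e \<Rightarrow> 'e \<Rightarrow> 'e \<times> 'e" where
  "fund_variation c b x w = (fund_rep c b x, frechet_derivative (fund_rep c b) (at x) w)"

text \<open>The second claim is the decisive one: its right side no longer contains
  \<open>Y\<close>. Since \<omega> vanishes on the lift, the derivative of the lift can be traded
  for a derivative of \<omega> at \<open>v\<close>. The third claim says that the bracket is
  vertical.\<close>

lemma bracket_properties:
  assumes v: "v \<in> H q" and U: "open U" "proj P q \<in> U" and Y: "smooth_vector_field_on U MA Y" "Y (proj P q) = proj_push P (q, v)"
  defines "c \<equiv> chart_at QA q" and "br \<equiv> \<lambda>b. lie_bracket QA (\<lambda>p. hlift P H p (Y (proj P p))) (fundamental P b) q"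
  shows "br b = frechet_derivative (fund_rep c b) (at (chart_fun c q)) v - frechet_derivative (lift_rep c Y) (at (chart_fun c q)) (fund_rep c b (chart_fun c q))"
    and "omega P H (q, br b) = frechet_derivative (omega_rep c) (at (chart_fun c q, v)) (fund_variation c b (chart_fun c q) v)"
    and "fundamental P (omega P H (q, br b)) q = br b"
proof -
  have c: "c \<in> QA" "q \<in> chart_dom c" using chart_at_in[OF QA] by (auto simp: c_def)
  define u where "u = chart_fun c q"
  have u: "u \<in> img c" using c by (auto simp: u_def)
  have comp: "components QA c q w = w" for w by (simp add: c_def components_chart_at[OF QA])
  obtain S where S: "open S" "u \<in> S" "S \<subseteq> img c" "C_inf_on S (lift_rep c Y)"
    and l0: "\<And>x. x \<in> S \<Longrightarrow> omega_rep c (x, lift_rep c Y x) = 0"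
    and lU: "\<And>x. x \<in> S \<Longrightarrow> proj P (chart_inv c x) \<in> U"
      "\<And>x. x \<in> S \<Longrightarrow> proj P (chart_inv c x) \<in> chart_dom (chart_at MA (proj P q))"
    and lY: "\<And>x. x \<in> S \<Longrightarrow> frechet_derivative (rep c (chart_at MA (proj P q)) (proj P)) (at x) (lift_rep c Y x) =
       components MA (chart_at MA (proj P q)) (proj P (chart_inv c x)) (Y (proj P (chart_inv c x)))"
    by (rule lift_rep_smooth[OF c U Y(1), folded u_def], rule that)
  have lu: "lift_rep c Y u = v"
    using c hlift_proj_push[OF v] by (simp add: lift_rep_def u_def chart_inv_left[OF QA] comp Y(2))
  define F where "F = fund_rep c b"
  define l where "l = lift_rep c Y"
  note dl = C_inf_on_has_derivative[OF S(4,2), folded l_def]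
  note dF = C_inf_on_has_derivative[OF fund_rep_smooth[OF c(1), of b] u, folded F_def]
  show br: "br b = frechet_derivative (fund_rep c b) (at (chart_fun c q)) v - frechet_derivative (lift_rep c Y) (at (chart_fun c q)) (fund_rep c b (chart_fun c q))"
  proof -
    have fl: "field_in_chart QA c (\<lambda>p. hlift P H p (Y (proj P p))) = l"
      by (rule ext) (simp add: field_in_chart_def chart_fun_tangent_chart lift_rep_def l_def)
    have fF: "field_in_chart QA c (fundamental P b) x = F x" if "x \<in> img c" for x
      using that c(1) by (auto simp: field_in_chart_def chart_fun_tangent_chart fundamental_components F_def chart_inv_left[OF QA])
    have dfF: "frechet_derivative (field_in_chart QA c (fundamental P b)) (at u) = frechet_derivative F (at u)"
      by (rule frechet_derivative_cong_open[OF open_chart_image[OF QA c(1)] u fF])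
    let ?Y = "\<lambda>p. hlift P H p (Y (proj P p))"
    have "br b = frechet_derivative (field_in_chart QA c (fundamental P b)) (at u) (field_in_chart QA c ?Y u) -
        frechet_derivative (field_in_chart QA c ?Y) (at u) (field_in_chart QA c (fundamental P b) u)"
      unfolding br_def lie_bracket_def Let_def c_def u_def ..
    also have "\<dots> = frechet_derivative F (at u) v - frechet_derivative l (at u) (F u)"
      unfolding dfF fl fF[OF u] unfolding l_def lu ..
    finally show ?thesis
      unfolding F_def l_def u_def .
  qed
  have br': "br b = frechet_derivative F (at u) v - frechet_derivative l (at u) (F u)"
    using br by (simp add: F_def l_def u_def)
  have uv: "(u, v) \<in> img c \<times> UNIV" using u by auto
  note dW = C_inf_on_has_derivative[OF omega_rep_smooth[OF c(1)] uv]
  \<comment> \<open>The identity \<open>omega_rep c (x, l x) = 0\<close>, differentiated in the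
    direction of the fundamental field.\<close>
  have W1: "frechet_derivative (omega_rep c) (at (u, v)) (F u, frechet_derivative l (at u) (F u)) = 0"
  proof -
    have "((\<lambda>x. omega_rep c (x, l x)) has_derivative (\<lambda>y. frechet_derivative (omega_rep c) (at (u, v)) (y, frechet_derivative l (at u) y))) (at u)"
      by (rule has_derivative_compose[OF has_derivative_Pair[OF has_derivative_ident dl]]) (use dW lu in \<open>simp add: l_def\<close>)
    from has_derivative_at_eq[OF this has_derivative_const S(1,2)]
    have "(\<lambda>y. frechet_derivative (omega_rep c) (at (u, v)) (y, frechet_derivative l (at u) y)) = (\<lambda>_. 0)"
      using l0 by (simp add: l_def)
    from fun_cong[OF this, of "F u"] show ?thesis by simp
  qed
  have "omega P H (q, br b) = omega_rep c (u, br b)"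
    using omega_rep_eq[OF c, of "br b"] by (simp add: comp u_def)
  also have "\<dots> = frechet_derivative (omega_rep c) (at (u, v)) (0, br b)"
    by (rule omega_rep_derivative_snd[OF c(1) u, symmetric])
  also have "\<dots> = frechet_derivative (omega_rep c) (at (u, v)) (F u, frechet_derivative l (at u) (F u) + br b)"
    using frechet_derivative_Pair_add[OF omega_rep_smooth[OF c(1)] uv, of "F u" "frechet_derivative l (at u) (F u)" "br b"] W1 by simp
  also have "frechet_derivative l (at u) (F u) + br b = frechet_derivative F (at u) v" by (simp add: br')
  finally show om: "omega P H (q, br b) = frechet_derivative (omega_rep c) (at (chart_fun c q, v)) (fund_variation c b (chart_fun c q) v)"
    by (simp add: fund_variation_def F_def u_def)
  have "proj_push P (q, br b) = 0"
  proof -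
    define d where "d = chart_at MA (proj P q)"
    have d: "d \<in> MA" "proj P q \<in> chart_dom d" using chart_at_in[OF MA] by (auto simp: d_def)
    define pr where "pr = rep c d (proj P)"
    define R where "R = rep_dom UNIV c d (proj P)"
    have R: "open R" "C_inf_on R pr"
      unfolding R_def pr_def using open_rep_dom[OF QA smooth_proj atlas_open_UNIV[OF QA] c(1) d(1)] by auto
    have S_R: "S \<subseteq> R"
      using S(3) lU(2) c(1) unfolding R_def rep_dom_def d_def by (fastforce simp: chart_inv_left[OF QA])
    have push: "frechet_derivative pr (at u) w = components MA d (proj P q) (proj_push P (q, w))" for w
      using proj_push_components[OF c(1) d(1) c(2) d(2), of w] by (simp add: pr_def u_def comp)
    have prF: "frechet_derivative pr (at x) (F x) = 0" if "x \<in> S" for x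
    proof -
      obtain p where p: "p \<in> chart_dom c" "x = chart_fun c p" using \<open>x \<in> S\<close> S(3) by auto
      then have pd: "proj P p \<in> chart_dom d" using lU(2)[OF that] c(1) by (simp add: d_def chart_inv_left[OF QA])
      show ?thesis
        using proj_push_components[OF c(1) d(1) p(1) pd, of "fundamental P b p"] linear_0[OF linear_components[OF MA d(1) pd]]
        by (simp add: proj_push_fundamental fundamental_components[OF c(1) p(1)] pr_def F_def p(2))
    qed
    have Dlin: "linear (frechet_derivative pr (at x))" if "x \<in> S" for x
      using C_inf_on_linear[OF R(2)] that S_R by blast
    have DC: "C_inf_on S (\<lambda>x. frechet_derivative pr (at x) w)" for w
      by (rule C_inf_on_subset[OF C_inf_on_frechet_derivative[OF R(2)] S_R])
    \<comment> \<open>The fundamental field projects to 0 throughout \<open>S\<close>; this is that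
      identity differentiated in the direction \<open>v\<close>.\<close>
    have 1: "frechet_derivative (\<lambda>x. frechet_derivative pr (at x) (F u)) (at u) v + frechet_derivative pr (at u) (frechet_derivative F (at u) v) = 0"
    proof -
      note h = has_derivative_linear_family[OF S(1,2) Dlin DC dF]
      from fun_cong[OF has_derivative_at_eq[OF h has_derivative_const S(1,2) prF], of v] show ?thesis by simp
    qed
    \<comment> \<open>The lift projects to \<open>Y\<close>. Along the orbit of \<open>q\<close> the
      base point stays fixed, so the projected value is constant and its derivative in the direction
      of the fundamental field is 0.\<close>
    have 2: "frechet_derivative (\<lambda>x. frechet_derivative pr (at x) v) (at u) (F u) + frechet_derivative pr (at u) (frechet_derivative l (at u) (F u)) = 0"
    proof -
      note h = has_derivative_linear_family[OF S(1,2) Dlin DC dl]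
      note x = lg.lie_exp_curve[of b]
      define \<sigma> where "\<sigma> t = act P q (lie_exp (struct_group P) (t *\<^sub>R b))" for t
      have \<sigma>0: "\<sigma> 0 = q" using x(2) unfolding \<sigma>_def by simp
      have vel: "has_velocity QA UNIV \<sigma> 0 (fundamental P b q)"
        unfolding \<sigma>_def[abs_def] by (rule fundamental_tangent_map(1))
      note hv = has_velocityD[OF vel c(1), unfolded \<sigma>0, OF c(2)]
      have der: "((\<lambda>t. chart_fun c (\<sigma> t)) has_vector_derivative F u) (at 0)"
        using hv(2) by (simp add: fundamental_components[OF c] F_def u_def)
      have "((\<lambda>t. frechet_derivative pr (at (chart_fun c (\<sigma> t))) (l (chart_fun c (\<sigma> t)))) has_vector_derivative
         (frechet_derivative (\<lambda>x. frechet_derivative pr (at x) (l u)) (at u) (F u) + frechet_derivative pr (at u) (frechet_derivative l (at u) (F u)))) (at 0)"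
        by (rule has_vector_derivative_compose_within[OF der]) (use h \<sigma>0 in \<open>auto simp: u_def\<close>)
      moreover have "((\<lambda>t. frechet_derivative pr (at (chart_fun c (\<sigma> t))) (l (chart_fun c (\<sigma> t)))) has_vector_derivative 0) (at 0)"
      proof -
        have tend: "((\<lambda>t. chart_fun c (\<sigma> t)) \<longlongrightarrow> u) (at 0)"
          using has_vector_derivative_continuous[OF der] \<sigma>0 by (simp add: continuous_within u_def)
        have "eventually (\<lambda>t. chart_fun c (\<sigma> t) \<in> S) (at 0)" by (rule topological_tendstoD[OF tend S(1,2)])
        with hv(1) have ev: "eventually (\<lambda>t. frechet_derivative pr (at (chart_fun c (\<sigma> t))) (l (chart_fun c (\<sigma> t))) = components MA d (proj P q) (Y (proj P q))) (at 0)"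
        proof eventually_elim
          case (elim t)
          then show ?case using lY[OF elim(2)] c(1) by (simp add: pr_def d_def l_def chart_inv_left[OF QA] \<sigma>_def)
        qed
        have at0: "frechet_derivative pr (at (chart_fun c (\<sigma> 0))) (l (chart_fun c (\<sigma> 0))) = components MA d (proj P q) (Y (proj P q))"
          using lY[OF S(2)] c by (simp add: pr_def d_def l_def chart_inv_left[OF QA] \<sigma>0 u_def)
        show ?thesis
          by (rule has_vector_derivative_compose_within[where x = "\<lambda>t. t" and w = 1 and g' = "\<lambda>_. 0" and g = "\<lambda>_. components MA d (proj P q) (Y (proj P q))", OF has_vector_derivative_id])
            (use ev at0 in auto)
      qed
      ultimately show ?thesis
        using vector_derivative_unique_at lu by (fastforce simp: l_def)
    qed
    \<comment> \<open>Subtracting the two identities leaves the second derivative of the projection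
      with its arguments in both orders; these terms cancel by symmetry.\<close>
    have "frechet_derivative pr (at u) (br b) = 0"
      using 1 2 symmetric_second_derivative[OF R subsetD[OF S_R S(2)], of "F u" v] linear_diff[OF Dlin[OF S(2)]]
      by (simp add: br' add_eq_0_iff)
    then show ?thesis
      using push[of "br b"] components_inject[OF MA d] linear_0[OF linear_components[OF MA d]] by metis
  qed
  then have "br b \<in> vertical P q" by (simp add: vertical_def)
  then obtain a where "br b = fundamental P a q" using vertical_eq by auto
  then show "fundamental P (omega P H (q, br b)) q = br b" by (simp add: omega_fundamental)
qed

text \<open>The description is well-defined because, by the second claim of
  \<open>bracket_properties\<close>, every extension gives the same value.\<close>

lemma B_tensor_bracket:
  assumes v: "v \<in> H q" and U: "open U" "proj P q \<in> U" and Y: "smooth_vector_field_on U MA Y" "Y (proj P q) = proj_push P (q, v)"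
  shows "B_tensor P H q (proj_push P (q, v)) b = omega P H (q, lie_bracket QA (\<lambda>p. hlift P H p (Y (proj P p))) (fundamental P b) q)"
  unfolding B_tensor_def
proof (rule the_equality)
  show "\<forall>U' Y'. open U' \<and> proj P q \<in> U' \<and> smooth_vector_field_on U' MA Y' \<and> Y' (proj P q) = proj_push P (q, v) \<longrightarrow>
      omega P H (q, lie_bracket QA (\<lambda>p. hlift P H p (Y (proj P p))) (fundamental P b) q) =
      omega P H (q, lie_bracket QA (\<lambda>p. hlift P H p (Y' (proj P p))) (fundamental P b) q)"
    using bracket_properties(2)[OF v U Y] bracket_properties(2)[OF v] by auto
qed (use U Y in blast)

lemma B_tensor_eq:
  assumes "v \<in> H q"
  shows "B_tensor P H q (proj_push P (q, v)) b = frechet_derivative (omega_rep (chart_at QA q))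
    (at (chart_fun (chart_at QA q) q, v)) (fund_variation (chart_at QA q) b (chart_fun (chart_at QA q) q) v)"
proof -
  obtain U Y where UY: "open U" "proj P q \<in> U" "smooth_vector_field_on U MA Y" "Y (proj P q) = proj_push P (q, v)"
    by (rule constant_base_field)
  show ?thesis using B_tensor_bracket[OF assms UY] bracket_properties(2)[OF assms UY] by simp
qed

theorem HL_FL_B_tensor:
  assumes L: "smooth_map_on UNIV (tangent_atlas QA) std_atlas L" "invariant_lagrangian P L" and v: "v \<in> H q"
  shows "blinfun_apply (HL P H L (q, v)) b + blinfun_apply (FL P L (q, v)) (B_tensor P H q (proj_push P (q, v)) b) = 0"
proof -
  obtain U Y where UY: "open U" "proj P q \<in> U" "smooth_vector_field_on U MA Y" "Y (proj P q) = proj_push P (q, v)"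
    by (rule constant_base_field)
  define c where "c = chart_at QA q"
  have c: "c \<in> QA" "q \<in> chart_dom c" using chart_at_in[OF QA] by (auto simp: c_def)
  define u where "u = chart_fun c q"
  have u: "u \<in> img c" using c by (auto simp: u_def)
  have comp: "components QA c q w = w" for w by (simp add: c_def components_chart_at[OF QA])
  obtain S where S: "open S" "u \<in> S" "S \<subseteq> img c" "C_inf_on S (lift_rep c Y)"
    by (rule lift_rep_smooth[OF c UY(1-3), folded u_def], rule that)
  define l where "l = lift_rep c Y"
  note dl = C_inf_on_has_derivative[OF S(4,2), folded l_def]
  have lu: "l u = v"
    using c hlift_proj_push[OF v] by (simp add: lift_rep_def u_def chart_inv_left[OF QA] comp UY(4) l_def)
  have uv: "(u, v) \<in> img c \<times> UNIV" using u by auto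
  note sL = lag_rep_smooth[OF L(1) c(1)]
  note dL = C_inf_on_has_derivative[OF sL uv]
  define f where "f b = frechet_derivative (lag_rep c L) (at (u, v)) (fund_rep c b u, frechet_derivative l (at u) (fund_rep c b u))" for b
  have "deriv (\<lambda>t. L (act P q (lie_exp (struct_group P) (t *\<^sub>R b)),
      hlift P H (act P q (lie_exp (struct_group P) (t *\<^sub>R b))) (proj_push P (q, v)))) 0 = f b" for b
  proof (rule DERIV_imp_deriv)
    define \<sigma> where "\<sigma> t = act P q (lie_exp (struct_group P) (t *\<^sub>R b))" for t
    have \<sigma>0: "\<sigma> 0 = q" using lg.lie_exp_curve(2)[of b] unfolding \<sigma>_def by simp
    have vel: "has_velocity QA UNIV \<sigma> 0 (fundamental P b q)"
      unfolding \<sigma>_def[abs_def] by (rule fundamental_tangent_map(1))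
    note hv = has_velocityD[OF vel c(1), unfolded \<sigma>0, OF c(2)]
    have der: "((\<lambda>t. chart_fun c (\<sigma> t)) has_vector_derivative fund_rep c b u) (at 0)"
      using hv(2) by (simp add: fundamental_components[OF c] u_def)
    have g: "((\<lambda>x. lag_rep c L (x, l x)) has_derivative (\<lambda>y. frechet_derivative (lag_rep c L) (at (u, v)) (y, frechet_derivative l (at u) y))) (at u)"
      by (rule has_derivative_compose[OF has_derivative_Pair[OF has_derivative_ident dl]]) (use dL lu in simp)
    \<comment> \<open>The base point does not move along the orbit, so lifting the fixed vector
      \<open>X\<close> agrees with lifting \<open>Y\<close>; thus \<open>HL\<close> becomes a
      derivative along the smooth section \<open>l\<close>.\<close>
    have eq: "L (\<sigma> t, hlift P H (\<sigma> t) (proj_push P (q, v))) = lag_rep c L (chart_fun c (\<sigma> t), l (chart_fun c (\<sigma> t)))"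
      if "\<sigma> t \<in> chart_dom c" for t
      using lag_rep_eq[OF c(1) that, of L "hlift P H (\<sigma> t) (proj_push P (q, v))"] that c(1) UY(4)
      by (simp add: l_def lift_rep_def chart_inv_left[OF QA]) (simp add: \<sigma>_def)
    have "((\<lambda>t. L (\<sigma> t, hlift P H (\<sigma> t) (proj_push P (q, v)))) has_vector_derivative f b) (at 0)"
      unfolding f_def
    proof (rule has_vector_derivative_compose_within[OF der])
      show "((\<lambda>x. lag_rep c L (x, l x)) has_derivative (\<lambda>y. frechet_derivative (lag_rep c L) (at (u, v)) (y, frechet_derivative l (at u) y))) (at (chart_fun c (\<sigma> 0)))"
        using g by (simp add: \<sigma>0 u_def)
      show "eventually (\<lambda>t. L (\<sigma> t, hlift P H (\<sigma> t) (proj_push P (q, v))) = lag_rep c L (chart_fun c (\<sigma> t), l (chart_fun c (\<sigma> t)))) (at 0)"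
        using hv(1) by eventually_elim (rule eq)
    qed (use eq \<sigma>0 c in auto)
    then show "((\<lambda>t. L (act P q (lie_exp (struct_group P) (t *\<^sub>R b)),
      hlift P H (act P q (lie_exp (struct_group P) (t *\<^sub>R b))) (proj_push P (q, v)))) has_real_derivative f b) (at 0)"
      by (simp add: \<sigma>_def has_real_derivative_iff_has_vector_derivative)
  qed
  moreover have "linear f"
  proof -
    have "linear (\<lambda>b. (fund_rep c b u, frechet_derivative l (at u) (fund_rep c b u)))"
      by (rule linearI) (simp_all add: linear_add[OF fund_rep_linear[OF c(1) u]] linear_scale[OF fund_rep_linear[OF c(1) u]]
          linear_add[OF has_derivative_linear[OF dl]] linear_scale[OF has_derivative_linear[OF dl]])
    from linear_compose[OF this has_derivative_linear[OF dL]] show ?thesis by (simp add: f_def[abs_def] o_def)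
  qed
  ultimately have HL: "blinfun_apply (HL P H L (q, v)) b = f b"
    using bounded_linear_Blinfun_apply[OF linear_imp_bounded_linear[of f]] by (simp add: HL_def Let_def)
  define z where "z = B_tensor P H q (proj_push P (q, v)) b"
  define br where "br = lie_bracket QA (\<lambda>p. hlift P H p (Y (proj P p))) (fundamental P b) q"
  have "z = omega P H (q, br)" unfolding z_def br_def by (rule B_tensor_bracket[OF v UY])
  then have "fundamental P z q = br" using bracket_properties(3)[OF v UY] by (simp add: br_def)
  then have "fund_rep c z u = br" using fundamental_components[OF c, of z] by (simp add: comp u_def)
  then have FL: "blinfun_apply (FL P L (q, v)) z = frechet_derivative (lag_rep c L) (at (u, v)) (0, br)"
    using FL_eq[OF L(1) c, of v z] by (simp add: comp u_def)
  \<comment> \<open>\<open>HL\<close> varies the fibre component by the derivative of the lift,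
    \<open>FL\<close> adds the bracket. Together they give the derivative of the fundamental field
    along \<open>v\<close>, the direction in which invariance makes \<open>dL\<close>
    vanish.\<close>
  have "f b + blinfun_apply (FL P L (q, v)) z = frechet_derivative (lag_rep c L) (at (u, v)) (fund_rep c b u, frechet_derivative l (at u) (fund_rep c b u) + br)"
    unfolding FL f_def by (rule frechet_derivative_Pair_add[OF sL uv, symmetric])
  also have "frechet_derivative l (at u) (fund_rep c b u) + br = frechet_derivative (fund_rep c b) (at u) v"
    using bracket_properties(1)[OF v UY, of b] by (simp add: br_def l_def c_def u_def)
  also have "frechet_derivative (lag_rep c L) (at (u, v)) (fund_rep c b u, \<dots>) = 0"
    by (rule infinitesimal_invariance[OF L c(1) u])
  finally show ?thesis by (simp add: HL z_def)
qed

end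

section \<open>Variations in charts\<close>

text \<open>The change of coordinates on the second tangent bundle. Its second-derivative term is
  symmetric in the two tangent directions, which is what makes the flip independent of the
  chart.\<close>

lemma tangent_transition_has_derivative:
  fixes A :: "('p, 'e::model_space) chart set"
  assumes A: "smooth_atlas A" and c: "c \<in> A" "d \<in> A" "p \<in> chart_dom c" "p \<in> chart_dom d"
  defines "T \<equiv> chart_fun d \<circ> chart_inv c" and "x \<equiv> chart_fun c p"
  shows "((chart_fun (tangent_chart A d) \<circ> chart_inv (tangent_chart A c)) has_derivative
    (\<lambda>(x', y'). (frechet_derivative T (at x) x', frechet_derivative (\<lambda>z. frechet_derivative T (at z) y) (at x) x' + frechet_derivative T (at x) y')))
    (at (x, y))"
proof -
  define S where "S = chart_fun c ` (chart_dom c \<inter> chart_dom d)"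
  have S: "open S" "C_inf_on S T" unfolding S_def T_def using open_overlap[OF A c(1,2)] C_inf_transition[OF A c(1,2)] by auto
  have x: "x \<in> S" using c by (auto simp: S_def x_def)
  have SU: "open (S \<times> (UNIV :: 'e set))" using S(1) by (intro open_Times) auto
  have xy: "(x, y) \<in> S \<times> UNIV" using x by simp
  have fst': "(fst has_derivative fst) (at (x, y))" "(snd has_derivative snd) (at (x, y))"
    using has_derivative_fst[OF has_derivative_ident] has_derivative_snd[OF has_derivative_ident] by auto
  have 1: "((\<lambda>z. T (fst z)) has_derivative (\<lambda>z. frechet_derivative T (at x) (fst z))) (at (x, y))"
    by (rule has_derivative_compose[OF fst'(1)]) (use C_inf_on_has_derivative[OF S(2) x] in simp)
  have fam: "C_inf_on (S \<times> UNIV) (\<lambda>z :: 'e \<times> 'e. frechet_derivative T (at (fst z)) w)" for w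
    using C_inf_on_compose[OF SU S(1) C_inf_on_frechet_derivative[OF S(2), of w] C_inf_on_fst[OF SU C_inf_on_ident[OF SU]]] by auto
  have 2: "((\<lambda>z. frechet_derivative T (at (fst z)) (snd z)) has_derivative
     (\<lambda>z. frechet_derivative (\<lambda>z. frechet_derivative T (at (fst z)) (snd (x, y))) (at (x, y)) z + frechet_derivative T (at (fst (x, y))) (snd z))) (at (x, y))"
    by (rule has_derivative_linear_family[OF SU xy _ fam fst'(2)]) (use C_inf_on_linear[OF S(2)] in auto)
  have 3: "((\<lambda>z. frechet_derivative T (at (fst z)) y) has_derivative (\<lambda>z. frechet_derivative (\<lambda>z. frechet_derivative T (at z) y) (at x) (fst z))) (at (x, y))"
    by (rule has_derivative_compose[OF fst'(1)]) (use C_inf_on_has_derivative[OF C_inf_on_frechet_derivative[OF S(2)] x] in simp)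
  have e: "frechet_derivative (\<lambda>z. frechet_derivative T (at (fst z)) y) (at (x, y)) z = frechet_derivative (\<lambda>z. frechet_derivative T (at z) y) (at x) (fst z)" for z
    using fun_cong[OF frechet_derivative_at[OF 3], of z] by simp
  have 4: "((\<lambda>z. frechet_derivative T (at (fst z)) (snd z)) has_derivative
     (\<lambda>z. frechet_derivative (\<lambda>z. frechet_derivative T (at z) y) (at x) (fst z) + frechet_derivative T (at x) (snd z))) (at (x, y))"
    using 2 by (simp only: e fst_conv snd_conv)
  have "((\<lambda>z. (T (fst z), frechet_derivative T (at (fst z)) (snd z))) has_derivative
    (\<lambda>(x', y'). (frechet_derivative T (at x) x', frechet_derivative (\<lambda>z. frechet_derivative T (at z) y) (at x) x' + frechet_derivative T (at x) y'))) (at (x, y))"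
    using has_derivative_Pair[OF 1 4] by (simp add: case_prod_beta')
  then show ?thesis
  proof (rule has_derivative_transform_within_open[OF _ SU xy])
    fix z :: "'e \<times> 'e" assume "z \<in> S \<times> UNIV"
    then show "(T (fst z), frechet_derivative T (at (fst z)) (snd z)) = (chart_fun (tangent_chart A d) \<circ> chart_inv (tangent_chart A c)) z"
      using tangent_transition[OF A c(1,2), of "fst z" "snd z"] by (auto simp: S_def T_def)
  qed
qed

text \<open>
  The first variation in an arbitrary chart. The flip is defined through the chosen chart; passing to
  another chart uses the symmetry of the second derivative of the transition map.
\<close>

lemma variation_components:
  fixes A :: "('p, 'e::model_space) chart set" and K :: "'p \<times> 'e \<Rightarrow> real"
  assumes A: "smooth_atlas A" and K: "smooth_map_on UNIV (tangent_atlas A) std_atlas K"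
    and \<xi>: "has_velocity (tangent_atlas A) J \<xi> t w" "\<xi> t = (p, v)" "at t within J \<noteq> bot"
    and c: "c \<in> A" "p \<in> chart_dom c"
    and w: "components (tangent_atlas A) (tangent_chart A c) (p, v) w = (x', y')"
  shows "differential (tangent_atlas A) K (canonical_flip A (velocity (tangent_atlas A) J \<xi> t)) =
    frechet_derivative (\<lambda>z. K (chart_inv (tangent_chart A c) z)) (at (chart_fun c p, x')) (components A c p v, y')"
proof -
  let ?TA = "tangent_atlas A"
  note TA = smooth_atlas_tangent[OF A]
  define c0 where "c0 = chart_at A p"
  have c0: "c0 \<in> A" "p \<in> chart_dom c0" using chart_at_in[OF A] by (auto simp: c0_def)
  define C0 C where "C0 = tangent_chart A c0" and "C = tangent_chart A c"
  have C0: "C0 \<in> ?TA" and C: "C \<in> ?TA" using in_tangent_atlas[OF A] c0 c by (auto simp: C0_def C_def)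
  have pC: "(p, v) \<in> chart_dom C0" "(p, v) \<in> chart_dom C" using c0 c by (auto simp: C0_def C_def)
  obtain x0' y0' where w0: "components ?TA C0 (p, v) w = (x0', y0')" by (cases "components ?TA C0 (p, v) w")
  define x0 y0 where "x0 = chart_fun c0 p" and "y0 = components A c0 p v"
  have x0: "x0 \<in> chart_fun c0 ` chart_dom c0" using c0 by (auto simp: x0_def)
  let ?KA = "\<lambda>z. K (chart_inv C0 z)" and ?K = "\<lambda>z. K (chart_inv C z)"
  have "differential ?TA K (canonical_flip A (velocity ?TA J \<xi> t)) = frechet_derivative ?KA (at (x0, x0')) (y0, y0')"
  proof -
    define CC where "CC = tangent_chart ?TA C0"
    have CC: "CC \<in> tangent_atlas ?TA" using in_tangent_atlas[OF TA C0] by (simp add: CC_def)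
    have vel: "velocity ?TA J \<xi> t = ((p, v), w)" using has_velocity_velocity[OF TA \<xi>(1,3)] \<xi>(2) by simp
    have "chart_fun CC ((p, v), w) = ((x0, y0), (x0', y0'))"
      using w0 by (simp add: CC_def chart_fun_tangent_chart C0_def x0_def y0_def)
    \<comment> \<open>After the flip, the velocity \<open>x0'\<close> of the base point is the fibre
      coordinate of the point, and the generator with its derivative, \<open>(y0, y0')\<close>, is
      the tangent vector there.\<close>
    then have flip: "canonical_flip A (velocity ?TA J \<xi> t) = chart_inv CC ((x0, x0'), (y0, y0'))"
      by (simp add: canonical_flip_def vel Let_def CC_def C0_def c0_def)
    have xin: "(x0, x0') \<in> chart_fun C0 ` chart_dom C0"
      using tangent_chart_image[OF A c0(1), of UNIV] x0 by (simp add: C0_def)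
    let ?p' = "chart_inv C0 (x0, x0')"
    define w' where "w' = snd (chart_inv CC ((x0, x0'), (y0, y0')))"
    have inv: "chart_inv CC ((x0, x0'), (y0, y0')) = (?p', w')"
      using chart_inv_tangent_chart[OF TA C0 xin] by (simp add: CC_def w'_def)
    have p': "?p' \<in> chart_dom C0" "chart_fun C0 ?p' = (x0, x0')"
      using chart_inv_in_dom[OF TA C0 xin] chart_inv_right[OF TA C0 xin] by auto
    have "components ?TA C0 ?p' w' = (y0, y0')"
      using components_chart_inv_tangent_chart[OF TA C0 xin] by (simp add: CC_def w'_def)
    then show ?thesis
      using differential_components[OF TA K C0 p'(1), of w'] unfolding flip inv p'(2) o_def by simp
  qed
  also have "frechet_derivative ?KA (at (x0, x0')) (y0, y0') = frechet_derivative ?K (at (chart_fun c p, x')) (components A c p v, y')"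
  proof -
    define T where "T = chart_fun c \<circ> chart_inv c0"
    define S where "S = chart_fun c0 ` (chart_dom c0 \<inter> chart_dom c)"
    have S: "open S" "C_inf_on S T" "x0 \<in> S"
      unfolding S_def T_def x0_def using open_overlap[OF A c0(1) c(1)] C_inf_transition[OF A c0(1) c(1)] c c0 by auto
    have Tx0: "T x0 = chart_fun c p" using c0 by (simp add: T_def x0_def chart_inv_left[OF A])
    define TT where "TT = chart_fun C \<circ> chart_inv C0"
    have dTT: "(TT has_derivative (\<lambda>(x', y'). (frechet_derivative T (at x0) x', frechet_derivative (\<lambda>z. frechet_derivative T (at z) y) (at x0) x' + frechet_derivative T (at x0) y')))
        (at (x0, y))" for y
      unfolding TT_def C_def C0_def T_def x0_def by (rule tangent_transition_has_derivative[OF A c0(1) c(1) c0(2) c(2)])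
    have "components ?TA C (p, v) w = frechet_derivative TT (at (chart_fun C0 (p, v))) (components ?TA C0 (p, v) w)"
      unfolding TT_def by (rule components_transition[OF TA C0 C pC])
    also have "chart_fun C0 (p, v) = (x0, y0)" by (simp add: C0_def chart_fun_tangent_chart x0_def y0_def)
    finally have "(x', y') = frechet_derivative TT (at (x0, y0)) (x0', y0')" using w w0 by (simp add: C_def)
    also have "frechet_derivative TT (at (x0, y0)) = (\<lambda>(x', y'). (frechet_derivative T (at x0) x', frechet_derivative (\<lambda>z. frechet_derivative T (at z) y0) (at x0) x' + frechet_derivative T (at x0) y'))"
      using frechet_derivative_at[OF dTT] by simp
    finally have x'y': "x' = frechet_derivative T (at x0) x0'"
      "y' = frechet_derivative (\<lambda>z. frechet_derivative T (at z) y0) (at x0) x0' + frechet_derivative T (at x0) y0'"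
      by auto
    have comp: "components A c p v = frechet_derivative T (at x0) y0"
      unfolding T_def x0_def y0_def by (rule components_transition[OF A c0(1) c(1) c0(2) c(2)])
    have TTx: "TT (x0, x0') = (chart_fun c p, x')"
      using tangent_transition[OF A c0(1) c(1), of x0 x0'] S(3) Tx0 by (simp add: TT_def C_def C0_def S_def T_def x'y')
    have in_img: "(chart_fun c p, x') \<in> chart_fun c ` chart_dom c \<times> UNIV" using c by auto
    have dK: "(?K has_derivative frechet_derivative ?K (at (chart_fun c p, x'))) (at (chart_fun c p, x'))"
      unfolding C_def by (rule C_inf_on_has_derivative[OF smooth_on_tangent_C_inf[OF A K c(1)] in_img])
    have "((\<lambda>z. ?K (TT z)) has_derivative (\<lambda>z. frechet_derivative ?K (at (chart_fun c p, x'))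
       ((\<lambda>(a, b). (frechet_derivative T (at x0) a, frechet_derivative (\<lambda>z. frechet_derivative T (at z) x0') (at x0) a + frechet_derivative T (at x0) b)) z))) (at (x0, x0'))"
      by (rule has_derivative_compose[OF dTT]) (use dK TTx in simp)
    moreover have "?K (TT z) = ?KA z" if "z \<in> S \<times> UNIV" for z
    proof -
      obtain q where q: "q \<in> chart_dom c0" "q \<in> chart_dom c" "fst z = chart_fun c0 q" using \<open>z \<in> S \<times> UNIV\<close> by (auto simp: S_def)
      have "chart_inv C0 z \<in> chart_dom C"
        using chart_inv_tangent_chart[OF A c0(1), of "fst z" "snd z"] q c0 by (cases z) (simp add: C0_def C_def chart_inv_left[OF A])
      then show ?thesis using chart_inv_left[OF TA C] by (simp add: TT_def)
    qed
    moreover have "open (S \<times> (UNIV :: 'e set))" using S(1) by (intro open_Times) auto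
    ultimately have "(?KA has_derivative (\<lambda>z. frechet_derivative ?K (at (chart_fun c p, x'))
       ((\<lambda>(a, b). (frechet_derivative T (at x0) a, frechet_derivative (\<lambda>z. frechet_derivative T (at z) x0') (at x0) a + frechet_derivative T (at x0) b)) z))) (at (x0, x0'))"
      using S(3) by (elim has_derivative_transform_within_open) auto
    from fun_cong[OF frechet_derivative_at[OF this], of "(y0, y0')"]
    show ?thesis
      using symmetric_second_derivative[OF S, of y0 x0'] by (simp add: comp x'y')
  qed
  finally show ?thesis by (simp add: C_def)
qed

lemma smooth_on_tangentI:
  fixes A :: "('p, 'e::model_space) chart set" and K :: "'p \<times> 'e \<Rightarrow> 'b::model_space"
  assumes A: "smooth_atlas A" and K: "\<And>c. c \<in> A \<Longrightarrow> C_inf_on (chart_fun c ` chart_dom c \<times> UNIV) (\<lambda>z. K (chart_inv (tangent_chart A c) z))"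
  shows "smooth_map_on UNIV (tangent_atlas A) std_atlas K"
proof (rule smooth_map_onI[OF smooth_atlas_tangent[OF A] smooth_atlas_std])
  fix z :: "'p \<times> 'e"
  define c where "c = chart_at A (fst z)"
  have c: "c \<in> A" "fst z \<in> chart_dom c" using chart_at_in[OF A] by (auto simp: c_def)
  note TA = smooth_atlas_tangent[OF A] and C = in_tangent_atlas[OF A c(1)]
  show "\<exists>C\<in>tangent_atlas A. \<exists>d\<in>std_atlas. z \<in> chart_dom C \<and> (\<exists>W g. open W \<and> chart_fun C z \<in> W \<and> C_inf_on W g \<and>
      (\<forall>x\<in>UNIV. x \<in> chart_dom C \<longrightarrow> chart_fun C x \<in> W \<longrightarrow> K x \<in> chart_dom d \<and> chart_fun d (K x) = g (chart_fun C x)))"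
  proof (intro bexI[OF _ C] bexI[OF _ std_atlas_chart(1)] conjI exI[of _ "chart_fun c ` chart_dom c \<times> UNIV"] exI[of _ "\<lambda>z. K (chart_inv (tangent_chart A c) z)"] ballI impI)
    show "open (chart_fun c ` chart_dom c \<times> (UNIV :: 'e set))" by (intro open_Times open_chart_image[OF A c(1)]) auto
    show "chart_fun (tangent_chart A c) z \<in> chart_fun c ` chart_dom c \<times> UNIV"
      using c(2) by (cases z) (auto simp: chart_fun_tangent_chart)
    show "z \<in> chart_dom (tangent_chart A c)" using c(2) by (cases z) auto
  qed (use K[OF c(1)] chart_inv_left[OF TA C] in auto)
qed

section \<open>The lemma of du Bois-Reymond\<close>

lemma C_inf_antiderivative:
  fixes g :: "real \<Rightarrow> real"
  assumes "open W" "C_inf_on W g" "t \<in> W"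
  obtains e G where "e > 0" "ball t e \<subseteq> W" "C_inf_on (ball t e) G" "\<And>s. s \<in> ball t e \<Longrightarrow> (G has_vector_derivative g s) (at s)"
proof -
  obtain e where e: "e > 0" "cball t e \<subseteq> W" using assms(1,3) open_contains_cball by blast
  define G where "G s = integral {t - e..s} g" for s
  have cont: "continuous_on {t - e..t + e} g"
    by (rule continuous_on_subset[OF C_inf_on_imp_continuous_on[OF assms(2)]]) (use e(2) in \<open>simp add: cball_eq_atLeastAtMost\<close>)
  have der: "(G has_vector_derivative g s) (at s)" if "s \<in> ball t e" for s
  proof -
    have s: "t - e < s" "s < t + e" using that by (auto simp: dist_real_def)
    then have "(G has_vector_derivative g s) (at s within {t - e..t + e})"
      unfolding G_def[abs_def] by (intro integral_has_vector_derivative[OF cont]) auto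
    then show ?thesis using at_within_interior[of s "{t - e..t + e}"] s by simp
  qed
  have sub: "ball t e \<subseteq> W" using e(2) by (auto simp: subset_iff)
  have "C_k_on k (ball t e) G" for k
  proof (cases k)
    case 0
    have "isCont G s" if "s \<in> ball t e" for s using has_vector_derivative_continuous[OF der[OF that]] .
    then show ?thesis using 0 by (simp add: continuous_at_imp_continuous_on)
  next
    case (Suc j)
    have D: "C_k_on j (ball t e) (\<lambda>s. v *\<^sub>R g s)" for v
      by (rule C_k_on_bounded_linear_comp[OF open_ball bounded_linear_scaleR_right C_inf_onD[OF C_inf_on_subset[OF assms(2) sub]]])
    show ?thesis
      unfolding Suc
      by (rule C_k_on_SucI[OF open_ball _ D]) (use der in \<open>simp add: has_vector_derivative_def\<close>)
  qed
  then show thesis using that[of e G] e(1) sub der by (simp add: C_inf_on_def)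
qed

abbreviation "smooth_fun J f \<equiv> smooth_map_on J std_atlas std_atlas f"

lemma smooth_funD:
  assumes "smooth_fun J f" "t \<in> J"
  obtains W g where "open W" "t \<in> W" "C_inf_on W g" "\<And>s. s \<in> J \<Longrightarrow> s \<in> W \<Longrightarrow> f s = g s"
  using smooth_map_onD[OF assms std_atlas_chart(1) std_atlas_chart(1)] by (metis UNIV_I chart.sel id_apply)

lemma smooth_funI:
  assumes "\<And>t. t \<in> J \<Longrightarrow> \<exists>W g. open W \<and> t \<in> W \<and> C_inf_on W g \<and> (\<forall>s\<in>J. s \<in> W \<longrightarrow> f s = g s)"
  shows "smooth_fun J f"
  unfolding smooth_map_on_def using assms by (fastforce simp: in_std_atlas)

lemma smooth_fun_has_vector_derivative:
  fixes f :: "real \<Rightarrow> 'b::real_normed_vector"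
  assumes "smooth_fun J f" "t \<in> J"
  obtains f' where "(f has_vector_derivative f') (at t within J)"
proof -
  obtain W g where W: "open W" "t \<in> W" "C_inf_on W g" "\<And>s. s \<in> J \<Longrightarrow> s \<in> W \<Longrightarrow> f s = g s"
    using smooth_funD[OF assms] by blast
  have "eventually (\<lambda>s. s \<in> J \<and> s \<in> W) (at t within J)" using W(1,2) by (auto simp: eventually_at_topological)
  then have "eventually (\<lambda>s. f s = g s) (at t within J)" by (rule eventually_mono) (use W(4) in auto)
  from has_vector_derivative_compose_within[where x = "\<lambda>s. s", OF has_vector_derivative_id C_inf_on_has_derivative[OF W(3,2)] this]
  show thesis using that W assms(2) by blast
qed

lemma smooth_fun_continuous_on:
  fixes f :: "real \<Rightarrow> 'b::real_normed_vector"
  shows "smooth_fun J f \<Longrightarrow> continuous_on J f"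
  unfolding continuous_on_eq_continuous_within
  using smooth_fun_has_vector_derivative has_vector_derivative_continuous by metis

lemma smooth_fun_add: "smooth_fun J f \<Longrightarrow> smooth_fun J g \<Longrightarrow> smooth_fun J (\<lambda>t. f t + g t :: 'b::real_normed_vector)"
proof (rule smooth_funI)
  fix t assume fg: "smooth_fun J f" "smooth_fun J g" and t: "t \<in> J"
  obtain W h where W: "open W" "t \<in> W" "C_inf_on W h" "\<And>s. s \<in> J \<Longrightarrow> s \<in> W \<Longrightarrow> f s = h s"
    using smooth_funD[OF fg(1) t] by blast
  obtain Z k where Z: "open Z" "t \<in> Z" "C_inf_on Z k" "\<And>s. s \<in> J \<Longrightarrow> s \<in> Z \<Longrightarrow> g s = k s"
    using smooth_funD[OF fg(2) t] by blast
  have "C_inf_on (W \<inter> Z) (\<lambda>s. h s + k s)"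
    by (intro C_inf_on_add open_Int W Z C_inf_on_subset[OF W(3)] C_inf_on_subset[OF Z(3)]) auto
  then show "\<exists>W h. open W \<and> t \<in> W \<and> C_inf_on W h \<and> (\<forall>s\<in>J. s \<in> W \<longrightarrow> f s + g s = h s)"
    using W Z by (intro exI[of _ "W \<inter> Z"] exI[of _ "\<lambda>s. h s + k s"]) auto
qed

lemma smooth_fun_const: "smooth_fun J (\<lambda>t. c)"
  by (rule smooth_map_on_const)

lemma smooth_fun_bounded_linear: "bounded_linear l \<Longrightarrow> smooth_fun J f \<Longrightarrow> smooth_fun J (\<lambda>t. l (f t))"
proof (rule smooth_funI)
  fix t assume l: "bounded_linear l" and f: "smooth_fun J f" and t: "t \<in> J"
  obtain W h where W: "open W" "t \<in> W" "C_inf_on W h" "\<And>s. s \<in> J \<Longrightarrow> s \<in> W \<Longrightarrow> f s = h s"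
    using smooth_funD[OF f t] by blast
  then show "\<exists>W h. open W \<and> t \<in> W \<and> C_inf_on W h \<and> (\<forall>s\<in>J. s \<in> W \<longrightarrow> l (f s) = h s)"
    using C_inf_on_bounded_linear_comp[OF W(1) l W(3)] by (intro exI[of _ W] exI[of _ "\<lambda>s. l (h s)"]) auto
qed

text \<open>\<open>F\<close> is differentiable only within \<open>J\<close>. Near each time it
  differs by a constant from an antiderivative of the smooth extension of \<open>f\<close>, which
  provides the extension across end points.\<close>

lemma smooth_fun_antiderivative:
  fixes f F :: "real \<Rightarrow> real"
  assumes J: "convex J" and f: "smooth_fun J f" and F: "\<And>t. t \<in> J \<Longrightarrow> (F has_vector_derivative f t) (at t within J)"
  shows "smooth_fun J F"
proof (rule smooth_funI)
  fix t assume t: "t \<in> J"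
  obtain W g where W: "open W" "t \<in> W" "C_inf_on W g" "\<And>s. s \<in> J \<Longrightarrow> s \<in> W \<Longrightarrow> f s = g s"
    using smooth_funD[OF f t] by blast
  obtain e G where G: "e > 0" "ball t e \<subseteq> W" "C_inf_on (ball t e) G" "\<And>s. s \<in> ball t e \<Longrightarrow> (G has_vector_derivative g s) (at s)"
    using C_inf_antiderivative[OF W(1,3,2)] by blast
  have "\<exists>k. \<forall>s\<in>J \<inter> ball t e. F s - G s = k"
  proof (rule has_derivative_zero_constant)
    show "convex (J \<inter> ball t e)" by (intro convex_Int J convex_ball)
    fix s assume s: "s \<in> J \<inter> ball t e"
    have "(F has_vector_derivative f s) (at s within J \<inter> ball t e)"
      by (rule has_vector_derivative_within_subset[OF F]) (use s in auto)
    moreover have "(G has_vector_derivative f s) (at s within J \<inter> ball t e)"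
      using has_vector_derivative_at_within[OF G(4)] s W(4) G(2) by (metis IntD1 IntD2 subsetD)
    ultimately have "((\<lambda>s. F s - G s) has_vector_derivative f s - f s) (at s within J \<inter> ball t e)"
      by (rule has_vector_derivative_diff)
    then show "((\<lambda>s. F s - G s) has_derivative (\<lambda>h. 0)) (at s within J \<inter> ball t e)"
      by (simp add: has_vector_derivative_def)
  qed
  then obtain k where k: "\<And>s. s \<in> J \<Longrightarrow> s \<in> ball t e \<Longrightarrow> F s - G s = k" by blast
  have "C_inf_on (ball t e) (\<lambda>s. G s + k)" by (intro C_inf_on_add G(3) C_inf_on_const) auto
  then show "\<exists>W g. open W \<and> t \<in> W \<and> C_inf_on W g \<and> (\<forall>s\<in>J. s \<in> W \<longrightarrow> F s = g s)"
    using G(1) k by (intro exI[of _ "ball t e"] exI[of _ "\<lambda>s. G s + k"]) (force simp: algebra_simps)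
qed

text \<open>
  The test function is the primitive of \<open>P + N\<close> minus its mean value, \<open>N\<close> being a primitive of \<open>M\<close>.
\<close>

lemma du_Bois_Reymond:
  fixes P M :: "real \<Rightarrow> real"
  assumes t01: "t0 < t1" and P: "smooth_fun {t0..t1} P" and M: "smooth_fun {t0..t1} M"
    and test: "\<And>f f'. smooth_fun {t0..t1} f \<Longrightarrow> f t0 = 0 \<Longrightarrow> f t1 = 0 \<Longrightarrow>
      (\<And>t. t \<in> {t0..t1} \<Longrightarrow> (f has_vector_derivative f' t) (at t within {t0..t1})) \<Longrightarrow>
      integral {t0..t1} (\<lambda>t. P t * f' t - M t * f t) = 0"
    and t: "t \<in> {t0..t1}"
  shows "(P has_vector_derivative - M t) (at t within {t0..t1})"
proof -
  let ?J = "{t0..t1}"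
  define N where "N t = integral {t0..t} M" for t
  have N: "(N has_vector_derivative M t) (at t within ?J)" if "t \<in> ?J" for t
    unfolding N_def[abs_def] by (rule integral_has_vector_derivative[OF smooth_fun_continuous_on[OF M] that])
  have sN: "smooth_fun ?J N" by (rule smooth_fun_antiderivative[OF _ M N]) auto
  define m where "m = integral ?J (\<lambda>t. P t + N t) / (t1 - t0)"
  define r where "r t = P t + N t + - m" for t
  have r: "smooth_fun ?J r" unfolding r_def[abs_def] by (intro smooth_fun_add P sN smooth_fun_const)
  note rc = smooth_fun_continuous_on[OF r]
  define f where "f t = integral {t0..t} r" for t
  have f: "(f has_vector_derivative r t) (at t within ?J)" if "t \<in> ?J" for t
    unfolding f_def[abs_def] by (rule integral_has_vector_derivative[OF rc that])
  have sf: "smooth_fun ?J f" by (rule smooth_fun_antiderivative[OF _ r f]) auto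
  have f0: "f t0 = 0" by (simp add: f_def)
  have f1: "f t1 = 0"
  proof -
    have "(\<lambda>t. P t + N t) integrable_on ?J"
      by (intro integrable_continuous_interval smooth_fun_continuous_on smooth_fun_add P sN)
    then have "integral ?J r = integral ?J (\<lambda>t. P t + N t) + integral ?J (\<lambda>t. - m)"
      unfolding r_def[abs_def] by (intro integral_add) auto
    then show ?thesis using t01 by (simp add: f_def m_def)
  qed
  \<comment> \<open>Integration by parts: the integrand is the derivative of
    \<open>N t * f t\<close>, and \<open>f\<close> vanishes at both ends.\<close>
  have "((\<lambda>t. N t * r t + M t * f t) has_integral (N t1 * f t1 - N t0 * f t0)) ?J"
  proof (rule fundamental_theorem_of_calculus)
    fix s assume s: "s \<in> ?J"
    show "((\<lambda>t. N t * f t) has_vector_derivative N s * r s + M s * f s) (at s within ?J)"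
      by (rule has_vector_derivative_mult[OF N[OF s] f[OF s]])
  qed (use t01 in simp)
  then have 1: "((\<lambda>t. N t * r t + M t * f t) has_integral 0) ?J" by (simp add: f0 f1)
  have "((\<lambda>t. m * r t) has_integral (m * f t1 - m * f t0)) ?J"
    by (rule fundamental_theorem_of_calculus) (use t01 f in \<open>auto intro: has_vector_derivative_mult_right\<close>)
  then have 2: "((\<lambda>t. m * r t) has_integral 0) ?J" by (simp add: f0 f1)
  have Mf: "(\<lambda>t. P t * r t - M t * f t) integrable_on ?J"
    by (intro integrable_continuous_interval continuous_intros smooth_fun_continuous_on P M sf rc)
  have "((\<lambda>t. P t * r t - M t * f t) has_integral 0) ?J"
    using integrable_integral[OF Mf] test[OF sf f0 f1 f] by simp
  \<comment> \<open>The three vanishing integrals combine to that of \<open>(P + N - m) * r\<close>,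
    which is the square of \<open>r\<close>; being continuous and nonnegative, it vanishes
    identically.\<close>
  from has_integral_diff[OF has_integral_add[OF this 1] 2]
  have "((\<lambda>t. r t * r t) has_integral 0) ?J"
    by (simp add: r_def algebra_simps)
  then have "((\<lambda>t. r t * r t) has_integral 0) (cbox t0 t1)" by simp
  moreover have "continuous_on (cbox t0 t1) (\<lambda>t. r t * r t)" using continuous_on_mult[OF rc rc] by simp
  ultimately have "r t * r t = 0" if "t \<in> ?J" for t
    using that t01 by (intro has_integral_0_cbox_imp_0[of t0 t1 "\<lambda>t. r t * r t"]) auto
  then have r0: "r t = 0" if "t \<in> ?J" for t using that by simp
  have "((\<lambda>t. m - N t) has_vector_derivative 0 - M t) (at t within ?J)"
    by (intro has_vector_derivative_diff has_vector_derivative_const N t)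
  moreover have "P t = m - N t" if "t \<in> ?J" for t using r0[OF that] by (simp add: r_def)
  ultimately show ?thesis
    using has_vector_derivative_transform[OF t, of P "\<lambda>t. m - N t"] by simp
qed

section \<open>Extremals\<close>

lemma has_vector_derivative_transform_eventually:
  assumes "(x has_vector_derivative w) (at t within J)" "eventually (\<lambda>s. y s = x s) (at t within J)" "y t = x t" "t \<in> J"
  shows "(y has_vector_derivative w) (at t within J)"
  using has_vector_derivative_compose_within[where g = "\<lambda>v. v" and g' = "\<lambda>v. v" and x = x and y = y, OF assms(1)] assms(2-4)
  by simp

lemma (in bundle_setup) fund_rep_joint_smooth:
  assumes "c \<in> QA" "open W" "C_inf_on W x" "x ` W \<subseteq> img c" "C_inf_on W b"
  shows "C_inf_on W (\<lambda>s. fund_rep c (b s) (x s))"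
  unfolding fund_rep_def
  by (intro C_inf_on_frechet_derivative_comp[OF assms(2) act_rep_smooth[OF assms(1)]] C_inf_on_Pair assms C_inf_on_const)
    (use assms act_rep_one(1) in auto)

text \<open>Along a vertical generator both the base point and the Lie algebra element move. The
  derivative splits into the derivative of the field for fixed \<open>b\<close> and, by linearity,
  the field of the derivative of \<open>b\<close>.\<close>

lemma (in bundle_setup) fund_rep_joint_derivative:
  assumes c: "c \<in> QA" and x: "x \<in> img c"
  shows "((\<lambda>z. fund_rep c (snd z) (fst z)) has_derivative (\<lambda>z. frechet_derivative (fund_rep c b) (at x) (fst z) + fund_rep c (snd z) x)) (at (x, b))"
proof -
  have o: "open (img c \<times> (UNIV :: 'h set))" by (intro open_Times open_chart_image[OF QA c]) auto
  have xb: "(x, b) \<in> img c \<times> UNIV" using x by simp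
  have fs: "(fst has_derivative fst) (at (x, b))" "(snd has_derivative snd) (at (x, b))"
    using has_derivative_fst[OF has_derivative_ident] has_derivative_snd[OF has_derivative_ident] by auto
  have C: "C_inf_on (img c \<times> UNIV) (\<lambda>z :: 'e \<times> 'h. fund_rep c w (fst z))" for w
    using C_inf_on_compose[OF o open_chart_image[OF QA c] fund_rep_smooth[OF c, of w] C_inf_on_fst[OF o C_inf_on_ident[OF o]]] by auto
  have "((\<lambda>z. fund_rep c (snd z) (fst z)) has_derivative
    (\<lambda>z. frechet_derivative (\<lambda>z. fund_rep c (snd (x, b)) (fst z)) (at (x, b)) z + fund_rep c (snd z) (fst (x, b)))) (at (x, b))"
    by (rule has_derivative_linear_family[where A = "\<lambda>z w. fund_rep c w (fst z)", OF o xb _ C fs(2)]) (use fund_rep_linear[OF c] in auto)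
  moreover have d: "((\<lambda>z. fund_rep c b (fst z)) has_derivative (\<lambda>z. frechet_derivative (fund_rep c b) (at x) (fst z))) (at (x, b))"
    by (rule has_derivative_compose[OF fs(1)]) (use C_inf_on_has_derivative[OF fund_rep_smooth[OF c] x] in simp)
  moreover have "frechet_derivative (\<lambda>z. fund_rep c b (fst z)) (at (x, b)) z = frechet_derivative (fund_rep c b) (at x) (fst z)" for z
    using fun_cong[OF frechet_derivative_at[OF d], of z] by simp
  ultimately show ?thesis by (simp only: fst_conv snd_conv)
qed

lemma frechet_derivative_linear_comp:
  assumes "bounded_linear l" "C_inf_on S f" "z \<in> S"
  shows "frechet_derivative (\<lambda>z. l (f z)) (at z) h = l (frechet_derivative f (at z) h)"
  using fun_cong[OF frechet_derivative_at[OF bounded_linear.has_derivative[OF assms(1) C_inf_on_has_derivative[OF assms(2,3)]]], of h]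
  by simp

text \<open>If \<open>f\<close> is not integrable, neither is the sum, and both integrals have the
  default value 0. This spares a proof that the variation of a generator is integrable.\<close>

lemma integral_add_null:
  fixes f g :: "real \<Rightarrow> real"
  assumes "(g has_integral 0) S"
  shows "integral S (\<lambda>t. f t + g t) = integral S f"
proof (cases "f integrable_on S")
  case True
  then show ?thesis using assms by (simp add: integral_add has_integral_integrable integral_unique)
next
  case False
  have "\<not> (\<lambda>t. f t + g t) integrable_on S"
  proof
    assume "(\<lambda>t. f t + g t) integrable_on S"
    from integrable_diff[OF this has_integral_integrable[OF assms]] False show False by simp
  qed
  with False show ?thesis by (simp add: not_integrable_integral)
qed

section \<open>Variations along a horizontal path\<close>

locale path_setup = horizontal_setup P H
  for P :: "('q::{t2_space, second_countable_topology}, 'e::model_space,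
               'm::{t2_space, second_countable_topology}, 'f::model_space,
               'g::{t2_space, second_countable_topology}, 'h::model_space) bundle_data"
    and H :: "'q \<Rightarrow> 'e set" +
  fixes t0 t1 :: real and q :: "real \<Rightarrow> 'q"
  assumes t01: "t0 < t1" and smooth_q: "smooth_map_on {t0..t1} std_atlas QA q"
    and horizontal_path: "\<And>t. t \<in> {t0..t1} \<Longrightarrow> snd (velocity QA {t0..t1} q t) \<in> H (q t)"
begin

abbreviation "J \<equiv> {t0..t1}"
abbreviation "TA \<equiv> tangent_atlas QA"

definition vel :: "real \<Rightarrow> 'e" where "vel t = snd (velocity QA J q t)"

lemma TA: "smooth_atlas TA" by (rule smooth_atlas_tangent[OF QA])

lemma nontrivial: "t \<in> J \<Longrightarrow> at t within J \<noteq> bot"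
  using t01 by (simp add: trivial_limit_within islimpt_Icc)

lemma eventually_in_J: "eventually (\<lambda>s. s \<in> J) (at t within J)"
  by (simp add: eventually_at_filter)

lemma q_velocity:
  assumes "t \<in> J"
  shows "has_velocity QA J q t (vel t)" "velocity QA J q t = (q t, vel t)" "vel t \<in> H (q t)"
proof -
  obtain v where v: "has_velocity QA J q t v" using smooth_curve_has_velocity[OF QA smooth_q assms] by blast
  with has_velocity_velocity[OF QA v nontrivial[OF assms]]
  show "has_velocity QA J q t (vel t)" "velocity QA J q t = (q t, vel t)" by (simp_all add: vel_def)
  show "vel t \<in> H (q t)" using horizontal_path[OF assms] by (simp add: vel_def)
qed

text \<open>A coordinate curve defined on an open interval around \<open>t\<close> even if
  \<open>t\<close> is an end point. It describes the path and its velocity on \<open>J\<close>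
  simultaneously, so quantities along the path become smooth up to the ends.\<close>

lemma path_rep:
  assumes t: "t \<in> J" and c: "c \<in> QA" "q t \<in> chart_dom c"
  obtains W g where "open W" "t \<in> W" "C_inf_on W g" "g ` W \<subseteq> img c"
    "\<And>s. s \<in> J \<Longrightarrow> s \<in> W \<Longrightarrow> q s \<in> chart_dom c"
    "\<And>s. s \<in> J \<Longrightarrow> s \<in> W \<Longrightarrow> chart_fun c (q s) = g s"
    "\<And>s. s \<in> J \<Longrightarrow> s \<in> W \<Longrightarrow> components QA c (q s) (vel s) = frechet_derivative g (at s) 1"
proof -
  obtain W0 g where W0: "open W0" "t \<in> W0" "C_inf_on W0 g" "\<And>s. s \<in> J \<Longrightarrow> s \<in> W0 \<Longrightarrow> q s \<in> chart_dom c"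
    "\<And>s. s \<in> J \<Longrightarrow> s \<in> W0 \<Longrightarrow> chart_fun c (q s) = g s"
    using smooth_curve_chart[OF QA smooth_q t c] by blast
  \<comment> \<open>Outside \<open>J\<close> the extension \<open>g\<close> could leave the chart
    image, where the coordinate expressions mean nothing; shrinking prevents this.\<close>
  define W where "W = W0 \<inter> g -` img c"
  have W: "open W" unfolding W_def
    by (intro continuous_open_preimage C_inf_on_imp_continuous_on W0 open_chart_image[OF QA c(1)])
  have "components QA c (q s) (vel s) = frechet_derivative g (at s) 1" if s: "s \<in> J" "s \<in> W" for s
  proof -
    have sW: "s \<in> W0" using s by (simp add: W_def)
    have "eventually (\<lambda>r. r \<in> J \<and> r \<in> W0) (at s within J)" using W0(1) sW by (auto simp: eventually_at_topological)
    then have "eventually (\<lambda>r. chart_fun c (q r) = g r) (at s within J)" by (rule eventually_mono) (use W0(5) in auto)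
    from has_vector_derivative_compose_within[where x = "\<lambda>s. s", OF has_vector_derivative_id C_inf_on_has_derivative[OF W0(3) sW] this _ s(1)]
    have "((\<lambda>r. chart_fun c (q r)) has_vector_derivative frechet_derivative g (at s) 1) (at s within J)"
      using W0(5)[OF s(1) sW] by simp
    then show ?thesis
      using vector_derivative_unique_within[OF nontrivial[OF s(1)] has_velocityD(2)[OF q_velocity(1)[OF s(1)] c(1) W0(4)[OF s(1) sW]]] by simp
  qed
  moreover have "t \<in> W" using W0(2) imageI[OF c(2), of "chart_fun c"] by (simp add: W_def W0(5)[OF t W0(2)])
  moreover have "C_inf_on W g" by (rule C_inf_on_subset[OF W0(3)]) (simp add: W_def)
  moreover have "g ` W \<subseteq> img c" by (auto simp: W_def)
  ultimately show thesis using that[of W g] W W0(4,5) by (simp add: W_def)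
qed

definition var :: "('q \<times> 'e \<Rightarrow> real) \<Rightarrow> (real \<Rightarrow> 'q \<times> 'e) \<Rightarrow> real \<Rightarrow> real" where
  "var K \<xi> t = differential TA K (admissible_variation QA t0 t1 \<xi> t)"

text \<open>Changes a generator by a vertical one. Applied to the zero section it produces the
  vertical generators, applied to an arbitrary generator it removes the vertical part.\<close>

lemma shift_smooth:
  assumes \<xi>: "smooth_map_on J std_atlas TA \<xi>" "\<And>s. s \<in> J \<Longrightarrow> fst (\<xi> s) = q s" and a: "smooth_fun J a"
    and \<eta>: "\<And>s. s \<in> J \<Longrightarrow> \<eta> s = (q s, snd (\<xi> s) + fundamental P (a s) (q s))"
  shows "smooth_map_on J std_atlas TA \<eta>"
proof (rule smooth_map_onI[OF smooth_atlas_std TA])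
  fix t assume t: "t \<in> J"
  define c where "c = chart_at QA (q t)"
  have c: "c \<in> QA" "q t \<in> chart_dom c" using chart_at_in[OF QA] by (auto simp: c_def)
  let ?C = "tangent_chart QA c"
  note C = in_tangent_atlas[OF QA c(1)]
  have tC: "\<xi> t \<in> chart_dom ?C" using \<xi>(2)[OF t] c(2) by (cases "\<xi> t") auto
  obtain W X where W: "open W" "t \<in> W" "C_inf_on W X" "\<And>s. s \<in> J \<Longrightarrow> s \<in> W \<Longrightarrow> \<xi> s \<in> chart_dom ?C"
    "\<And>s. s \<in> J \<Longrightarrow> s \<in> W \<Longrightarrow> chart_fun ?C (\<xi> s) = X s"
    using smooth_curve_chart[OF TA \<xi>(1) t C tC] by blast
  obtain Z b where Z: "open Z" "t \<in> Z" "C_inf_on Z b" "\<And>s. s \<in> J \<Longrightarrow> s \<in> Z \<Longrightarrow> a s = b s"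
    using smooth_funD[OF a t] by blast
  define Y where "Y = (W \<inter> (\<lambda>s. fst (X s)) -` img c) \<inter> Z"
  have X1: "C_inf_on W (\<lambda>s. fst (X s))" "C_inf_on W (\<lambda>s. snd (X s))" using C_inf_on_fst C_inf_on_snd W by blast+
  have Y: "open Y" unfolding Y_def
    by (intro open_Int Z continuous_open_preimage C_inf_on_imp_continuous_on[OF X1(1)] W open_chart_image[OF QA c(1)])
  have X2: "C_inf_on Y (\<lambda>s. fst (X s))" "C_inf_on Y (\<lambda>s. snd (X s))" "C_inf_on Y b"
    by (rule C_inf_on_subset[OF X1(1)] C_inf_on_subset[OF X1(2)] C_inf_on_subset[OF Z(3)], auto simp: Y_def)+
  have "fst (X s) = chart_fun c (q s) \<and> snd (X s) = components QA c (q s) (snd (\<xi> s)) \<and> q s \<in> chart_dom c"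
    if "s \<in> J" "s \<in> W" for s
  proof -
    have v: "\<xi> s = (q s, snd (\<xi> s))" using \<xi>(2)[OF that(1)] by (metis prod.collapse)
    show ?thesis
      using W(4,5)[OF that] by (subst (asm) (1 2) v) (metis SigmaD1 chart_dom_tangent_chart chart_fun_tangent_chart fst_conv snd_conv)
  qed
  then have XX: "fst (X s) = chart_fun c (q s)" "snd (X s) = components QA c (q s) (snd (\<xi> s))" "q s \<in> chart_dom c"
    if "s \<in> J" "s \<in> W" for s
    using that by auto
  let ?g = "\<lambda>s. (fst (X s), snd (X s) + fund_rep c (b s) (fst (X s)))"
  have "C_inf_on Y ?g"
    by (intro C_inf_on_Pair C_inf_on_add fund_rep_joint_smooth[OF c(1)] X2 Y) (auto simp: Y_def)
  moreover have "t \<in> Y" using W(2) Z(2) XX[OF t W(2)] by (auto simp: Y_def)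
  moreover have "\<eta> s \<in> chart_dom ?C \<and> chart_fun ?C (\<eta> s) = ?g s" if s: "s \<in> J" "s \<in> Y" for s
  proof -
    have s': "s \<in> W" "s \<in> Z" using s by (auto simp: Y_def)
    note x = XX[OF s(1) s'(1)]
    show ?thesis
      unfolding \<eta>[OF s(1)] using x Z(4)[OF s(1) s'(2)]
      by (simp add: chart_fun_tangent_chart linear_add[OF linear_components[OF QA c(1) x(3)]] fundamental_components[OF c(1) x(3)])
  qed
  ultimately show "\<exists>c\<in>std_atlas. \<exists>D\<in>TA. t \<in> chart_dom c \<and> (\<exists>W g. open W \<and> chart_fun c t \<in> W \<and> C_inf_on W g \<and>
      (\<forall>x\<in>J. x \<in> chart_dom c \<longrightarrow> chart_fun c x \<in> W \<longrightarrow> \<eta> x \<in> chart_dom D \<and> chart_fun D (\<eta> x) = g (chart_fun c x)))"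
    using Y by (intro bexI[OF _ std_atlas_chart(1)] bexI[OF _ C] conjI exI[of _ Y] exI[of _ ?g]) auto
qed

lemma zero_section_smooth: "smooth_map_on J std_atlas TA (\<lambda>s. (q s, 0))"
proof (rule smooth_map_onI[OF smooth_atlas_std TA])
  fix t assume t: "t \<in> J"
  define c where "c = chart_at QA (q t)"
  have c: "c \<in> QA" "q t \<in> chart_dom c" using chart_at_in[OF QA] by (auto simp: c_def)
  obtain W g where W: "open W" "t \<in> W" "C_inf_on W g"
    "\<And>s. s \<in> J \<Longrightarrow> s \<in> W \<Longrightarrow> q s \<in> chart_dom c" "\<And>s. s \<in> J \<Longrightarrow> s \<in> W \<Longrightarrow> chart_fun c (q s) = g s"
    using path_rep[OF t c] by metis
  have "C_inf_on W (\<lambda>s. (g s, 0 :: 'e))" by (intro C_inf_on_Pair W C_inf_on_const)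
  then show "\<exists>c\<in>std_atlas. \<exists>D\<in>TA. t \<in> chart_dom c \<and> (\<exists>W g. open W \<and> chart_fun c t \<in> W \<and> C_inf_on W g \<and>
      (\<forall>x\<in>J. x \<in> chart_dom c \<longrightarrow> chart_fun c x \<in> W \<longrightarrow> (q x, 0) \<in> chart_dom D \<and> chart_fun D (q x, 0) = g (chart_fun c x)))"
    using W linear_0[OF linear_components[OF QA c(1)]]
    by (intro bexI[OF _ std_atlas_chart(1)] bexI[OF _ in_tangent_atlas[OF QA c(1)]] conjI exI[of _ W] exI[of _ "\<lambda>s. (g s, 0)"])
      (auto simp: chart_fun_tangent_chart)
qed

text \<open>The classical coordinate formula for the first variation: the components of the
  generator vary the position, their time derivative varies the velocity.\<close>

lemma var_eq:
  assumes K: "smooth_map_on UNIV TA std_atlas K" and t: "t \<in> J" and c: "c \<in> QA" "q t \<in> chart_dom c"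
    and \<xi>: "\<And>s. s \<in> J \<Longrightarrow> fst (\<xi> s) = q s"
    and y': "((\<lambda>s. components QA c (q s) (snd (\<xi> s))) has_vector_derivative y') (at t within J)"
  shows "var K \<xi> t = frechet_derivative (lag_rep c K) (at (chart_fun c (q t), components QA c (q t) (vel t)))
    (components QA c (q t) (snd (\<xi> t)), y')"
proof -
  let ?C = "tangent_chart QA c"
  note C = in_tangent_atlas[OF QA c(1)]
  note hq = has_velocityD[OF q_velocity(1)[OF t] c]
  have \<xi>s: "\<xi> s = (q s, snd (\<xi> s))" if "s \<in> J" for s using \<xi>[OF that] by (metis prod.collapse)
  have tC: "\<xi> t \<in> chart_dom ?C" using \<xi>s[OF t] c(2) by (metis SigmaI UNIV_I chart_dom_tangent_chart)
  have "((\<lambda>s. (chart_fun c (q s), components QA c (q s) (snd (\<xi> s)))) has_vector_derivative (components QA c (q t) (vel t), y')) (at t within J)"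
    by (rule has_vector_derivative_Pair[OF hq(2) y'])
  then have "((\<lambda>s. chart_fun ?C (\<xi> s)) has_vector_derivative (components QA c (q t) (vel t), y')) (at t within J)"
    by (rule has_vector_derivative_transform[OF t, rotated]) (metis \<xi>s chart_fun_tangent_chart)
  moreover have "eventually (\<lambda>s. \<xi> s \<in> chart_dom ?C) (at t within J)"
    using hq(1) eventually_in_J by eventually_elim (metis \<xi>s SigmaI UNIV_I chart_dom_tangent_chart)
  ultimately obtain w where w: "has_velocity TA J \<xi> t w" "components TA ?C (\<xi> t) w = (components QA c (q t) (vel t), y')"
    using has_velocity_chart_derivative[where \<sigma> = \<xi>, OF TA C tC _ _ t] by blast
  show ?thesis
    unfolding var_def admissible_variation_def lag_rep_def[abs_def]
    by (rule variation_components[OF QA K w(1) \<xi>s[OF t] nontrivial[OF t] c]) (use w(2) \<xi>s[OF t] in simp)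
qed

lemma components_has_vector_derivative:
  assumes \<xi>: "smooth_map_on J std_atlas TA \<xi>" "\<And>s. s \<in> J \<Longrightarrow> fst (\<xi> s) = q s" and t: "t \<in> J" and c: "c \<in> QA" "q t \<in> chart_dom c"
  obtains y' where "((\<lambda>s. components QA c (q s) (snd (\<xi> s))) has_vector_derivative y') (at t within J)"
proof -
  let ?C = "tangent_chart QA c"
  obtain w where w: "has_velocity TA J \<xi> t w" using smooth_curve_has_velocity[OF TA \<xi>(1) t] by blast
  have \<xi>s: "\<xi> s = (q s, snd (\<xi> s))" if "s \<in> J" for s using \<xi>(2)[OF that] by (metis prod.collapse)
  have tC: "\<xi> t \<in> chart_dom ?C" using \<xi>s[OF t] c(2) by (metis SigmaI UNIV_I chart_dom_tangent_chart)
  have "((\<lambda>s. snd (chart_fun ?C (\<xi> s))) has_vector_derivative snd (components TA ?C (\<xi> t) w)) (at t within J)"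
    by (rule bounded_linear.has_vector_derivative[OF bounded_linear_snd has_velocityD(2)[OF w in_tangent_atlas[OF QA c(1)] tC]])
  then have "((\<lambda>s. components QA c (q s) (snd (\<xi> s))) has_vector_derivative snd (components TA ?C (\<xi> t) w)) (at t within J)"
    by (rule has_vector_derivative_transform[OF t, rotated]) (metis \<xi>s chart_fun_tangent_chart snd_conv)
  then show thesis by (rule that)
qed

text \<open>The variation is linear in components and their time derivatives. The vertical summand
  contributes two parts: one with \<open>a\<close> frozen, which is \<open>fund_variation\<close>,
  and one from the derivative of \<open>a\<close>.\<close>

lemma var_shift:
  assumes K: "smooth_map_on UNIV TA std_atlas K"
    and \<xi>: "smooth_map_on J std_atlas TA \<xi>" "\<And>s. s \<in> J \<Longrightarrow> fst (\<xi> s) = q s"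
    and \<eta>: "\<And>s. s \<in> J \<Longrightarrow> \<eta> s = (q s, snd (\<xi> s) + fundamental P (a s) (q s))"
    and t: "t \<in> J" and a': "(a has_vector_derivative a') (at t within J)" and c: "c \<in> QA" "q t \<in> chart_dom c"
  defines "x \<equiv> chart_fun c (q t)" and "x' \<equiv> components QA c (q t) (vel t)"
  shows "var K \<eta> t = var K \<xi> t + frechet_derivative (lag_rep c K) (at (x, x')) (fund_variation c (a t) x x') +
    frechet_derivative (lag_rep c K) (at (x, x')) (0, fund_rep c a' x)"
proof -
  note hq = has_velocityD[OF q_velocity(1)[OF t] c]
  have xi: "x \<in> img c" using c by (auto simp: x_def)
  obtain y' where y': "((\<lambda>s. components QA c (q s) (snd (\<xi> s))) has_vector_derivative y') (at t within J)"
    using components_has_vector_derivative[OF \<xi> t c] by blast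
  define f' where "f' = frechet_derivative (fund_rep c (a t)) (at x) x' + fund_rep c a' x"
  have "((\<lambda>s. (chart_fun c (q s), a s)) has_vector_derivative (x', a')) (at t within J)"
    unfolding x'_def by (rule has_vector_derivative_Pair[OF hq(2) a'])
  from has_vector_derivative_compose_within[OF this _ _ _ t, where g = "\<lambda>z. fund_rep c (snd z) (fst z)"
      and y = "\<lambda>s. fund_rep c (a s) (chart_fun c (q s))", OF fund_rep_joint_derivative[OF c(1) xi, of "a t", unfolded x_def]]
  have "((\<lambda>s. fund_rep c (a s) (chart_fun c (q s))) has_vector_derivative f') (at t within J)"
    by (simp add: x_def f'_def)
  from has_vector_derivative_add[OF y' this]
  have s: "((\<lambda>s. components QA c (q s) (snd (\<xi> s)) + fund_rep c (a s) (chart_fun c (q s))) has_vector_derivative y' + f') (at t within J)" .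
  have eq: "components QA c (q s) (snd (\<eta> s)) = components QA c (q s) (snd (\<xi> s)) + fund_rep c (a s) (chart_fun c (q s))"
    if "s \<in> J" "q s \<in> chart_dom c" for s
    using that by (simp add: \<eta> linear_add[OF linear_components[OF QA c(1)]] fundamental_components[OF c(1)])
  have "((\<lambda>s. components QA c (q s) (snd (\<eta> s))) has_vector_derivative y' + f') (at t within J)"
  proof (rule has_vector_derivative_transform_eventually[OF s])
    show "eventually (\<lambda>s. components QA c (q s) (snd (\<eta> s)) = components QA c (q s) (snd (\<xi> s)) + fund_rep c (a s) (chart_fun c (q s))) (at t within J)"
      using hq(1) eventually_in_J by eventually_elim (rule eq)
  qed (use eq[OF t c(2)] t in auto)
  from var_eq[OF K t c _ this] have "var K \<eta> t = frechet_derivative (lag_rep c K) (at (x, x')) (components QA c (q t) (snd (\<eta> t)), y' + f')"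
    by (simp add: x_def x'_def \<eta>)
  also have "(components QA c (q t) (snd (\<eta> t)), y' + f') =
      (components QA c (q t) (snd (\<xi> t)), y') + fund_variation c (a t) x x' + (0, fund_rep c a' x)"
    using eq[OF t c(2)] by (simp add: f'_def fund_variation_def x_def)
  also have "frechet_derivative (lag_rep c K) (at (x, x')) \<dots> = var K \<xi> t + frechet_derivative (lag_rep c K) (at (x, x')) (fund_variation c (a t) x x') +
    frechet_derivative (lag_rep c K) (at (x, x')) (0, fund_rep c a' x)"
    using linear_add[OF C_inf_on_linear[OF lag_rep_smooth[OF K c(1)]], of "(x, x')"] xi var_eq[OF K t c \<xi>(2) y'] by (simp add: x_def x'_def)
  finally show ?thesis .
qed

text \<open>The case of \<open>var_shift\<close> with the zero generator, whose variation is
  0.\<close>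

lemma var_vertical:
  assumes K: "smooth_map_on UNIV TA std_atlas K" and t: "t \<in> J" and a': "(a has_vector_derivative a') (at t within J)" and c: "c \<in> QA" "q t \<in> chart_dom c"
  defines "x \<equiv> chart_fun c (q t)" and "x' \<equiv> components QA c (q t) (vel t)"
  shows "var K (\<lambda>s. (q s, fundamental P (a s) (q s))) t = frechet_derivative (lag_rep c K) (at (x, x')) (fund_variation c (a t) x x') +
    frechet_derivative (lag_rep c K) (at (x, x')) (0, fund_rep c a' x)"
proof -
  note hq = has_velocityD[OF q_velocity(1)[OF t] c]
  have "eventually (\<lambda>s. components QA c (q s) 0 = 0) (at t within J)"
    using hq(1) by eventually_elim (rule linear_0[OF linear_components[OF QA c(1)]])
  from has_vector_derivative_transform_eventually[where y = "\<lambda>s. components QA c (q s) 0", OF has_vector_derivative_const this _ t]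
  have "((\<lambda>s. components QA c (q s) (snd (q s, 0))) has_vector_derivative 0) (at t within J)"
    using linear_0[OF linear_components[OF QA c]] by simp
  from var_eq[OF K t c _ this] have "var K (\<lambda>s. (q s, 0)) t = 0"
    using linear_0[OF linear_components[OF QA c]] linear_0[OF C_inf_on_linear[OF lag_rep_smooth[OF K c(1)]], of "(x, x')"] c
    by (simp add: x_def x'_def zero_prod_def)
  then show ?thesis
    using var_shift[OF K zero_section_smooth _ _ t a' c, of "\<lambda>s. (q s, fundamental P (a s) (q s))"] by (simp add: x_def x'_def)
qed

lemma var_shift_invariant:
  assumes L: "smooth_map_on UNIV TA std_atlas L" "invariant_lagrangian P L"
    and \<xi>: "smooth_map_on J std_atlas TA \<xi>" "\<And>s. s \<in> J \<Longrightarrow> fst (\<xi> s) = q s"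
    and \<eta>: "\<And>s. s \<in> J \<Longrightarrow> \<eta> s = (q s, snd (\<xi> s) + fundamental P (a s) (q s))"
    and t: "t \<in> J" and a': "(a has_vector_derivative a') (at t within J)"
  shows "var L \<eta> t = var L \<xi> t + blinfun_apply (FL P L (q t, vel t)) a'"
proof -
  define c where "c = chart_at QA (q t)"
  have c: "c \<in> QA" "q t \<in> chart_dom c" using chart_at_in[OF QA] by (auto simp: c_def)
  have xi: "chart_fun c (q t) \<in> img c" using c by auto
  show ?thesis
    using var_shift[OF L(1) \<xi> \<eta> t a' c] infinitesimal_invariance[OF L c(1) xi] FL_eq[OF L(1) c]
    by (simp add: fund_variation_def)
qed

lemma var_vertical_invariant:
  assumes L: "smooth_map_on UNIV TA std_atlas L" "invariant_lagrangian P L"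
    and t: "t \<in> J" and a': "(a has_vector_derivative a') (at t within J)"
  shows "var L (\<lambda>s. (q s, fundamental P (a s) (q s))) t = blinfun_apply (FL P L (q t, vel t)) a'"
proof -
  define c where "c = chart_at QA (q t)"
  have c: "c \<in> QA" "q t \<in> chart_dom c" using chart_at_in[OF QA] by (auto simp: c_def)
  have xi: "chart_fun c (q t) \<in> img c" using c by auto
  show ?thesis
    using var_vertical[OF L(1) t a' c] infinitesimal_invariance[OF L c(1) xi] FL_eq[OF L(1) c]
    by (simp add: fund_variation_def)
qed

text \<open>Moves the formula for \<B> from the chosen chart to an arbitrary one without a further
  change of coordinates: \<open>e \<bullet> omega\<close> is treated as a Lagrangian, and its
  variation under the vertical generator with constant \<open>b\<close> is computed in both
  charts.\<close>

lemma B_tensor_chart: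
  assumes t: "t \<in> J" and c: "c \<in> QA" "q t \<in> chart_dom c"
  shows "B_tensor P H (q t) (proj_push P (q t, vel t)) b =
    frechet_derivative (omega_rep c) (at (chart_fun c (q t), components QA c (q t) (vel t)))
      (fund_variation c b (chart_fun c (q t)) (components QA c (q t) (vel t)))"
proof (rule vector_eq_ldot[THEN iffD1], rule allI)
  fix e :: 'h
  define K where "K Z = e \<bullet> omega P H Z" for Z
  have lr: "lag_rep d K = (\<lambda>z. e \<bullet> omega_rep d z)" for d by (rule ext) (simp add: lag_rep_def K_def omega_rep_def)
  have K: "smooth_map_on UNIV TA std_atlas K"
  proof (rule smooth_on_tangentI[OF QA])
    fix d assume d: "d \<in> QA"
    show "C_inf_on (img d \<times> UNIV) (\<lambda>z. K (chart_inv (tangent_chart QA d) z))"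
      using C_inf_on_bounded_linear_comp[OF open_img[OF d] bounded_linear_inner_right[of e] omega_rep_smooth[OF d]]
      by (simp add: K_def omega_rep_def)
  qed
  have var: "var K (\<lambda>s. (q s, fundamental P b (q s))) t = e \<bullet> frechet_derivative (omega_rep d) (at (chart_fun d (q t), components QA d (q t) (vel t)))
      (fund_variation d b (chart_fun d (q t)) (components QA d (q t) (vel t)))" if d: "d \<in> QA" "q t \<in> chart_dom d" for d
  proof -
    have xi: "chart_fun d (q t) \<in> img d" using d by auto
    then have z: "(chart_fun d (q t), w) \<in> img d \<times> UNIV" for w by auto
    have "fund_rep d 0 (chart_fun d (q t)) = 0" by (rule linear_0[OF fund_rep_linear[OF d(1) xi]])
    then show ?thesis
      using var_vertical[OF K t has_vector_derivative_const d, of b]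
      unfolding lr frechet_derivative_linear_comp[OF bounded_linear_inner_right omega_rep_smooth[OF d(1)] z]
      using linear_0[OF C_inf_on_linear[OF omega_rep_smooth[OF d(1)] z]] by (simp add: zero_prod_def)
  qed
  note c0 = chart_at_in[OF QA, of "q t"]
  have "e \<bullet> B_tensor P H (q t) (proj_push P (q t, vel t)) b = var K (\<lambda>s. (q s, fundamental P b (q s))) t"
    using var[OF c0] B_tensor_eq[OF q_velocity(3)[OF t], of b] by (simp add: components_chart_at[OF QA])
  then show "e \<bullet> B_tensor P H (q t) (proj_push P (q t, vel t)) b = e \<bullet> frechet_derivative (omega_rep c) (at (chart_fun c (q t), components QA c (q t) (vel t)))
      (fund_variation c b (chart_fun c (q t)) (components QA c (q t) (vel t)))"
    using var[OF c] by simp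
qed

lemma B_tensor_scaleR:
  assumes t: "t \<in> J"
  shows "B_tensor P H (q t) (proj_push P (q t, vel t)) (r *\<^sub>R b) = r *\<^sub>R B_tensor P H (q t) (proj_push P (q t, vel t)) b"
proof -
  define c where "c = chart_at QA (q t)"
  have c: "c \<in> QA" "q t \<in> chart_dom c" using chart_at_in[OF QA] by (auto simp: c_def)
  define x where "x = chart_fun c (q t)"
  have x: "x \<in> img c" using c by (auto simp: x_def)
  have sc: "fund_rep c (r *\<^sub>R b) y = r *\<^sub>R fund_rep c b y" if "y \<in> img c" for y
    by (rule linear_scale[OF fund_rep_linear[OF c(1) that]])
  have "((\<lambda>y. r *\<^sub>R fund_rep c b y) has_derivative (\<lambda>w. r *\<^sub>R frechet_derivative (fund_rep c b) (at x) w)) (at x)"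
    by (intro has_derivative_scaleR_right C_inf_on_has_derivative[OF fund_rep_smooth[OF c(1)] x])
  from fun_cong[OF frechet_derivative_at[OF has_derivative_transform_within_open[OF this open_chart_image[OF QA c(1)] x]]]
  have "frechet_derivative (fund_rep c (r *\<^sub>R b)) (at x) w = r *\<^sub>R frechet_derivative (fund_rep c b) (at x) w" for w
    using sc by metis
  then have "fund_variation c (r *\<^sub>R b) x w = r *\<^sub>R fund_variation c b x w" for w
    by (simp add: fund_variation_def sc[OF x])
  then show ?thesis
    unfolding B_tensor_chart[OF t c] using linear_scale[OF C_inf_on_linear[OF omega_rep_smooth[OF c(1)]]] x
    by (simp add: x_def)
qed

lemma FL_smooth_fun:
  assumes L: "smooth_map_on UNIV TA std_atlas L"
  shows "smooth_fun J (\<lambda>t. blinfun_apply (FL P L (q t, vel t)) b)"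
proof (rule smooth_funI)
  fix t assume t: "t \<in> J"
  define c where "c = chart_at QA (q t)"
  have c: "c \<in> QA" "q t \<in> chart_dom c" using chart_at_in[OF QA] by (auto simp: c_def)
  obtain W g where W: "open W" "t \<in> W" "C_inf_on W g" "g ` W \<subseteq> img c"
    "\<And>s. s \<in> J \<Longrightarrow> s \<in> W \<Longrightarrow> q s \<in> chart_dom c"
    "\<And>s. s \<in> J \<Longrightarrow> s \<in> W \<Longrightarrow> chart_fun c (q s) = g s"
    "\<And>s. s \<in> J \<Longrightarrow> s \<in> W \<Longrightarrow> components QA c (q s) (vel s) = frechet_derivative g (at s) 1"
    by (rule path_rep[OF t c], rule that)
  let ?h = "\<lambda>s. frechet_derivative (lag_rep c L) (at (g s, frechet_derivative g (at s) 1)) (0, fund_rep c b (g s))"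
  have "C_inf_on W ?h"
    by (intro C_inf_on_frechet_derivative_comp[OF W(1) open_img[OF c(1)] lag_rep_smooth[OF L c(1)]] C_inf_on_Pair W C_inf_on_const
        C_inf_on_frechet_derivative fund_rep_joint_smooth[OF c(1)]) (use W(4) in auto)
  moreover have "blinfun_apply (FL P L (q s, vel s)) b = ?h s" if "s \<in> J" "s \<in> W" for s
    using FL_eq[OF L c(1) W(5)[OF that]] W(6,7)[OF that] by simp
  ultimately show "\<exists>W g. open W \<and> t \<in> W \<and> C_inf_on W g \<and> (\<forall>s\<in>J. s \<in> W \<longrightarrow> blinfun_apply (FL P L (q s, vel s)) b = g s)"
    using W(1,2) by (intro exI[of _ W] exI[of _ ?h]) auto
qed

text \<open>The smoothness in time that the lemma of du Bois-Reymond demands; the unique description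
  in \<open>B_tensor\<close> gives none, but \<open>B_tensor_chart\<close> in one fixed chart
  does.\<close>

lemma multiplier_B_smooth_fun:
  assumes \<mu>: "smooth_fun J \<mu>"
  shows "smooth_fun J (\<lambda>t. blinfun_apply (\<mu> t) (B_tensor P H (q t) (proj_push P (q t, vel t)) b))"
proof (rule smooth_funI)
  fix t assume t: "t \<in> J"
  define c where "c = chart_at QA (q t)"
  have c: "c \<in> QA" "q t \<in> chart_dom c" using chart_at_in[OF QA] by (auto simp: c_def)
  obtain W g where W: "open W" "t \<in> W" "C_inf_on W g" "g ` W \<subseteq> img c"
    "\<And>s. s \<in> J \<Longrightarrow> s \<in> W \<Longrightarrow> q s \<in> chart_dom c"
    "\<And>s. s \<in> J \<Longrightarrow> s \<in> W \<Longrightarrow> chart_fun c (q s) = g s"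
    "\<And>s. s \<in> J \<Longrightarrow> s \<in> W \<Longrightarrow> components QA c (q s) (vel s) = frechet_derivative g (at s) 1"
    by (rule path_rep[OF t c], rule that)
  obtain Z m where Z: "open Z" "t \<in> Z" "C_inf_on Z m" "\<And>s. s \<in> J \<Longrightarrow> s \<in> Z \<Longrightarrow> \<mu> s = m s"
    using smooth_funD[OF \<mu> t] by blast
  let ?g' = "\<lambda>s. frechet_derivative g (at s) 1"
  let ?B = "\<lambda>s. frechet_derivative (omega_rep c) (at (g s, ?g' s)) (fund_rep c b (g s), frechet_derivative (fund_rep c b) (at (g s)) (?g' s))"
  have g': "C_inf_on W ?g'" by (rule C_inf_on_frechet_derivative[OF W(3)])
  have B: "C_inf_on W ?B"
    by (intro C_inf_on_frechet_derivative_comp[OF W(1) open_img[OF c(1)] omega_rep_smooth[OF c(1)]] C_inf_on_Pair W g' C_inf_on_const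
        fund_rep_joint_smooth[OF c(1)] C_inf_on_frechet_derivative_comp[OF W(1) open_chart_image[OF QA c(1)] fund_rep_smooth[OF c(1)]])
      (use W(4) in auto)
  let ?h = "\<lambda>s. blinfun_apply (m s) (?B s)"
  have "C_inf_on (W \<inter> Z) ?h"
    by (intro C_inf_on_bounded_bilinear[OF _ bounded_bilinear_blinfun_apply] open_Int W Z C_inf_on_subset[OF B] C_inf_on_subset[OF Z(3)]) auto
  moreover have "blinfun_apply (\<mu> s) (B_tensor P H (q s) (proj_push P (q s, vel s)) b) = ?h s" if "s \<in> J" "s \<in> W" "s \<in> Z" for s
    using B_tensor_chart[OF that(1) c(1) W(5)[OF that(1,2)], of b] W(6,7)[OF that(1,2)] Z(4)[OF that(1,3)] by (simp add: fund_variation_def)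
  ultimately show "\<exists>W g. open W \<and> t \<in> W \<and> C_inf_on W g \<and> (\<forall>s\<in>J. s \<in> W \<longrightarrow> blinfun_apply (\<mu> s) (B_tensor P H (q s) (proj_push P (q s, vel s)) b) = g s)"
    using W(1,2) Z(1,2) by (intro exI[of _ "W \<inter> Z"] exI[of _ ?h]) auto
qed

lemma vertical_generator:
  assumes f: "smooth_fun J f" "f t0 = 0" "f t1 = 0" and \<gamma>: "\<And>t. t \<in> J \<Longrightarrow> \<gamma> t = (q t, vel t)"
  shows "generator QA t0 t1 \<gamma> (\<lambda>s. (q s, fundamental P (f s *\<^sub>R b) (q s)))"
proof -
  have "smooth_fun J (\<lambda>s. f s *\<^sub>R b)" by (rule smooth_fun_bounded_linear[OF bounded_linear_scaleR_left f(1)])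
  from shift_smooth[OF zero_section_smooth _ this]
  have "smooth_map_on J std_atlas TA (\<lambda>s. (q s, fundamental P (f s *\<^sub>R b) (q s)))" by simp
  then show ?thesis
    using f \<gamma> linear_0[OF linear_fundamental] by (simp add: generator_def)
qed

theorem unconstrained_imp_FL_const:
  assumes L: "smooth_map_on UNIV TA std_atlas L" "invariant_lagrangian P L" and \<gamma>: "\<And>t. t \<in> J \<Longrightarrow> \<gamma> t = (q t, vel t)"
    and ext: "unconstrained_extremal QA t0 t1 (\<lambda>_. L) \<gamma>"
  shows "\<exists>C. \<forall>t\<in>J. FL P L (\<gamma> t) = C"
proof (intro exI ballI blinfun_eqI)
  fix t b assume t: "t \<in> J"
  let ?P = "\<lambda>t. blinfun_apply (FL P L (q t, vel t)) b"
  \<comment> \<open>Testing with the generators of \<open>f s *\<^sub>R b\<close> for fixed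
    \<open>b\<close> gives the integral of \<open>?P\<close> times the derivative of
    \<open>f\<close>: the case \<open>M = 0\<close> of du Bois-Reymond.\<close>
  have "(?P has_vector_derivative - 0) (at s within J)" if s: "s \<in> J" for s
  proof (rule du_Bois_Reymond[where M = "\<lambda>_. 0", OF t01 FL_smooth_fun[OF L(1)] smooth_fun_const _ s])
    fix f f' :: "real \<Rightarrow> real" assume f: "smooth_fun J f" "f t0 = 0" "f t1 = 0"
      "\<And>t. t \<in> J \<Longrightarrow> (f has_vector_derivative f' t) (at t within J)"
    let ?\<xi> = "\<lambda>s. (q s, fundamental P (f s *\<^sub>R b) (q s))"
    have "var L ?\<xi> s = ?P s * f' s - 0 * f s" if s: "s \<in> J" for s
    proof -
      have "((\<lambda>s. f s *\<^sub>R b) has_vector_derivative f' s *\<^sub>R b) (at s within J)"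
        by (rule bounded_linear.has_vector_derivative[OF bounded_linear_scaleR_left f(4)[OF s]])
      from var_vertical_invariant[OF L s this] show ?thesis
        by (simp add: blinfun.scaleR_right)
    qed
    then have "integral J (\<lambda>s. ?P s * f' s - 0 * f s) = integral J (var L ?\<xi>)"
      by (intro integral_cong) simp
    also have "\<dots> = 0"
      using ext vertical_generator[OF f(1-3) \<gamma>] by (simp add: unconstrained_extremal_def action_variation_def var_def[abs_def])
    finally show "integral J (\<lambda>s. ?P s * f' s - 0 * f s) = 0" .
  qed
  then have "\<exists>k. \<forall>s\<in>J. ?P s = k"
    by (intro has_derivative_zero_constant) (auto simp: has_vector_derivative_def)
  \<comment> \<open>This fixes the constant left open by \<open>exI\<close> as the value of
    \<open>FL\<close> at \<open>t0\<close>.\<close>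
  then show "blinfun_apply (FL P L (\<gamma> t)) b = blinfun_apply (FL P L (\<gamma> t0)) b"
    using \<gamma>[OF t] \<gamma>[of t0] t t01 by (metis atLeastAtMost_iff less_imp_le order_refl)
qed

end

context path_setup
begin

text \<open>Removing the vertical part \<omega>(\<xi>) from a generator leaves a horizontal one, on
  which the nonholonomic condition applies. For constant \<open>FL\<close> the removed part
  contributes the integral of a total derivative.\<close>

theorem FL_const_imp_unconstrained:
  assumes L: "smooth_map_on UNIV TA std_atlas L" "invariant_lagrangian P L" and \<gamma>: "\<And>t. t \<in> J \<Longrightarrow> \<gamma> t = (q t, vel t)"
    and nh: "nonholonomic_extremal QA H t0 t1 (\<lambda>_. L) \<gamma>" and C: "\<And>t. t \<in> J \<Longrightarrow> FL P L (\<gamma> t) = C"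
  shows "unconstrained_extremal QA t0 t1 (\<lambda>_. L) \<gamma>"
  unfolding unconstrained_extremal_def
proof (intro allI impI)
  fix \<xi> assume gen: "generator QA t0 t1 \<gamma> \<xi>"
  have \<xi>: "smooth_map_on J std_atlas TA \<xi>" "\<And>s. s \<in> J \<Longrightarrow> fst (\<xi> s) = q s" "snd (\<xi> t0) = 0" "snd (\<xi> t1) = 0"
    using gen \<gamma> by (auto simp: generator_def)
  define a where "a s = omega P H (\<xi> s)" for s
  have a: "smooth_fun J a"
    unfolding a_def[abs_def] by (rule smooth_map_on_compose[OF TA \<xi>(1) smooth_omega]) auto
  have ends: "t0 \<in> J" "t1 \<in> J" using t01 by auto
  have a0: "a t = 0" if "t \<in> J" "snd (\<xi> t) = 0" for t
    using linear_0[OF linear_omega] that \<xi>(2) by (metis a_def prod.collapse)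
  have am: "smooth_fun J (\<lambda>s. - a s)" by (rule smooth_fun_bounded_linear[OF bounded_linear_minus[OF bounded_linear_ident] a])
  define \<eta> where "\<eta> s = (q s, snd (\<xi> s) + fundamental P (- a s) (q s))" for s
  have \<eta>: "smooth_map_on J std_atlas TA \<eta>" by (rule shift_smooth[OF \<xi>(1,2) am]) (auto simp: \<eta>_def)
  have neg: "fundamental P (- b) p = - fundamental P b p" for b p by (rule linear_neg[OF linear_fundamental])
  have hor: "snd (\<eta> s) \<in> H (q s)" if "s \<in> J" for s
  proof -
    have "\<xi> s = (q s, snd (\<xi> s))" using \<xi>(2)[OF that] by (metis prod.collapse)
    then show ?thesis using omega_split[of "snd (\<xi> s)" "q s"] by (simp add: \<eta>_def neg a_def)
  qed
  have "generator QA t0 t1 \<gamma> \<eta>"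
    using \<eta> \<gamma> a0[OF ends(1) \<xi>(3)] a0[OF ends(2) \<xi>(4)] \<xi>(3,4) linear_0[OF linear_fundamental]
    by (simp add: generator_def \<eta>_def)
  then have int0: "integral J (var L \<eta>) = 0"
    using nh hor \<gamma> unfolding nonholonomic_extremal_def action_variation_def var_def[abs_def] by simp
  define a' where "a' t = vector_derivative a (at t within J)" for t
  have a': "(a has_vector_derivative a' t) (at t within J)" if "t \<in> J" for t
    using smooth_fun_has_vector_derivative[OF a that] vector_derivative_within[OF nontrivial[OF that]] unfolding a'_def by metis
  have "var L \<xi> t = var L \<eta> t + blinfun_apply C (a' t)" if t: "t \<in> J" for t
  proof -
    have "var L \<xi> t = var L \<eta> t + blinfun_apply (FL P L (q t, vel t)) (a' t)"
    proof (rule var_shift_invariant[OF L \<eta> _ _ t a'[OF t]])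
      show "\<xi> s = (q s, snd (\<eta> s) + fundamental P (a s) (q s))" if "s \<in> J" for s
        using \<xi>(2)[OF that] by (simp add: \<eta>_def neg prod_eq_iff)
    qed (simp add: \<eta>_def)
    then show ?thesis using C[OF t] \<gamma>[OF t] by simp
  qed
  then have "integral J (var L \<xi>) = integral J (\<lambda>t. var L \<eta> t + blinfun_apply C (a' t))"
    by (intro integral_cong) simp
  \<comment> \<open>The integral of \<open>C (a')\<close> is the difference of \<open>C (a)\<close>
    at the end points, where the generator and hence \<open>a\<close> vanish.\<close>
  also have "\<dots> = integral J (var L \<eta>)"
  proof (rule integral_add_null)
    have "((\<lambda>t. blinfun_apply C (a' t)) has_integral (blinfun_apply C (a t1) - blinfun_apply C (a t0))) J"
      by (rule fundamental_theorem_of_calculus)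
        (use t01 a' in \<open>auto intro: bounded_linear.has_vector_derivative[OF blinfun.bounded_linear_right]\<close>)
    then show "((\<lambda>t. blinfun_apply C (a' t)) has_integral 0) J"
      using a0[OF ends(1) \<xi>(3)] a0[OF ends(2) \<xi>(4)] by (simp add: blinfun.zero_right)
  qed
  finally show "action_variation QA t0 t1 (\<lambda>_. L) (admissible_variation QA t0 t1 \<xi>) = 0"
    using int0 by (simp add: action_variation_def var_def[abs_def])
qed

text \<open>The multiplier value \<open>m\<close> is frozen, as the modified Lagrangian is
  differentiated in the tangent variable only. The variation of \<omega> under the vertical
  generator is \<open>a'\<close> plus \<B>: \<omega> inverts fundamental fields, and its derivative
  along \<open>fund_variation\<close> is \<B>.\<close>

lemma var_multiplier:
  assumes L: "smooth_map_on UNIV TA std_atlas L" "invariant_lagrangian P L"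
    and t: "t \<in> J" and a': "(a has_vector_derivative a') (at t within J)"
  shows "var (\<lambda>Z. L Z - blinfun_apply m (omega P H Z)) (\<lambda>s. (q s, fundamental P (a s) (q s))) t =
    blinfun_apply (FL P L (q t, vel t) - m) a' - blinfun_apply m (B_tensor P H (q t) (proj_push P (q t, vel t)) (a t))"
proof -
  let ?K = "\<lambda>Z. L Z - blinfun_apply m (omega P H Z)"
  have rep: "lag_rep c ?K = (\<lambda>z. lag_rep c L z - blinfun_apply m (omega_rep c z))" for c
    by (rule ext) (simp add: lag_rep_def omega_rep_def)
  have sm: "C_inf_on (img c \<times> UNIV) (\<lambda>z. blinfun_apply m (omega_rep c z))" if "c \<in> QA" for c
    by (rule C_inf_on_bounded_linear_comp[OF open_img[OF that] blinfun.bounded_linear_right omega_rep_smooth[OF that]])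
  have K: "smooth_map_on UNIV TA std_atlas ?K"
  proof (rule smooth_on_tangentI[OF QA])
    fix c assume c: "c \<in> QA"
    show "C_inf_on (img c \<times> UNIV) (\<lambda>z. ?K (chart_inv (tangent_chart QA c) z))"
      using C_inf_on_diff[OF open_img[OF c] lag_rep_smooth[OF L(1) c] sm[OF c]] by (simp add: lag_rep_def omega_rep_def)
  qed
  define c where "c = chart_at QA (q t)"
  have c: "c \<in> QA" "q t \<in> chart_dom c" using chart_at_in[OF QA] by (auto simp: c_def)
  define x x' where "x = chart_fun c (q t)" and "x' = components QA c (q t) (vel t)"
  have x: "x \<in> img c" using c by (auto simp: x_def)
  then have xx: "(x, x') \<in> img c \<times> UNIV" by simp
  have D: "frechet_derivative (lag_rep c ?K) (at (x, x')) h =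
      frechet_derivative (lag_rep c L) (at (x, x')) h - blinfun_apply m (frechet_derivative (omega_rep c) (at (x, x')) h)" for h
    unfolding rep
    using fun_cong[OF frechet_derivative_at[OF has_derivative_diff[OF C_inf_on_has_derivative[OF lag_rep_smooth[OF L(1) c(1)] xx]
      bounded_linear.has_derivative[OF blinfun.bounded_linear_right C_inf_on_has_derivative[OF omega_rep_smooth[OF c(1)] xx]]]], of h] by simp
  have "omega_rep c (x, fund_rep c a' x) = a'"
    using omega_rep_eq[OF c, of "fundamental P a' (q t)"] by (simp add: omega_fundamental fundamental_components[OF c] x_def)
  then have "frechet_derivative (omega_rep c) (at (x, x')) (0, fund_rep c a' x) = a'"
    using omega_rep_derivative_snd[OF c(1) x] by simp
  moreover have "frechet_derivative (lag_rep c L) (at (x, x')) (fund_variation c (a t) x x') = 0"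
    unfolding fund_variation_def by (rule infinitesimal_invariance[OF L c(1) x])
  moreover have "frechet_derivative (lag_rep c L) (at (x, x')) (0, fund_rep c a' x) = blinfun_apply (FL P L (q t, vel t)) a'"
    using FL_eq[OF L(1) c] by (simp add: x_def x'_def)
  moreover have "frechet_derivative (omega_rep c) (at (x, x')) (fund_variation c (a t) x x') = B_tensor P H (q t) (proj_push P (q t, vel t)) (a t)"
    using B_tensor_chart[OF t c] by (simp add: x_def x'_def)
  ultimately show ?thesis
    using var_vertical[OF K t a' c] D by (simp add: x_def[symmetric] x'_def[symmetric] blinfun.diff_left)
qed

text \<open>With test generators \<open>f s *\<^sub>R b\<close> the variation has the form required
  by du Bois-Reymond, with \<open>P\<close> the pairing of \<open>FL - \<mu>\<close> with
  \<open>b\<close> and \<open>M\<close> that of \<mu> with \<B>. Homogeneity of \<B> in its last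
  argument extracts the factor \<open>f s\<close>.\<close>

theorem vakonomic_multiplier_equation:
  assumes L: "smooth_map_on UNIV TA std_atlas L" "invariant_lagrangian P L" and \<gamma>: "\<And>t. t \<in> J \<Longrightarrow> \<gamma> t = (q t, vel t)"
    and vak: "vakonomic_extremal P H t0 t1 L \<mu> \<gamma>" and t: "t \<in> J"
  shows "((\<lambda>s. blinfun_apply (FL P L (q s, vel s) - \<mu> s) b) has_vector_derivative
    - blinfun_apply (\<mu> t) (B_tensor P H (q t) (proj_push P (q t, vel t)) b)) (at t within J)"
proof (rule du_Bois_Reymond[OF t01 _ _ _ t])
  have \<mu>: "smooth_fun J \<mu>" using vak by (simp add: vakonomic_extremal_def)
  show "smooth_fun J (\<lambda>t. blinfun_apply (\<mu> t) (B_tensor P H (q t) (proj_push P (q t, vel t)) b))"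
    by (rule multiplier_B_smooth_fun[OF \<mu>])
  have "smooth_fun J (\<lambda>s. blinfun_apply (FL P L (q s, vel s)) b + - blinfun_apply (\<mu> s) b)"
    by (intro smooth_fun_add FL_smooth_fun[OF L(1)]
        smooth_fun_bounded_linear[OF bounded_linear_minus[OF blinfun.bounded_linear_left] \<mu>])
  then show "smooth_fun J (\<lambda>s. blinfun_apply (FL P L (q s, vel s) - \<mu> s) b)" by (simp add: blinfun.diff_left)
  fix f f' :: "real \<Rightarrow> real" assume f: "smooth_fun J f" "f t0 = 0" "f t1 = 0"
      "\<And>t. t \<in> J \<Longrightarrow> (f has_vector_derivative f' t) (at t within J)"
  let ?\<xi> = "\<lambda>s. (q s, fundamental P (f s *\<^sub>R b) (q s))"
  let ?B = "\<lambda>s. B_tensor P H (q s) (proj_push P (q s, vel s)) b"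
  have "var (\<lambda>Z. L Z - blinfun_apply (\<mu> s) (omega P H Z)) ?\<xi> s =
      blinfun_apply (FL P L (q s, vel s) - \<mu> s) b * f' s - blinfun_apply (\<mu> s) (?B s) * f s" if s: "s \<in> J" for s
  proof -
    have "((\<lambda>s. f s *\<^sub>R b) has_vector_derivative f' s *\<^sub>R b) (at s within J)"
      by (rule bounded_linear.has_vector_derivative[OF bounded_linear_scaleR_left f(4)[OF s]])
    from var_multiplier[OF L s this] show ?thesis
      by (simp add: blinfun.scaleR_right B_tensor_scaleR[OF s])
  qed
  then have "integral J (\<lambda>s. blinfun_apply (FL P L (q s, vel s) - \<mu> s) b * f' s - blinfun_apply (\<mu> s) (?B s) * f s) =
      integral J (\<lambda>s. var (\<lambda>Z. L Z - blinfun_apply (\<mu> s) (omega P H Z)) ?\<xi> s)"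
    by (intro integral_cong) simp
  also have "\<dots> = 0"
    using vak vertical_generator[OF f(1-3) \<gamma>]
    by (simp add: vakonomic_extremal_def unconstrained_extremal_def action_variation_def var_def)
  finally show "integral J (\<lambda>s. blinfun_apply (FL P L (q s, vel s) - \<mu> s) b * f' s - blinfun_apply (\<mu> s) (?B s) * f s) = 0" .
qed

end

text \<open>Passes from the equation tested on each \<open>b\<close> to a derivative in the dual
  space: in finite dimension a form is a finite combination of fixed forms whose coefficients are
  its values on a spanning set.\<close>

lemma blinfun_has_vector_derivativeI:
  fixes f :: "real \<Rightarrow> 'h::model_space \<Rightarrow>\<^sub>L real"
  assumes f: "\<And>b. ((\<lambda>s. blinfun_apply (f s) b) has_vector_derivative f' b) (at t within J)" and J: "at t within J \<noteq> bot"
  obtains D where "(f has_vector_derivative D) (at t within J)" "\<And>b. blinfun_apply D b = f' b"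
proof -
  obtain E :: "'h set" and d where E: "finite E" "\<And>x. x = (\<Sum>b\<in>E. (x \<bullet> d b) *\<^sub>R b)"
    by (rule model_space_expansion) blast
  define w where "w b = Blinfun (\<lambda>x. x \<bullet> d b)" for b
  have w: "blinfun_apply (w b) x = x \<bullet> d b" for b x
    unfolding w_def by (simp add: bounded_linear_Blinfun_apply bounded_linear_inner_left)
  have exp: "f s = (\<Sum>b\<in>E. blinfun_apply (f s) b *\<^sub>R w b)" for s
  proof (rule blinfun_eqI)
    fix x
    show "blinfun_apply (f s) x = blinfun_apply (\<Sum>b\<in>E. blinfun_apply (f s) b *\<^sub>R w b) x"
      using linear_expansion[OF bounded_linear.linear[OF blinfun.bounded_linear_right] E(2), of "f s" x]
      by (simp add: blinfun.sum_left blinfun.scaleR_left w mult.commute)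
  qed
  define D where "D = (\<Sum>b\<in>E. f' b *\<^sub>R w b)"
  have "((\<lambda>s. \<Sum>b\<in>E. blinfun_apply (f s) b *\<^sub>R w b) has_vector_derivative D) (at t within J)"
    unfolding D_def by (intro has_vector_derivative_sum bounded_linear.has_vector_derivative[OF bounded_linear_scaleR_left] f)
  then have D: "(f has_vector_derivative D) (at t within J)" using exp by simp
  moreover have "blinfun_apply D b = f' b" for b
    by (rule vector_derivative_unique_within[OF J bounded_linear.has_vector_derivative[OF blinfun.bounded_linear_left D] f])
  ultimately show thesis by (rule that)
qed

theorem corollary4p12:
  fixes P :: "('q::{t2_space, second_countable_topology}, 'e::model_space,
               'm::{t2_space, second_countable_topology}, 'f::model_space,
               'g::{t2_space, second_countable_topology}, 'h::model_space) bundle_data"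
    and H :: "'q \<Rightarrow> 'e set"
    and L :: "'q \<times> 'e \<Rightarrow> real"
    and t0 t1 :: real
  assumes "t0 < t1"
    and "principal_bundle P"
    and "horizontal_distribution P H"
    and "smooth_map_on UNIV (tangent_atlas (total_atlas P)) std_atlas L"
    and "invariant_lagrangian P L"
  shows "(\<forall>q. \<forall>v \<in> H q. \<forall>b.
            blinfun_apply (HL P H L (q, v)) b +
            blinfun_apply (FL P L (q, v)) (B_tensor P H q (proj_push P (q, v)) b) = 0) \<and>
         (\<forall>\<gamma>. horizontal_admissible_path (total_atlas P) H t0 t1 \<gamma> \<longrightarrow>
            (nonholonomic_extremal (total_atlas P) H t0 t1 (\<lambda>_. L) \<gamma> \<longrightarrow>
               (unconstrained_extremal (total_atlas P) t0 t1 (\<lambda>_. L) \<gamma> \<longleftrightarrow>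
                (\<exists>C. \<forall>t\<in>{t0..t1}. FL P L (\<gamma> t) = C))) \<and>
            (\<forall>\<mu>. vakonomic_extremal P H t0 t1 L \<mu> \<gamma> \<longrightarrow>
               (\<forall>t\<in>{t0..t1}. \<exists>D.
                  ((\<lambda>s. FL P L (\<gamma> s) - \<mu> s) has_vector_derivative D) (at t within {t0..t1}) \<and>
                  (\<forall>b. blinfun_apply D b =
                     - blinfun_apply (\<mu> t)
                         (B_tensor P H (fst (\<gamma> t)) (proj_push P (\<gamma> t)) b)))))"
proof (intro conjI allI ballI impI)
  interpret horizontal_setup P H
    using assms(2,3) by unfold_locales
  fix q :: 'q and v b assume "v \<in> H q"
  then show "blinfun_apply (HL P H L (q, v)) b + blinfun_apply (FL P L (q, v)) (B_tensor P H q (proj_push P (q, v)) b) = 0"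
    by (rule HL_FL_B_tensor[OF assms(4,5)])
next
  fix \<gamma> assume path: "horizontal_admissible_path (total_atlas P) H t0 t1 \<gamma>"
    and nh: "nonholonomic_extremal (total_atlas P) H t0 t1 (\<lambda>_. L) \<gamma>"
  obtain q where q: "smooth_map_on {t0..t1} std_atlas (total_atlas P) q"
    "\<And>t. t \<in> {t0..t1} \<Longrightarrow> \<gamma> t = velocity (total_atlas P) {t0..t1} q t" "\<And>t. t \<in> {t0..t1} \<Longrightarrow> snd (\<gamma> t) \<in> H (q t)"
    using path unfolding horizontal_admissible_path_def by blast
  interpret path_setup P H t0 t1 q
    by unfold_locales (use assms q in auto)
  have \<gamma>: "\<gamma> t = (q t, vel t)" if "t \<in> {t0..t1}" for t
    using q(2)[OF that] q_velocity(2)[OF that] by simp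
  show "unconstrained_extremal (total_atlas P) t0 t1 (\<lambda>_. L) \<gamma> \<longleftrightarrow> (\<exists>C. \<forall>t\<in>{t0..t1}. FL P L (\<gamma> t) = C)"
    using unconstrained_imp_FL_const[OF assms(4,5) \<gamma>] FL_const_imp_unconstrained[OF assms(4,5) \<gamma> nh] by blast
next
  fix \<gamma> \<mu> t assume path: "horizontal_admissible_path (total_atlas P) H t0 t1 \<gamma>"
    and vak: "vakonomic_extremal P H t0 t1 L \<mu> \<gamma>" and t: "t \<in> {t0..t1}"
  obtain q where q: "smooth_map_on {t0..t1} std_atlas (total_atlas P) q"
    "\<And>t. t \<in> {t0..t1} \<Longrightarrow> \<gamma> t = velocity (total_atlas P) {t0..t1} q t" "\<And>t. t \<in> {t0..t1} \<Longrightarrow> snd (\<gamma> t) \<in> H (q t)"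
    using path unfolding horizontal_admissible_path_def by blast
  interpret path_setup P H t0 t1 q
    by unfold_locales (use assms q in auto)
  have \<gamma>: "\<gamma> t = (q t, vel t)" if "t \<in> {t0..t1}" for t
    using q(2)[OF that] q_velocity(2)[OF that] by simp
  obtain D where D: "((\<lambda>s. FL P L (q s, vel s) - \<mu> s) has_vector_derivative D) (at t within {t0..t1})"
    "\<And>b. blinfun_apply D b = - blinfun_apply (\<mu> t) (B_tensor P H (q t) (proj_push P (q t, vel t)) b)"
    using blinfun_has_vector_derivativeI[OF vakonomic_multiplier_equation[OF assms(4,5) \<gamma> vak t] nontrivial[OF t]] by blast
  \<comment> \<open>\<gamma> is prescribed on the interval only, so the derivative is carried over
    from the velocity lift of \<open>q\<close> by agreement there.\<close>
  have "((\<lambda>s. FL P L (\<gamma> s) - \<mu> s) has_vector_derivative D) (at t within {t0..t1})"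
    by (rule has_vector_derivative_transform[OF t _ D(1)]) (simp add: \<gamma>)
  then show "\<exists>D. ((\<lambda>s. FL P L (\<gamma> s) - \<mu> s) has_vector_derivative D) (at t within {t0..t1}) \<and>
      (\<forall>b. blinfun_apply D b = - blinfun_apply (\<mu> t) (B_tensor P H (fst (\<gamma> t)) (proj_push P (\<gamma> t)) b))"
    using D(2) \<gamma>[OF t] by auto
qed

end
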